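(* Let $T>0$ and let $(u^{\varepsilon},v^{\varepsilon})$, $\varepsilon\in(0,1)$, be the solution of the reaction-diffusion system $\partial_t u^{\varepsilon}=\frac{v^{\varepsilon}-F(u^{\varepsilon})}{\varepsilon}$, $\partial_t v^{\varepsilon}=\Delta v^{\varepsilon}+\frac{F(u^{\varepsilon})-v^{\varepsilon}}{\varepsilon}$ in $\Omega$ with Neumann boundary conditions and initial data $(u_0,v_0)$, where $F$, $u_0$, $v_0$ satisfy the assumptions listed in the context. Then, up to a subsequence $\varepsilon\to0$, there are functions $u,v$ such that $u^{\varepsilon}\to u$ weakly$^*$ in $L^{\infty}((0,T)\times\Omega)$, and $F(u^{\varepsilon})\to v$ and $v^{\varepsilon}\to v$ strongly in $L^2((0,T)\times\Omega)$. Moreover, the Young measure $\{\mu_{t,x}\}_{t,x}$ generated by $\{u^{\varepsilon}\}_{\varepsilon\in(0,1)}$ is a convex combination of Dirac masses: for a.e. $(t,x)\in(0,T)\times\Omega$, $$\mu_{t,x}=\lambda_1(t,x)\,\delta_{S_1(v(t,x))}+\lambda_2(t,x)\,\delta_{S_2(v(t,x))}+\lambda_3(t,x)\,\delta_{S_3(v(t,x))},$$ where $\lambda_1(t,x),\lambda_2(t,x),\lambda_3(t,x)$ are nonnegative numbers such that $\sum_{i=1}^3\lambda_i(t,x)=1$.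
   Context: $\Omega\subset\mathbb{R}^d$ is a smooth bounded domain. Assumptions on $F$: (1) $F\in C^1(\mathbb{R};\mathbb{R})$, $F(0)=0$, $F\ge0$ on $[0,\infty)$. (2) There are $0<\alpha_-<\alpha_+<\beta_-<\beta_+$ with $F(\beta_-)=F(\alpha_-)=:f_-$ and $F(\alpha_+)=F(\beta_+)=:f_+$; $F$ is strictly increasing on $(-\infty,\alpha_+)$ and on $(\beta_-,\infty)$ and strictly decreasing on $(\alpha_+,\beta_-)$; $\lim_{u\to\infty}F(u)=\infty$ and $\lim_{u\to-\infty}F(u)=-\infty$. The inverses of $F$ on its monotone branches are $S_1:(-\infty,f_+)\to(-\infty,\alpha_+)$, $S_2:(f_-,f_+)\to(\alpha_+,\beta_-)$, $S_3:(f_-,\infty)\to(\beta_-,\infty)$, so $F(S_i(r))=r$; each $S_i$ is extended to all of $\mathbb{R}$ by constants (continuously). (3) Nondegeneracy: for every (nonempty open) subinterval of $(f_-,f_+)$ and real $a_1,a_2,a_3$, if $\sum_{i=1}^3a_i\,(S_i'(r)+1)=0$ on that subinterval, then $a_1+a_2+a_3=0$. Assumptions on initial data: $u_0,v_0\ge0$, $u_0,v_0\in C^{2+\alpha}(\overline{\Omega})$ for some $\alpha\in(0,1)$, and $u_0,v_0$ satisfy the Neumann boundary condition. For each $\varepsilon$ the system, with $u^{\varepsilon}(0,x)=u_0(x)$, $v^{\varepsilon}(0,x)=v_0(x)$ and Neumann boundary conditions, has a unique global classical solution $(u^{\varepsilon},v^{\varepsilon})$ on $[0,\infty)\times\Omega$;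 it is nonnegative and bounded in $L^\infty$ uniformly in $\varepsilon$. The Young measure $\{\mu_{t,x}\}$ generated by $\{u^{\varepsilon}\}$ is the family of probability measures such that (along a subsequence) $G(u^{\varepsilon})$ converges weakly$^*$ to $\int_{\mathbb{R}}G\,d\mu_{t,x}$ for every bounded continuous $G:\mathbb{R}\to\mathbb{R}$. *)

theory Defs
  imports "HOL-Probability.Probability"
begin

subsection \<open>Smooth bounded domains\<close>

text \<open>\<open>C\<^sup>k\<close> regularity of a real function on an \<^emph>\<open>open\<close> set, through iterated partial
  derivatives.\<close>

primrec Ck_on :: "nat \<Rightarrow> ('a::euclidean_space \<Rightarrow> real) \<Rightarrow> 'a set \<Rightarrow> bool" where
  "Ck_on 0 f U \<longleftrightarrow> continuous_on U f"
| "Ck_on (Suc k) f U \<longleftrightarrow>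
     f differentiable_on U \<and> (\<forall>b\<in>Basis. Ck_on k (\<lambda>x. frechet_derivative f (at x) b) U)"

definition smooth_on :: "('a::euclidean_space \<Rightarrow> real) \<Rightarrow> 'a set \<Rightarrow> bool" where
  "smooth_on f U \<longleftrightarrow> (\<forall>k. Ck_on k f U)"

text \<open>On \<open>U\<close> the set \<open>\<Omega>\<close> lies on the negative side of the smooth hypersurface \<open>{\<rho> = 0}\<close>;
  in particular \<open>frontier \<Omega> \<inter> U = {x \<in> U. \<rho> x = 0}\<close>.\<close>

definition local_defining_function ::
  "'a::euclidean_space set \<Rightarrow> 'a set \<Rightarrow> ('a \<Rightarrow> real) \<Rightarrow> bool" where
  "local_defining_function \<Omega> U \<rho> \<longleftrightarrow>
     open U \<and> smooth_on \<rho> U \<and>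
     (\<forall>x\<in>U. frechet_derivative \<rho> (at x) \<noteq> (\<lambda>_. 0)) \<and>
     \<Omega> \<inter> U = {x \<in> U. \<rho> x < 0}"

definition smooth_bounded_domain :: "'a::euclidean_space set \<Rightarrow> bool" where
  "smooth_bounded_domain \<Omega> \<longleftrightarrow>
     open \<Omega> \<and> connected \<Omega> \<and> \<Omega> \<noteq> {} \<and> bounded \<Omega> \<and>
     (\<forall>x\<in>frontier \<Omega>. \<exists>U \<rho>. x \<in> U \<and> local_defining_function \<Omega> U \<rho>)"

text \<open>The outward unit normal is \<open>\<nabla>\<rho>(x) / |\<nabla>\<rho>(x)|\<close>.\<close>

definition outward_unit_normal :: "'a::euclidean_space set \<Rightarrow> 'a \<Rightarrow> 'a \<Rightarrow> bool" where
  "outward_unit_normal \<Omega> x n \<longleftrightarrow>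
     norm n = 1 \<and>
     (\<exists>U \<rho> c. x \<in> U \<and> local_defining_function \<Omega> U \<rho> \<and> c > 0 \<and> GDERIV \<rho> x :> c *\<^sub>R n)"

text \<open>The normal derivative is taken from inside \<open>\<Omega>\<close>, so that only values on the closure of
  \<open>\<Omega>\<close> matter.\<close>

definition neumann_condition :: "'a::euclidean_space set \<Rightarrow> ('a \<Rightarrow> real) \<Rightarrow> bool" where
  "neumann_condition \<Omega> f \<longleftrightarrow>
     (\<forall>x\<in>frontier \<Omega>. \<forall>n. outward_unit_normal \<Omega> x n \<longrightarrow>
        ((\<lambda>s. (f x - f (x - s *\<^sub>R n)) / s) \<longlongrightarrow> 0) (at_right 0))"

subsection \<open>Regularity of the initial data\<close>

definition holder_continuous_on :: "real \<Rightarrow> 'a::metric_space set \<Rightarrow> ('a \<Rightarrow> 'b::metric_space) \<Rightarrow> bool"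
  where
  "holder_continuous_on \<alpha> S f \<longleftrightarrow>
     (\<exists>C. \<forall>x\<in>S. \<forall>y\<in>S. dist (f x) (f y) \<le> C * dist x y powr \<alpha>)"

text \<open>The space \<open>C\<^sup>2\<^sup>+\<^sup>\<alpha>\<close> on the closure of \<open>\<Omega>\<close>: here \<open>g x\<close> is the gradient and \<open>H x\<close> the Hessian
  (as a linear map) at \<open>x \<in> \<Omega>\<close>; their values on the boundary are the continuous extensions.\<close>

definition C2_holder_closure :: "real \<Rightarrow> 'a::euclidean_space set \<Rightarrow> ('a \<Rightarrow> real) \<Rightarrow> bool" where
  "C2_holder_closure \<alpha> \<Omega> f \<longleftrightarrow>
     (\<exists>g H. continuous_on (closure \<Omega>) f \<and>
            continuous_on (closure \<Omega>) g \<and>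
            (\<forall>b\<in>Basis. continuous_on (closure \<Omega>) (\<lambda>x. H x b) \<and>
                       holder_continuous_on \<alpha> (closure \<Omega>) (\<lambda>x. H x b)) \<and>
            (\<forall>x\<in>\<Omega>. (GDERIV f x :> g x) \<and> (g has_derivative H x) (at x)))"

subsection \<open>The nonmonotone reaction function\<close>

text \<open>The inverses of \<open>F\<close> on its three monotone branches, extended continuously by constants;
  \<open>ap\<close> and \<open>bm\<close> stand for \<open>\<alpha>\<^sub>+\<close> and \<open>\<beta>\<^sub>-\<close>, so that \<open>F ap\<close> is \<open>f\<^sub>+\<close> and \<open>F bm\<close> is \<open>f\<^sub>-\<close>.\<close>

definition S1 :: "(real \<Rightarrow> real) \<Rightarrow> real \<Rightarrow> real \<Rightarrow> real" where
  "S1 F ap r = (if r < F ap then the_inv_into {..<ap} F r else ap)"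

definition S2 :: "(real \<Rightarrow> real) \<Rightarrow> real \<Rightarrow> real \<Rightarrow> real \<Rightarrow> real" where
  "S2 F ap bm r =
     (if r \<le> F bm then bm else if r < F ap then the_inv_into {ap<..<bm} F r else ap)"

definition S3 :: "(real \<Rightarrow> real) \<Rightarrow> real \<Rightarrow> real \<Rightarrow> real" where
  "S3 F bm r = (if r \<le> F bm then bm else the_inv_into {bm<..} F r)"

text \<open>Since \<open>F'\<close> may vanish inside a monotone branch, the \<open>S\<^sub>i\<close> need not be differentiable
  everywhere on \<open>(f\<^sub>-, f\<^sub>+)\<close>; the identity \<open>\<Sum>a\<^sub>i(S\<^sub>i' + 1) = 0\<close> on a subinterval is understood to
  include that the derivatives exist there.\<close>

definition nondegenerate :: "(real \<Rightarrow> real) \<Rightarrow> real \<Rightarrow> real \<Rightarrow> bool" where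
  "nondegenerate F ap bm \<longleftrightarrow>
     (\<forall>p q a1 a2 a3. p < q \<longrightarrow> {p<..<q} \<subseteq> {F bm<..<F ap} \<longrightarrow>
        (\<forall>r\<in>{p<..<q}.
           S1 F ap field_differentiable (at r) \<and>
           S2 F ap bm field_differentiable (at r) \<and>
           S3 F bm field_differentiable (at r) \<and>
           a1 * (deriv (S1 F ap) r + 1) + a2 * (deriv (S2 F ap bm) r + 1)
             + a3 * (deriv (S3 F bm) r + 1) = 0) \<longrightarrow>
        a1 + a2 + a3 = 0)"

definition admissible_reaction ::
  "(real \<Rightarrow> real) \<Rightarrow> real \<Rightarrow> real \<Rightarrow> real \<Rightarrow> real \<Rightarrow> bool" where
  "admissible_reaction F am ap bm bp \<longleftrightarrow>
     F C1_differentiable_on UNIV \<and> F 0 = 0 \<and> (\<forall>x\<ge>0. F x \<ge> 0) \<and>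
     0 < am \<and> am < ap \<and> ap < bm \<and> bm < bp \<and>
     F bm = F am \<and> F ap = F bp \<and>
     strict_mono_on {..<ap} F \<and> strict_antimono_on {ap<..<bm} F \<and> strict_mono_on {bm<..} F \<and>
     filterlim F at_top at_top \<and> filterlim F at_bot at_bot \<and>
     nondegenerate F ap bm"

subsection \<open>Classical solutions\<close>

text \<open>Both components are continuous on \<open>[0,\<infty>)\<close> times the closure of \<open>\<Omega>\<close>, \<open>u\<close> is \<open>C\<^sup>1\<close> in time,
  and \<open>v\<close> is of class \<open>C\<^sup>1\<close> in time and \<open>C\<^sup>2\<close> in space for positive times, with derivatives extending
  continuously to the boundary. The functions \<open>vt\<close>, \<open>g\<close>, \<open>H\<close> are the time derivative, the spatial
  gradient and the spatial Hessian of \<open>v\<close>, and the trace of \<open>H t x\<close> is the Laplacian. Only \<open>v\<close>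
  diffuses, so the boundary condition is imposed on \<open>v\<close>.\<close>

definition classical_solution ::
  "'a::euclidean_space set \<Rightarrow> (real \<Rightarrow> real) \<Rightarrow> real \<Rightarrow> ('a \<Rightarrow> real) \<Rightarrow> ('a \<Rightarrow> real)
     \<Rightarrow> (real \<Rightarrow> 'a \<Rightarrow> real) \<Rightarrow> (real \<Rightarrow> 'a \<Rightarrow> real) \<Rightarrow> bool" where
  "classical_solution \<Omega> F \<epsilon> u0 v0 u v \<longleftrightarrow>
     continuous_on ({0..} \<times> closure \<Omega>) (\<lambda>(t, x). u t x) \<and>
     continuous_on ({0..} \<times> closure \<Omega>) (\<lambda>(t, x). v t x) \<and>
     (\<forall>x\<in>closure \<Omega>. u 0 x = u0 x \<and> v 0 x = v0 x) \<and>
     (\<forall>t>0. \<forall>x\<in>\<Omega>. ((\<lambda>s. u s x) has_real_derivative (v t x - F (u t x)) / \<epsilon>) (at t)) \<and>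
     (\<exists>vt g H.
        continuous_on ({0<..} \<times> closure \<Omega>) (\<lambda>(t, x). vt t x) \<and>
        continuous_on ({0<..} \<times> closure \<Omega>) (\<lambda>(t, x). g t x) \<and>
        (\<forall>b\<in>Basis. continuous_on ({0<..} \<times> closure \<Omega>) (\<lambda>(t, x). H t x b)) \<and>
        (\<forall>t>0. \<forall>x\<in>\<Omega>.
           ((\<lambda>s. v s x) has_real_derivative vt t x) (at t) \<and>
           (GDERIV (v t) x :> g t x) \<and>
           (g t has_derivative H t x) (at x) \<and>
           vt t x = (\<Sum>b\<in>Basis. H t x b \<bullet> b) + (F (u t x) - v t x) / \<epsilon>)) \<and>
     (\<forall>t>0. neumann_condition \<Omega> (v t))"

subsection \<open>Modes of convergence and Young measures\<close>

definition in_Linf :: "'z measure \<Rightarrow> ('z \<Rightarrow> real) \<Rightarrow> bool" where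
  "in_Linf M f \<longleftrightarrow> f \<in> borel_measurable M \<and> (\<exists>C. AE z in M. \<bar>f z\<bar> \<le> C)"

definition weak_star_Linf :: "'z measure \<Rightarrow> (nat \<Rightarrow> 'z \<Rightarrow> real) \<Rightarrow> ('z \<Rightarrow> real) \<Rightarrow> bool" where
  "weak_star_Linf M f g \<longleftrightarrow>
     (\<forall>k. in_Linf M (f k)) \<and> in_Linf M g \<and>
     (\<forall>\<phi>. integrable M \<phi> \<longrightarrow>
        (\<lambda>k. \<integral>z. f k z * \<phi> z \<partial>M) \<longlonglongrightarrow> (\<integral>z. g z * \<phi> z \<partial>M))"

definition in_L2 :: "'z measure \<Rightarrow> ('z \<Rightarrow> real) \<Rightarrow> bool" where
  "in_L2 M f \<longleftrightarrow> f \<in> borel_measurable M \<and> integrable M (\<lambda>z. (f z)\<^sup>2)"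

definition strong_L2 :: "'z measure \<Rightarrow> (nat \<Rightarrow> 'z \<Rightarrow> real) \<Rightarrow> ('z \<Rightarrow> real) \<Rightarrow> bool" where
  "strong_L2 M f g \<longleftrightarrow>
     (\<forall>k. in_L2 M (f k)) \<and> in_L2 M g \<and> (\<lambda>k. \<integral>z. (f k z - g z)\<^sup>2 \<partial>M) \<longlonglongrightarrow> 0"

definition generates_young_measure ::
  "'z measure \<Rightarrow> (nat \<Rightarrow> 'z \<Rightarrow> real) \<Rightarrow> ('z \<Rightarrow> real measure) \<Rightarrow> bool" where
  "generates_young_measure M f \<mu> \<longleftrightarrow>
     (\<forall>z\<in>space M. prob_space (\<mu> z) \<and> sets (\<mu> z) = sets borel) \<and>
     (\<forall>G :: real \<Rightarrow> real. continuous_on UNIV G \<longrightarrow> bounded (range G) \<longrightarrow>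
        weak_star_Linf M (\<lambda>k z. G (f k z)) (\<lambda>z. \<integral>y. G y \<partial>\<mu> z))"

abbreviation spacetime :: "real \<Rightarrow> 'a::euclidean_space set \<Rightarrow> (real \<times> 'a) measure" where
  "spacetime T \<Omega> \<equiv> lebesgue_on ({0<..<T} \<times> \<Omega>)"

end

theory Submission
  imports Defs "HOL-Library.Diagonal_Subsequence"
begin

text \<open>An energy estimate gives local bounds on \<open>\<nabla>v\<close> and shows that \<open>v - F(u)\<close> tends to \<open>0\<close> locally in
  \<open>L\<^sup>2\<close>. If \<open>\<Psi>' = h \<circ> F\<close> and \<open>\<Phi>' = h\<close>, then \<open>\<Psi>(u) + \<Phi>(v)\<close> has controlled time derivative, while functions
  of \<open>v\<close> have controlled space gradient; hence the product of the weak limits of \<open>\<Psi>(u) + \<Phi>(v)\<close> and \<open>H(v)\<close> is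
  the weak limit of the product, for every \<open>H\<close>. So the average of \<open>\<Psi>(u) + \<Phi>(F(u))\<close>, conditioned on \<open>r = F(u)\<close>
  under the Young measure, does not depend on \<open>r\<close>. If the law of \<open>F(u)\<close> charged both sides of an interval \<open>(p, q)\<close>,
  then comparing these averages for bump functions \<open>h\<close> supported in \<open>[p, q]\<close> would give weights \<open>a\<^sub>i\<close> with
  \<open>\<Sum>a\<^sub>i (S\<^sub>i' + 1) = 0\<close> on a subinterval and \<open>\<Sum>a\<^sub>i \<noteq> 0\<close>, against nondegeneracy. Hence \<open>F(u)\<close> has a one-point
  law, which means strong convergence of \<open>F(u)\<close> and of \<open>v\<close>; splitting \<open>G(u)\<close> along the three branches
  \<open>u = S\<^sub>i(F(u))\<close> then yields the Young measure.\<close>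

section \<open>Solutions with directional derivatives\<close>

text \<open>The energy estimate does not make \<open>v\<close> compact: its time derivative contains
  \<open>(F u - v) / \<epsilon>\<close>, which the energy controls in L2 only to the order
  \<open>1 / sqrt \<epsilon>\<close>. Testing the two equations with \<open>h (F u)\<close> and
  \<open>h v\<close> and adding them leaves the stiff term
  \<open>(h (F u) - h v) * (v - F u) / \<epsilon>\<close>, quadratic in \<open>v - F u\<close> and
  hence bounded in L1 by the energy. This is why products of these special combinations with
  functions of \<open>v\<close> pass to the limit although neither factor is known to converge
  strongly. All estimates are interior, on balls inside the cylinder; the boundary condition serves
  only the minimum principle that bounds \<open>u\<close> and \<open>v\<close> uniformly in
  \<epsilon>. No Young measure is at hand while concentration is proved: weak limits of a countable
  family of functions of \<open>u\<close> stand in for its integrals. Therefore the bumps have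
  rational endpoints, and all null sets can be collected into one. The measure is assembled only at
  the end, from the weak limits of the indicators of the three branches.\<close>

definition has_dir_deriv :: "'b::real_normed_vector \<Rightarrow> ('b \<Rightarrow> real) \<Rightarrow> real \<Rightarrow> 'b \<Rightarrow> bool" where
  "has_dir_deriv d f D z \<longleftrightarrow> ((\<lambda>s. f (z + s *\<^sub>R d)) has_real_derivative D) (at 0)"

lemma has_dir_deriv_mult:
  "has_dir_deriv d f a z \<Longrightarrow> has_dir_deriv d g b z \<Longrightarrow>
    has_dir_deriv d (\<lambda>z. f z * g z) (a * g z + f z * b) z"
  unfolding has_dir_deriv_def by (auto intro!: derivative_eq_intros)

lemma has_dir_deriv_add:
  "has_dir_deriv d f a z \<Longrightarrow> has_dir_deriv d g b z \<Longrightarrow> has_dir_deriv d (\<lambda>z. f z + g z) (a + b) z"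
  unfolding has_dir_deriv_def by (auto intro!: derivative_eq_intros)

lemma has_dir_deriv_chain:
  assumes "has_dir_deriv d f a z" "(\<phi> has_real_derivative b) (at (f z))"
  shows "has_dir_deriv d (\<lambda>z. \<phi> (f z)) (b * a) z"
  using assms unfolding has_dir_deriv_def
  by (intro DERIV_chain2[where f=\<phi>]) auto

lemma has_dir_deriv_at:
  assumes "has_dir_deriv d f D (z + s *\<^sub>R d)"
  shows "((\<lambda>s. f (z + s *\<^sub>R d)) has_real_derivative D) (at s)"
proof -
  have "((\<lambda>t. f (z + (s + t) *\<^sub>R d)) has_real_derivative D) (at 0)"
    using assms unfolding has_dir_deriv_def by (simp add: scaleR_add_left algebra_simps)
  then show ?thesis
    using DERIV_shift[of "\<lambda>s. f (z + s *\<^sub>R d)" D 0 s] by (simp add: add.commute)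
qed

lemma has_dir_deriv_shift:
  "has_dir_deriv d f D (z + h) \<Longrightarrow> has_dir_deriv d (\<lambda>z. f (z + h)) D z"
  unfolding has_dir_deriv_def by (simp add: algebra_simps)

lemma has_dir_deriv_transfer:
  fixes z d :: "'b::real_normed_vector"
  assumes f: "has_dir_deriv d f D z" and S: "open S" "z \<in> S" and eq: "\<And>y. y \<in> S \<Longrightarrow> f y = g y"
  shows "has_dir_deriv d g D z"
proof -
  have "open ((\<lambda>s::real. z + s *\<^sub>R d) -` S)"
    by (rule open_vimage[OF S(1)]) (auto intro!: continuous_intros)
  then show ?thesis
    using f S eq unfolding has_dir_deriv_def
    by (auto intro: has_field_derivative_transform_within_open
        [where S="(\<lambda>s::real. z + s *\<^sub>R d) -` S"])
qed

lemma has_dir_deriv_zero: "has_dir_deriv d (\<lambda>_. 0) 0 z"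
  unfolding has_dir_deriv_def by simp

section \<open>Integration over closed balls and integration by parts along a direction\<close>

abbreviation ballm :: "'b::euclidean_space \<Rightarrow> real \<Rightarrow> 'b measure" where
  "ballm a r \<equiv> restrict_space lborel (cball a r)"

lemma finite_measure_ballm: "finite_measure (ballm a r)"
  by (rule finite_measureI)
    (use emeasure_lborel_cball_finite[of a r] in \<open>auto simp: emeasure_restrict_space space_restrict_space less_top[symmetric]\<close>)

lemma integrable_ballm:
  "continuous_on (cball a r) f \<Longrightarrow> integrable (ballm a r) (f :: 'b::euclidean_space \<Rightarrow> real)"
  using borel_integrable_compact[of "cball a r" f]
  by (subst integrable_restrict_space) (auto simp: mult.commute)

lemma integral_ballm: "integral\<^sup>L (ballm a r) f = (\<integral>z. indicator (cball a r) z * (f z::real) \<partial>lborel)"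
  by (subst integral_restrict_space) auto

lemma integral_lborel_shift:
  fixes f :: "'b::euclidean_space \<Rightarrow> real"
  assumes "f \<in> borel_measurable borel"
  shows "(\<integral>z. f (z + h) \<partial>lborel) = (\<integral>z. f z \<partial>lborel)"
proof -
  have "(\<integral>z. f z \<partial>lborel) = (\<integral>z. f z \<partial>distr lborel borel ((+) h))"
    by (simp add: lborel_distr_plus)
  also have "\<dots> = (\<integral>z. f (h + z) \<partial>lborel)"
    using assms by (subst integral_distr) auto
  finally show ?thesis by (simp add: add.commute)
qed

lemma integrable_lborel_shift:
  fixes f :: "'b::euclidean_space \<Rightarrow> real"
  assumes "integrable lborel f"
  shows "integrable lborel (\<lambda>z. f (z + h))"
proof -
  have "integrable (distr lborel borel ((+) h)) f"
    using assms by (simp add: lborel_distr_plus)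
  then have "integrable lborel (\<lambda>z. f (h + z))"
    by (subst (asm) integrable_distr_eq) (use assms in auto)
  then show ?thesis by (simp add: add.commute)
qed

text \<open>By translation invariance every difference quotient of \<open>G\<close> along
  \<open>d\<close> has integral zero, and the quotients converge dominatedly to the derivative. This
  gives integration by parts from differentiability along the single direction \<open>d\<close>,
  without slicing the ball. The derivative is extended by zero as \<open>D\<close>, since
  \<open>G\<close> vanishes off the ball and is differentiable on a neighbourhood of it.\<close>

lemma integral_dir_deriv_eq_0:
  fixes G G' :: "'b::euclidean_space \<Rightarrow> real"
  assumes Q: "cball a r \<subseteq> Q" "open Q" and G: "continuous_on Q G" and G': "continuous_on Q G'"
    and D: "\<And>z. z \<in> Q \<Longrightarrow> has_dir_deriv d G (G' z) z"
    and Z: "\<And>z. z \<notin> cball a r \<Longrightarrow> G z = 0"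
  shows "(\<integral>z. G' z \<partial>ballm a r) = 0"
proof -
  define D where "D z = indicator (cball a r) z * G' z" for z
  have op: "open (- cball a r)" by auto
  have pd: "has_dir_deriv d G (D z) z" for z
  proof (cases "z \<in> cball a r")
    case True then show ?thesis using D Q by (auto simp: D_def)
  next
    case False
    then have "has_dir_deriv d G 0 z"
      using has_dir_deriv_transfer[OF has_dir_deriv_zero op] Z by auto
    then show ?thesis using False by (simp add: D_def)
  qed
  have "continuous_on (Q \<union> - cball a r) G"
    by (rule continuous_on_open_Un[OF Q(2) op G])
      (use Z in \<open>auto intro: continuous_on_eq[OF continuous_on_const[of _ 0]]\<close>)
  moreover have "Q \<union> - cball a r = UNIV" using Q by auto
  ultimately have Gc: "continuous_on UNIV G" by simp
  have Gm: "G \<in> borel_measurable borel" by (rule borel_measurable_continuous_onI[OF Gc])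
  have Gi: "integrable lborel G"
  proof -
    have "integrable lborel (\<lambda>z. indicator (cball a r) z *\<^sub>R G z)"
      by (rule borel_integrable_compact) (use Gc continuous_on_subset in auto)
    moreover have "(\<lambda>z. indicator (cball a r) z *\<^sub>R G z) = G"
      using Z by (auto simp: indicator_def fun_eq_iff)
    ultimately show ?thesis by simp
  qed
  have cG': "continuous_on (cball a r) G'" using G' Q continuous_on_subset by blast
  then have Dm: "D \<in> borel_measurable borel"
    unfolding D_def using borel_measurable_continuous_on_indicator[of "cball a r" G'] by simp
  obtain B where B: "B \<ge> 0" "\<And>z. z \<in> cball a r \<Longrightarrow> \<bar>G' z\<bar> \<le> B"
  proof -
    have "bounded (G' ` cball a r)"
      by (intro compact_imp_bounded compact_continuous_image cG') auto
    then obtain B where "\<forall>x\<in>G' ` cball a r. norm x \<le> B" unfolding bounded_iff by blast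
    then have "\<And>z. z \<in> cball a r \<Longrightarrow> \<bar>G' z\<bar> \<le> max B 0" by (force simp: le_max_iff_disj)
    then show ?thesis using that[of "max B 0"] by simp
  qed
  have DB: "\<bar>D z\<bar> \<le> B" for z using B by (auto simp: D_def indicator_def)
  define m where "m n = 1 / real (Suc n)" for n
  have mpos: "0 < m n" "m n \<le> 1" for n by (auto simp: m_def)
  define s where "s n z = (G (z + m n *\<^sub>R d) - G z) / m n" for n z
  have lim: "(\<lambda>n. s n z) \<longlonglongrightarrow> D z" for z
  proof -
    have L: "(\<lambda>h. (G (z + h *\<^sub>R d) - G z) / h) \<midarrow>0\<rightarrow> D z"
      using pd[of z] unfolding has_dir_deriv_def DERIV_def by simp
    have "m \<longlonglongrightarrow> 0" unfolding m_def by (rule LIMSEQ_Suc[OF lim_1_over_n])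
    moreover have "m i \<in> UNIV - {0}" for i using mpos(1)[of i] by auto
    ultimately have "((\<lambda>h. (G (z + h *\<^sub>R d) - G z) / h) \<circ> m) \<longlonglongrightarrow> D z"
      by (intro L[unfolded tendsto_at_iff_sequentially, rule_format])
    then show ?thesis by (simp add: s_def comp_def)
  qed
  \<comment> \<open>Inside the enlarged ball the mean value theorem gives the bound
    \<open>B\<close>. Outside it both values of \<open>G\<close> vanish, because a step length is at
    most 1 and so moves a point by at most \<open>norm d\<close>.\<close>
  have bound: "\<bar>s n z\<bar> \<le> indicator (cball a (r + norm d)) z * B" for n z
  proof (cases "z \<in> cball a (r + norm d)")
    case True
    have "\<bar>G (z + m n *\<^sub>R d) - G (z + 0 *\<^sub>R d)\<bar> \<le> B * \<bar>m n - 0\<bar>"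
      using field_differentiable_bound[of UNIV "\<lambda>s. G (z + s *\<^sub>R d)" "\<lambda>s. D (z + s *\<^sub>R d)" B "m n" 0]
        has_dir_deriv_at[OF pd] DB by auto
    then show ?thesis using True mpos[of n] by (auto simp: s_def divide_simps)
  next
    case False
    then have 1: "dist a z > r + norm d" by auto
    have "dist a z \<le> dist a (z + m n *\<^sub>R d) + m n * norm d"
      using dist_triangle[of a z "z + m n *\<^sub>R d"] mpos[of n] by (simp add: dist_norm)
    moreover have "m n * norm d \<le> norm d" using mpos[of n] by (simp add: mult_left_le_one_le)
    ultimately have "dist a (z + m n *\<^sub>R d) > r" using 1 by linarith
    moreover have "dist a z > r" using 1 norm_ge_zero[of d] by linarith
    ultimately show ?thesis using Z[of z] Z[of "z + m n *\<^sub>R d"] B(1) by (simp add: s_def)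
  qed
  have "(\<lambda>n. \<integral>z. s n z \<partial>lborel) \<longlonglongrightarrow> (\<integral>z. D z \<partial>lborel)"
  proof (rule integral_dominated_convergence[where w="\<lambda>z. indicator (cball a (r + norm d)) z * B"])
    show "s n \<in> borel_measurable lborel" for n
      unfolding s_def using Gm by measurable
    show "integrable lborel (\<lambda>z. indicator (cball a (r + norm d)) z * B)"
      using borel_integrable_compact[of "cball a (r + norm d)" "\<lambda>_. B"] by simp
  qed (use lim bound Dm in auto)
  moreover have "(\<integral>z. s n z \<partial>lborel) = 0" for n
    unfolding s_def using Gi Gm integrable_lborel_shift[OF Gi, of "m n *\<^sub>R d"] by (simp add: integral_lborel_shift)
  ultimately have "(\<integral>z. D z \<partial>lborel) = 0" by (simp add: LIMSEQ_const_iff)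
  then show ?thesis by (simp add: integral_ballm D_def)
qed


text \<open>The interior setting of all estimates: an open set, no boundary and no initial
  condition. Derivatives are directional because \<open>u\<close> is differentiable in time only;
  \<open>(1, 0)\<close> is the time direction. The gradient is required along every
  \<open>y\<close>, as shifts in arbitrary space directions occur, whereas second derivatives are
  needed only to form the Laplacian.\<close>

locale rd_solution =
  fixes Q :: "(real \<times> 'a::euclidean_space) set" and F :: "real \<Rightarrow> real" and \<epsilon> M :: real
    and u v vt :: "real \<times> 'a \<Rightarrow> real" and g h :: "'a \<Rightarrow> real \<times> 'a \<Rightarrow> real"
  assumes openQ: "open Q" and eps: "0 < \<epsilon>" and contF: "continuous_on UNIV F"
    and cont_u: "continuous_on Q u" and cont_v: "continuous_on Q v" and cont_vt: "continuous_on Q vt"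
    and cont_g: "b \<in> Basis \<Longrightarrow> continuous_on Q (g b)" and cont_h: "b \<in> Basis \<Longrightarrow> continuous_on Q (h b)"
    and deriv_u: "z \<in> Q \<Longrightarrow> has_dir_deriv (1, 0) u ((v z - F (u z)) / \<epsilon>) z"
    and deriv_v: "z \<in> Q \<Longrightarrow> has_dir_deriv (1, 0) v (vt z) z"
    and grad_v: "z \<in> Q \<Longrightarrow> has_dir_deriv (0, y) v (\<Sum>b\<in>Basis. (y \<bullet> b) * g b z) z"
    and hess_v: "z \<in> Q \<Longrightarrow> b \<in> Basis \<Longrightarrow> has_dir_deriv (0, b) (g b) (h b z) z"
    and eq_v: "z \<in> Q \<Longrightarrow> vt z = (\<Sum>b\<in>Basis. h b z) + (F (u z) - v z) / \<epsilon>"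
    and bounds: "z \<in> Q \<Longrightarrow> u z \<in> {0..M} \<and> v z \<in> {0..M} \<and> F (u z) \<in> {0..M}"
begin

text \<open>The dissipation density of the functional with density
  \<open>\<Psi> u + v^2 / 2\<close>, where \<open>\<Psi>' = F\<close>.\<close>

definition energy :: "real \<times> 'a \<Rightarrow> real" where
  "energy z = (\<Sum>b\<in>Basis. (g b z)\<^sup>2) + (v z - F (u z))\<^sup>2 / \<epsilon>"

lemma grad_v_Basis: "z \<in> Q \<Longrightarrow> b \<in> Basis \<Longrightarrow> has_dir_deriv (0, b) v (g b z) z"
  using grad_v[of z b] by (simp add: inner_Basis if_distrib[of "\<lambda>c. c * _"] cong: if_cong)

lemma cont_Fu: "continuous_on Q (\<lambda>z. F (u z))"
  using continuous_on_compose2[OF contF cont_u] by auto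

lemma cont_energy: "continuous_on Q energy"
  unfolding energy_def using eps by (intro continuous_intros cont_g cont_v cont_Fu) auto

lemma energy_nonneg: "energy z \<ge> 0"
  unfolding energy_def using eps by (intro add_nonneg_nonneg sum_nonneg) auto

text \<open>The equation for \<open>u\<close> is multiplied by \<open>\<phi> (F u)\<close>, that for
  \<open>v\<close> by \<open>\<phi> v\<close>, and the sum is tested with \<open>\<omega>\<close>.
  The two terms of order \<open>1 / \<epsilon>\<close> merge into a product of differences, which
  has a sign when \<open>\<phi>\<close> is monotone and is quadratic in \<open>v - F u\<close> when
  \<open>\<phi>\<close> is Lipschitz. The time derivative and one derivative of the Laplacian are
  moved to the other factors.\<close>

lemma weak_form:
  assumes r: "cball a r \<subseteq> Q"
    and \<omega>: "continuous_on Q \<omega>" "continuous_on Q \<omega>t" "\<And>b. b \<in> Basis \<Longrightarrow> continuous_on Q (\<omega>b b)"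
    and D\<omega>: "\<And>z. z \<in> Q \<Longrightarrow> has_dir_deriv (1, 0) \<omega> (\<omega>t z) z"
      "\<And>z b. z \<in> Q \<Longrightarrow> b \<in> Basis \<Longrightarrow> has_dir_deriv (0, b) \<omega> (\<omega>b b z) z"
    and Z: "\<And>z. z \<notin> cball a r \<Longrightarrow> \<omega> z = 0"
    and \<Psi>: "\<And>x. (\<Psi> has_real_derivative \<phi> (F x)) (at x)"
    and \<Phi>: "\<And>x. (\<Phi> has_real_derivative \<phi> x) (at x)"
    and \<phi>: "\<And>x. (\<phi> has_real_derivative \<phi>' x) (at x)" and \<phi>': "continuous_on UNIV \<phi>'"
  shows "(\<integral>z. \<omega>t z * (\<Psi> (u z) + \<Phi> (v z)) \<partial>ballm a r) =
    (\<integral>z. (\<Sum>b\<in>Basis. \<omega>b b z * \<phi> (v z) * g b z + \<omega> z * \<phi>' (v z) * (g b z)\<^sup>2)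
      - \<omega> z * ((\<phi> (F (u z)) - \<phi> (v z)) * (v z - F (u z)) / \<epsilon>) \<partial>ballm a r)"
proof -
  have c1: "continuous_on UNIV \<Psi>" "continuous_on UNIV \<Phi>" "continuous_on UNIV \<phi>"
    using \<Psi> \<Phi> \<phi> by (auto intro!: DERIV_continuous_on)
  note c2 = continuous_on_compose2[OF c1(1) cont_u] continuous_on_compose2[OF c1(2) cont_v]
    continuous_on_compose2[OF c1(3) cont_v] continuous_on_compose2[OF c1(3) cont_Fu]
    continuous_on_compose2[OF \<phi>' cont_v]
  note ci = continuous_intros c2 cont_u cont_v cont_vt cont_g cont_h cont_Fu \<omega>
  \<comment> \<open>\<open>Gt\<close> is the time derivative of
    \<open>\<omega> * (\<Psi> u + \<Phi> v)\<close> and \<open>Gb b\<close> the derivative along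
    \<open>b\<close> of \<open>\<omega> * \<phi> v * g b\<close>; both functions vanish off the
    ball, so both integrals are zero.\<close>
  define Gt where "Gt z = \<omega>t z * (\<Psi> (u z) + \<Phi> (v z)) +
    \<omega> z * (\<phi> (F (u z)) * ((v z - F (u z)) / \<epsilon>) + \<phi> (v z) * vt z)" for z
  define Gb where "Gb b z = (\<omega>b b z * \<phi> (v z) + \<omega> z * (\<phi>' (v z) * g b z)) * g b z
    + \<omega> z * \<phi> (v z) * h b z" for b z
  have cGt: "continuous_on Q Gt" unfolding Gt_def using eps by (intro ci) auto
  have cGb: "continuous_on Q (Gb b)" if "b \<in> Basis" for b unfolding Gb_def using that by (intro ci) auto
  have 1: "(\<integral>z. Gt z \<partial>ballm a r) = 0"
  proof (rule integral_dir_deriv_eq_0[OF r openQ _ cGt])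
    show "continuous_on Q (\<lambda>z. \<omega> z * (\<Psi> (u z) + \<Phi> (v z)))" by (intro ci) auto
    show "has_dir_deriv (1, 0) (\<lambda>z. \<omega> z * (\<Psi> (u z) + \<Phi> (v z))) (Gt z) z" if "z \<in> Q" for z
      unfolding Gt_def using that
      by (intro has_dir_deriv_mult has_dir_deriv_add has_dir_deriv_chain[where \<phi>=\<Psi>]
          has_dir_deriv_chain[where \<phi>=\<Phi>] \<Psi> \<Phi> deriv_u deriv_v D\<omega>)
  qed (use Z in auto)
  have 2: "(\<integral>z. Gb b z \<partial>ballm a r) = 0" if b: "b \<in> Basis" for b
  proof (rule integral_dir_deriv_eq_0[OF r openQ _ cGb[OF b]])
    show "continuous_on Q (\<lambda>z. \<omega> z * \<phi> (v z) * g b z)" using b by (intro ci) auto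
    show "has_dir_deriv (0, b) (\<lambda>z. \<omega> z * \<phi> (v z) * g b z) (Gb b z) z" if "z \<in> Q" for z
      unfolding Gb_def using that b
      by (intro has_dir_deriv_mult has_dir_deriv_chain[where \<phi>=\<phi>] \<phi> grad_v_Basis hess_v D\<omega>)
  qed (use Z in auto)
  have i1: "integrable (ballm a r) Gt" by (rule integrable_ballm[OF continuous_on_subset[OF cGt r]])
  have i2: "integrable (ballm a r) (Gb b)" if "b \<in> Basis" for b
    by (rule integrable_ballm[OF continuous_on_subset[OF cGb[OF that] r]])
  let ?R = "\<lambda>z. (\<Sum>b\<in>Basis. \<omega>b b z * \<phi> (v z) * g b z + \<omega> z * \<phi>' (v z) * (g b z)\<^sup>2)
      - \<omega> z * ((\<phi> (F (u z)) - \<phi> (v z)) * (v z - F (u z)) / \<epsilon>)"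
  have cR: "continuous_on Q ?R" using eps by (intro ci) auto
  have i3: "integrable (ballm a r) ?R" by (rule integrable_ballm[OF continuous_on_subset[OF cR r]])
  \<comment> \<open>The two integrands differ by \<open>Gt\<close> minus the sum of the
    \<open>Gb b\<close>: once the equation for \<open>vt\<close> is inserted, the Laplacian terms
    cancel.\<close>
  have "(\<integral>z. \<omega>t z * (\<Psi> (u z) + \<Phi> (v z)) \<partial>ballm a r)
    = (\<integral>z. ?R z + (Gt z - (\<Sum>b\<in>Basis. Gb b z)) \<partial>ballm a r)"
  proof (rule Bochner_Integration.integral_cong[OF refl])
    fix z assume "z \<in> space (ballm a r)"
    then have z: "z \<in> Q" using r by (auto simp: space_restrict_space)
    have "(\<Sum>b\<in>Basis. Gb b z) = (\<Sum>b\<in>Basis. \<omega>b b z * \<phi> (v z) * g b z + \<omega> z * \<phi>' (v z) * (g b z)\<^sup>2)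
        + \<omega> z * \<phi> (v z) * (\<Sum>b\<in>Basis. h b z)"
      unfolding Gb_def sum_distrib_left sum.distrib[symmetric]
      by (rule sum.cong) (auto simp: algebra_simps power2_eq_square)
    then show "\<omega>t z * (\<Psi> (u z) + \<Phi> (v z)) = ?R z + (Gt z - (\<Sum>b\<in>Basis. Gb b z))"
      unfolding Gt_def eq_v[OF z] using eps by (simp add: field_simps)
  qed
  also have "\<dots> = (\<integral>z. ?R z \<partial>ballm a r)"
    using i1 i2 i3 1 2 by simp
  finally show ?thesis .
qed

end

section \<open>Cutoff functions and elementary bounds for integrals\<close>

lemma compact_bound_abs:
  assumes "compact S" "continuous_on S (f :: 'b::topological_space \<Rightarrow> real)"
  obtains B where "B \<ge> 0" "\<And>z. z \<in> S \<Longrightarrow> \<bar>f z\<bar> \<le> B"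
proof -
  have "bounded (f ` S)" by (intro compact_imp_bounded compact_continuous_image assms)
  then obtain B where B: "\<forall>x\<in>f ` S. norm x \<le> B" unfolding bounded_iff by blast
  then have "\<And>z. z \<in> S \<Longrightarrow> \<bar>f z\<bar> \<le> max B 0" by (force simp: le_max_iff_disj)
  then show ?thesis using that[of "max B 0"] by simp
qed

lemma abs_integral_ballm_le:
  assumes "continuous_on (cball a r) f" "continuous_on (cball a r) g"
    and "\<And>z. z \<in> cball a r \<Longrightarrow> \<bar>f z\<bar> \<le> (g z :: real)"
  shows "\<bar>\<integral>z. f z \<partial>ballm a r\<bar> \<le> (\<integral>z. g z \<partial>ballm a r)"
proof -
  have "\<bar>\<integral>z. f z \<partial>ballm a r\<bar> \<le> (\<integral>z. \<bar>f z\<bar> \<partial>ballm a r)" by (rule integral_abs_bound)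
  also have "\<dots> \<le> (\<integral>z. g z \<partial>ballm a r)"
    using assms by (intro integral_mono integrable_ballm continuous_intros) (auto simp: space_restrict_space)
  finally show ?thesis .
qed

lemma integral_ballm_mono:
  assumes "continuous_on (cball a r) f" "continuous_on (cball a r) g"
    and "\<And>z. z \<in> cball a r \<Longrightarrow> f z \<le> (g z :: real)"
  shows "(\<integral>z. f z \<partial>ballm a r) \<le> (\<integral>z. g z \<partial>ballm a r)"
  using assms by (intro integral_mono integrable_ballm) (auto simp: space_restrict_space)

text \<open>After the change of variables the integral runs over a ball contained in the larger one,
  and the integrand is nonnegative there.\<close>

lemma integral_ballm_shift_le:
  fixes f :: "'b::euclidean_space \<Rightarrow> real"
  assumes f: "integrable (ballm a R) f" and nn: "\<And>z. z \<in> cball a R \<Longrightarrow> 0 \<le> f z" and h: "r + norm h \<le> R"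
  shows "(\<integral>z. f (z + h) \<partial>ballm a r) \<le> (\<integral>z. f z \<partial>ballm a R)"
proof -
  define \<phi> where "\<phi> y = indicator (cball (a + h) r) y *\<^sub>R f y" for y
  have sub: "cball (a + h) r \<subseteq> cball a R"
  proof
    fix y assume "y \<in> cball (a + h) r"
    then have "norm (a + h - y) \<le> r" by (simp add: dist_norm)
    moreover have "norm (a - y) \<le> norm (a + h - y) + norm h"
      using norm_triangle_ineq4[of "a + h - y" h] by (simp add: algebra_simps)
    ultimately show "y \<in> cball a R" using h by (simp add: dist_norm)
  qed
  have i2: "integrable lborel (\<lambda>y. indicator (cball a R) y *\<^sub>R f y)"
    using f by (subst (asm) integrable_restrict_space) (auto simp: mult.commute)
  have "integrable lborel (\<lambda>y. indicator (cball (a + h) r) y *\<^sub>R (indicator (cball a R) y *\<^sub>R f y))"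
    by (rule integrable_mult_indicator[OF _ i2]) auto
  moreover have "(\<lambda>y. indicator (cball (a + h) r) y *\<^sub>R (indicator (cball a R) y *\<^sub>R f y)) = \<phi>"
    using sub by (auto simp: \<phi>_def indicator_def fun_eq_iff simp del: mem_cball)
  ultimately have i1: "integrable lborel \<phi>" by simp
  have "(\<integral>z. f (z + h) \<partial>ballm a r) = (\<integral>z. \<phi> (z + h) \<partial>lborel)"
    unfolding integral_ballm \<phi>_def
    by (rule Bochner_Integration.integral_cong[OF refl]) (auto simp: indicator_def dist_norm)
  also have "\<dots> = (\<integral>z. \<phi> z \<partial>lborel)" using i1 by (intro integral_lborel_shift) auto
  also have "\<dots> \<le> (\<integral>y. indicator (cball a R) y *\<^sub>R f y \<partial>lborel)"
  proof (rule integral_mono[OF i1 i2])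
    show "\<phi> y \<le> indicator (cball a R) y *\<^sub>R f y" for y
      using sub nn[of y] unfolding \<phi>_def by (auto simp: indicator_def simp del: mem_cball)
  qed
  finally show ?thesis by (simp add: integral_ballm)
qed

text \<open>Squaring the positive part makes the cutoff continuously differentiable across the
  sphere; a test function in the weak form needs no second derivative.\<close>

definition bump :: "'b::real_inner \<Rightarrow> real \<Rightarrow> 'b \<Rightarrow> real" where
  "bump a \<rho> z = (max 0 (\<rho>\<^sup>2 - (norm (z - a))\<^sup>2))\<^sup>2"

definition bump_deriv :: "'b::real_inner \<Rightarrow> real \<Rightarrow> 'b \<Rightarrow> 'b \<Rightarrow> real" where
  "bump_deriv a \<rho> d z = - (4 * max 0 (\<rho>\<^sup>2 - (norm (z - a))\<^sup>2) * ((z - a) \<bullet> d))"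

lemma DERIV_pos_part_square: "((\<lambda>x::real. (max 0 x)\<^sup>2) has_real_derivative 2 * max 0 x) (at x)"
proof (cases "x = 0")
  case False
  have "((\<lambda>x::real. x\<^sup>2) has_real_derivative 2 * x) (at x)" "((\<lambda>x::real. 0) has_real_derivative 0) (at x)"
    by (auto intro!: derivative_eq_intros)
  then show ?thesis
    using False
    by (cases "x > 0")
      (auto intro: has_field_derivative_transform_within_open[where S="{0<..}"]
        has_field_derivative_transform_within_open[where S="{..<0}" and f="\<lambda>_. 0"])
next
  case True
  have "((\<lambda>h::real. (max 0 h)\<^sup>2 / h) \<longlongrightarrow> 0) (at 0)"
  proof (rule Lim_null_comparison)
    show "\<forall>\<^sub>F h in at 0. norm ((max 0 h)\<^sup>2 / h) \<le> \<bar>h::real\<bar>"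
      by (rule always_eventually) (auto simp: max_def power2_eq_square)
    show "((\<lambda>h::real. \<bar>h\<bar>) \<longlongrightarrow> 0) (at 0)" by (rule tendsto_rabs_zero) (rule tendsto_ident_at)
  qed
  then show ?thesis using True by (simp add: DERIV_def)
qed

lemma has_dir_deriv_bump: "has_dir_deriv d (bump a \<rho>) (bump_deriv a \<rho> d z) z"
proof -
  have "has_dir_deriv d (\<lambda>z. \<rho>\<^sup>2 - (norm (z - a))\<^sup>2) (- (2 * ((z - a) \<bullet> d))) z"
    unfolding has_dir_deriv_def power2_norm_eq_inner has_field_derivative_def
    by (auto intro!: derivative_eq_intros simp: inner_commute algebra_simps)
  from has_dir_deriv_chain[OF this DERIV_pos_part_square]
  show ?thesis unfolding bump_def bump_deriv_def by (simp add: algebra_simps)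
qed

lemma continuous_on_bump: "continuous_on S (bump a \<rho>)" "continuous_on S (bump_deriv a \<rho> d)"
  unfolding bump_def bump_deriv_def by (intro continuous_intros)+

lemma bump_outside: "0 \<le> \<rho> \<Longrightarrow> z \<notin> cball a \<rho> \<Longrightarrow> bump a \<rho> z = 0"
  by (auto simp: bump_def dist_norm norm_minus_commute power_mono max_def not_le[symmetric])

lemma bump_nonneg: "bump a \<rho> z \<ge> 0" by (simp add: bump_def)

lemma bump_pos: "z \<in> ball a \<rho> \<Longrightarrow> bump a \<rho> z > 0"
  using power_strict_mono[of "norm (a - z)" \<rho> 2]
  by (auto simp: bump_def dist_norm norm_minus_commute max_def)

lemma bump_ge:
  assumes "z \<in> cball a r'" "0 \<le> r'"
  shows "bump a \<rho> z \<ge> (max 0 (\<rho>\<^sup>2 - r'\<^sup>2))\<^sup>2"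
proof -
  have "(norm (z - a))\<^sup>2 \<le> r'\<^sup>2" using assms by (intro power_mono) (auto simp: dist_norm norm_minus_commute)
  then show ?thesis unfolding bump_def by (intro power_mono) auto
qed

section \<open>The interior energy estimate\<close>

lemma continuous_antiderivative:
  assumes "continuous_on UNIV (f :: real \<Rightarrow> real)"
  shows "\<exists>G. \<forall>x. (G has_real_derivative f x) (at x)"
proof -
  have "\<exists>G. \<forall>x::real. -\<infinity> < ereal x \<longrightarrow> ereal x < \<infinity> \<longrightarrow> (G has_vector_derivative f x) (at x)"
    using assms by (intro einterval_antiderivative)
      (auto simp: continuous_on_eq_continuous_at)
  then show ?thesis by (auto simp: has_real_derivative_iff_has_vector_derivative)
qed

text \<open>A Caccioppoli estimate: the weak form with \<open>\<phi>\<close> the identity and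
  \<open>\<omega>\<close> the square of a cutoff \<open>\<theta>\<close>. The square lets the term
  with the gradient of \<open>\<omega>\<close> be absorbed into the dissipation. The order of the
  quantifiers matters: \<open>E\<close> is fixed before the solution and before \<epsilon>, so it
  depends only on \<open>F\<close>, \<open>M\<close> and the ball.\<close>

lemma energy_bound:
  fixes F :: "real \<Rightarrow> real" and M :: real and a :: "real \<times> 'a::euclidean_space"
  assumes F: "continuous_on UNIV F" and r: "0 < r"
  shows "\<exists>E. \<forall>Q \<epsilon> u v vt g h. rd_solution Q F \<epsilon> M u v vt g h \<longrightarrow> cball a (3 * r) \<subseteq> Q \<longrightarrow>
    (\<integral>z. rd_solution.energy F \<epsilon> u v g z \<partial>ballm a (2 * r)) \<le> E"
proof -
  obtain \<Psi> where \<Psi>: "\<And>x. (\<Psi> has_real_derivative F x) (at x)" using continuous_antiderivative[OF F] by blast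
  have "continuous_on {0..M} \<Psi>" using \<Psi> by (intro DERIV_continuous_on) (auto intro: has_field_derivative_at_within)
  then obtain P where P: "P \<ge> 0" "\<And>x. x \<in> {0..M} \<Longrightarrow> \<bar>\<Psi> x\<bar> \<le> P"
    using compact_bound_abs[of "{0..M}" \<Psi>] by auto
  define \<theta> where "\<theta> = bump a (3 * r)"
  define \<theta>d where "\<theta>d = bump_deriv a (3 * r)"
  have c\<theta>: "continuous_on S \<theta>" "continuous_on S (\<theta>d d)" for S d
    unfolding \<theta>_def \<theta>d_def by (rule continuous_on_bump)+
  obtain K1 where K1: "K1 \<ge> 0" "\<And>z. z \<in> cball a (3 * r) \<Longrightarrow> \<bar>2 * \<theta> z * \<theta>d (1, 0) z\<bar> \<le> K1"
    by (rule compact_bound_abs[of "cball a (3 * r)" "\<lambda>z. 2 * \<theta> z * \<theta>d (1, 0) z"])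
      (auto intro!: continuous_intros c\<theta> simp del: mem_cball)
  obtain K2 where K2: "K2 \<ge> 0" "\<And>z. z \<in> cball a (3 * r) \<Longrightarrow> \<bar>\<Sum>b\<in>Basis. (\<theta>d (0, b) z)\<^sup>2\<bar> \<le> K2"
    by (rule compact_bound_abs[of "cball a (3 * r)" "\<lambda>z. \<Sum>b\<in>Basis. (\<theta>d (0, b) z)\<^sup>2"])
      (auto intro!: continuous_intros c\<theta> simp del: mem_cball)
  \<comment> \<open>A lower bound for the square of \<open>\<theta>\<close> on the ball of radius
    \<open>2 * r\<close>, from \<open>bump_ge\<close> with the radii \<open>3 * r\<close> and
    \<open>2 * r\<close>; it removes the weight from the estimate.\<close>
  define \<kappa> where "\<kappa> = ((max 0 ((3 * r)\<^sup>2 - (2 * r)\<^sup>2))\<^sup>2)\<^sup>2"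
  have \<kappa>: "\<kappa> > 0" unfolding \<kappa>_def using r by (simp add: power_mult_distrib max_def)
  have \<kappa>_le: "\<kappa> \<le> (\<theta> z)\<^sup>2" if "z \<in> cball a (2 * r)" for z
    unfolding \<kappa>_def \<theta>_def using r that by (intro power_mono bump_ge) auto
  \<comment> \<open>\<open>K1 * (P + M^2)\<close> bounds the integrand containing the time
    derivative of the cutoff, \<open>2 * M^2 * K2\<close> is the price of absorbing the cross term,
    and \<open>2 / \<kappa>\<close> undoes the factors lost in \<open>lower\<close> and
    \<open>\<kappa>_le\<close>.\<close>
  define E where "E = 2 / \<kappa> * ((K1 * (P + M\<^sup>2) + 2 * M\<^sup>2 * K2) * measure (ballm a (3 * r)) (space (ballm a (3 * r))))"
  have "(\<integral>z. rd_solution.energy F \<epsilon> u v g z \<partial>ballm a (2 * r)) \<le> E"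
    if sol: "rd_solution Q F \<epsilon> M u v vt g h" and sub: "cball a (3 * r) \<subseteq> Q" for Q \<epsilon> u v vt g h
  proof -
    interpret rd_solution Q F \<epsilon> M u v vt g h by (rule sol)
    let ?C = "cball a (3 * r)"
    note cs = cont_u[THEN continuous_on_subset, OF sub] cont_v[THEN continuous_on_subset, OF sub]
      cont_g[THEN continuous_on_subset, OF _ sub] cont_Fu[THEN continuous_on_subset, OF sub]
      cont_energy[THEN continuous_on_subset, OF sub] c\<theta>
    have c\<Psi>u: "continuous_on ?C (\<lambda>z. \<Psi> (u z))"
      by (rule continuous_on_compose2[OF DERIV_continuous_on cs(1), of UNIV]) (auto intro: \<Psi>)
    have wf: "(\<integral>z. (2 * \<theta> z * \<theta>d (1, 0) z) * (\<Psi> (u z) + (v z)\<^sup>2 / 2) \<partial>ballm a (3 * r)) =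
      (\<integral>z. (\<Sum>b\<in>Basis. (2 * \<theta> z * \<theta>d (0, b) z) * v z * g b z + (\<theta> z)\<^sup>2 * 1 * (g b z)\<^sup>2)
      - (\<theta> z)\<^sup>2 * ((F (u z) - v z) * (v z - F (u z)) / \<epsilon>) \<partial>ballm a (3 * r))"
    proof (rule weak_form[where \<omega>="\<lambda>z. (\<theta> z)\<^sup>2" and \<phi>="\<lambda>x. x" and \<phi>'="\<lambda>_. 1" and \<Phi>="\<lambda>x. x\<^sup>2 / 2"
          and \<omega>b="\<lambda>b z. 2 * \<theta> z * \<theta>d (0, b) z"])
      have D: "has_dir_deriv d (\<lambda>z. (\<theta> z)\<^sup>2) (2 * \<theta> z * \<theta>d d z) z" for d z
        using has_dir_deriv_mult[OF has_dir_deriv_bump[of d a "3 * r" z] has_dir_deriv_bump[of d a "3 * r" z]]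
        unfolding \<theta>_def \<theta>d_def by (simp add: power2_eq_square algebra_simps)
      show "has_dir_deriv (1, 0) (\<lambda>z. (\<theta> z)\<^sup>2) (2 * \<theta> z * \<theta>d (1, 0) z) z" for z by (rule D)
      show "has_dir_deriv (0, b) (\<lambda>z. (\<theta> z)\<^sup>2) (2 * \<theta> z * \<theta>d (0, b) z) z" for z b by (rule D)
      show "(\<theta> z)\<^sup>2 = 0" if "z \<notin> ?C" for z using bump_outside[OF _ that] r by (simp add: \<theta>_def)
      show "((\<lambda>x. x\<^sup>2 / 2) has_real_derivative x) (at x)" for x :: real by (auto intro!: derivative_eq_intros)
    qed (use sub \<Psi> in \<open>auto intro!: continuous_intros c\<theta>\<close>)
    \<comment> \<open>Half of the weighted dissipation survives: the cross term is absorbed by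
      completing the square in \<open>\<theta> * g b + 2 * \<theta>d * v\<close>, at the cost of
      \<open>2 * v^2 * \<theta>d^2\<close> for each direction.\<close>
    have lower: "(\<theta> z)\<^sup>2 / 2 * energy z \<le>
       (\<Sum>b\<in>Basis. (2 * \<theta> z * \<theta>d (0, b) z) * v z * g b z + (\<theta> z)\<^sup>2 * 1 * (g b z)\<^sup>2)
      - (\<theta> z)\<^sup>2 * ((F (u z) - v z) * (v z - F (u z)) / \<epsilon>) + 2 * M\<^sup>2 * K2" if z: "z \<in> ?C" for z
    proof -
      have v2: "(v z)\<^sup>2 \<le> M\<^sup>2" using bounds[of z] z sub by (intro power_mono) auto
      have 1: "(\<theta> z)\<^sup>2 / 2 * (g b z)\<^sup>2 - 2 * (v z)\<^sup>2 * (\<theta>d (0, b) z)\<^sup>2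
        \<le> (2 * \<theta> z * \<theta>d (0, b) z) * v z * g b z + (\<theta> z)\<^sup>2 * 1 * (g b z)\<^sup>2" for b
      proof -
        have "0 \<le> (\<theta> z * g b z + 2 * (\<theta>d (0, b) z * v z))\<^sup>2 / 2" by simp
        then show ?thesis by (simp add: power2_eq_square algebra_simps)
      qed
      have "(\<Sum>b\<in>Basis. (\<theta> z)\<^sup>2 / 2 * (g b z)\<^sup>2) - 2 * (v z)\<^sup>2 * (\<Sum>b\<in>Basis. (\<theta>d (0, b) z)\<^sup>2)
        \<le> (\<Sum>b\<in>Basis. (2 * \<theta> z * \<theta>d (0, b) z) * v z * g b z + (\<theta> z)\<^sup>2 * 1 * (g b z)\<^sup>2)"
        unfolding sum_distrib_left sum_subtractf[symmetric] by (rule sum_mono) (rule 1)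
      moreover have "2 * (v z)\<^sup>2 * (\<Sum>b\<in>Basis. (\<theta>d (0, b) z)\<^sup>2) \<le> 2 * M\<^sup>2 * K2"
        using K2(2)[OF z] v2 by (intro mult_mono) (auto simp: sum_nonneg)
      moreover have "(\<theta> z)\<^sup>2 / 2 * ((v z - F (u z))\<^sup>2 / \<epsilon>) \<le> - ((\<theta> z)\<^sup>2 * ((F (u z) - v z) * (v z - F (u z)) / \<epsilon>))"
      proof -
        have "- ((F (u z) - v z) * (v z - F (u z))) = (v z - F (u z))\<^sup>2" by (simp add: power2_eq_square algebra_simps)
        then have "- ((\<theta> z)\<^sup>2 * ((F (u z) - v z) * (v z - F (u z)) / \<epsilon>)) = (\<theta> z)\<^sup>2 * ((v z - F (u z))\<^sup>2 / \<epsilon>)"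
          by (metis minus_divide_left mult_minus_right)
        moreover have "0 \<le> (\<theta> z)\<^sup>2 * ((v z - F (u z))\<^sup>2 / \<epsilon>)" using eps by simp
        ultimately show ?thesis by simp
      qed
      moreover have "(\<theta> z)\<^sup>2 / 2 * energy z = (\<Sum>b\<in>Basis. (\<theta> z)\<^sup>2 / 2 * (g b z)\<^sup>2) + (\<theta> z)\<^sup>2 / 2 * ((v z - F (u z))\<^sup>2 / \<epsilon>)"
        unfolding energy_def by (simp add: algebra_simps sum_distrib_left)
      ultimately show ?thesis by linarith
    qed
    have upper: "(2 * \<theta> z * \<theta>d (1, 0) z) * (\<Psi> (u z) + (v z)\<^sup>2 / 2) \<le> K1 * (P + M\<^sup>2)" if z: "z \<in> ?C" for z
    proof -
      have v2: "(v z)\<^sup>2 \<le> M\<^sup>2" using bounds[of z] z sub by (intro power_mono) auto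
      have "\<bar>\<Psi> (u z) + (v z)\<^sup>2 / 2\<bar> \<le> P + M\<^sup>2"
      proof -
        have "\<bar>\<Psi> (u z)\<bar> \<le> P" using P(2) bounds[of z] z sub by blast
        then show ?thesis using v2 zero_le_power2[of "v z"] zero_le_power2[of M] by linarith
      qed
      then have "\<bar>2 * \<theta> z * \<theta>d (1, 0) z\<bar> * \<bar>\<Psi> (u z) + (v z)\<^sup>2 / 2\<bar> \<le> K1 * (P + M\<^sup>2)"
        using K1(2)[OF z] K1(1) by (intro mult_mono) auto
      then show ?thesis unfolding abs_mult[symmetric] by linarith
    qed
    let ?m = "measure (ballm a (3 * r)) (space (ballm a (3 * r)))"
    interpret finite_measure "ballm a (3 * r)" by (rule finite_measure_ballm)
    have "\<kappa> / 2 * (\<integral>z. energy z \<partial>ballm a (2 * r)) = (\<integral>z. \<kappa> / 2 * energy z \<partial>ballm a (2 * r))" by simp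
    also have "\<dots> \<le> (\<integral>z. (\<theta> z)\<^sup>2 / 2 * energy z \<partial>ballm a (2 * r))"
    proof (rule integral_ballm_mono)
      have s2: "cball a (2 * r) \<subseteq> ?C" using r by auto
      show "continuous_on (cball a (2 * r)) (\<lambda>z. \<kappa> / 2 * energy z)"
        "continuous_on (cball a (2 * r)) (\<lambda>z. (\<theta> z)\<^sup>2 / 2 * energy z)"
        by (intro continuous_intros cs continuous_on_subset[OF cs(5) s2]; simp)+
      show "\<kappa> / 2 * energy z \<le> (\<theta> z)\<^sup>2 / 2 * energy z" if "z \<in> cball a (2 * r)" for z
        using \<kappa>_le[OF that] energy_nonneg[of z] by (intro mult_right_mono) auto
    qed
    also have "\<dots> \<le> (\<integral>z. (\<theta> z)\<^sup>2 / 2 * energy z \<partial>ballm a (3 * r))"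
    proof -
      have "continuous_on ?C (\<lambda>z. (\<theta> z)\<^sup>2 / 2 * energy z)" by (intro continuous_intros cs) auto
      then show ?thesis
        using integral_ballm_shift_le[OF integrable_ballm, of a "3 * r" "\<lambda>z. (\<theta> z)\<^sup>2 / 2 * energy z" "2 * r" 0] r energy_nonneg
        by simp
    qed
    also have "\<dots> \<le> (\<integral>z. ((\<Sum>b\<in>Basis. (2 * \<theta> z * \<theta>d (0, b) z) * v z * g b z + (\<theta> z)\<^sup>2 * 1 * (g b z)\<^sup>2)
      - (\<theta> z)\<^sup>2 * ((F (u z) - v z) * (v z - F (u z)) / \<epsilon>)) + 2 * M\<^sup>2 * K2 \<partial>ballm a (3 * r))"
      using lower eps by (intro integral_ballm_mono continuous_intros cs) auto
    also have "\<dots> = (\<integral>z. (2 * \<theta> z * \<theta>d (1, 0) z) * (\<Psi> (u z) + (v z)\<^sup>2 / 2) \<partial>ballm a (3 * r)) + 2 * M\<^sup>2 * K2 * ?m"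
      unfolding wf using eps
      by (subst Bochner_Integration.integral_add) (auto intro!: integrable_ballm continuous_intros cs)
    also have "\<dots> \<le> (\<integral>z. K1 * (P + M\<^sup>2) \<partial>ballm a (3 * r)) + 2 * M\<^sup>2 * K2 * ?m"
      using upper by (intro add_mono integral_ballm_mono continuous_intros cs c\<Psi>u) auto
    also have "\<dots> = \<kappa> / 2 * E"
      unfolding E_def using \<kappa> by (simp add: algebra_simps)
    finally show ?thesis using \<kappa> by simp
  qed
  then show ?thesis by blast
qed

text \<open>The integral against \<open>f\<close> is differentiated in the length
  \<open>\<sigma>\<close> of the shift, and the mean value inequality is applied to the resulting
  function of one variable. The bound \<open>B\<close> concerns the derivative only after
  integration against \<open>f\<close>: for the time derivative of \<open>v\<close> no pointwise
  bound uniform in \<epsilon> is available, but its integrals against suitable functions are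
  bounded.\<close>

lemma integral_shift_bound:
  fixes f w w' :: "'b::euclidean_space \<Rightarrow> real"
  assumes Q: "\<And>z \<sigma>. z \<in> cball a r \<Longrightarrow> \<sigma> \<in> {0..1} \<Longrightarrow> z + h + \<sigma> *\<^sub>R d \<in> Q"
    and f: "continuous_on (cball a r) f" and w: "continuous_on Q w" and w': "continuous_on Q w'"
    and D: "\<And>z. z \<in> Q \<Longrightarrow> has_dir_deriv d w (w' z) z"
    and B: "\<And>\<sigma>. \<sigma> \<in> {0..1} \<Longrightarrow> \<bar>\<integral>z. f z * w' (z + h + \<sigma> *\<^sub>R d) \<partial>ballm a r\<bar> \<le> B"
  shows "\<bar>(\<integral>z. f z * w (z + h + d) \<partial>ballm a r) - (\<integral>z. f z * w (z + h) \<partial>ballm a r)\<bar> \<le> B"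
proof -
  define I where "I \<sigma> = (\<integral>z. f z * w (z + h + \<sigma> *\<^sub>R d) \<partial>ballm a r)" for \<sigma>
  define I' where "I' \<sigma> = (\<integral>z. f z * w' (z + h + \<sigma> *\<^sub>R d) \<partial>ballm a r)" for \<sigma>
  interpret finite_measure "ballm a r" by (rule finite_measure_ballm)
  \<comment> \<open>The compact set swept out by the ball under the shifts; a bound of
    \<open>w'\<close> on it dominates the difference quotients.\<close>
  define C where "C = (\<lambda>(z, \<sigma>). z + h + \<sigma> *\<^sub>R d) ` (cball a r \<times> {0..1::real})"
  have "compact C" unfolding C_def
    by (intro compact_continuous_image compact_Times) (auto intro!: continuous_intros simp: case_prod_unfold)
  moreover have "continuous_on C w'" by (rule continuous_on_subset[OF w']) (auto simp: C_def Q)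
  ultimately obtain K where K: "K \<ge> 0" "\<And>z. z \<in> C \<Longrightarrow> \<bar>w' z\<bar> \<le> K" by (rule compact_bound_abs) auto
  have inC: "z + h + \<sigma> *\<^sub>R d \<in> C" if "z \<in> cball a r" "\<sigma> \<in> {0..1}" for z \<sigma>
    unfolding C_def using that by (intro image_eqI[of _ _ "(z, \<sigma>)"]) auto
  obtain L where L: "L \<ge> 0" "\<And>z. z \<in> cball a r \<Longrightarrow> \<bar>f z\<bar> \<le> L"
    using compact_bound_abs[OF compact_cball f] by blast
  have cw: "continuous_on (cball a r) (\<lambda>z. f z * k (z + h + \<sigma> *\<^sub>R d))"
    if "continuous_on Q k" "\<sigma> \<in> {0..1}" for \<sigma> k
    using Q that by (intro continuous_intros f continuous_on_compose2[OF that(1)]) auto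
  have der: "((\<lambda>\<sigma>. w (z + h + \<sigma> *\<^sub>R d)) has_real_derivative w' (z + h + \<sigma> *\<^sub>R d)) (at \<sigma> within {0..1})"
    if "z \<in> cball a r" "\<sigma> \<in> {0..1}" for z \<sigma>
    using has_dir_deriv_at[OF D[OF Q[OF that]]] by (rule has_field_derivative_at_within)
  have "(I has_real_derivative I' \<sigma>) (at \<sigma> within {0..1})" if \<sigma>: "\<sigma> \<in> {0..1}" for \<sigma>
    unfolding has_field_derivative_iff tendsto_at_iff_sequentially
  proof (intro allI impI)
    fix X :: "nat \<Rightarrow> real" assume X: "\<forall>i. X i \<in> {0..1} - {\<sigma>}" and lim: "X \<longlonglongrightarrow> \<sigma>"
    have "(\<lambda>i. \<integral>z. f z * ((w (z + h + X i *\<^sub>R d) - w (z + h + \<sigma> *\<^sub>R d)) / (X i - \<sigma>)) \<partial>ballm a r)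
      \<longlonglongrightarrow> (\<integral>z. f z * w' (z + h + \<sigma> *\<^sub>R d) \<partial>ballm a r)"
    proof (rule integral_dominated_convergence[where w="\<lambda>_. L * K"])
      show "AE z in ballm a r. (\<lambda>i. f z * ((w (z + h + X i *\<^sub>R d) - w (z + h + \<sigma> *\<^sub>R d)) / (X i - \<sigma>)))
          \<longlonglongrightarrow> f z * w' (z + h + \<sigma> *\<^sub>R d)"
      proof (rule AE_I2)
        fix z assume "z \<in> space (ballm a r)"
        then have z: "z \<in> cball a r" by (simp add: space_restrict_space)
        show "(\<lambda>i. f z * ((w (z + h + X i *\<^sub>R d) - w (z + h + \<sigma> *\<^sub>R d)) / (X i - \<sigma>)))
          \<longlonglongrightarrow> f z * w' (z + h + \<sigma> *\<^sub>R d)"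
          using der[OF z \<sigma>, unfolded has_field_derivative_iff tendsto_at_iff_sequentially, rule_format, of X] X lim
          by (intro tendsto_intros) (auto simp: comp_def)
      qed
      show "AE z in ballm a r. norm (f z * ((w (z + h + X i *\<^sub>R d) - w (z + h + \<sigma> *\<^sub>R d)) / (X i - \<sigma>))) \<le> L * K" for i
      proof (rule AE_I2)
        fix z assume "z \<in> space (ballm a r)"
        then have z: "z \<in> cball a r" by (simp add: space_restrict_space)
        have "norm (w (z + h + X i *\<^sub>R d) - w (z + h + \<sigma> *\<^sub>R d)) \<le> K * norm (X i - \<sigma>)"
          by (rule field_differentiable_bound[of "{0..1}"])
            (use der[OF z] K(2)[OF inC[OF z]] X \<sigma> in auto)
        moreover have "X i \<noteq> \<sigma>" using X by auto
        ultimately have "\<bar>(w (z + h + X i *\<^sub>R d) - w (z + h + \<sigma> *\<^sub>R d)) / (X i - \<sigma>)\<bar> \<le> K"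
          by (simp add: abs_divide divide_le_eq)
        then show "norm (f z * ((w (z + h + X i *\<^sub>R d) - w (z + h + \<sigma> *\<^sub>R d)) / (X i - \<sigma>))) \<le> L * K"
          unfolding real_norm_def abs_mult using L z by (intro mult_mono) auto
      qed
      show "(\<lambda>z. f z * w' (z + h + \<sigma> *\<^sub>R d)) \<in> borel_measurable (ballm a r)"
        using integrable_ballm[OF cw[OF w' \<sigma>]] by simp
      show "(\<lambda>z. f z * ((w (z + h + X i *\<^sub>R d) - w (z + h + \<sigma> *\<^sub>R d)) / (X i - \<sigma>))) \<in> borel_measurable (ballm a r)" for i
      proof -
        have "(\<lambda>z. (f z * w (z + h + X i *\<^sub>R d) - f z * w (z + h + \<sigma> *\<^sub>R d)) / (X i - \<sigma>)) \<in> borel_measurable (ballm a r)"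
          using integrable_ballm[OF cw[OF w, of "X i"]] integrable_ballm[OF cw[OF w \<sigma>]] X
          by (intro borel_measurable_divide borel_measurable_diff) auto
        then show ?thesis by (simp add: algebra_simps diff_divide_distrib)
      qed
    qed simp
    moreover have "(\<integral>z. f z * ((w (z + h + X i *\<^sub>R d) - w (z + h + \<sigma> *\<^sub>R d)) / (X i - \<sigma>)) \<partial>ballm a r)
      = (I (X i) - I \<sigma>) / (X i - \<sigma>)" for i
    proof -
      have "(I (X i) - I \<sigma>) / (X i - \<sigma>) =
        (\<integral>z. (f z * w (z + h + X i *\<^sub>R d) - f z * w (z + h + \<sigma> *\<^sub>R d)) / (X i - \<sigma>) \<partial>ballm a r)"
        unfolding I_def using integrable_ballm[OF cw[OF w, of "X i"]] integrable_ballm[OF cw[OF w \<sigma>]] X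
        by simp
      then show ?thesis by (simp add: algebra_simps diff_divide_distrib)
    qed
    ultimately show "((\<lambda>y. (I y - I \<sigma>) / (y - \<sigma>)) \<circ> X) \<longlonglongrightarrow> I' \<sigma>"
      unfolding comp_def I'_def by (simp only:)
  qed
  then have "norm (I 1 - I 0) \<le> B * norm (1 - 0 :: real)"
    by (intro field_differentiable_bound[of "{0..1}" I I']) (use B in \<open>auto simp: I'_def\<close>)
  then show ?thesis by (simp add: I_def)
qed

section \<open>The shift estimate that feeds compensated compactness\<close>

context rd_solution
begin

text \<open>A test function built from a shifted solution is defined only where both the point and
  its translate lie in \<open>Q\<close>; the weak form is applied on that smaller open set.\<close>

lemma restrict_domain:
  assumes "open Q'" "Q' \<subseteq> Q"
  shows "rd_solution Q' F \<epsilon> M u v vt g h"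
proof -
  have s: "z \<in> Q' \<Longrightarrow> z \<in> Q" for z using assms by blast
  show ?thesis
    by (rule rd_solution.intro; (rule assms(1) eps contF continuous_on_subset[OF cont_u assms(2)]
        continuous_on_subset[OF cont_v assms(2)] continuous_on_subset[OF cont_vt assms(2)] |
        (rule continuous_on_subset[OF cont_g assms(2)] continuous_on_subset[OF cont_h assms(2)]
          deriv_u[OF s] deriv_v[OF s] grad_v[OF s] hess_v[OF s] eq_v[OF s] bounds[OF s]; assumption)))
qed

text \<open>The shift is split into a space part and a time part. A space shift of
  \<open>H v\<close> costs the gradient of \<open>v\<close>, which the energy controls. A time shift
  costs \<open>vt\<close>, which it does not control; but \<open>\<Psi> u + \<Phi> v\<close> has a
  controlled time derivative, so the weak form moves the time derivative from the shifted
  \<open>H v\<close> onto this factor. Only bounds by \<open>K\<close> and the energy enter, hence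
  the constant is uniform in \<epsilon>; each of its terms comes from a product of three factors
  bounded by \<open>K\<close>.\<close>

lemma dc_estimate:
  assumes r: "0 < r" "cball a (2 * r) \<subseteq> Q" and K: "1 \<le> K"
    and c\<zeta>: "continuous_on UNIV \<zeta>" "\<And>d. continuous_on UNIV (\<zeta>d d)"
    and D\<zeta>: "\<And>d z. has_dir_deriv d \<zeta> (\<zeta>d d z) z"
    and Z: "\<And>z. z \<notin> cball a r \<Longrightarrow> \<zeta> z = 0"
    and b\<zeta>: "\<And>z. z \<in> cball a r \<Longrightarrow> \<bar>\<zeta> z\<bar> \<le> K" "\<And>z. z \<in> cball a r \<Longrightarrow> \<bar>\<zeta>d (1, 0) z\<bar> \<le> K"
      "\<And>b z. b \<in> Basis \<Longrightarrow> z \<in> cball a r \<Longrightarrow> \<bar>\<zeta>d (0, b) z\<bar> \<le> K"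
    and \<Psi>: "\<And>x. (\<Psi> has_real_derivative \<phi> (F x)) (at x)"
    and \<Phi>: "\<And>x. (\<Phi> has_real_derivative \<phi> x) (at x)"
    and \<phi>: "\<And>x. (\<phi> has_real_derivative \<phi>' x) (at x)" and \<phi>': "continuous_on UNIV \<phi>'"
    and H: "\<And>x. (H has_real_derivative H' x) (at x)" and H': "continuous_on UNIV H'"
    and bK: "\<And>x. x \<in> {0..M} \<Longrightarrow> \<bar>\<phi> x\<bar> \<le> K" "\<And>x. x \<in> {0..M} \<Longrightarrow> \<bar>\<phi>' x\<bar> \<le> K"
      "\<And>x. x \<in> {0..M} \<Longrightarrow> \<bar>H x\<bar> \<le> K" "\<And>x. x \<in> {0..M} \<Longrightarrow> \<bar>H' x\<bar> \<le> K"
      "\<And>z. z \<in> Q \<Longrightarrow> \<bar>\<Psi> (u z) + \<Phi> (v z)\<bar> \<le> K"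
    and E: "(\<integral>z. energy z \<partial>ballm a (2 * r)) \<le> E"
    and d: "norm d \<le> r"
  shows "\<bar>(\<integral>z. (\<Psi> (u z) + \<Phi> (v z)) * \<zeta> z * H (v (z + d)) \<partial>ballm a r)
      - (\<integral>z. (\<Psi> (u z) + \<Phi> (v z)) * \<zeta> z * H (v z) \<partial>ballm a r)\<bar>
    \<le> norm d * (K^3 * ((2 * real DIM('a) + 1) * measure lborel (cball a r) + 5 * E))"
proof -
  interpret finite_measure "ballm a r" by (rule finite_measure_ballm)
  let ?N = "real DIM('a)"
  obtain s y where sy: "d = (s, y)" by (cases d)
  have sn: "\<bar>s\<bar> \<le> norm d" and yn: "norm y \<le> norm d"
    using norm_fst_le[of s y] norm_snd_le[of y s] by (auto simp: sy)
  define U where "U z = \<Psi> (u z) + \<Phi> (v z)" for z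
  define w where "w z = H (v z)" for z
  define W where "W b z = H' (v z) * g b z" for b z
  have c1: "continuous_on UNIV \<Psi>" "continuous_on UNIV \<Phi>" "continuous_on UNIV \<phi>" "continuous_on UNIV H"
    using \<Psi> \<Phi> \<phi> H by (auto intro!: DERIV_continuous_on)
  have cU: "continuous_on Q U" unfolding U_def
    by (intro continuous_intros continuous_on_compose2[OF c1(1) cont_u] continuous_on_compose2[OF c1(2) cont_v]) auto
  have cw: "continuous_on Q w" unfolding w_def by (intro continuous_on_compose2[OF c1(4) cont_v]) auto
  have cH': "continuous_on Q (\<lambda>z. H' (v z))" by (intro continuous_on_compose2[OF H' cont_v]) auto
  have cW: "continuous_on Q (W b)" if "b \<in> Basis" for b
    unfolding W_def using that by (intro continuous_intros cH' cont_g)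
  have c\<phi>: "continuous_on Q (\<lambda>z. \<phi> (v z))" "continuous_on Q (\<lambda>z. \<phi> (F (u z)))" "continuous_on Q (\<lambda>z. \<phi>' (v z))"
    by (intro continuous_on_compose2[OF c1(3) cont_v] continuous_on_compose2[OF c1(3) cont_Fu]
        continuous_on_compose2[OF \<phi>' cont_v]; simp)+
  have sub: "z + h \<in> cball a (2 * r)" if "z \<in> cball a r" "norm h \<le> r" for z h
    using that norm_triangle_ineq4[of "a - z" h] by (simp add: dist_norm algebra_simps)
  then have subQ: "z + h \<in> Q" if "z \<in> cball a r" "norm h \<le> r" for z h using that r by blast
  have subQ0: "cball a r \<subseteq> Q" using subQ[of _ 0] r by auto
  have shift_c: "continuous_on (cball a r) (\<lambda>z. k (z + h))" if "continuous_on Q k" "norm h \<le> r" for k h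
    by (rule continuous_on_compose2[OF that(1)]) (use subQ[OF _ that(2)] in \<open>auto intro!: continuous_intros simp del: mem_cball\<close>)
  have here_c: "continuous_on (cball a r) k" if "continuous_on Q k" for k
    using that subQ0 continuous_on_subset by blast
  have \<zeta>c: "continuous_on S \<zeta>" "continuous_on S (\<zeta>d e)" for S e using c\<zeta> continuous_on_subset by blast+
  have E1: "(\<integral>z. energy (z + h) \<partial>ballm a r) \<le> E" if "norm h \<le> r" for h
    using integral_ballm_shift_le[OF integrable_ballm[OF continuous_on_subset[OF cont_energy r(2)]], of r h]
      energy_nonneg E that by force
  have iE: "integrable (ballm a r) (\<lambda>z. energy (z + h))" if "norm h \<le> r" for h
    by (intro integrable_ballm shift_c cont_energy that)
  have E0: "(\<integral>z. energy z \<partial>ballm a r) \<le> E" and iE0: "integrable (ballm a r) energy"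
    using E1[of 0] iE[of 0] r by auto
  have ms: "measure (ballm a r) (space (ballm a r)) = measure lborel (cball a r)"
    by (simp add: measure_restrict_space space_restrict_space)
  have bv: "v z \<in> {0..M}" "F (u z) \<in> {0..M}" if "z \<in> Q" for z using bounds[OF that] by auto
  have g_le: "\<bar>g b z\<bar> \<le> 1 + (g b z)\<^sup>2" for b z
    using zero_le_power2[of "\<bar>g b z\<bar> - 1"] by (simp add: power2_eq_square algebra_simps)
  have prod_le: "x * y \<le> x\<^sup>2 + y\<^sup>2" for x y :: real
    using sum_squares_bound[of x y] zero_le_power2[of x] zero_le_power2[of y] by (cases "x * y \<ge> 0") linarith+
  have g_energy: "(\<Sum>b\<in>Basis. (g b z)\<^sup>2) \<le> energy z" for z
    unfolding energy_def using eps by simp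

  \<comment> \<open>Here a pointwise bound suffices: since \<open>x <= 1 + x^2\<close>, the
    derivative along \<open>(0, y)\<close> is at most a multiple of \<open>norm d\<close> times the
    dimension plus the energy at the shifted point. The energy is integrable with bound
    \<open>E\<close> because the shifted ball stays in the ball of radius
    \<open>2 * r\<close>.\<close>
  have space_step: "\<bar>(\<integral>z. U z * \<zeta> z * w (z + (0, y)) \<partial>ballm a r) - (\<integral>z. U z * \<zeta> z * w z \<partial>ballm a r)\<bar>
      \<le> norm d * (K^3 * (?N * measure lborel (cball a r) + E))"
  proof -
    have "\<bar>(\<integral>z. U z * \<zeta> z * w (z + 0 + (0, y)) \<partial>ballm a r) - (\<integral>z. U z * \<zeta> z * w (z + 0) \<partial>ballm a r)\<bar>
      \<le> norm d * (K^3 * (?N * measure lborel (cball a r) + E))"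
    proof (rule integral_shift_bound[where Q=Q and w'="\<lambda>z. H' (v z) * (\<Sum>b\<in>Basis. (y \<bullet> b) * g b z)"])
      show "continuous_on (cball a r) (\<lambda>z. U z * \<zeta> z)" by (intro continuous_intros here_c cU \<zeta>c)
      show "continuous_on Q (\<lambda>z. H' (v z) * (\<Sum>b\<in>Basis. (y \<bullet> b) * g b z))"
        by (intro continuous_intros cH' cont_g)
      show "has_dir_deriv (0, y) w (H' (v z) * (\<Sum>b\<in>Basis. (y \<bullet> b) * g b z)) z" if "z \<in> Q" for z
        unfolding w_def by (rule has_dir_deriv_chain[OF grad_v[OF that] H])
      fix \<sigma> :: real assume \<sigma>: "\<sigma> \<in> {0..1}"
      have nh: "norm (\<sigma> *\<^sub>R (0::real, y)) \<le> r"
        using \<sigma> yn d mult_left_le_one_le[of "norm y" \<sigma>] by (simp add: norm_Pair)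
      then show "z + 0 + \<sigma> *\<^sub>R (0, y) \<in> Q" if "z \<in> cball a r" for z using subQ[OF that nh] by simp
      let ?h = "\<sigma> *\<^sub>R (0::real, y)"
      have "\<bar>\<integral>z. U z * \<zeta> z * (H' (v (z + ?h)) * (\<Sum>b\<in>Basis. (y \<bullet> b) * g b (z + ?h))) \<partial>ballm a r\<bar>
        \<le> (\<integral>z. norm d * K^3 * (?N + energy (z + ?h)) \<partial>ballm a r)"
      proof (rule abs_integral_ballm_le)
        show "continuous_on (cball a r) (\<lambda>z. U z * \<zeta> z * (H' (v (z + ?h)) * (\<Sum>b\<in>Basis. (y \<bullet> b) * g b (z + ?h))))"
          by (intro continuous_intros here_c cU \<zeta>c shift_c[OF cH' nh] shift_c[OF cont_g nh])
        show "continuous_on (cball a r) (\<lambda>z. norm d * K^3 * (?N + energy (z + ?h)))"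
          by (intro continuous_intros shift_c cont_energy nh)
        fix z assume z: "z \<in> cball a r"
        have zQ: "z \<in> Q" "z + ?h \<in> Q" using subQ0 z subQ[OF z nh] by auto
        have "\<bar>\<Sum>b\<in>Basis. (y \<bullet> b) * g b (z + ?h)\<bar> \<le> (\<Sum>b\<in>Basis. norm d * (1 + (g b (z + ?h))\<^sup>2))"
        proof (rule order_trans[OF sum_abs], rule sum_mono)
          fix b :: 'a assume "b \<in> Basis"
          then have "\<bar>y \<bullet> b\<bar> \<le> norm d" using Basis_le_norm[of b y] yn by linarith
          then show "\<bar>(y \<bullet> b) * g b (z + ?h)\<bar> \<le> norm d * (1 + (g b (z + ?h))\<^sup>2)"
            unfolding abs_mult using g_le by (intro mult_mono) auto
        qed
        also have "\<dots> = norm d * (?N + (\<Sum>b\<in>Basis. (g b (z + ?h))\<^sup>2))"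
          by (simp add: sum_distrib_left[symmetric] sum.distrib)
        also have "\<dots> \<le> norm d * (?N + energy (z + ?h))"
          using g_energy by (intro mult_left_mono) auto
        finally have 1: "\<bar>\<Sum>b\<in>Basis. (y \<bullet> b) * g b (z + ?h)\<bar> \<le> norm d * (?N + energy (z + ?h))" .
        have "\<bar>U z * \<zeta> z * (H' (v (z + ?h)) * (\<Sum>b\<in>Basis. (y \<bullet> b) * g b (z + ?h)))\<bar>
          \<le> K * K * (K * (norm d * (?N + energy (z + ?h))))"
          unfolding abs_mult using 1 K bK(5)[OF zQ(1)] b\<zeta>(1)[OF z] bK(4)[OF bv(1)[OF zQ(2)]] energy_nonneg
          by (intro mult_mono) (auto simp: U_def)
        then show "\<bar>U z * \<zeta> z * (H' (v (z + ?h)) * (\<Sum>b\<in>Basis. (y \<bullet> b) * g b (z + ?h)))\<bar>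
            \<le> norm d * K^3 * (?N + energy (z + ?h))"
          by (simp add: power3_eq_cube mult_ac)
      qed
      also have "\<dots> = norm d * K^3 * (?N * measure lborel (cball a r) + (\<integral>z. energy (z + ?h) \<partial>ballm a r))"
        using iE[OF nh] ms by simp
      also have "\<dots> \<le> norm d * K^3 * (?N * measure lborel (cball a r) + E)"
        using E1[OF nh] K by (intro mult_left_mono add_left_mono) auto
      finally show "\<bar>\<integral>z. U z * \<zeta> z * (H' (v (z + 0 + ?h)) * (\<Sum>b\<in>Basis. (y \<bullet> b) * g b (z + 0 + ?h))) \<partial>ballm a r\<bar>
        \<le> norm d * (K^3 * (?N * measure lborel (cball a r) + E))" by (simp add: mult.assoc)
    qed (rule cw)
    then show ?thesis by simp
  qed

  \<comment> \<open>The time shift starts from the point already moved by \<open>(0, y)\<close>; all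
    intermediate shifts \<open>hh\<close> have norm at most \<open>norm d\<close>, so they stay
    within the ball where the energy is bounded.\<close>
  have time_step: "\<bar>(\<integral>z. U z * \<zeta> z * w (z + (0, y) + (s, 0)) \<partial>ballm a r) - (\<integral>z. U z * \<zeta> z * w (z + (0, y)) \<partial>ballm a r)\<bar>
      \<le> norm d * (K^3 * ((?N + 1) * measure lborel (cball a r) + 4 * E))"
  proof (rule integral_shift_bound[where Q=Q and w'="\<lambda>z. H' (v z) * (s * vt z)"])
    show "continuous_on (cball a r) (\<lambda>z. U z * \<zeta> z)" by (intro continuous_intros here_c cU \<zeta>c)
    show "continuous_on Q (\<lambda>z. H' (v z) * (s * vt z))"
      by (intro continuous_intros cH' cont_vt)
    show "has_dir_deriv (s, 0) w (H' (v z) * (s * vt z)) z" if "z \<in> Q" for z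
    proof -
      have "has_dir_deriv (s, 0) v (s * vt z) z"
      proof -
        have "((\<lambda>x. v (z + (s * x) *\<^sub>R (1, 0))) has_real_derivative vt z * s) (at 0)"
          by (rule DERIV_chain2[where f="\<lambda>x. v (z + x *\<^sub>R (1, 0))" and g="\<lambda>x. s * x"])
            (use deriv_v[OF that] in \<open>auto simp: has_dir_deriv_def intro!: derivative_eq_intros\<close>)
        then show ?thesis by (simp add: has_dir_deriv_def mult_ac)
      qed
      then show ?thesis unfolding w_def by (rule has_dir_deriv_chain[OF _ H])
    qed
    fix \<sigma> :: real assume \<sigma>: "\<sigma> \<in> {0..1}"
    define hh where "hh = (0, y) + \<sigma> *\<^sub>R (s, 0::'a)"
    have hh: "hh = (\<sigma> * s, y)" by (simp add: hh_def)
    have nh: "norm hh \<le> r"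
    proof -
      have "(\<sigma> * s)\<^sup>2 \<le> s\<^sup>2" using \<sigma> mult_left_le_one_le[of "s\<^sup>2" "\<sigma>\<^sup>2"] by (simp add: power_mult_distrib power_le_one)
      then have "norm hh \<le> norm d" unfolding hh sy norm_Pair by simp
      then show ?thesis using d by simp
    qed
    show "z + (0, y) + \<sigma> *\<^sub>R (s, 0) \<in> Q" if "z \<in> cball a r" for z
      using subQ[OF that nh] by (simp add: hh_def add.assoc)
    define Q' where "Q' = Q \<inter> (\<lambda>z. z + hh) -` Q"
    have oQ': "open Q'" unfolding Q'_def
      by (intro open_Int openQ open_vimage) (auto intro!: continuous_intros)
    have rQ': "cball a r \<subseteq> Q'" using subQ0 subQ[OF _ nh] by (auto simp: Q'_def)
    interpret Q': rd_solution Q' F \<epsilon> M u v vt g h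
      by (rule restrict_domain[OF oQ']) (simp add: Q'_def)
    have cQ': "continuous_on Q' (\<lambda>z. k (z + hh))" if "continuous_on Q k" for k
      by (rule continuous_on_compose2[OF that]) (auto simp: Q'_def intro!: continuous_intros)
    \<comment> \<open>The test function is \<open>\<zeta> z * H (v (z + hh))\<close>. Its time
      derivative contains the wanted term \<open>\<zeta> * H' * vt\<close>, and in space only its
      first derivatives appear, so no second derivative of \<open>v\<close> has to be
      bounded.\<close>
    define \<omega>t where "\<omega>t z = \<zeta>d (1, 0) z * w (z + hh) + \<zeta> z * (H' (v (z + hh)) * vt (z + hh))" for z
    define \<omega>b where "\<omega>b b z = \<zeta>d (0, b) z * w (z + hh) + \<zeta> z * W b (z + hh)" for b z
    have wf: "(\<integral>z. \<omega>t z * (\<Psi> (u z) + \<Phi> (v z)) \<partial>ballm a r) =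
      (\<integral>z. (\<Sum>b\<in>Basis. \<omega>b b z * \<phi> (v z) * g b z + (\<zeta> z * w (z + hh)) * \<phi>' (v z) * (g b z)\<^sup>2)
      - (\<zeta> z * w (z + hh)) * ((\<phi> (F (u z)) - \<phi> (v z)) * (v z - F (u z)) / \<epsilon>) \<partial>ballm a r)"
    proof (rule Q'.weak_form[OF rQ' _ _ _ _ _ _ \<Psi> \<Phi> \<phi> \<phi>'])
      show "continuous_on Q' (\<lambda>z. \<zeta> z * w (z + hh))" by (intro continuous_intros \<zeta>c cQ' cw)
      show "continuous_on Q' \<omega>t" unfolding \<omega>t_def by (intro continuous_intros \<zeta>c cQ' cw cH' cont_vt)
      show "continuous_on Q' (\<omega>b b)" if "b \<in> Basis" for b
        unfolding \<omega>b_def by (intro continuous_intros \<zeta>c cQ' cw cW that)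
      show "has_dir_deriv (1, 0) (\<lambda>z. \<zeta> z * w (z + hh)) (\<omega>t z) z" if "z \<in> Q'" for z
        unfolding \<omega>t_def w_def
        using that by (intro has_dir_deriv_mult D\<zeta> has_dir_deriv_shift[where f="\<lambda>z. H (v z)"]
            has_dir_deriv_chain[OF deriv_v H]) (auto simp: Q'_def)
      show "has_dir_deriv (0, b) (\<lambda>z. \<zeta> z * w (z + hh)) (\<omega>b b z) z" if "z \<in> Q'" "b \<in> Basis" for z b
        unfolding \<omega>b_def w_def W_def
        using that by (intro has_dir_deriv_mult D\<zeta> has_dir_deriv_shift[where f="\<lambda>z. H (v z)"]
            has_dir_deriv_chain[OF grad_v_Basis H]) (auto simp: Q'_def)
      show "\<zeta> z * w (z + hh) = 0" if "z \<notin> cball a r" for z using Z[OF that] by simp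
    qed
    have c_\<omega>t: "continuous_on (cball a r) \<omega>t" and c_\<omega>b: "\<And>b. b \<in> Basis \<Longrightarrow> continuous_on (cball a r) (\<omega>b b)"
      unfolding \<omega>t_def \<omega>b_def by (intro continuous_intros \<zeta>c shift_c[OF _ nh] cw cH' cont_vt cW; assumption)+
    have "\<bar>\<integral>z. \<omega>t z * (\<Psi> (u z) + \<Phi> (v z)) \<partial>ballm a r\<bar> \<le> (\<integral>z. K^3 * (?N + 3 * energy z + energy (z + hh)) \<partial>ballm a r)"
      unfolding wf
    proof (rule abs_integral_ballm_le)
      show "continuous_on (cball a r) (\<lambda>z. (\<Sum>b\<in>Basis. \<omega>b b z * \<phi> (v z) * g b z + (\<zeta> z * w (z + hh)) * \<phi>' (v z) * (g b z)\<^sup>2)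
        - (\<zeta> z * w (z + hh)) * ((\<phi> (F (u z)) - \<phi> (v z)) * (v z - F (u z)) / \<epsilon>))"
        using eps by (intro continuous_intros c_\<omega>b here_c[OF cont_g] here_c[OF cont_v] here_c[OF cont_Fu] here_c[OF c\<phi>(1)] here_c[OF c\<phi>(2)] here_c[OF c\<phi>(3)] \<zeta>c
            shift_c[OF cw nh]) auto
      show "continuous_on (cball a r) (\<lambda>z. K^3 * (?N + 3 * energy z + energy (z + hh)))"
        by (intro continuous_intros shift_c[OF _ nh] here_c cont_energy)
      fix z assume z: "z \<in> cball a r"
      have zQ: "z \<in> Q" "z + hh \<in> Q" using subQ0 z subQ[OF z nh] by auto
      have K0: "0 \<le> K" using K by simp
      have bw: "\<bar>w (z + hh)\<bar> \<le> K" unfolding w_def by (rule bK(3)[OF bv(1)[OF zQ(2)]])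
      have bz: "\<bar>\<zeta> z * w (z + hh)\<bar> \<le> K * K"
        unfolding abs_mult using b\<zeta>(1)[OF z] bw K0 by (intro mult_mono) auto
      have t1: "\<bar>\<omega>b b z * \<phi> (v z) * g b z\<bar> \<le> K^3 * (1 + 2 * (g b z)\<^sup>2 + (g b (z + hh))\<^sup>2)"
        if b: "b \<in> Basis" and "True" for b
      proof -
        have "\<bar>\<zeta>d (0, b) z\<bar> * \<bar>w (z + hh)\<bar> \<le> K * K"
          using b\<zeta>(3)[OF b z] bw K0 by (intro mult_mono) auto
        moreover have "\<bar>\<zeta> z\<bar> * (\<bar>H' (v (z + hh))\<bar> * \<bar>g b (z + hh)\<bar>) \<le> K * (K * \<bar>g b (z + hh)\<bar>)"
          using b\<zeta>(1)[OF z] bK(4)[OF bv(1)[OF zQ(2)]] K0 by (intro mult_mono) auto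
        ultimately have "\<bar>\<omega>b b z\<bar> \<le> K * K * (1 + \<bar>g b (z + hh)\<bar>)"
          unfolding \<omega>b_def W_def by (intro order_trans[OF abs_triangle_ineq]) (simp add: abs_mult algebra_simps)
        then have "\<bar>\<omega>b b z * \<phi> (v z) * g b z\<bar> \<le> K * K * (1 + \<bar>g b (z + hh)\<bar>) * K * \<bar>g b z\<bar>"
          unfolding abs_mult using bK(1)[OF bv(1)[OF zQ(1)]] K0 by (intro mult_mono) auto
        also have "\<dots> = K^3 * (\<bar>g b z\<bar> + \<bar>g b (z + hh)\<bar> * \<bar>g b z\<bar>)"
          by (simp add: power3_eq_cube algebra_simps)
        also have "\<dots> \<le> K^3 * (1 + 2 * (g b z)\<^sup>2 + (g b (z + hh))\<^sup>2)"
          using g_le[of b z] prod_le[of "\<bar>g b (z + hh)\<bar>" "\<bar>g b z\<bar>"] K0 by (intro mult_left_mono) auto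
        finally show ?thesis .
      qed
      have K3: "K * K * K = K^3" by (simp add: power3_eq_cube)
      have t2: "\<bar>(\<zeta> z * w (z + hh)) * \<phi>' (v z) * (g b z)\<^sup>2\<bar> \<le> K^3 * (g b z)\<^sup>2" for b
        unfolding abs_mult[of _ "(g b z)\<^sup>2"] abs_mult[of _ "\<phi>' (v z)"] K3[symmetric]
        using bz bK(2)[OF bv(1)[OF zQ(1)]] K0 by (intro mult_mono) auto
      \<comment> \<open>Since \<open>\<phi>\<close> is Lipschitz on \<open>{0..M}\<close> with
        constant \<open>K\<close>, the stiff term is at most a multiple of
        \<open>(v - F u)^2 / \<epsilon>\<close>, which is part of the energy.\<close>
      have t3: "\<bar>(\<zeta> z * w (z + hh)) * ((\<phi> (F (u z)) - \<phi> (v z)) * (v z - F (u z)) / \<epsilon>)\<bar>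
        \<le> K^3 * ((v z - F (u z))\<^sup>2 / \<epsilon>)"
      proof -
        have "\<bar>\<phi> (F (u z)) - \<phi> (v z)\<bar> \<le> K * \<bar>F (u z) - v z\<bar>"
          using field_differentiable_bound[of "{0..M}" \<phi> \<phi>' K "F (u z)" "v z"]
            \<phi> bK(2) bv[OF zQ(1)] by (auto intro: has_field_derivative_at_within)
        then have "\<bar>\<phi> (F (u z)) - \<phi> (v z)\<bar> * \<bar>v z - F (u z)\<bar> \<le> K * \<bar>F (u z) - v z\<bar> * \<bar>v z - F (u z)\<bar>"
          by (intro mult_right_mono) auto
        also have "\<dots> = K * (v z - F (u z))\<^sup>2"
          using abs_minus_commute[of "F (u z)" "v z"] by (simp add: power2_eq_square mult.assoc)
        finally have "\<bar>(\<phi> (F (u z)) - \<phi> (v z)) * (v z - F (u z)) / \<epsilon>\<bar> \<le> K * (v z - F (u z))\<^sup>2 / \<epsilon>"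
          unfolding abs_divide abs_mult using eps by (simp add: divide_right_mono)
        then have "\<bar>(\<zeta> z * w (z + hh)) * ((\<phi> (F (u z)) - \<phi> (v z)) * (v z - F (u z)) / \<epsilon>)\<bar>
          \<le> K * K * (K * (v z - F (u z))\<^sup>2 / \<epsilon>)"
          unfolding abs_mult[of "\<zeta> z * w (z + hh)"] using bz K0 by (intro mult_mono) auto
        then show ?thesis by (simp add: power3_eq_cube mult.assoc)
      qed
      have "\<bar>(\<Sum>b\<in>Basis. \<omega>b b z * \<phi> (v z) * g b z + (\<zeta> z * w (z + hh)) * \<phi>' (v z) * (g b z)\<^sup>2)\<bar>
        \<le> (\<Sum>b\<in>Basis. K^3 * (1 + 3 * (g b z)\<^sup>2 + (g b (z + hh))\<^sup>2))"
      proof (rule order_trans[OF sum_abs], rule sum_mono)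
        fix b :: 'a assume b: "b \<in> Basis"
        have "\<bar>\<omega>b b z * \<phi> (v z) * g b z + (\<zeta> z * w (z + hh)) * \<phi>' (v z) * (g b z)\<^sup>2\<bar>
          \<le> K^3 * (1 + 2 * (g b z)\<^sup>2 + (g b (z + hh))\<^sup>2) + K^3 * (g b z)\<^sup>2"
          by (rule order_trans[OF abs_triangle_ineq add_mono[OF t1[OF b TrueI] t2]])
        then show "\<bar>\<omega>b b z * \<phi> (v z) * g b z + (\<zeta> z * w (z + hh)) * \<phi>' (v z) * (g b z)\<^sup>2\<bar>
          \<le> K^3 * (1 + 3 * (g b z)\<^sup>2 + (g b (z + hh))\<^sup>2)" by (simp add: algebra_simps)
      qed
      also have "\<dots> = K^3 * (?N + 3 * (\<Sum>b\<in>Basis. (g b z)\<^sup>2) + (\<Sum>b\<in>Basis. (g b (z + hh))\<^sup>2))"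
        by (simp add: sum_distrib_left[symmetric] sum.distrib)
      finally have "\<bar>(\<Sum>b\<in>Basis. \<omega>b b z * \<phi> (v z) * g b z + (\<zeta> z * w (z + hh)) * \<phi>' (v z) * (g b z)\<^sup>2)
        - (\<zeta> z * w (z + hh)) * ((\<phi> (F (u z)) - \<phi> (v z)) * (v z - F (u z)) / \<epsilon>)\<bar>
        \<le> K^3 * (?N + 3 * (\<Sum>b\<in>Basis. (g b z)\<^sup>2) + (\<Sum>b\<in>Basis. (g b (z + hh))\<^sup>2)) + K^3 * ((v z - F (u z))\<^sup>2 / \<epsilon>)"
        using t3 by linarith
      also have "\<dots> = K^3 * (?N + 3 * (\<Sum>b\<in>Basis. (g b z)\<^sup>2) + (\<Sum>b\<in>Basis. (g b (z + hh))\<^sup>2) + (v z - F (u z))\<^sup>2 / \<epsilon>)"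
        by (simp add: algebra_simps)
      also have "\<dots> \<le> K^3 * (?N + 3 * energy z + energy (z + hh))"
      proof -
        have ar1: "3 * S + t \<le> 3 * (S + t)" if "0 \<le> t" for S t :: real using that by simp
        have ar2: "n + a + b + t \<le> n + c + d" if "a + t \<le> c" "b \<le> d" for n a b c d t :: real using that by simp
        have "3 * (\<Sum>b\<in>Basis. (g b z)\<^sup>2) + (v z - F (u z))\<^sup>2 / \<epsilon> \<le> 3 * energy z"
          unfolding energy_def by (rule ar1) (use eps in simp)
        from ar2[OF this g_energy[of "z + hh"], of ?N] show ?thesis
          by (rule mult_left_mono) (use K0 in simp)
      qed
      finally show "\<bar>(\<Sum>b\<in>Basis. \<omega>b b z * \<phi> (v z) * g b z + (\<zeta> z * w (z + hh)) * \<phi>' (v z) * (g b z)\<^sup>2)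
        - (\<zeta> z * w (z + hh)) * ((\<phi> (F (u z)) - \<phi> (v z)) * (v z - F (u z)) / \<epsilon>)\<bar>
        \<le> K^3 * (?N + 3 * energy z + energy (z + hh))" .
    qed
    show "\<bar>\<integral>z. U z * \<zeta> z * (H' (v (z + (0, y) + \<sigma> *\<^sub>R (s, 0))) * (s * vt (z + (0, y) + \<sigma> *\<^sub>R (s, 0)))) \<partial>ballm a r\<bar>
      \<le> norm d * (K^3 * ((?N + 1) * measure lborel (cball a r) + 4 * E))"
    proof -
      let ?m = "measure lborel (cball a r)"
      have zh: "z + (0, y) + \<sigma> *\<^sub>R (s, 0) = z + hh" for z by (simp add: hh_def add.assoc)
      have cA: "continuous_on (cball a r) (\<lambda>z. \<omega>t z * U z)"
        by (intro continuous_intros c_\<omega>t here_c cU)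
      have cB: "continuous_on (cball a r) (\<lambda>z. \<zeta>d (1, 0) z * w (z + hh) * U z)"
        by (intro continuous_intros \<zeta>c shift_c[OF cw nh] here_c cU)
      \<comment> \<open>\<open>\<omega>t\<close> minus the term in which the derivative falls on
        \<open>\<zeta>\<close> is the integrand to be estimated, up to the factor \<open>s\<close>;
        this factor supplies \<open>norm d\<close>.\<close>
      have "(\<integral>z. U z * \<zeta> z * (H' (v (z + hh)) * (s * vt (z + hh))) \<partial>ballm a r)
        = (\<integral>z. s * (\<omega>t z * U z - \<zeta>d (1, 0) z * w (z + hh) * U z) \<partial>ballm a r)"
        by (rule Bochner_Integration.integral_cong[OF refl]) (simp add: \<omega>t_def algebra_simps)
      also have "\<dots> = s * ((\<integral>z. \<omega>t z * U z \<partial>ballm a r) - (\<integral>z. \<zeta>d (1, 0) z * w (z + hh) * U z \<partial>ballm a r))"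
        by (simp add: integrable_ballm[OF cA] integrable_ballm[OF cB])
      finally have eq: "(\<integral>z. U z * \<zeta> z * (H' (v (z + hh)) * (s * vt (z + hh))) \<partial>ballm a r)
        = s * ((\<integral>z. \<omega>t z * U z \<partial>ballm a r) - (\<integral>z. \<zeta>d (1, 0) z * w (z + hh) * U z \<partial>ballm a r))" .
      have "\<bar>\<integral>z. \<omega>t z * U z \<partial>ballm a r\<bar> \<le> (\<integral>z. K^3 * (?N + 3 * energy z + energy (z + hh)) \<partial>ballm a r)"
        unfolding U_def by fact
      also have "\<dots> = K^3 * (?N * ?m + 3 * (\<integral>z. energy z \<partial>ballm a r) + (\<integral>z. energy (z + hh) \<partial>ballm a r))"
        using iE[OF nh] iE0 ms by simp
      also have "\<dots> \<le> K^3 * (?N * ?m + 4 * E)"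
        using E1[OF nh] E0 K by (intro mult_left_mono) auto
      finally have 1: "\<bar>\<integral>z. \<omega>t z * U z \<partial>ballm a r\<bar> \<le> K^3 * (?N * ?m + 4 * E)" .
      have "\<bar>\<integral>z. \<zeta>d (1, 0) z * w (z + hh) * U z \<partial>ballm a r\<bar> \<le> (\<integral>z. K * K * K \<partial>ballm a r)"
      proof (rule abs_integral_ballm_le[OF cB])
        fix z assume z: "z \<in> cball a r"
        have zQ: "z \<in> Q" "z + hh \<in> Q" using subQ0 z subQ[OF z nh] by auto
        show "\<bar>\<zeta>d (1, 0) z * w (z + hh) * U z\<bar> \<le> K * K * K"
          unfolding abs_mult using b\<zeta>(2)[OF z] bK(3)[OF bv(1)[OF zQ(2)]] bK(5)[OF zQ(1)] K
          by (intro mult_mono) (auto simp: w_def U_def)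
      qed simp
      also have "\<dots> = K^3 * ?m" using ms by (simp add: power3_eq_cube)
      finally have 2: "\<bar>\<integral>z. \<zeta>d (1, 0) z * w (z + hh) * U z \<partial>ballm a r\<bar> \<le> K^3 * ?m" .
      have "\<bar>(\<integral>z. \<omega>t z * U z \<partial>ballm a r) - (\<integral>z. \<zeta>d (1, 0) z * w (z + hh) * U z \<partial>ballm a r)\<bar>
        \<le> K^3 * ((?N + 1) * ?m + 4 * E)"
        using 1 2 by (simp add: algebra_simps)
      then show ?thesis
        unfolding zh eq abs_mult using sn by (intro mult_mono) auto
    qed
  qed (rule cw)
  have e: "z + (0, y) + (s, 0) = z + d" for z by (simp add: sy add.assoc)
  have tri: "\<bar>x - x''\<bar> \<le> p + q" if "\<bar>x - x'\<bar> \<le> p" "\<bar>x' - x''\<bar> \<le> q" for x x' x'' p q :: real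
    using that by linarith
  have eq: "norm d * (K^3 * ((?N + 1) * measure lborel (cball a r) + 4 * E)) + norm d * (K^3 * (?N * measure lborel (cball a r) + E))
    = norm d * (K^3 * ((2 * ?N + 1) * measure lborel (cball a r) + 5 * E))" by (simp add: algebra_simps)
  note t = time_step[unfolded e U_def w_def] and sp = space_step[unfolded U_def w_def]
  show ?thesis by (rule order_trans[OF tri[OF t sp] eq_refl[OF eq]])
qed

end

section \<open>Weak compactness and compensated compactness\<close>

lemma LIMSEQ_approx:
  fixes a :: "nat \<Rightarrow> real"
  assumes "\<And>e. e > 0 \<Longrightarrow> \<exists>b l. b \<longlonglongrightarrow> l \<and> (\<forall>k. \<bar>a k - b k\<bar> \<le> e) \<and> \<bar>L - l\<bar> \<le> e"
  shows "a \<longlonglongrightarrow> L"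
proof (rule LIMSEQ_I)
  fix r :: real assume r: "0 < r"
  obtain b l where b: "b \<longlonglongrightarrow> l" "\<And>k. \<bar>a k - b k\<bar> \<le> r / 4" "\<bar>L - l\<bar> \<le> r / 4"
    using assms[of "r / 4"] r by auto
  obtain N where N: "\<And>k. k \<ge> N \<Longrightarrow> norm (b k - l) < r / 4" using LIMSEQ_D[OF b(1), of "r / 4"] r by auto
  have "norm (a k - L) < r" if "k \<ge> N" for k
    using b(2)[of k] b(3) N[OF that] r by (simp add: abs_le_iff abs_less_iff) argo
  then show "\<exists>no. \<forall>n\<ge>no. norm (a n - L) < r" by blast
qed

lemma bounded_double_sequence_convergent_subseq:
  fixes a :: "nat \<Rightarrow> nat \<Rightarrow> real"
  assumes "\<And>n k. \<bar>a n k\<bar> \<le> c n"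
  shows "\<exists>r. strict_mono r \<and> (\<forall>n. convergent (\<lambda>k. a n (r k)))"
proof -
  interpret subseqs "\<lambda>n s. convergent (\<lambda>k. a n (s k))"
  proof
    fix n :: nat and s :: "nat \<Rightarrow> nat"
    have "bounded (range (\<lambda>k. a n (s k)))" unfolding bounded_iff using assms by auto
    then obtain l r where "strict_mono r" "((\<lambda>k. a n (s k)) \<circ> r) \<longlonglongrightarrow> l"
      using bounded_imp_convergent_subsequence by blast
    then show "\<exists>r. strict_mono r \<and> convergent (\<lambda>k. a n ((s \<circ> r) k))"
      by (auto simp: convergent_def comp_def)
  qed
  \<comment> \<open>With its first \<open>Suc n\<close> terms dropped, the diagonal sequence is a
    subsequence of the one chosen at stage \<open>n\<close>; the dropped terms do not affect
    convergence.\<close>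
  have "convergent (\<lambda>k. a n ((diagseq \<circ> ((+) (Suc n))) k))" for n
  proof (rule diagseq_holds)
    fix r s :: "nat \<Rightarrow> nat" and n assume "strict_mono r" "convergent (\<lambda>k. a n (s k))"
    then show "convergent (\<lambda>k. a n ((s \<circ> r) k))"
      using LIMSEQ_subseq_LIMSEQ[of "\<lambda>k. a n (s k)" _ r] by (auto simp: convergent_def comp_def)
  qed
  then have "convergent (\<lambda>k. a n (diagseq (k + Suc n)))" for n
    unfolding comp_def add.commute[of _ "Suc n"] .
  then have "convergent (\<lambda>k. a n (diagseq k))" for n
    by (rule convergent_ignore_initial_segment[of "\<lambda>k. a n (diagseq k)" "Suc n", THEN iffD1])
  then show ?thesis using subseq_diagseq by blast
qed

text \<open>Closing a countable base under finite intersections keeps it countable and gives a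
  generator to which Dynkin's argument applies; the empty intersection contributes
  \<open>UNIV\<close>.\<close>

lemma countable_Int_stable_generator:
  "\<exists>G :: 'b::second_countable_topology set set. countable G \<and> Int_stable G \<and> UNIV \<in> G \<and>
    sets borel = sigma_sets UNIV G"
proof -
  obtain B :: "'b set set" where B: "countable B" "topological_basis B" using ex_countable_basis by auto
  define G where "G = Inter ` {A. finite A \<and> A \<subseteq> B}"
  have "countable G" unfolding G_def using B(1) by (intro countable_image countable_Collect_finite_subset)
  moreover have "Int_stable G"
  proof (rule Int_stableI)
    fix a b assume "a \<in> G" "b \<in> G"
    then obtain A A' where "a = \<Inter>A" "b = \<Inter>A'" "finite A" "finite A'" "A \<subseteq> B" "A' \<subseteq> B" by (auto simp: G_def)
    then show "a \<inter> b \<in> G" unfolding G_def by (intro image_eqI[of _ _ "A \<union> A'"]) auto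
  qed
  moreover have "UNIV \<in> G" unfolding G_def by (intro image_eqI[of _ _ "{}"]) auto
  moreover have "sets borel = sigma_sets UNIV G"
  proof
    have "B \<subseteq> G" unfolding G_def by (auto intro!: image_eqI[of _ _ "{_}"])
    moreover have "sets (borel :: 'b measure) = sigma_sets UNIV B" 
      by (subst borel_eq_countable_basis[OF B]) (simp add: sets_measure_of)
    ultimately show "sets borel \<subseteq> sigma_sets UNIV G" by (simp add: sigma_sets_mono')
    have "open a" if "a \<in> G" for a
      using that topological_basis_open[OF B(2)] by (auto simp: G_def intro!: open_Inter)
    then show "sigma_sets UNIV G \<subseteq> sets borel"
      by (intro sets.sigma_sets_subset[of G borel, simplified]) auto
  qed
  ultimately show ?thesis by blast
qed

lemma AE_nonneg_of_set_integral:
  assumes f: "integrable M (f :: 'a \<Rightarrow> real)"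
    and nn: "\<And>A. A \<in> sets M \<Longrightarrow> 0 \<le> (\<integral>z. indicator A z * f z \<partial>M)"
  shows "AE z in M. 0 \<le> f z"
proof -
  define A where "A = {z \<in> space M. f z < 0}"
  have A: "A \<in> sets M" unfolding A_def using f by measurable
  have i: "integrable M (\<lambda>z. - (indicator A z * f z))"
    using integrable_mult_indicator[OF A f] by (simp add: mult.commute)
  have ge: "AE z in M. 0 \<le> - (indicator A z * f z)" by (rule AE_I2) (auto simp: A_def indicator_def)
  have "(\<integral>z. - (indicator A z * f z) \<partial>M) \<le> 0" using nn[OF A] by simp
  moreover have "0 \<le> (\<integral>z. - (indicator A z * f z) \<partial>M)" using ge by (rule integral_nonneg_AE)
  ultimately have "AE z in M. - (indicator A z * f z) = 0"
    using integral_nonneg_eq_0_iff_AE[OF i ge] by simp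
  then show ?thesis
    by (rule AE_mp) (auto simp: A_def indicator_def intro!: AE_I2 split: if_splits)
qed

text \<open>Convergence of the integrals over an intersection-stable generator extends to all Borel
  sets by Dynkin induction; the uniform bound \<open>C\<close> supplies the domination needed for
  disjoint unions. The limiting set function is absolutely continuous and has a density by
  Radon-Nikodym. Integrable test functions are then reached through L1 approximation by simple
  ones.\<close>

lemma weak_star_compact_single_limit:
  fixes f :: "nat \<Rightarrow> 'b::second_countable_topology \<Rightarrow> real"
  assumes M: "finite_measure M" "sets M = sets borel"
    and G: "Int_stable G" "UNIV \<in> G" "sets borel = sigma_sets UNIV G"
    and f: "\<And>k. f k \<in> borel_measurable borel" "\<And>k z. \<bar>f k z\<bar> \<le> C"
    and conv: "\<And>A. A \<in> G \<Longrightarrow> convergent (\<lambda>k. \<integral>z. indicator A z * f k z \<partial>M)"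
  shows "\<exists>g. g \<in> borel_measurable borel \<and> (\<forall>z. \<bar>g z\<bar> \<le> C) \<and>
    (\<forall>\<phi>. integrable M \<phi> \<longrightarrow> (\<lambda>k. \<integral>z. f k z * \<phi> z \<partial>M) \<longlonglongrightarrow> (\<integral>z. g z * \<phi> z \<partial>M))"
proof -
  interpret finite_measure M by fact
  have C0: "C \<ge> 0" using f(2)[of 0 undefined] by linarith
  have spM: "space M = UNIV" using sets_eq_imp_space_eq[OF M(2)] by simp
  have meas[measurable_cong, simp]: "sets M = sets borel" by fact
  have fM[measurable]: "f k \<in> borel_measurable M" for k using f(1) by (simp add: measurable_cong_sets[OF M(2) refl])
  have fi: "integrable M (f k)" for k
    by (rule integrable_const_bound[where B=C]) (use f in auto)
  define I where "I k A = (\<integral>z. indicator A z * f k z \<partial>M)" for k A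
  have fiA: "integrable M (\<lambda>z. indicator A z * f k z)" if "A \<in> sets borel" for k A
    using integrable_mult_indicator[of A M "f k"] that fi by simp
  have iC: "integrable M (\<lambda>z. indicator A z * C)" if "A \<in> sets borel" for A
    using integrable_mult_indicator[of A M "\<lambda>_. C"] that by simp
  have I_le: "\<bar>I k A\<bar> \<le> C * measure M A" if A: "A \<in> sets borel" for k A
  proof -
    have "\<bar>I k A\<bar> \<le> (\<integral>z. \<bar>indicator A z * f k z\<bar> \<partial>M)" unfolding I_def by (rule integral_abs_bound)
    also have "\<dots> \<le> (\<integral>z. indicator A z * C \<partial>M)"
      using f(2) C0 by (intro integral_mono integrable_abs fiA[OF A] iC[OF A]) (auto simp: indicator_def)
    finally show ?thesis using A spM by (simp add: mult.commute)
  qed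
  have Iun: "I k (\<Union>i. A i) = (\<Sum>i. I k (A i))"
    if "disjoint_family A" "\<And>i::nat. A i \<in> sets borel" for A k
    using lebesgue_integral_countable_add[of A M "f k"] that fi fiA[of "\<Union>i. A i" k]
    by (auto simp: I_def set_lebesgue_integral_def set_integrable_def disjoint_family_on_def)
  have summ: "summable (\<lambda>i. C * measure M (A i))" if "disjoint_family A" "\<And>i::nat. A i \<in> sets borel" for A
    using that by (intro summable_mult sums_summable[OF finite_measure_UNION]) auto
  \<comment> \<open>Tannery's theorem interchanges limit and series: the terms are dominated by
    \<open>C * measure M (A i)\<close>, which is summable.\<close>
  have lim_un: "(\<lambda>k. I k (\<Union>i. A i)) \<longlonglongrightarrow> (\<Sum>i. L i) \<and> summable L"
    if A: "disjoint_family A" "\<And>i::nat. A i \<in> sets borel" and L: "\<And>i. (\<lambda>k. I k (A i)) \<longlonglongrightarrow> L i" for A L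
  proof -
    have "eventually (\<lambda>(i,k). norm (I k (A i)) \<le> C * measure M (A i)) (at_top \<times>\<^sub>F sequentially)"
      using I_le A by (intro always_eventually) auto
    from tannerys_theorem[OF L this summ[OF A]] show ?thesis
      unfolding Iun[OF A] using summable_norm_cancel[of L] by (auto simp del: real_norm_def)
  qed
  have conv': "convergent (\<lambda>k. I k A)" if "A \<in> sets borel" for A
  proof -
    have "A \<in> sigma_sets UNIV G" using that G(3) by simp
    have cl: "G \<subseteq> Pow UNIV" by auto
    from G(1) cl \<open>A \<in> sigma_sets UNIV G\<close> show ?thesis
    proof (induction rule: sigma_sets_induct_disjoint)
      case (basic A) then show ?case using conv by (simp add: I_def)
    next
      case empty show ?case by (simp add: I_def convergent_const)
    next
      case (compl A)
      have A: "A \<in> sets borel" using compl G by simp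
      have "I k (UNIV - A) = I k UNIV - I k A" for k
      proof -
        have "I k UNIV - I k A = (\<integral>z. indicator UNIV z * f k z - indicator A z * f k z \<partial>M)"
          unfolding I_def using fiA[OF A] fiA[of UNIV] by simp
        also have "\<dots> = I k (UNIV - A)" unfolding I_def
          by (rule Bochner_Integration.integral_cong) (auto simp: indicator_def)
        finally show ?thesis by simp
      qed
      moreover have "convergent (\<lambda>k. I k UNIV)" using conv[OF G(2)] by (simp add: I_def)
      ultimately show ?case using convergent_diff[OF _ compl(2), of "\<lambda>k. I k UNIV"] by simp
    next
      case (union A)
      have lims: "\<And>i. (\<lambda>k. I k (A i)) \<longlonglongrightarrow> lim (\<lambda>k. I k (A i))" using union(3) by (simp add: convergent_LIMSEQ_iff)
      have Ab: "\<And>i. A i \<in> sets borel" using union(2) G(3) by auto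
      have "(\<lambda>k. I k (\<Union>i. A i)) \<longlonglongrightarrow> (\<Sum>i. lim (\<lambda>k. I k (A i)))"
        by (rule lim_un[OF union(1) Ab lims, THEN conjunct1])
      then show ?case by (auto simp: convergent_def)
    qed
  qed
  define L where "L A = lim (\<lambda>k. I k A)" for A
  have L: "(\<lambda>k. I k A) \<longlonglongrightarrow> L A" if "A \<in> sets borel" for A
    using conv'[OF that] by (simp add: L_def convergent_LIMSEQ_iff)
  have L_le: "\<bar>L A\<bar> \<le> C * measure M A" if "A \<in> sets borel" for A
    by (rule LIMSEQ_le_const2[OF tendsto_rabs[OF L[OF that]]]) (use I_le that in auto)
  \<comment> \<open>Adding \<open>C\<close> times the measure makes the signed limit nonnegative, so
    that the Radon-Nikodym theorem for positive measures applies; \<open>g0\<close> subtracts the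
    constant again.\<close>
  define \<nu> where "\<nu> A = L A + C * measure M A" for A
  have \<nu>0: "0 \<le> \<nu> A" if "A \<in> sets borel" for A using L_le[OF that] by (auto simp: \<nu>_def)
  define N where "N = measure_of UNIV (sets (borel :: 'b measure)) (\<lambda>A. ennreal (\<nu> A))"
  have emN: "emeasure N A = ennreal (\<nu> A)" if "A \<in> sets borel" for A
    unfolding N_def
  proof (rule emeasure_measure_of_sigma)
    show "sigma_algebra UNIV (sets (borel :: 'b measure))" using sets.sigma_algebra_axioms[of "borel :: 'b measure"] by simp
    show "positive (sets borel) (\<lambda>A. ennreal (\<nu> A))"
      using L_le[of "{}"] by (simp add: positive_def \<nu>_def)
    show "countably_additive (sets borel) (\<lambda>A. ennreal (\<nu> A))"
    proof (rule countably_additiveI)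
      fix A :: "nat \<Rightarrow> 'b set" assume A: "range A \<subseteq> sets borel" "disjoint_family A"
      then have A': "\<And>i. A i \<in> sets borel" by auto
      have 1: "L (\<Union>i. A i) = (\<Sum>i. L (A i))" "summable (\<lambda>i. L (A i))"
        using lim_un[OF A(2) A' L[OF A']] L[of "\<Union>i. A i"] A' LIMSEQ_unique by blast+
      have 2: "(\<lambda>i. C * measure M (A i)) sums (C * measure M (\<Union>i. A i))"
        using finite_measure_UNION[of A] A A' by (intro sums_mult) auto
      have "(\<lambda>i. \<nu> (A i)) sums \<nu> (\<Union>i. A i)"
        unfolding \<nu>_def 1(1) by (intro sums_add 2 summable_sums 1(2))
      then show "(\<Sum>i. ennreal (\<nu> (A i))) = ennreal (\<nu> (\<Union>i. A i))"
        using \<nu>0 A' by (subst suminf_ennreal2) (auto simp: sums_iff)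
    qed
  qed (use that in auto)
  have sN: "sets N = sets M" using sets.sigma_sets_eq[of "borel :: 'b measure"] by (simp add: N_def)
  have "finite_measure N"
    by (rule finite_measureI) (simp add: emN sets_eq_imp_space_eq[OF sN] spM)
  moreover have "absolutely_continuous M N"
    unfolding absolutely_continuous_def
  proof
    fix A assume "A \<in> null_sets M"
    then have A: "A \<in> sets borel" "measure M A = 0" by (auto simp: measure_def)
    then have "\<nu> A = 0" using L_le[of A] by (simp add: \<nu>_def)
    then show "A \<in> null_sets N" using A emN[of A] sN by auto
  qed
  ultimately obtain h where h: "h \<in> borel_measurable M" "density M h = N"
    using Radon_Nikodym_finite_measure sN by blast
  have hint: "(\<integral>\<^sup>+z. h z * indicator A z \<partial>M) = ennreal (\<nu> A)" if "A \<in> sets borel" for A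
    using emeasure_density[of h M A] h that emN by simp
  have hfin: "AE z in M. h z \<noteq> \<infinity>"
    using hint[of UNIV] h by (intro nn_integral_PInf_AE) auto
  define h' where "h' z = enn2real (h z)" for z
  have h'm[measurable]: "h' \<in> borel_measurable M" unfolding h'_def using h by measurable
  have h'A: "has_bochner_integral M (\<lambda>z. indicator A z * h' z) (\<nu> A)" if "A \<in> sets borel" for A
  proof (rule has_bochner_integral_nn_integral)
    show "(\<integral>\<^sup>+ z. ennreal (indicator A z * h' z) \<partial>M) = ennreal (\<nu> A)"
      unfolding hint[OF that, symmetric]
      by (rule nn_integral_cong_AE) (use hfin in \<open>auto simp: h'_def indicator_def ennreal_enn2real_if\<close>)
    show "(\<lambda>z. indicator A z * h' z) \<in> borel_measurable M" using that by simp
  qed (use that \<nu>0 in \<open>auto simp: h'_def\<close>)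
  define g0 where "g0 z = h' z - C" for z
  have g0i: "integrable M g0" unfolding g0_def using h'A[of UNIV] by (auto dest: has_bochner_integral_integrable[THEN has_bochner_integral_iff[THEN iffD1, THEN conjunct1]] simp: has_bochner_integral_iff)
  have g0A: "(\<integral>z. indicator A z * g0 z \<partial>M) = L A" if A: "A \<in> sets borel" for A
  proof -
    have "(\<integral>z. indicator A z * g0 z \<partial>M) = (\<integral>z. indicator A z * h' z - indicator A z * C \<partial>M)"
      by (simp add: g0_def algebra_simps)
    also have "\<dots> = \<nu> A - C * measure M A"
      using h'A[OF A] A spM by (subst Bochner_Integration.integral_diff) (auto simp: has_bochner_integral_iff less_top[symmetric])
    finally show ?thesis by (simp add: \<nu>_def)
  qed
  have iA: "integrable M (\<lambda>z. indicator A z * g0 z)" if "A \<in> sets borel" for A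
    using integrable_mult_indicator[of A M g0] that g0i by simp
  have "AE z in M. 0 \<le> C - g0 z"
  proof (rule AE_nonneg_of_set_integral)
    show "0 \<le> (\<integral>z. indicator A z * (C - g0 z) \<partial>M)" if "A \<in> sets M" for A
      using L_le[of A] g0A[of A] iA[of A] that spM
      by (simp add: right_diff_distrib Bochner_Integration.integral_diff less_top[symmetric] mult.commute)
  qed (use g0i in auto)
  moreover have "AE z in M. 0 \<le> C + g0 z"
  proof (rule AE_nonneg_of_set_integral)
    show "0 \<le> (\<integral>z. indicator A z * (C + g0 z) \<partial>M)" if "A \<in> sets M" for A
      using L_le[of A] g0A[of A] iA[of A] that spM
      by (simp add: distrib_left Bochner_Integration.integral_add less_top[symmetric] mult.commute)
  qed (use g0i in auto)
  ultimately have bd: "AE z in M. \<bar>g0 z\<bar> \<le> C" by eventually_elim auto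
  \<comment> \<open>\<open>g0\<close> satisfies the bound only almost everywhere; truncation makes
    it hold at every point.\<close>
  define g where "g z = max (- C) (min C (g0 z))" for z
  have gM[measurable]: "g \<in> borel_measurable M"
    unfolding g_def using borel_measurable_integrable[OF g0i]
    by (intro borel_measurable_max borel_measurable_min) auto
  then have gm: "g \<in> borel_measurable borel" by (simp add: measurable_cong_sets[OF M(2) refl])
  have gC: "\<bar>g z\<bar> \<le> C" for z using C0 by (auto simp: g_def)
  have gg0: "AE z in M. g z = g0 z" using bd by eventually_elim (auto simp: g_def)
  have gA: "(\<integral>z. indicator A z * g z \<partial>M) = L A" if A: "A \<in> sets borel" for A
    unfolding g0A[OF A, symmetric] using A g0i gg0 by (intro integral_cong_AE) auto
  have "(\<lambda>k. \<integral>z. f k z * \<phi> z \<partial>M) \<longlonglongrightarrow> (\<integral>z. g z * \<phi> z \<partial>M)" if "integrable M \<phi>" for \<phi>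
    using that
  proof induction
    case (base A c)
    then have "(\<lambda>k. c * I k A) \<longlonglongrightarrow> c * (\<integral>z. indicator A z * g z \<partial>M)"
      using L[of A] gA[of A] by (intro tendsto_mult_left) auto
    then show ?case by (simp add: I_def mult_ac)
  next
    case (add \<phi> \<psi>)
    have i: "integrable M (\<lambda>z. k z * p z)" if "k \<in> borel_measurable M" "\<And>z. \<bar>k z\<bar> \<le> C" "integrable M p" for k p :: "'b \<Rightarrow> real"
      by (rule Bochner_Integration.integrable_bound[where f="\<lambda>z. C * p z"])
        (use that C0 in \<open>auto simp: abs_mult intro!: mult_mono\<close>)
    show ?case
      using add.IH tendsto_add[of "\<lambda>k. \<integral>z. f k z * \<phi> z \<partial>M" _ sequentially "\<lambda>k. \<integral>z. f k z * \<psi> z \<partial>M"]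
      by (simp add: distrib_left i[OF fM f(2)] i[OF gM gC] add.hyps)
  next
    case (lim \<phi> s)
    have i: "integrable M (\<lambda>z. k z * p z)" if "k \<in> borel_measurable M" "\<And>z. \<bar>k z\<bar> \<le> C" "integrable M p" for k p :: "'b \<Rightarrow> real"
      by (rule Bochner_Integration.integrable_bound[where f="\<lambda>z. C * p z"])
        (use that C0 in \<open>auto simp: abs_mult intro!: mult_mono\<close>)
    \<comment> \<open>The approximating functions satisfy
      \<open>norm (s i z) <= 2 * norm (\<phi> z)\<close>, hence the factor 3 in the dominating
      function.\<close>
    have "(\<lambda>i. \<integral>z. \<bar>\<phi> z - s i z\<bar> \<partial>M) \<longlonglongrightarrow> (\<integral>z. 0 \<partial>M)"
    proof (rule integral_dominated_convergence[where w="\<lambda>z. 3 * \<bar>\<phi> z\<bar>"])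
      show "AE z in M. (\<lambda>i. \<bar>\<phi> z - s i z\<bar>) \<longlonglongrightarrow> 0"
      proof (rule AE_I2)
        fix z assume "z \<in> space M"
        from tendsto_diff[OF tendsto_const[of "\<phi> z"] lim.hyps(2)[OF this]]
        show "(\<lambda>i. \<bar>\<phi> z - s i z\<bar>) \<longlonglongrightarrow> 0" by (intro tendsto_rabs_zero) simp
      qed
      show "AE z in M. norm \<bar>\<phi> z - s i z\<bar> \<le> 3 * \<bar>\<phi> z\<bar>" for i
      proof (rule AE_I2)
        fix z assume "z \<in> space M"
        from lim.hyps(3)[OF this, of i] show "norm \<bar>\<phi> z - s i z\<bar> \<le> 3 * \<bar>\<phi> z\<bar>" by simp
      qed
    qed (use lim.hyps(1,4) in auto)
    then have small: "(\<lambda>i. C * (\<integral>z. \<bar>\<phi> z - s i z\<bar> \<partial>M)) \<longlonglongrightarrow> 0" using tendsto_mult_right_zero by fastforce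
    have d: "\<bar>(\<integral>z. k z * \<phi> z \<partial>M) - (\<integral>z. k z * s i z \<partial>M)\<bar> \<le> C * (\<integral>z. \<bar>\<phi> z - s i z\<bar> \<partial>M)"
      if k: "k \<in> borel_measurable M" "\<And>z. \<bar>k z\<bar> \<le> C" for k i
    proof -
      have "(\<integral>z. k z * \<phi> z \<partial>M) - (\<integral>z. k z * s i z \<partial>M) = (\<integral>z. k z * (\<phi> z - s i z) \<partial>M)"
        using i[OF k lim.hyps(4)] i[OF k lim.hyps(1)] by (simp add: right_diff_distrib)
      also have "\<bar>\<dots>\<bar> \<le> (\<integral>z. \<bar>k z * (\<phi> z - s i z)\<bar> \<partial>M)" by (rule integral_abs_bound)
      also have "\<dots> \<le> (\<integral>z. C * \<bar>\<phi> z - s i z\<bar> \<partial>M)"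
        using lim.hyps(1,4) k C0 by (intro integral_mono integrable_abs i) (auto simp: abs_mult intro!: mult_right_mono)
      finally show ?thesis using lim.hyps(1,4) by simp
    qed
    show ?case
    proof (rule LIMSEQ_approx)
      fix e :: real assume "e > 0"
      from LIMSEQ_D[OF small this] obtain j where "norm (C * (\<integral>z. \<bar>\<phi> z - s j z\<bar> \<partial>M) - 0) < e" by blast
      then have j: "C * (\<integral>z. \<bar>\<phi> z - s j z\<bar> \<partial>M) \<le> e" by (simp add: abs_less_iff)
      show "\<exists>b l. b \<longlonglongrightarrow> l \<and> (\<forall>k. \<bar>(\<integral>z. f k z * \<phi> z \<partial>M) - b k\<bar> \<le> e) \<and> \<bar>(\<integral>z. g z * \<phi> z \<partial>M) - l\<bar> \<le> e"
        using lim.IH[of j] order_trans[OF d[OF fM f(2)] j] order_trans[OF d[OF gM gC] j] by blast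
    qed
  qed
  then show ?thesis using gm gC by blast
qed

text \<open>One subsequence serves all the sequences \<open>f j\<close>: the integrals of
  \<open>f j k\<close> over the \<open>i\<close>-th generating set are numbered by the code of the
  pair \<open>(j, i)\<close>, and the diagonal argument is applied once to all of them.\<close>

lemma weak_star_compact:
  fixes f :: "nat \<Rightarrow> nat \<Rightarrow> 'b::second_countable_topology \<Rightarrow> real"
  assumes M: "finite_measure M" "sets M = sets borel"
    and f: "\<And>j k. f j k \<in> borel_measurable borel" "\<And>j k z. \<bar>f j k z\<bar> \<le> C j"
  shows "\<exists>r g. strict_mono r \<and> (\<forall>j. g j \<in> borel_measurable borel \<and> (\<forall>z. \<bar>g j z\<bar> \<le> C j) \<and>
    (\<forall>\<phi>. integrable M \<phi> \<longrightarrow> (\<lambda>k. \<integral>z. f j (r k) z * \<phi> z \<partial>M) \<longlonglongrightarrow> (\<integral>z. g j z * \<phi> z \<partial>M)))"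
proof -
  interpret finite_measure M by fact
  obtain G :: "'b set set" where G: "countable G" "Int_stable G" "UNIV \<in> G" "sets borel = sigma_sets UNIV G"
    using countable_Int_stable_generator by blast
  define A where "A = from_nat_into G"
  have A: "range A = G" unfolding A_def using G(1,3) by (intro range_from_nat_into) auto
  have Ab: "A i \<in> sets borel" for i using A G(4) by (auto intro: sigma_sets.Basic)
  define a where "a n k = (\<integral>z. indicator (A (snd (prod_decode n))) z * f (fst (prod_decode n)) k z \<partial>M)" for n k
  have "\<bar>a n k\<bar> \<le> C (fst (prod_decode n)) * measure M UNIV" for n k
  proof -
    have "\<bar>a n k\<bar> \<le> (\<integral>z. \<bar>indicator (A (snd (prod_decode n))) z * f (fst (prod_decode n)) k z\<bar> \<partial>M)"
      unfolding a_def by (rule integral_abs_bound)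
    also have "\<dots> \<le> (\<integral>z. C (fst (prod_decode n)) \<partial>M)"
    proof (rule integral_mono)
      have "f j k \<in> borel_measurable M" for j using f(1) by (simp add: measurable_cong_sets[OF M(2) refl])
      moreover have C0: "0 \<le> C (fst (prod_decode n))" using f(2) abs_ge_zero order_trans by blast
      ultimately show "integrable M (\<lambda>z. \<bar>indicator (A (snd (prod_decode n))) z * f (fst (prod_decode n)) k z\<bar>)"
        using Ab M(2) f(2)[of "fst (prod_decode n)" k]
        by (intro integrable_abs integrable_const_bound[where B="C (fst (prod_decode n))"])
          (auto simp: indicator_def)
      show "\<bar>indicator (A (snd (prod_decode n))) z * f (fst (prod_decode n)) k z\<bar> \<le> C (fst (prod_decode n))" for z
        using f(2) C0 by (auto simp: indicator_def)
    qed simp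
    finally show ?thesis using sets_eq_imp_space_eq[OF M(2)] by (simp add: mult.commute)
  qed
  from bounded_double_sequence_convergent_subseq[of a "\<lambda>n. C (fst (prod_decode n)) * measure M UNIV", OF this]
  obtain r where r: "strict_mono r" "\<And>n. convergent (\<lambda>k. a n (r k))" by blast
  define P where "P j g \<longleftrightarrow> g \<in> borel_measurable borel \<and> (\<forall>z. \<bar>g z\<bar> \<le> C j) \<and>
    (\<forall>\<phi>. integrable M \<phi> \<longrightarrow> (\<lambda>k. \<integral>z. f j (r k) z * \<phi> z \<partial>M) \<longlonglongrightarrow> (\<integral>z. g z * \<phi> z \<partial>M))" for j g
  have "\<exists>g. P j g" for j
    unfolding P_def
  proof (rule weak_star_compact_single_limit[OF M G(2,3,4) f])
    fix B assume "B \<in> G"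
    then have "B \<in> range A" using A by simp
    then obtain i where "B = A i" by (rule rangeE)
    then show "convergent (\<lambda>k. \<integral>z. indicator B z * f j (r k) z \<partial>M)"
      using r(2)[of "prod_encode (j, i)"] by (simp add: a_def)
  qed
  then have "\<exists>g. \<forall>j. P j (g j)" by (intro choice allI)
  then obtain g where g: "\<And>j. P j (g j)" by blast
  show ?thesis
    by (intro exI[of _ r] exI[of _ g] conjI r(1) allI g[unfolded P_def])
qed

section \<open>Averages, translations and products of weak limits\<close>

lemma LIMSEQ_zero_imp_small:
  fixes X :: "nat \<Rightarrow> real"
  assumes "X \<longlonglongrightarrow> 0" "0 < e"
  shows "\<exists>n. X n \<le> e"
proof -
  obtain n where "norm (X n - 0) < e" using LIMSEQ_D[OF assms] by blast
  then have "X n \<le> e" by (simp add: abs_less_iff)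
  then show ?thesis by blast
qed

text \<open>Measurability gives continuous approximants off a negligible set; truncating them at
  \<open>C\<close> keeps the limit because \<open>w\<close> itself obeys that bound.\<close>

lemma bounded_borel_AE_limit_continuous:
  fixes w :: "'b::euclidean_space \<Rightarrow> real"
  assumes w: "w \<in> borel_measurable borel" "\<And>z. \<bar>w z\<bar> \<le> C"
  obtains g :: "nat \<Rightarrow> 'b \<Rightarrow> real" where "\<And>n. continuous_on UNIV (g n)" "\<And>n z. \<bar>g n z\<bar> \<le> C"
    "AE z in lborel. (\<lambda>n. g n z) \<longlonglongrightarrow> w z"
proof -
  have C: "0 \<le> C" using w(2)[of 0] by linarith
  have "w \<in> borel_measurable lebesgue" using w(1) by (simp add: measurable_completion)
  then have "w measurable_on UNIV" by (intro lebesgue_measurable_imp_measurable_on_real) auto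
  then obtain N g where N: "negligible N" "\<And>n. continuous_on UNIV (g n)"
      "\<And>z. z \<notin> N \<Longrightarrow> (\<lambda>n. g n z) \<longlonglongrightarrow> w z"
    unfolding measurable_on_def by auto
  define g' where "g' n z = max (- C) (min C (g n z))" for n :: nat and z
  have "continuous_on UNIV (g' n)" for n unfolding g'_def by (intro continuous_intros N(2))
  moreover have "\<bar>g' n z\<bar> \<le> C" for n z unfolding g'_def using C by auto
  moreover have "AE z in lborel. (\<lambda>n. g' n z) \<longlonglongrightarrow> w z"
  proof -
    have "AE z in lebesgue. z \<notin> N" using N(1) by (intro AE_not_in) (simp add: negligible_iff_null_sets)
    then have "AE z in lborel. z \<notin> N" by (simp add: AE_completion_iff)
    then show ?thesis
    proof eventually_elim
      case (elim z)
      have "(\<lambda>n. g' n z) \<longlonglongrightarrow> max (- C) (min C (w z))"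
        unfolding g'_def by (intro tendsto_intros N(3) elim)
      moreover have "max (- C) (min C (w z)) = w z" using w(2)[of z] by auto
      ultimately show ?case by simp
    qed
  qed
  ultimately show ?thesis by (rule that)
qed

lemma AE_ballm: "AE z in lborel. P z \<Longrightarrow> AE z in ballm a r. P z"
  by (subst AE_restrict_space_iff) auto

lemma borel_measurable_ballm: "f \<in> borel_measurable borel \<Longrightarrow> f \<in> borel_measurable (ballm a r)"
  by (rule measurable_restrict_space1) simp

lemma integrable_ballm_bounded:
  fixes f :: "'b::euclidean_space \<Rightarrow> real"
  assumes "f \<in> borel_measurable borel" "\<And>z. \<bar>f z\<bar> \<le> C"
  shows "integrable (ballm a r) f"
proof -
  interpret finite_measure "ballm a r" by (rule finite_measure_ballm)
  show ?thesis using assms borel_measurable_ballm by (intro integrable_const_bound[where B=C]) auto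
qed

text \<open>A continuous approximant \<open>g n\<close> close to \<open>w\<close> in L1 on the ball
  of radius \<open>r + 1\<close> is uniformly continuous there; the larger radius makes room for
  shifts of norm at most 1.\<close>

lemma translation_continuous_L1:
  fixes w :: "'b::euclidean_space \<Rightarrow> real"
  assumes w: "w \<in> borel_measurable borel" "\<And>z. \<bar>w z\<bar> \<le> C" and e: "0 < e"
  shows "\<exists>\<eta>>0. \<forall>h. norm h \<le> \<eta> \<longrightarrow> (\<integral>z. \<bar>w (z + h) - w z\<bar> \<partial>ballm a r) \<le> e"
proof -
  obtain g :: "nat \<Rightarrow> 'b \<Rightarrow> real" where g: "\<And>n. continuous_on UNIV (g n)" "\<And>n z. \<bar>g n z\<bar> \<le> C"
    "AE z in lborel. (\<lambda>n. g n z) \<longlonglongrightarrow> w z"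
    using bounded_borel_AE_limit_continuous[OF w] by blast
  have gm: "g n \<in> borel_measurable borel" for n by (rule borel_measurable_continuous_onI[OF g(1)])
  interpret finite_measure "ballm a r" by (rule finite_measure_ballm)
  let ?m = "measure (ballm a r) (space (ballm a r))"
  have "(\<lambda>n. \<integral>z. \<bar>g n z - w z\<bar> \<partial>ballm a (r + 1)) \<longlonglongrightarrow> (\<integral>z. 0 \<partial>ballm a (r + 1))"
  proof (rule integral_dominated_convergence[where w="\<lambda>z. 2 * C"])
    show "AE z in ballm a (r + 1). (\<lambda>n. \<bar>g n z - w z\<bar>) \<longlonglongrightarrow> 0"
    proof (rule AE_mp[OF AE_ballm[OF g(3)]], rule AE_I2, rule impI)
      fix z assume "(\<lambda>n. g n z) \<longlonglongrightarrow> w z"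
      from tendsto_diff[OF this tendsto_const[of "w z"]]
      show "(\<lambda>n. \<bar>g n z - w z\<bar>) \<longlonglongrightarrow> 0" by (intro tendsto_rabs_zero) simp
    qed
    show "AE z in ballm a (r + 1). norm \<bar>g n z - w z\<bar> \<le> 2 * C" for n
    proof (rule AE_I2)
      fix z show "norm \<bar>g n z - w z\<bar> \<le> 2 * C" using g(2)[of n z] w(2)[of z] by simp
    qed
    show "integrable (ballm a (r + 1)) (\<lambda>z. 2 * C)" by (rule integrable_ballm) simp
  qed (use gm w(1) in \<open>auto intro!: borel_measurable_ballm\<close>)
  then obtain n where n: "(\<integral>z. \<bar>g n z - w z\<bar> \<partial>ballm a (r + 1)) \<le> e / 3"
    using LIMSEQ_zero_imp_small[of "\<lambda>n. \<integral>z. \<bar>g n z - w z\<bar> \<partial>ballm a (r + 1)" "e / 3"] e by auto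
  have "uniformly_continuous_on (cball a (r + 1)) (g n)"
    by (rule compact_uniformly_continuous[OF continuous_on_subset[OF g(1)]]) auto
  then obtain d where d: "d > 0" "\<And>x y. x \<in> cball a (r + 1) \<Longrightarrow> y \<in> cball a (r + 1) \<Longrightarrow> dist y x < d \<Longrightarrow>
      dist (g n y) (g n x) < e / (3 * (?m + 1))"
    unfolding uniformly_continuous_on_def using e by (metis add_nonneg_pos divide_pos_pos measure_nonneg mult_pos_pos zero_less_numeral zero_less_one)
  define \<eta> where "\<eta> = min 1 (d / 2)"
  have "(\<integral>z. \<bar>w (z + h) - w z\<bar> \<partial>ballm a r) \<le> e" if h: "norm h \<le> \<eta>" for h
  proof -
    have h1: "norm h \<le> 1" "norm h < d" using h d(1) by (auto simp: \<eta>_def)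
    have wm: "(\<lambda>z. w (z + h)) \<in> borel_measurable borel" using w(1) by simp
    have gmh: "(\<lambda>z. g n (z + h)) \<in> borel_measurable borel" using gm by simp
    have i1: "integrable (ballm a r) (\<lambda>z. \<bar>w (z + h) - w z\<bar>)"
      using wm w by (intro integrable_abs Bochner_Integration.integrable_diff integrable_ballm_bounded[where C=C]) auto
    have i2: "integrable (ballm a r) (\<lambda>z. \<bar>g n (z + h) - w (z + h)\<bar>)"
      using wm gmh w g by (intro integrable_abs Bochner_Integration.integrable_diff integrable_ballm_bounded[where C=C]) auto
    have i3: "integrable (ballm a R) (\<lambda>z. \<bar>g n z - w z\<bar>)" for R
      using gm w g by (intro integrable_abs Bochner_Integration.integrable_diff integrable_ballm_bounded[where C=C]) auto
    have "(\<integral>z. \<bar>w (z + h) - w z\<bar> \<partial>ballm a r) \<le>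
      (\<integral>z. \<bar>g n (z + h) - w (z + h)\<bar> + (\<bar>g n z - w z\<bar> + e / (3 * (?m + 1))) \<partial>ballm a r)"
    proof (rule integral_mono[OF i1])
      show "integrable (ballm a r) (\<lambda>z. \<bar>g n (z + h) - w (z + h)\<bar> + (\<bar>g n z - w z\<bar> + e / (3 * (?m + 1))))"
        using i2 i3 by simp
      fix z assume "z \<in> space (ballm a r)"
      then have z: "dist a z \<le> r" by (simp add: space_restrict_space)
      have "dist a (z + h) \<le> r + 1" using z h1 dist_triangle[of a "z + h" z] by (simp add: dist_norm)
      then have "dist (g n (z + h)) (g n z) < e / (3 * (?m + 1))"
        using z h1 by (intro d(2)) (auto simp: dist_norm)
      then show "\<bar>w (z + h) - w z\<bar> \<le> \<bar>g n (z + h) - w (z + h)\<bar> + (\<bar>g n z - w z\<bar> + e / (3 * (?m + 1)))"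
        unfolding dist_real_def by linarith
    qed
    also have "\<dots> = (\<integral>z. \<bar>g n (z + h) - w (z + h)\<bar> \<partial>ballm a r) + ((\<integral>z. \<bar>g n z - w z\<bar> \<partial>ballm a r) + e / (3 * (?m + 1)) * ?m)"
      using i2 i3 by simp
    also have "\<dots> \<le> e / 3 + (e / 3 + e / 3)"
    proof (intro add_mono)
      show "(\<integral>z. \<bar>g n (z + h) - w (z + h)\<bar> \<partial>ballm a r) \<le> e / 3"
        using integral_ballm_shift_le[OF i3, of "r + 1" r h] n h1 by simp
      show "(\<integral>z. \<bar>g n z - w z\<bar> \<partial>ballm a r) \<le> e / 3"
        using integral_ballm_shift_le[OF i3, of "r + 1" r 0] n by simp
      have "?m * e \<le> (?m + 1) * e" using e by (simp add: mult_right_mono)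
      then show "e / (3 * (?m + 1)) * ?m \<le> e / 3"
        by (simp add: field_simps add_pos_nonneg)
    qed
    finally show ?thesis by simp
  qed
  moreover have "\<eta> > 0" using d(1) by (simp add: \<eta>_def)
  ultimately show ?thesis by blast
qed

text \<open>Averaging \<open>w k\<close> over balls of radius \<open>\<eta>\<close> turns weak
  convergence into pointwise convergence, so the product of the averages with the weakly convergent
  \<open>f k\<close> passes to the limit. The hypothesis \<open>shift\<close> says that replacing
  \<open>w k\<close> by its average changes the integral of the product little, uniformly in
  \<open>k\<close>; for the limit the same replacement is justified by continuity of translations in
  L1. Strong compactness of neither factor is assumed.\<close>

lemma compensated_compactness:
  fixes f w :: "nat \<Rightarrow> 'b::euclidean_space \<Rightarrow> real"
  assumes f: "\<And>k. f k \<in> borel_measurable borel" "\<And>k z. \<bar>f k z\<bar> \<le> C"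
    and w: "\<And>k. w k \<in> borel_measurable borel" "\<And>k z. \<bar>w k z\<bar> \<le> C"
    and fl: "fl \<in> borel_measurable borel" "\<And>z. \<bar>fl z\<bar> \<le> C"
    and wl: "wl \<in> borel_measurable borel" "\<And>z. \<bar>wl z\<bar> \<le> C"
    and weak_f: "\<And>\<phi>. \<phi> \<in> borel_measurable borel \<Longrightarrow> (\<And>z. \<bar>\<phi> z\<bar> \<le> C) \<Longrightarrow>
      (\<lambda>k. \<integral>z. f k z * \<phi> z \<partial>ballm a r) \<longlonglongrightarrow> (\<integral>z. fl z * \<phi> z \<partial>ballm a r)"
    and weak_w: "\<And>z \<eta>. z \<in> cball a r \<Longrightarrow> 0 < \<eta> \<Longrightarrow> \<eta> \<le> \<eta>0 \<Longrightarrow>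
      (\<lambda>k. \<integral>y. w k y \<partial>ballm z \<eta>) \<longlonglongrightarrow> (\<integral>y. wl y \<partial>ballm z \<eta>)"
    and shift: "\<And>k h. norm h \<le> \<eta>0 \<Longrightarrow>
      \<bar>(\<integral>z. f k z * w k (z + h) \<partial>ballm a r) - (\<integral>z. f k z * w k z \<partial>ballm a r)\<bar> \<le> norm h * K"
    and \<eta>0: "0 < \<eta>0" and K: "0 \<le> K"
  shows "(\<lambda>k. \<integral>z. f k z * w k z \<partial>ballm a r) \<longlonglongrightarrow> (\<integral>z. fl z * wl z \<partial>ballm a r)"
proof (rule LIMSEQ_approx)
  fix e :: real assume e: "e > 0"
  have C0: "0 \<le> C" using f(2)[of 0 0] by linarith
  obtain \<eta>1 where \<eta>1: "\<eta>1 > 0" "\<And>h. norm h \<le> \<eta>1 \<Longrightarrow> (\<integral>z. \<bar>wl (z + h) - wl z\<bar> \<partial>ballm a r) \<le> e / (C + 1)"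
    using translation_continuous_L1[OF wl, of "e / (C + 1)" a r] e C0 by auto
  \<comment> \<open>Up to \<open>\<eta>0\<close> the shift estimate is available, up to
    \<open>\<eta>1\<close> translations of \<open>wl\<close> are small in L1, and up to
    \<open>e / (K + 1)\<close> the shift error \<open>\<eta> * K\<close> is at most
    \<open>e\<close>.\<close>
  define \<eta> where "\<eta> = min (min \<eta>0 \<eta>1) (e / (K + 1))"
  have \<eta>: "0 < \<eta>" "\<eta> \<le> \<eta>0" "\<eta> \<le> \<eta>1" "\<eta> * K \<le> e"
  proof -
    show "0 < \<eta>" "\<eta> \<le> \<eta>0" "\<eta> \<le> \<eta>1" using \<eta>0 \<eta>1(1) e K by (auto simp: \<eta>_def)
    have "\<eta> * K \<le> e / (K + 1) * K" using K by (intro mult_right_mono) (auto simp: \<eta>_def)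
    also have "\<dots> \<le> e" using K e by (simp add: divide_le_eq algebra_simps)
    finally show "\<eta> * K \<le> e" .
  qed
  define m where "m = measure lborel (cball (0::'b) \<eta>)"
  have m: "m > 0" unfolding m_def using \<eta>(1) by (simp add: content_cball unit_ball_vol_pos)
  define N where "N = ballm a r"
  define V where "V = ballm (0::'b) \<eta>"
  interpret N: finite_measure N unfolding N_def by (rule finite_measure_ballm)
  interpret V: finite_measure V unfolding V_def by (rule finite_measure_ballm)
  interpret NV: pair_sigma_finite N V by unfold_locales
  interpret NV': finite_measure "N \<Otimes>\<^sub>M V" by (rule finite_measure_pair_measure) unfold_locales
  have mV: "measure V (space V) = m" unfolding V_def m_def by (simp add: measure_restrict_space space_restrict_space)
  have spV: "h \<in> space V \<Longrightarrow> norm h \<le> \<eta>" for h by (simp add: V_def space_restrict_space)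
  have spN: "space N = cball a r" by (simp add: N_def space_restrict_space)
  have idm[measurable]: "(\<lambda>x. x) \<in> N \<rightarrow>\<^sub>M borel" "(\<lambda>x. x) \<in> V \<rightarrow>\<^sub>M borel"
    unfolding N_def V_def by (rule measurable_restrict_space1; simp)+
  define A where "A w z = (\<integral>h. w (z + h) \<partial>V) / m" for w :: "'b \<Rightarrow> real" and z
  \<comment> \<open>By Fubini, averaging over \<open>h\<close> the integral of \<open>p\<close>
    against the translate of \<open>q\<close> by \<open>h\<close> is the same as integrating
    \<open>p\<close> against the averaged function \<open>A q\<close>.\<close>
  have fub: "(\<integral>h. (\<integral>z. p z * q (z + h) \<partial>N) \<partial>V) / m = (\<integral>z. p z * A q z \<partial>N)"
    and A_meas: "A q \<in> borel_measurable borel" and A_le: "\<And>z. \<bar>A q z\<bar> \<le> C"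
    and int_pq: "\<And>h. integrable N (\<lambda>z. p z * q (z + h))"
    and int_h: "integrable V (\<lambda>h. \<integral>z. p z * q (z + h) \<partial>N)"
    if p: "p \<in> borel_measurable borel" "\<And>z. \<bar>p z\<bar> \<le> C" and q: "q \<in> borel_measurable borel" "\<And>z. \<bar>q z\<bar> \<le> C" for p q
  proof -
    note p(1)[measurable] q(1)[measurable]
    have bd: "\<bar>p x * q y\<bar> \<le> C * C" for x y unfolding abs_mult using p(2) q(2) C0 by (intro mult_mono) auto
    have pm: "(\<lambda>x. p (fst x)) \<in> borel_measurable (N \<Otimes>\<^sub>M V)"
      by (rule measurable_compose[OF measurable_compose[OF measurable_fst idm(1)] p(1)])
    have sm: "(\<lambda>x. fst x + snd x) \<in> borel_measurable (N \<Otimes>\<^sub>M V)"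
      by (intro borel_measurable_add measurable_compose[OF measurable_fst idm(1)] measurable_compose[OF measurable_snd idm(2)])
    have qm: "(\<lambda>x. q (fst x + snd x)) \<in> borel_measurable (N \<Otimes>\<^sub>M V)"
      by (rule measurable_compose[OF sm q(1)])
    have int: "integrable (N \<Otimes>\<^sub>M V) (\<lambda>(z, h). p z * q (z + h))"
      using pm qm bd by (intro NV'.integrable_const_bound[where B="C * C"]) (auto simp: case_prod_unfold)
    have "(\<integral>h. (\<integral>z. p z * q (z + h) \<partial>N) \<partial>V) = (\<integral>z. (\<integral>h. p z * q (z + h) \<partial>V) \<partial>N)"
      using NV.Fubini_integral[OF int] .
    also have "\<dots> = (\<integral>z. m * (p z * A q z) \<partial>N)" using m by (simp add: A_def)
    finally show "(\<integral>h. (\<integral>z. p z * q (z + h) \<partial>N) \<partial>V) / m = (\<integral>z. p z * A q z \<partial>N)" using m by simp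
    show "integrable N (\<lambda>z. p z * q (z + h))" for h
      unfolding N_def using p q bd by (intro integrable_ballm_bounded[where C="C * C"]) auto
    show "integrable V (\<lambda>h. \<integral>z. p z * q (z + h) \<partial>N)"
      using NV.integrable_snd[OF int] by simp
    have qm': "(\<lambda>x. q (fst x + snd x)) \<in> borel_measurable (borel \<Otimes>\<^sub>M V)"
      by (rule measurable_compose[OF _ q(1)])
        (intro borel_measurable_add measurable_compose[OF measurable_snd idm(2)] measurable_fst)
    have "(\<lambda>z. \<integral>h. q (z + h) \<partial>V) \<in> borel_measurable borel"
      by (rule V.borel_measurable_lebesgue_integral) (use qm' in \<open>simp add: case_prod_unfold\<close>)
    then show "A q \<in> borel_measurable borel" unfolding A_def by simp
    show "\<bar>A q z\<bar> \<le> C" for z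
    proof -
      have "\<bar>\<integral>h. q (z + h) \<partial>V\<bar> \<le> (\<integral>h. \<bar>q (z + h)\<bar> \<partial>V)" by (rule integral_abs_bound)
      also have "\<dots> \<le> (\<integral>h. C \<partial>V)"
        unfolding V_def using q by (intro integral_mono integrable_abs integrable_ballm_bounded[where C=C] integrable_ballm) auto
      also have "\<dots> = m * C" using mV by simp
      finally show ?thesis unfolding A_def using m by (simp add: field_simps)
    qed
  qed
  have Aw_m: "A (w k) \<in> borel_measurable borel" and Aw_le: "\<bar>A (w k) z\<bar> \<le> C" for k z
    by (rule A_meas[OF f(1)[of k] f(2) w(1) w(2)], rule A_le[OF f(1)[of k] f(2) w(1) w(2)])
  have Al_m: "A wl \<in> borel_measurable borel" and Al_le: "\<bar>A wl z\<bar> \<le> C" for z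
    by (rule A_meas[OF fl wl], rule A_le[OF fl wl])
  have fub_w: "(\<integral>h. (\<integral>z. f k z * w k (z + h) \<partial>N) \<partial>V) / m = (\<integral>z. f k z * A (w k) z \<partial>N)"
    and int_h_w: "integrable V (\<lambda>h. \<integral>z. f k z * w k (z + h) \<partial>N)" for k
    by (rule fub[OF f(1) f(2) w(1) w(2)], rule int_h[OF f(1) f(2) w(1) w(2)])
  define b where "b k = (\<integral>z. f k z * A (w k) z \<partial>N)" for k
  have "b \<longlonglongrightarrow> (\<integral>z. fl z * A wl z \<partial>N)"
  proof -
    have 1: "(\<lambda>k. \<integral>z. f k z * A wl z \<partial>N) \<longlonglongrightarrow> (\<integral>z. fl z * A wl z \<partial>N)"
      unfolding N_def by (rule weak_f[OF Al_m Al_le])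
    \<comment> \<open>At a fixed centre the average is the integral of \<open>w k\<close> over the
      ball of radius \<open>\<eta>\<close> about it, divided by a constant, so convergence of
      integrals over balls suffices.\<close>
    have Aw: "(\<lambda>k. A (w k) z) \<longlonglongrightarrow> A wl z" if z: "z \<in> cball a r" for z
    proof -
      have sh: "(\<integral>h. q (z + h) \<partial>V) = (\<integral>y. q y \<partial>ballm z \<eta>)" if "q \<in> borel_measurable borel" for q :: "'b \<Rightarrow> real"
      proof -
        have "(\<integral>y. q y \<partial>ballm z \<eta>) = (\<integral>y. indicator (cball z \<eta>) (y + z) * q (y + z) \<partial>lborel)"
          unfolding integral_ballm by (intro integral_lborel_shift[symmetric] borel_measurable_times borel_measurable_indicator that) auto
        also have "\<dots> = (\<integral>h. q (z + h) \<partial>V)" unfolding V_def integral_ballm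
          by (rule Bochner_Integration.integral_cong) (auto simp: indicator_def dist_norm add.commute)
        finally show ?thesis by simp
      qed
      show ?thesis unfolding A_def sh[OF w(1)] sh[OF wl(1)]
        using m by (intro tendsto_divide weak_w z \<eta> tendsto_const) auto
    qed
    have 2: "(\<lambda>k. \<integral>z. f k z * (A (w k) z - A wl z) \<partial>N) \<longlonglongrightarrow> (\<integral>z. 0 \<partial>N)"
    proof (rule integral_dominated_convergence[where w="\<lambda>_. C * (2 * C)"])
      have bd: "\<bar>f k z * (A (w k) z - A wl z)\<bar> \<le> C * \<bar>A (w k) z - A wl z\<bar>" for k z
        unfolding abs_mult using f(2) by (intro mult_right_mono) auto
      show "AE z in N. (\<lambda>k. f k z * (A (w k) z - A wl z)) \<longlonglongrightarrow> 0"
      proof (rule AE_I2)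
        fix z assume "z \<in> space N"
        then have z: "z \<in> cball a r" using spN by simp
        have "(\<lambda>k. A (w k) z - A wl z) \<longlonglongrightarrow> A wl z - A wl z"
          by (intro tendsto_diff Aw[OF z] tendsto_const)
        then have "(\<lambda>k. A (w k) z - A wl z) \<longlonglongrightarrow> 0" by simp
        then have "(\<lambda>k. C * \<bar>A (w k) z - A wl z\<bar>) \<longlonglongrightarrow> 0"
          by (intro tendsto_mult_right_zero tendsto_rabs_zero)
        then show "(\<lambda>k. f k z * (A (w k) z - A wl z)) \<longlonglongrightarrow> 0"
          by (rule Lim_null_comparison[rotated]) (use bd in auto)
      qed
      show "AE z in N. norm (f k z * (A (w k) z - A wl z)) \<le> C * (2 * C)" for k
      proof (rule AE_I2)
        fix z
        have "\<bar>A (w k) z - A wl z\<bar> \<le> 2 * C"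
          using Aw_le[of k z] Al_le[of z] by linarith
        then show "norm (f k z * (A (w k) z - A wl z)) \<le> C * (2 * C)"
          using order_trans[OF bd[of k z] mult_left_mono[OF _ C0]] by simp
      qed
      show "integrable N (\<lambda>_. C * (2 * C))" by simp
    qed (use f w Al_m Aw_m in \<open>auto simp: N_def intro!: borel_measurable_ballm\<close>)
    have iA: "integrable N (\<lambda>z. f k z * q z)" if "q \<in> borel_measurable borel" "\<And>z. \<bar>q z\<bar> \<le> C" for q k
    proof -
      have "\<bar>f k z * q z\<bar> \<le> C * C" for z unfolding abs_mult using f(2) that(2) C0 by (intro mult_mono) auto
      then show ?thesis unfolding N_def using f that by (intro integrable_ballm_bounded[where C="C * C"]) auto
    qed
    have "(\<integral>z. f k z * (A (w k) z - A wl z) \<partial>N) + (\<integral>z. f k z * A wl z \<partial>N) = b k" for k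
      unfolding b_def using iA[OF Aw_m[of k] Aw_le, of k] iA[OF Al_m Al_le, of k]
      by (simp add: right_diff_distrib)
    with tendsto_add[OF 2 1] show ?thesis by simp
  qed
  moreover have "\<bar>(\<integral>z. f k z * w k z \<partial>N) - b k\<bar> \<le> e" for k
  proof -
    let ?I = "\<lambda>h. \<integral>z. f k z * w k (z + h) \<partial>N" and ?J = "\<integral>z. f k z * w k z \<partial>N"
    \<comment> \<open>\<open>b k\<close> is the average of the shifted integrals, so its distance to
      the unshifted integral is at most the average of the shift errors.\<close>
    have "?J - b k = (\<integral>h. ?J - ?I h \<partial>V) / m"
      unfolding b_def fub_w[symmetric] using int_h_w[of k] m mV by (simp add: diff_divide_distrib)
    moreover have "\<bar>\<integral>h. ?J - ?I h \<partial>V\<bar> \<le> (\<integral>h. e \<partial>V)"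
    proof (rule order_trans[OF integral_abs_bound integral_mono])
      show "\<bar>?J - ?I h\<bar> \<le> e" if "h \<in> space V" for h
      proof -
        have h: "norm h \<le> \<eta>" using spV that by simp
        have "\<bar>?J - ?I h\<bar> \<le> norm h * K" using shift[of h k] h \<eta>(2) by (simp add: N_def abs_minus_commute)
        also have "\<dots> \<le> \<eta> * K" using h K by (intro mult_right_mono)
        finally show ?thesis using \<eta>(4) by simp
      qed
    qed (use int_h_w[of k] in auto)
    ultimately show ?thesis using m mV by (simp add: abs_divide divide_le_eq mult.commute)
  qed
  moreover have "\<bar>(\<integral>z. fl z * wl z \<partial>N) - (\<integral>z. fl z * A wl z \<partial>N)\<bar> \<le> e"
  proof -
    let ?I = "\<lambda>h. \<integral>z. fl z * wl (z + h) \<partial>N" and ?J = "\<integral>z. fl z * wl z \<partial>N"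
    have "?J - (\<integral>z. fl z * A wl z \<partial>N) = (\<integral>h. ?J - ?I h \<partial>V) / m"
      unfolding fub[OF fl wl, symmetric] using int_h[OF fl wl] m mV by (simp add: diff_divide_distrib)
    moreover have "\<bar>\<integral>h. ?J - ?I h \<partial>V\<bar> \<le> (\<integral>h. e \<partial>V)"
    proof (rule order_trans[OF integral_abs_bound integral_mono])
      show "\<bar>?J - ?I h\<bar> \<le> e" if "h \<in> space V" for h
      proof -
        have h: "norm h \<le> \<eta>1" using spV that \<eta>(3) by force
        have i: "integrable N (\<lambda>z. wl (z + h))" "integrable N wl"
          unfolding N_def using wl by (intro integrable_ballm_bounded[where C=C]; simp)+
        have "?J - ?I h = (\<integral>z. fl z * (wl z - wl (z + h)) \<partial>N)"
          using int_pq[OF fl wl, of h] int_pq[OF fl wl, of 0] by (simp add: right_diff_distrib)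
        also have "\<bar>\<dots>\<bar> \<le> (\<integral>z. \<bar>fl z * (wl z - wl (z + h))\<bar> \<partial>N)" by (rule integral_abs_bound)
        also have "\<dots> \<le> (\<integral>z. C * \<bar>wl (z + h) - wl z\<bar> \<partial>N)"
        proof (rule integral_mono)
          show "integrable N (\<lambda>z. \<bar>fl z * (wl z - wl (z + h))\<bar>)"
            using int_pq[OF fl wl, of h] int_pq[OF fl wl, of 0] by (simp add: right_diff_distrib)
          show "\<bar>fl z * (wl z - wl (z + h))\<bar> \<le> C * \<bar>wl (z + h) - wl z\<bar>" for z
            unfolding abs_mult abs_minus_commute[of "wl z"] using fl(2) by (intro mult_right_mono) auto
        qed (use i in auto)
        also have "\<dots> \<le> C * (e / (C + 1))"
          using mult_left_mono[OF \<eta>1(2)[OF h] C0] by (simp add: N_def)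
        also have "\<dots> \<le> e" using C0 e by (simp add: divide_le_eq algebra_simps)
        finally show ?thesis .
      qed
    qed (use int_h[OF fl wl] in auto)
    ultimately show ?thesis using m mV by (simp add: abs_divide divide_le_eq mult.commute)
  qed
  ultimately show "\<exists>b l. b \<longlonglongrightarrow> l \<and> (\<forall>k. \<bar>(\<integral>z. f k z * w k z \<partial>ballm a r) - b k\<bar> \<le> e) \<and>
      \<bar>(\<integral>z. fl z * wl z \<partial>ballm a r) - l\<bar> \<le> e" unfolding N_def by blast
qed

text \<open>Polynomials are chosen as test functions because they are dense in the continuous
  functions on a compact set and have continuous derivatives along every direction.\<close>

lemma real_polynomial_function_dir_deriv:
  fixes p :: "'b::real_normed_vector \<Rightarrow> real"
  assumes "real_polynomial_function p"
  shows "\<exists>p'. \<forall>d. continuous_on UNIV (p' d) \<and> (\<forall>z. has_dir_deriv d p (p' d z) z)"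
  using assms
proof induction
  case (linear f)
  have "has_dir_deriv d f (f d) z" for d z
    unfolding has_dir_deriv_def bounded_linear.linear[OF linear, THEN linear_add] bounded_linear.linear[OF linear, THEN linear_scale]
    by (auto intro!: derivative_eq_intros)
  then show ?case by (intro exI[of _ "\<lambda>d z. f d"]) auto
next
  case (const c)
  have "has_dir_deriv d (\<lambda>_::'b. c) 0 z" for d z by (simp add: has_dir_deriv_def)
  then show ?case by (intro exI[of _ "\<lambda>d z. 0"]) auto
next
  case (add f g)
  then obtain f' g' where *: "\<And>d. continuous_on UNIV (f' d)" "\<And>d z. has_dir_deriv d f (f' d z) z"
    "\<And>d. continuous_on UNIV (g' d)" "\<And>d z. has_dir_deriv d g (g' d z) z" by blast
  then show ?case
    by (intro exI[of _ "\<lambda>d z. f' d z + g' d z"]) (auto intro!: continuous_intros has_dir_deriv_add)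
next
  case (mult f g)
  then obtain f' g' where *: "\<And>d. continuous_on UNIV (f' d)" "\<And>d z. has_dir_deriv d f (f' d z) z"
    "\<And>d. continuous_on UNIV (g' d)" "\<And>d z. has_dir_deriv d g (g' d z) z" by blast
  have "continuous_on UNIV f" "continuous_on UNIV g"
    using mult.hyps continuous_real_polymonial_function by (auto simp: continuous_on_eq_continuous_at)
  then show ?case using *
    by (intro exI[of _ "\<lambda>d z. f' d z * g z + f z * g' d z"]) (auto intro!: continuous_intros has_dir_deriv_mult)
qed

text \<open>Weierstrass approximation extends the hypothesis from polynomials to continuous
  functions, and almost everywhere approximation extends it to \<open>D\<close> itself. The integral
  of the bump times the square of \<open>D\<close> then vanishes, and the bump is positive inside
  the ball.\<close>

lemma AE_zero_of_test_functions:
  fixes D :: "'b::euclidean_space \<Rightarrow> real"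
  assumes D: "D \<in> borel_measurable borel" "\<And>z. \<bar>D z\<bar> \<le> C"
    and test: "\<And>p. real_polynomial_function p \<Longrightarrow> (\<integral>z. D z * (bump a r z * p z) \<partial>ballm a r) = 0"
  shows "AE z in lborel. z \<in> ball a r \<longrightarrow> D z = 0"
proof -
  have C0: "0 \<le> C" using D(2)[of 0] by linarith
  interpret finite_measure "ballm a r" by (rule finite_measure_ballm)
  have cb: "continuous_on S (bump a r)" for S by (rule continuous_on_bump)
  obtain B where B: "B \<ge> 0" "\<And>z. z \<in> cball a r \<Longrightarrow> \<bar>bump a r z\<bar> \<le> B"
    using compact_bound_abs[OF compact_cball cb] by blast
  have bm: "bump a r \<in> borel_measurable borel" by (rule borel_measurable_continuous_onI[OF cb])
  have idg: "integrable (ballm a r) (\<lambda>z. D z * (bump a r z * g z))"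
    if "g \<in> borel_measurable borel" "\<And>z. z \<in> cball a r \<Longrightarrow> \<bar>g z\<bar> \<le> P" for g P
  proof (rule integrable_const_bound[where B="C * (B * P)"])
    show "AE z in ballm a r. norm (D z * (bump a r z * g z)) \<le> C * (B * P)"
      using D(2) B C0 that(2) unfolding real_norm_def abs_mult
      by (intro AE_I2 mult_mono) (auto simp: space_restrict_space intro!: mult_mono simp del: mem_cball)
  qed (use D bm that in \<open>auto intro!: borel_measurable_ballm\<close>)
  have cont: "(\<integral>z. D z * (bump a r z * g z) \<partial>ballm a r) = 0" if g: "continuous_on UNIV g" for g
  proof -
    obtain P where P: "P \<ge> 0" "\<And>z. z \<in> cball a r \<Longrightarrow> \<bar>g z\<bar> \<le> P"
      using compact_bound_abs[OF compact_cball continuous_on_subset[OF g]] by blast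
    have gm: "g \<in> borel_measurable borel" by (rule borel_measurable_continuous_onI[OF g])
    let ?m = "measure (ballm a r) (space (ballm a r))"
    have "\<bar>\<integral>z. D z * (bump a r z * g z) \<partial>ballm a r\<bar> \<le> 0 + e" if e: "e > 0" for e
    proof -
      \<comment> \<open>The summand 1 keeps the denominator positive even if
        \<open>C * B * ?m\<close> is zero; with this accuracy the total error is at most
        \<open>e\<close>.\<close>
      define d where "d = e / (C * B * ?m + 1)"
      have d: "d > 0" unfolding d_def using e C0 B(1) by (intro divide_pos_pos add_nonneg_pos mult_nonneg_nonneg) auto
      obtain p where p: "real_polynomial_function p" "\<And>x. x \<in> cball a r \<Longrightarrow> \<bar>g x - p x\<bar> < d"
        using Stone_Weierstrass_real_polynomial_function[OF compact_cball continuous_on_subset[OF g] d] by blast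
      have pc: "continuous_on UNIV p" using p(1) continuous_real_polymonial_function by (auto simp: continuous_on_eq_continuous_at)
      have pm: "p \<in> borel_measurable borel" by (rule borel_measurable_continuous_onI[OF pc])
      obtain P' where P': "P' \<ge> 0" "\<And>z. z \<in> cball a r \<Longrightarrow> \<bar>p z\<bar> \<le> P'"
        using compact_bound_abs[OF compact_cball continuous_on_subset[OF pc]] by blast
      have "(\<integral>z. D z * (bump a r z * g z) \<partial>ballm a r) = (\<integral>z. D z * (bump a r z * (g z - p z)) \<partial>ballm a r)"
        using test[OF p(1)] idg[OF gm P(2)] idg[OF pm P'(2)] by (simp add: right_diff_distrib)
      also have "\<bar>\<dots>\<bar> \<le> (\<integral>z. \<bar>D z * (bump a r z * (g z - p z))\<bar> \<partial>ballm a r)" by (rule integral_abs_bound)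
      also have "\<dots> \<le> (\<integral>z. C * (B * d) \<partial>ballm a r)"
      proof (rule integral_mono)
        show "integrable (ballm a r) (\<lambda>z. \<bar>D z * (bump a r z * (g z - p z))\<bar>)"
          using idg[OF gm P(2)] idg[OF pm P'(2)] by (simp add: right_diff_distrib)
        fix z assume "z \<in> space (ballm a r)"
        then have z: "z \<in> cball a r" by (simp add: space_restrict_space)
        show "\<bar>D z * (bump a r z * (g z - p z))\<bar> \<le> C * (B * d)"
          unfolding abs_mult using D(2)[of z] B(1) B(2)[OF z] p(2)[OF z] C0 by (intro mult_mono) auto
      qed simp
      also have "\<dots> = d * (C * B * ?m)" by simp
      also have "\<dots> \<le> d * (C * B * ?m + 1)" using d by (intro mult_left_mono) auto
      also have "\<dots> = e" unfolding d_def using C0 B(1)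
        by (subst nonzero_eq_divide_eq[symmetric]) (auto simp: add_nonneg_eq_0_iff intro!: less_imp_neq[symmetric] add_nonneg_pos)
      finally show ?thesis by simp
    qed
    then have "\<bar>\<integral>z. D z * (bump a r z * g z) \<partial>ballm a r\<bar> \<le> 0" by (rule field_le_epsilon)
    then show ?thesis by simp
  qed
  obtain g :: "nat \<Rightarrow> 'b \<Rightarrow> real" where g: "\<And>n. continuous_on UNIV (g n)" "\<And>n z. \<bar>g n z\<bar> \<le> C"
    "AE z in lborel. (\<lambda>n. g n z) \<longlonglongrightarrow> D z"
    using bounded_borel_AE_limit_continuous[OF D] by blast
  have "(\<lambda>n. \<integral>z. D z * (bump a r z * g n z) \<partial>ballm a r) \<longlonglongrightarrow> (\<integral>z. D z * (bump a r z * D z) \<partial>ballm a r)"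
  proof (rule integral_dominated_convergence[where w="\<lambda>_. C * (B * C)"])
    show "AE z in ballm a r. (\<lambda>n. D z * (bump a r z * g n z)) \<longlonglongrightarrow> D z * (bump a r z * D z)"
      by (rule AE_mp[OF AE_ballm[OF g(3)]], rule AE_I2, rule impI, intro tendsto_intros)
    show "AE z in ballm a r. norm (D z * (bump a r z * g n z)) \<le> C * (B * C)" for n
      using D(2) B C0 g(2) unfolding real_norm_def abs_mult
      by (intro AE_I2 mult_mono) (auto simp: space_restrict_space intro!: mult_mono simp del: mem_cball)
  qed (use idg[OF D] idg[OF borel_measurable_continuous_onI[OF g(1)] g(2)] in auto)
  then have "(\<integral>z. D z * (bump a r z * D z) \<partial>ballm a r) = 0"
    by (simp add: cont[OF g(1)] LIMSEQ_const_iff)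
  moreover have nn: "AE z in ballm a r. 0 \<le> D z * (bump a r z * D z)"
    using bump_nonneg[of a r] by (intro AE_I2) (simp add: mult.left_commute[of "D _"])
  ultimately have "AE z in ballm a r. D z * (bump a r z * D z) = 0"
    using integral_nonneg_eq_0_iff_AE[OF idg[OF D] nn] by simp
  then have "AE z in lborel. z \<in> cball a r \<longrightarrow> D z * (bump a r z * D z) = 0"
    by (subst (asm) AE_restrict_space_iff) auto
  then show ?thesis
    by (rule AE_mp) (use bump_pos[of _ a r] in \<open>fastforce intro!: AE_I2\<close>)
qed

section \<open>The reaction function\<close>

text \<open>Monotonicity is given on the open interval only. Two interior points between
  \<open>x\<close> and \<open>y\<close> carry the strict inequality, and continuity adds weak
  inequalities towards the ends.\<close>

lemma strict_mono_closed_interval: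
  fixes F :: "real \<Rightarrow> real"
  assumes c: "continuous_on {a..b} F" and m: "strict_mono_on {a<..<b} F" and xy: "a \<le> x" "x < y" "y \<le> b"
  shows "F x < F y"
proof -
  define p q where "p = x + (y - x) / 3" and "q = x + 2 * (y - x) / 3"
  have pq: "x < p" "p < q" "q < y" using xy by (auto simp: p_def q_def field_simps)
  have "F p < F q" using m pq xy by (auto simp: strict_mono_on_def)
  moreover have "F x \<le> F p"
  proof (rule continuous_le_on_closure[of "{x<..<p}" F x "F p"])
    show "continuous_on (closure {x<..<p}) F" using c pq xy by (auto intro: continuous_on_subset)
    show "F t \<le> F p" if "t \<in> {x<..<p}" for t
      using that m pq xy by (intro less_imp_le) (auto simp: strict_mono_on_def)
  qed (use pq in auto)
  moreover have "F q \<le> F y"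
  proof (rule continuous_ge_on_closure[of "{q<..<y}" F y "F q"])
    show "continuous_on (closure {q<..<y}) F" using c pq xy by (auto intro: continuous_on_subset)
    show "F q \<le> F t" if "t \<in> {q<..<y}" for t
      using that m pq xy by (intro less_imp_le) (auto simp: strict_mono_on_def)
  qed (use pq in auto)
  ultimately show ?thesis by linarith
qed

text \<open>A monotone function can be discontinuous only by jumping over values, and
  \<open>iv\<close> forbids gaps in the range.\<close>

lemma mono_interval_range_continuous:
  fixes f :: "real \<Rightarrow> real"
  assumes m: "mono f" and iv: "\<And>a b y. f a < y \<Longrightarrow> y < f b \<Longrightarrow> \<exists>x. f x = y"
  shows "continuous_on UNIV f"
proof (rule continuous_at_imp_continuous_on, rule ballI)
  fix r :: real
  have lt: "f x < f y \<Longrightarrow> x < y" for x y using m by (meson monoD not_le)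
  show "isCont f r"
    unfolding isCont_def
  proof (rule order_tendstoI)
    fix a assume a: "a < f r"
    show "\<forall>\<^sub>F x in at r. a < f x"
    proof (cases "\<exists>s. f s < f r")
      case True
      then obtain s where s: "f s < f r" by blast
      define y where "y = (max a (f s) + f r) / 2"
      have y: "f s < y" "y < f r" "a < y" using s a by (auto simp: y_def max_def)
      then obtain x where x: "f x = y" using iv by blast
      have "x < r" using lt x y by simp
      then have "\<forall>\<^sub>F t in at r. t \<in> {x<..}" by (intro topological_tendstoD[OF tendsto_ident_at]) auto
      then show ?thesis
      proof eventually_elim
        case (elim t) then show ?case using monoD[OF m, of x t] x y by auto
      qed
    next
      case False
      then show ?thesis using a by (intro always_eventually) (auto simp: not_less intro: less_le_trans)
    qed
  next
    fix a assume a: "f r < a"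
    show "\<forall>\<^sub>F x in at r. f x < a"
    proof (cases "\<exists>s. f r < f s")
      case True
      then obtain s where s: "f r < f s" by blast
      define y where "y = (min a (f s) + f r) / 2"
      have y: "y < f s" "f r < y" "y < a" using s a by (auto simp: y_def min_def)
      then obtain x where x: "f x = y" using iv by blast
      have "r < x" using lt x y by simp
      then have "\<forall>\<^sub>F t in at r. t \<in> {..<x}" by (intro topological_tendstoD[OF tendsto_ident_at]) auto
      then show ?thesis
      proof eventually_elim
        case (elim t) then show ?case using monoD[OF m, of t x] x y by auto
      qed
    next
      case False
      then show ?thesis using a by (intro always_eventually) (auto simp: not_less intro: le_less_trans)
    qed
  qed
qed

text \<open>If \<open>F'\<close> vanished along the whole image of \<open>S\<close>, then
  \<open>F\<close> would be constant between two values of \<open>S\<close>, contrary to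
  \<open>F (S r) = r\<close>. So \<open>F'\<close> is nonzero at some \<open>S r\<close>, hence
  nearby by continuity, and there the inverse function rule applies. Only a subinterval is claimed,
  since \<open>F'\<close> may vanish at points of a branch.\<close>

lemma inverse_branch_differentiable:
  fixes F S :: "real \<Rightarrow> real"
  assumes S: "continuous_on UNIV S" and pq: "p < q" and inv: "\<And>r. r \<in> {p<..<q} \<Longrightarrow> F (S r) = r"
    and F: "\<And>x. (F has_real_derivative F' x) (at x)" and F': "continuous_on UNIV F'"
  shows "\<exists>p' q'. p \<le> p' \<and> p' < q' \<and> q' \<le> q \<and> (\<forall>r\<in>{p'<..<q'}. F' (S r) \<noteq> 0 \<and>
    (S has_real_derivative inverse (F' (S r))) (at r))"
proof -
  have "\<exists>r\<in>{p<..<q}. F' (S r) \<noteq> 0"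
  proof (rule ccontr)
    assume "\<not> ?thesis"
    then have z: "F' (S r) = 0" if "r \<in> {p<..<q}" for r using that by blast
    define r0 r1 where "r0 = p + (q - p) / 3" and "r1 = p + 2 * (q - p) / 3"
    have r: "r0 \<in> {p<..<q}" "r1 \<in> {p<..<q}" "r0 < r1" using pq by (auto simp: r0_def r1_def field_simps)
    have conn: "is_interval (S ` {r0..r1})"
      unfolding is_interval_connected_1 by (intro connected_continuous_image continuous_on_subset[OF S]) auto
    have seg: "F' y = 0" if y: "y \<in> closed_segment (S r0) (S r1)" for y
    proof -
      have "closed_segment (S r0) (S r1) \<subseteq> S ` {r0..r1}"
        using conn r by (intro closed_segment_subset) (auto simp: is_interval_convex_1)
      then have "y \<in> S ` {r0..r1}" using y by blast
      then obtain s where s: "s \<in> {r0..r1}" "y = S s" by blast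
      then have "s \<in> {p<..<q}" using r by auto
      then show ?thesis using z s(2) by simp
    qed
    have "(F has_real_derivative 0) (at y within closed_segment (S r0) (S r1))"
      if "y \<in> closed_segment (S r0) (S r1)" for y
      using F[of y] seg[OF that] by (simp add: has_field_derivative_at_within)
    then have "\<exists>c. \<forall>y\<in>closed_segment (S r0) (S r1). F y = c"
      by (intro has_field_derivative_zero_constant) auto
    then have "F (S r0) = F (S r1)" by auto
    then show False using inv r by auto
  qed
  then obtain r where r: "r \<in> {p<..<q}" "F' (S r) \<noteq> 0" by blast
  have cFS: "continuous_on UNIV (\<lambda>r. F' (S r))" by (rule continuous_on_compose2[OF F' S]) auto
  have "open ({p<..<q} \<inter> (\<lambda>r. F' (S r)) -` (- {0}))"
    by (intro open_Int open_vimage cFS) auto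
  moreover have "r \<in> {p<..<q} \<inter> (\<lambda>r. F' (S r)) -` (- {0})" using r by simp
  ultimately obtain e where e0: "e > 0" "\<And>y. dist y r < e \<Longrightarrow> y \<in> {p<..<q} \<inter> (\<lambda>r. F' (S r)) -` (- {0})"
    unfolding open_dist by blast
  have e: "e > 0" "\<And>y. \<bar>y - r\<bar> < e \<Longrightarrow> y \<in> {p<..<q} \<and> F' (S y) \<noteq> 0"
    using e0 by (auto simp: dist_real_def)
  have "(S has_real_derivative inverse (F' (S y))) (at y)" if "\<bar>y - r\<bar> < e" for y
  proof (rule DERIV_inverse_function[where f=F and a="r - e" and b="r + e"])
    show "(F has_real_derivative F' (S y)) (at (S y))" by (rule F)
    show "F' (S y) \<noteq> 0" using e that by blast
    show "isCont S y" using S by (simp add: continuous_on_eq_continuous_at)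
    show "F (S t) = t" if "r - e < t" "t < r + e" for t using inv e(2)[of t] that by auto
  qed (use that in auto)
  moreover have "y \<in> {r - e<..<r + e} \<Longrightarrow> \<bar>y - r\<bar> < e" for y by auto
  moreover have "p \<le> r - e"
  proof (rule ccontr)
    assume "\<not> p \<le> r - e"
    then have "\<bar>p - r\<bar> < e" using r(1) by auto
    from e(2)[OF this] show False by simp
  qed
  moreover have "r + e \<le> q"
  proof (rule ccontr)
    assume "\<not> r + e \<le> q"
    then have "\<bar>q - r\<bar> < e" using r(1) by auto
    from e(2)[OF this] show False by simp
  qed
  ultimately show ?thesis using e by (intro exI[of _ "r - e"] exI[of _ "r + e"]) auto
qed

section \<open>Bump functions of one variable and the three branches of \<open>F\<close>\<close>

lemma DERIV_zero_on_interval_eq: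
  fixes f :: "real \<Rightarrow> real"
  assumes "x \<le> y" "\<And>s. s \<in> {x..y} \<Longrightarrow> (f has_real_derivative 0) (at s)"
  shows "f x = f y"
proof -
  have "\<exists>c. \<forall>s\<in>{x..y}. f s = c"
    using assms by (intro has_field_derivative_zero_constant) (auto intro: has_field_derivative_at_within)
  then show ?thesis using assms(1) by auto
qed

text \<open>Both factors are squared so that the product is continuously differentiable. For
  \<open>p < q\<close> it is positive inside \<open>(p, q)\<close> and zero outside, so an
  antiderivative is constant on either side of that interval.\<close>

definition hat :: "real \<Rightarrow> real \<Rightarrow> real \<Rightarrow> real" where
  "hat p q r = (max 0 (r - p))\<^sup>2 * (max 0 (q - r))\<^sup>2"

lemma hat_nonneg: "hat p q r \<ge> 0" by (simp add: hat_def)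

lemma hat_pos: "p < r \<Longrightarrow> r < q \<Longrightarrow> hat p q r > 0" by (simp add: hat_def max_def)

lemma hat_outside: "r \<le> p \<or> q \<le> r \<Longrightarrow> hat p q r = 0" by (auto simp: hat_def max_def)

lemma DERIV_pos_part_square_shift:
  "((\<lambda>r. (max 0 (r - p))\<^sup>2) has_real_derivative 2 * max 0 (r - p)) (at r)"
  "((\<lambda>r. (max 0 (p - r))\<^sup>2) has_real_derivative - (2 * max 0 (p - r))) (at r)"
proof -
  have 1: "((\<lambda>r. r - p) has_real_derivative 1) (at r)" "((\<lambda>r. p - r) has_real_derivative - 1) (at r)"
    by (auto intro!: derivative_eq_intros)
  show "((\<lambda>r. (max 0 (r - p))\<^sup>2) has_real_derivative 2 * max 0 (r - p)) (at r)"
    using DERIV_chain2[OF DERIV_pos_part_square 1(1)] by simp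
  show "((\<lambda>r. (max 0 (p - r))\<^sup>2) has_real_derivative - (2 * max 0 (p - r))) (at r)"
    using DERIV_chain2[OF DERIV_pos_part_square 1(2)] by simp
qed

lemma DERIV_hat: "\<exists>h'. continuous_on UNIV h' \<and> (\<forall>r. (hat p q has_real_derivative h' r) (at r))"
proof (intro exI conjI allI)
  let ?h = "\<lambda>r. 2 * max 0 (r - p) * (max 0 (q - r))\<^sup>2 + - (2 * max 0 (q - r)) * (max 0 (r - p))\<^sup>2"
  show "continuous_on UNIV ?h" by (intro continuous_intros)
  show "(hat p q has_real_derivative ?h r) (at r)" for r
    unfolding hat_def[abs_def] by (rule DERIV_mult[OF DERIV_pos_part_square_shift])
qed

lemma continuous_on_hat: "continuous_on S (hat p q)"
  unfolding hat_def[abs_def] by (intro continuous_intros)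

locale reaction =
  fixes F :: "real \<Rightarrow> real" and am ap bm bp :: real
  assumes adm: "admissible_reaction F am ap bm bp"
begin

lemma order: "0 < am" "am < ap" "ap < bm" "bm < bp" "F bm = F am" "F ap = F bp" "F 0 = 0"
  and F_nonneg: "x \<ge> 0 \<Longrightarrow> F x \<ge> 0"
  and F_top: "filterlim F at_top at_top" and F_bot: "filterlim F at_bot at_bot"
  and nondeg: "nondegenerate F ap bm"
  using adm by (auto simp: admissible_reaction_def)

lemma DERIV_F: "\<exists>F'. continuous_on UNIV F' \<and> (\<forall>x. (F has_real_derivative F' x) (at x))"
  using adm by (auto simp: admissible_reaction_def C1_differentiable_on_def has_real_derivative_iff_has_vector_derivative)

lemma cont_F: "continuous_on S F"
  using DERIV_F by (meson DERIV_continuous_on continuous_on_subset has_field_derivative_at_within subset_UNIV)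

lemma F_mono1: "x < y \<Longrightarrow> y \<le> ap \<Longrightarrow> F x < F y"
  by (rule strict_mono_closed_interval[of x ap, OF cont_F])
    (use adm in \<open>auto simp: admissible_reaction_def strict_mono_on_def\<close>)

lemma F_anti2: "ap \<le> x \<Longrightarrow> x < y \<Longrightarrow> y \<le> bm \<Longrightarrow> F y < F x"
proof -
  assume "ap \<le> x" "x < y" "y \<le> bm"
  then have "- F x < - F y"
    by (intro strict_mono_closed_interval[of ap bm "\<lambda>x. - F x"] continuous_intros cont_F)
      (use adm in \<open>auto simp: admissible_reaction_def monotone_on_def\<close>)
  then show ?thesis by simp
qed

lemma F_mono3: "bm \<le> x \<Longrightarrow> x < y \<Longrightarrow> F x < F y"
  by (rule strict_mono_closed_interval[of bm y, OF cont_F])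
    (use adm in \<open>auto simp: admissible_reaction_def strict_mono_on_def\<close>)

lemma F_lt1: "x \<le> ap \<Longrightarrow> y \<le> ap \<Longrightarrow> F x < F y \<longleftrightarrow> x < y"
  using F_mono1 by (metis not_less_iff_gr_or_eq)
lemma F_lt2: "ap \<le> x \<Longrightarrow> x \<le> bm \<Longrightarrow> ap \<le> y \<Longrightarrow> y \<le> bm \<Longrightarrow> F x < F y \<longleftrightarrow> y < x"
  using F_anti2 by (metis not_less_iff_gr_or_eq)
lemma F_lt3: "bm \<le> x \<Longrightarrow> bm \<le> y \<Longrightarrow> F x < F y \<longleftrightarrow> x < y"
  using F_mono3 by (metis not_less_iff_gr_or_eq)

lemma f_minus_pos: "0 < F bm" and f_minus_less_f_plus: "F bm < F ap"
  using F_mono1[of 0 am] F_anti2[of ap bm] order by auto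

lemma inj_branches: "inj_on F {..<ap}" "inj_on F {ap<..<bm}" "inj_on F {bm<..}"
  using F_lt1 F_lt2 F_lt3 by (auto intro!: inj_onI) (metis less_imp_le not_less_iff_gr_or_eq)+

lemma S1_F: "u \<le> ap \<Longrightarrow> S1 F ap (F u) = u"
  using F_mono1[of u ap] by (cases "u = ap") (auto simp: S1_def the_inv_into_f_f[OF inj_branches(1)])

lemma S2_F: "ap \<le> u \<Longrightarrow> u \<le> bm \<Longrightarrow> S2 F ap bm (F u) = u"
  using F_anti2[of u bm] F_anti2[of ap u] f_minus_less_f_plus
  by (cases "u = ap"; cases "u = bm") (auto simp: S2_def the_inv_into_f_f[OF inj_branches(2)])

lemma S3_F: "bm \<le> u \<Longrightarrow> S3 F bm (F u) = u"
  using F_mono3[of bm u] by (cases "u = bm") (auto simp: S3_def the_inv_into_f_f[OF inj_branches(3)])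

lemma surj1: "r \<le> F ap \<Longrightarrow> \<exists>u\<le>ap. F u = r"
proof -
  assume r: "r \<le> F ap"
  have "\<forall>\<^sub>F x in at_bot. F x \<le> r \<and> x \<le> ap"
    using F_bot eventually_le_at_bot[of ap] by (auto simp: filterlim_at_bot intro: eventually_conj)
  then obtain x where "F x \<le> r" "x \<le> ap" unfolding eventually_at_bot_linorder by blast
  then show ?thesis using IVT'[of F x r ap] r cont_F by auto
qed

lemma surj2: "F bm \<le> r \<Longrightarrow> r \<le> F ap \<Longrightarrow> \<exists>u. ap \<le> u \<and> u \<le> bm \<and> F u = r"
  using IVT2'[of F bm r ap] cont_F order by auto

lemma surj3: "F bm \<le> r \<Longrightarrow> \<exists>u\<ge>bm. F u = r"
proof -
  assume r: "F bm \<le> r"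
  have "\<forall>\<^sub>F x in at_top. r \<le> F x \<and> bm \<le> x"
    using F_top eventually_ge_at_top[of bm] by (auto simp: filterlim_at_top intro: eventually_conj)
  then obtain x where "r \<le> F x" "bm \<le> x" unfolding eventually_at_top_linorder by blast
  then show ?thesis using IVT'[of F bm r x] r cont_F by auto
qed

lemma F_S1: "r \<le> F ap \<Longrightarrow> F (S1 F ap r) = r" and S1_le: "S1 F ap r \<le> ap"
proof -
  have *: "F (S1 F ap r) = r \<and> S1 F ap r \<le> ap" if r: "r \<le> F ap"
  proof -
    obtain u where "u \<le> ap" "F u = r" using surj1[OF r] by blast
    then show ?thesis using S1_F[of u] by simp
  qed
  then show "r \<le> F ap \<Longrightarrow> F (S1 F ap r) = r" by blast
  show "S1 F ap r \<le> ap" using * by (cases "r \<le> F ap") (auto simp: S1_def)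
qed

lemma F_S2: "F bm \<le> r \<Longrightarrow> r \<le> F ap \<Longrightarrow> F (S2 F ap bm r) = r"
proof -
  assume "F bm \<le> r" "r \<le> F ap"
  then obtain u where "ap \<le> u" "u \<le> bm" "F u = r" using surj2 by blast
  then show ?thesis using S2_F[of u] by simp
qed

lemma S2_bounds: "ap \<le> S2 F ap bm r" "S2 F ap bm r \<le> bm"
proof -
  have "ap \<le> S2 F ap bm r \<and> S2 F ap bm r \<le> bm"
  proof (cases "F bm \<le> r \<and> r \<le> F ap")
    case True
    then obtain u where "ap \<le> u" "u \<le> bm" "F u = r" using surj2 by blast
    then show ?thesis using S2_F[of u] by simp
  next
    case False then show ?thesis using order by (auto simp: S2_def)
  qed
  then show "ap \<le> S2 F ap bm r" "S2 F ap bm r \<le> bm" by auto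
qed

lemma F_S3: "F bm \<le> r \<Longrightarrow> F (S3 F bm r) = r" and S3_ge: "bm \<le> S3 F bm r"
proof -
  show "F (S3 F bm r) = r" if r: "F bm \<le> r"
  proof -
    obtain u where "u \<ge> bm" "F u = r" using surj3[OF r] by blast
    then show ?thesis using S3_F[of u] by simp
  qed
  show "bm \<le> S3 F bm r"
  proof (cases "F bm \<le> r")
    case True
    then obtain u where "u \<ge> bm" "F u = r" using surj3 by blast
    then show ?thesis using S3_F[of u] by simp
  qed (simp add: S3_def)
qed

text \<open>Continuity comes from monotonicity and from the range being an interval, with no
  condition on \<open>F'\<close>: any value below \<open>S1 F ap b\<close> is attained at its own
  image under \<open>F\<close>.\<close>

lemma continuous_S1: "continuous_on UNIV (S1 F ap)"
proof (rule mono_interval_range_continuous)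
  show "mono (S1 F ap)"
  proof (rule monoI)
    fix x y :: real assume xy: "x \<le> y"
    show "S1 F ap x \<le> S1 F ap y"
    proof (cases "y < F ap")
      case True
      then have "\<not> F (S1 F ap y) < F (S1 F ap x)" using F_S1 xy by simp
      then show ?thesis using F_lt1[OF S1_le S1_le] by (simp add: not_less)
    next
      case False then show ?thesis using S1_le[of x] by (simp add: S1_def[of _ _ y])
    qed
  qed
  show "\<exists>x. S1 F ap x = y" if "y < S1 F ap b" for y b
    using S1_F[of y] that S1_le[of b] by (intro exI[of _ "F y"]) simp
qed

lemma continuous_S2: "continuous_on UNIV (S2 F ap bm)"
proof -
  \<comment> \<open>\<open>S2\<close> is decreasing, so its negative is the monotone function to
    which the criterion applies.\<close>
  have "continuous_on UNIV (\<lambda>r. - S2 F ap bm r)"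
  proof (rule mono_interval_range_continuous)
    show "mono (\<lambda>r. - S2 F ap bm r)"
    proof (rule monoI)
      fix x y :: real assume xy: "x \<le> y"
      show "- S2 F ap bm x \<le> - S2 F ap bm y"
      proof (cases "F bm \<le> x \<and> y \<le> F ap")
        case True
        then have "\<not> F (S2 F ap bm y) < F (S2 F ap bm x)" using F_S2 xy by simp
        then show ?thesis using F_lt2[OF S2_bounds S2_bounds] by (simp add: not_less)
      next
        case False
        then have "S2 F ap bm x = bm \<or> S2 F ap bm y = ap"
          using f_minus_less_f_plus by (auto simp: S2_def)
        then show ?thesis using S2_bounds[of x] S2_bounds[of y] by auto
      qed
    qed
    show "\<exists>x. - S2 F ap bm x = y" if "- S2 F ap bm a < y" "y < - S2 F ap bm b" for y a b
      using S2_F[of "- y"] that S2_bounds[of a] S2_bounds[of b] by (intro exI[of _ "F (- y)"]) simp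
  qed
  from continuous_on_minus[OF this] show ?thesis by simp
qed

lemma continuous_S3: "continuous_on UNIV (S3 F bm)"
proof (rule mono_interval_range_continuous)
  show "mono (S3 F bm)"
  proof (rule monoI)
    fix x y :: real assume xy: "x \<le> y"
    show "S3 F bm x \<le> S3 F bm y"
    proof (cases "F bm < x")
      case True
      then have "\<not> F (S3 F bm y) < F (S3 F bm x)" using F_S3 xy by simp
      then show ?thesis using F_lt3[OF S3_ge S3_ge] by (simp add: not_less)
    next
      case False then show ?thesis using S3_ge[of y] by (simp add: S3_def[of _ _ x])
    qed
  qed
  show "\<exists>x. S3 F bm x = y" if "S3 F bm a < y" for y a
    using S3_F[of y] that S3_ge[of a] by (intro exI[of _ "F y"]) simp
qed

section \<open>The potentials away from the support of the hat\<close>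

context
  fixes p q :: real and \<Psi> \<Phi> :: "real \<Rightarrow> real"
  assumes \<Psi>: "\<And>x. (\<Psi> has_real_derivative hat p q (F x)) (at x)"
    and \<Phi>: "\<And>x. (\<Phi> has_real_derivative hat p q x) (at x)" and pq: "p < q"
begin

lemma \<Psi>_eq:
  assumes "x \<le> y" "\<And>s. s \<in> {x..y} \<Longrightarrow> F s \<le> p \<or> q \<le> F s"
  shows "\<Psi> x = \<Psi> y"
proof (rule DERIV_zero_on_interval_eq[OF assms(1)])
  show "(\<Psi> has_real_derivative 0) (at s)" if "s \<in> {x..y}" for s
    using \<Psi>[of s] hat_outside[OF assms(2)[OF that]] by simp
qed

lemma \<Psi>_mono:
  assumes "x \<le> y"
  shows "\<Psi> x \<le> \<Psi> y"
  by (rule DERIV_nonneg_imp_nondecreasing[OF assms]) (use \<Psi> hat_nonneg in blast)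

lemma \<Phi>_less: "\<Phi> p < \<Phi> q"
proof (rule DERIV_pos_imp_increasing_open[OF pq])
  show "\<exists>y. (\<Phi> has_real_derivative y) (at x) \<and> 0 < y" if "p < x" "x < q" for x
    using \<Phi> hat_pos that by blast
  show "continuous_on {p..q} \<Phi>"
    by (rule DERIV_continuous_on[OF has_field_derivative_at_within[OF \<Phi>]])
qed

lemma \<Phi>_below: "r \<le> p \<Longrightarrow> \<Phi> r = \<Phi> p" and \<Phi>_above: "q \<le> r \<Longrightarrow> \<Phi> r = \<Phi> q"
proof -
  have D: "(\<Phi> has_real_derivative 0) (at s)" if "s \<le> p \<or> q \<le> s" for s
    using \<Phi>[of s] hat_outside[OF that] by simp
  show "\<Phi> r = \<Phi> p" if "r \<le> p" by (rule DERIV_zero_on_interval_eq[OF that]) (simp add: D)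
  show "\<Phi> r = \<Phi> q" if "q \<le> r" by (rule DERIV_zero_on_interval_eq[OF that, symmetric]) (simp add: D)
qed

text \<open>Where \<open>F <= p\<close> the derivative \<open>hat p q (F s)\<close> is zero. For
  nonnegative arguments this sublevel set has a piece starting at 0 on the first branch and a piece
  around \<open>bm\<close>, so \<open>\<Psi>\<close> takes there only the values
  \<open>\<Psi> 0\<close> and \<open>\<Psi> bm\<close>.\<close>

lemma \<Psi>_below_left: "0 \<le> u \<Longrightarrow> u \<le> ap \<Longrightarrow> F u \<le> p \<Longrightarrow> \<Psi> u = \<Psi> 0"
proof -
  assume u: "0 \<le> u" "u \<le> ap" "F u \<le> p"
  have "F s \<le> p" if "s \<in> {0..u}" for s using F_mono1[of s u] u that by (cases "s = u") auto
  then show ?thesis using \<Psi>_eq[of 0 u] u by auto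
qed

lemma \<Psi>_below_right: "ap \<le> u \<Longrightarrow> F u \<le> p \<Longrightarrow> \<Psi> u = \<Psi> bm"
proof -
  assume u: "ap \<le> u" "F u \<le> p"
  show ?thesis
  proof (cases "u \<le> bm")
    case True
    have "F s \<le> p" if "s \<in> {u..bm}" for s using F_anti2[of u s] u that by (cases "s = u") auto
    then show ?thesis using \<Psi>_eq[of u bm] True by auto
  next
    case False
    have "F s \<le> p" if "s \<in> {bm..u}" for s using F_mono3[of s u] u that by (cases "s = u") auto
    then show ?thesis using \<Psi>_eq[of bm u] False by auto
  qed
qed

text \<open>The set where \<open>F >= q\<close> likewise has a piece around \<open>ap\<close> and a
  piece on the third branch; the latter extends to the right end \<open>M\<close> of the range of
  \<open>u\<close>.\<close>

lemma \<Psi>_above_left: "u \<le> bm \<Longrightarrow> q \<le> F u \<Longrightarrow> \<Psi> u = \<Psi> ap"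
proof -
  assume u: "u \<le> bm" "q \<le> F u"
  show ?thesis
  proof (cases "u \<le> ap")
    case True
    have "q \<le> F s" if "s \<in> {u..ap}" for s using F_mono1[of u s] u that by (cases "s = u") auto
    then show ?thesis using \<Psi>_eq[of u ap] True by auto
  next
    case False
    have "q \<le> F s" if "s \<in> {ap..u}" for s using F_anti2[of s u] u that by (cases "s = u") auto
    then show ?thesis using \<Psi>_eq[of ap u] False by auto
  qed
qed

lemma \<Psi>_above_right: "bm \<le> u \<Longrightarrow> u \<le> M \<Longrightarrow> q \<le> F u \<Longrightarrow> \<Psi> u = \<Psi> M"
proof -
  assume u: "bm \<le> u" "u \<le> M" "q \<le> F u"
  have "q \<le> F s" if "s \<in> {u..M}" for s using F_mono3[of u s] u that by (cases "s = u") auto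
  then show ?thesis using \<Psi>_eq[of u M] u by auto
qed

end

text \<open>\<open>rel\<close> equates two evaluations of the average of
  \<open>\<Psi> u + \<Phi> (F u)\<close>, one taken below \<open>p\<close> and one above
  \<open>q\<close>; \<open>a\<close> is the share of \<open>ap <= u\<close> in the first,
  \<open>b\<close> the share of the third branch in the second. In terms of the branches it says
  that \<open>(1 - a) * \<Psi> (S1 y) + (a - b) * \<Psi> (S2 y) + b * \<Psi> (S3 y) + \<Phi>
  y\<close> has equal values at \<open>p'\<close> and \<open>q'\<close>. The coefficients add up to
  1, so the derivative of this function is the hat times a combination of the
  \<open>S_i' + 1\<close>. By nondegeneracy that combination is nonzero somewhere, and on a small
  interval where it keeps its sign the function is strictly monotone.\<close>

lemma nondegeneracy_contradiction:
  assumes pq: "p < q" and a: "0 \<le> a" "a \<le> 1" and b: "0 \<le> b" "b \<le> 1" and M: "bp \<le> M"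
    and \<Psi>: "\<And>p' q' x. (\<Psi> p' q' has_real_derivative hat p' q' (F x)) (at x)"
    and \<Phi>: "\<And>p' q' x. (\<Phi> p' q' has_real_derivative hat p' q' x) (at x)"
    and rel: "\<And>p' q'. p' \<in> \<rat> \<Longrightarrow> q' \<in> \<rat> \<Longrightarrow> p \<le> p' \<Longrightarrow> p' < q' \<Longrightarrow> q' \<le> q \<Longrightarrow>
      a * (\<Psi> p' q' bm - \<Psi> p' q' 0) = (1 - b) * (\<Psi> p' q' ap - \<Psi> p' q' 0)
        + b * (\<Psi> p' q' M - \<Psi> p' q' 0) + (\<Phi> p' q' q' - \<Phi> p' q' p')"
  shows False
proof -
  have rats: "\<exists>p' q'. p' \<in> \<rat> \<and> q' \<in> \<rat> \<and> x < p' \<and> p' < q' \<and> q' < y" if "x < y" for x y :: real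
    using Rats_dense_in_real[OF that] Rats_dense_in_real by (meson less_trans)
  have Mbm: "bm < M" using M order by linarith
  consider "p < F bm" | "q > F ap" | "F bm \<le> p" "q \<le> F ap" by linarith
  then show False
  proof cases
    \<comment> \<open>Below \<open>F bm\<close> only the first branch meets the interval, so
      \<open>\<Psi>\<close> has the same value at \<open>ap\<close>, \<open>bm\<close> and
      \<open>M\<close>, and the relation says that a nonnegative and a positive number add up to
      zero.\<close>
    case 1
    then obtain p' q' where r: "p' \<in> \<rat>" "q' \<in> \<rat>" "p < p'" "p' < q'" "q' < min q (F bm)"
      using rats[of p "min q (F bm)"] pq by auto
    have high: "q' \<le> F s" if "ap \<le> s" for s
    proof (cases "s \<le> bm")
      case True
      then have "F bm \<le> F s" using F_anti2[of s bm] that by (cases "s = bm") auto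
      then show ?thesis using r by simp
    next
      case False
      then have "F bm \<le> F s" using F_mono3[of bm s] by auto
      then show ?thesis using r by simp
    qed
    have e: "\<Psi> p' q' bm = \<Psi> p' q' ap" "\<Psi> p' q' M = \<Psi> p' q' ap"
      using \<Psi>_eq[OF \<Psi> \<Phi> r(4), of ap bm] \<Psi>_eq[OF \<Psi> \<Phi> r(4), of ap M] high order Mbm by auto
    define c where "c = \<Psi> p' q' ap - \<Psi> p' q' 0"
    have "0 \<le> c" using \<Psi>_mono[OF \<Psi> \<Phi> r(4), of 0 ap] order by (simp add: c_def)
    have "a * c = (1 - b) * c + b * c + (\<Phi> p' q' q' - \<Phi> p' q' p')"
      using rel[OF r(1,2)] r e by (simp add: c_def)
    then have "(1 - a) * c + (\<Phi> p' q' q' - \<Phi> p' q' p') = 0" by (simp add: algebra_simps)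
    moreover have "0 \<le> (1 - a) * c" using a \<open>0 \<le> c\<close> by simp
    ultimately show False using \<Phi>_less[OF \<Psi> \<Phi> r(4)] by simp
  next
    \<comment> \<open>Above \<open>F ap\<close> only the third branch meets the interval, so the
      values of \<open>\<Psi>\<close> at 0, \<open>ap\<close> and \<open>bm\<close> coincide, with
      the same contradiction.\<close>
    case 2
    then obtain p' q' where r: "p' \<in> \<rat>" "q' \<in> \<rat>" "max p (F ap) < p'" "p' < q'" "q' < q"
      using rats[of "max p (F ap)" q] pq by auto
    have low: "F s \<le> p'" if "0 \<le> s" "s \<le> bm" for s
    proof (cases "s \<le> ap")
      case True
      then have "F s \<le> F ap" using F_mono1[of s ap] by (cases "s = ap") auto
      then show ?thesis using r by simp
    next
      case False
      then have "F s \<le> F ap" using F_anti2[of ap s] that by auto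
      then show ?thesis using r by simp
    qed
    have e: "\<Psi> p' q' 0 = \<Psi> p' q' ap" "\<Psi> p' q' 0 = \<Psi> p' q' bm"
      using \<Psi>_eq[OF \<Psi> \<Phi> r(4), of 0 ap] \<Psi>_eq[OF \<Psi> \<Phi> r(4), of 0 bm] low order by auto
    define c where "c = \<Psi> p' q' M - \<Psi> p' q' 0"
    have "0 \<le> c" using \<Psi>_mono[OF \<Psi> \<Phi> r(4), of 0 M] order Mbm by (simp add: c_def)
    have "0 = b * c + (\<Phi> p' q' q' - \<Phi> p' q' p')"
      using rel[OF r(1,2)] r e by (simp add: c_def)
    moreover have "0 \<le> b * c" using b \<open>0 \<le> c\<close> by simp
    ultimately show False using \<Phi>_less[OF \<Psi> \<Phi> r(4)] by simp
  next
    case 3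
    let ?S1 = "S1 F ap" and ?S2 = "S2 F ap bm" and ?S3 = "S3 F bm"
    obtain F' where F': "continuous_on UNIV F'" "\<And>x. (F has_real_derivative F' x) (at x)"
      using DERIV_F by blast
    \<comment> \<open>The interval is shrunk once per branch, until all three inverses are
      differentiable on it.\<close>
    obtain p1 q1 where 1: "p \<le> p1" "p1 < q1" "q1 \<le> q" "\<And>r. r \<in> {p1<..<q1} \<Longrightarrow> F' (?S1 r) \<noteq> 0 \<and>
        (?S1 has_real_derivative inverse (F' (?S1 r))) (at r)"
      using inverse_branch_differentiable[OF continuous_S1 pq F_S1 F'(2,1)] 3 by force
    obtain p2 q2 where 2: "p1 \<le> p2" "p2 < q2" "q2 \<le> q1" "\<And>r. r \<in> {p2<..<q2} \<Longrightarrow> F' (?S2 r) \<noteq> 0 \<and>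
        (?S2 has_real_derivative inverse (F' (?S2 r))) (at r)"
      using inverse_branch_differentiable[OF continuous_S2 1(2) F_S2 F'(2,1)] 3 1(1,3) by force
    obtain p3 q3 where 4: "p2 \<le> p3" "p3 < q3" "q3 \<le> q2" "\<And>r. r \<in> {p3<..<q3} \<Longrightarrow> F' (?S3 r) \<noteq> 0 \<and>
        (?S3 has_real_derivative inverse (F' (?S3 r))) (at r)"
      using inverse_branch_differentiable[OF continuous_S3 2(2) F_S3 F'(2,1)] 3 1(1,3) 2(1,3) by force
    have D: "F' (?S1 r) \<noteq> 0" "F' (?S2 r) \<noteq> 0" "F' (?S3 r) \<noteq> 0"
      "(?S1 has_real_derivative inverse (F' (?S1 r))) (at r)"
      "(?S2 has_real_derivative inverse (F' (?S2 r))) (at r)"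
      "(?S3 has_real_derivative inverse (F' (?S3 r))) (at r)" if "r \<in> {p3<..<q3}" for r
      using that 1(4)[of r] 2(1,3) 2(4)[of r] 4(1,3) 4(4)[of r] by auto
    \<comment> \<open>Since \<open>1 = (1 - a) + (a - b) + b\<close>, this is the sum of
      \<open>a_i * (S_i' + 1)\<close> with the weights \<open>1 - a\<close>, \<open>a - b\<close>
      and \<open>b\<close>; if it vanished throughout, nondegeneracy would force the sum of the
      weights, which is 1, to be 0.\<close>
    define k where "k r = (1 - a) * inverse (F' (?S1 r)) + (a - b) * inverse (F' (?S2 r)) + b * inverse (F' (?S3 r)) + 1" for r
    have "\<exists>r\<in>{p3<..<q3}. k r \<noteq> 0"
    proof (rule ccontr)
      assume "\<not> ?thesis"
      then have z: "k r = 0" if "r \<in> {p3<..<q3}" for r using that by blast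
      have "\<forall>r\<in>{p3<..<q3}. ?S1 field_differentiable (at r) \<and> ?S2 field_differentiable (at r) \<and>
          ?S3 field_differentiable (at r) \<and> (1 - a) * (deriv ?S1 r + 1) + (a - b) * (deriv ?S2 r + 1)
             + b * (deriv ?S3 r + 1) = 0"
      proof
        fix r assume r: "r \<in> {p3<..<q3}"
        have "deriv ?S1 r = inverse (F' (?S1 r))" "deriv ?S2 r = inverse (F' (?S2 r))" "deriv ?S3 r = inverse (F' (?S3 r))"
          using D(4-6)[OF r] by (auto intro: DERIV_imp_deriv)
        then show "?S1 field_differentiable (at r) \<and> ?S2 field_differentiable (at r) \<and>
          ?S3 field_differentiable (at r) \<and> (1 - a) * (deriv ?S1 r + 1) + (a - b) * (deriv ?S2 r + 1)
             + b * (deriv ?S3 r + 1) = 0"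
          using D(4-6)[OF r] z[OF r] by (auto simp: field_differentiable_def k_def algebra_simps)
      qed
      moreover have "{p3<..<q3} \<subseteq> {F bm<..<F ap}" using 3 1 2 4 by auto
      ultimately have "(1 - a) + (a - b) + b = 0"
        using nondeg 4(2) unfolding nondegenerate_def by blast
      then show False by simp
    qed
    then obtain r where r: "r \<in> {p3<..<q3}" "k r \<noteq> 0" by blast
    have ck: "continuous_on {p3<..<q3} k" unfolding k_def
      by (intro continuous_intros continuous_on_compose2[OF F'(1) continuous_on_subset[OF continuous_S1]]
          continuous_on_compose2[OF F'(1) continuous_on_subset[OF continuous_S2]]
          continuous_on_compose2[OF F'(1) continuous_on_subset[OF continuous_S3]]) (use D in auto)
    \<comment> \<open>The sign of \<open>k\<close> near \<open>r\<close> is not known; multiplying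
      by it treats both cases at once.\<close>
    define s where "s = sgn (k r)"
    have s: "s * k r > 0" using r(2) by (simp add: s_def sgn_if)
    have "open ({p3<..<q3} \<inter> (\<lambda>r. s * k r) -` {0<..})"
      by (rule continuous_open_preimage) (auto intro!: continuous_intros ck)
    moreover have "r \<in> {p3<..<q3} \<inter> (\<lambda>r. s * k r) -` {0<..}" using r(1) s by simp
    ultimately obtain e where e0: "e > 0" "\<And>y. dist y r < e \<Longrightarrow> y \<in> {p3<..<q3} \<inter> (\<lambda>r. s * k r) -` {0<..}"
      unfolding open_dist by blast
    have e: "e > 0" "\<And>y. \<bar>y - r\<bar> < e \<Longrightarrow> y \<in> {p3<..<q3} \<and> 0 < s * k y"
      using e0 by (auto simp: dist_real_def)
    obtain p' q' where pq': "p' \<in> \<rat>" "q' \<in> \<rat>" "r - e < p'" "p' < q'" "q' < r + e"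
      using rats[of "r - e" "r + e"] e(1) by auto
    have in3: "y \<in> {p3<..<q3}" "0 < s * k y" if "y \<in> {p'..q'}" for y
      using e(2)[of y] that pq' by auto
    have in_big: "p < p'" "q' < q" "F bm < p'" "q' < F ap"
      using in3[of p'] in3[of q'] pq'(4) 1 2 4 3 by auto
    let ?\<Psi> = "\<Psi> p' q'" and ?\<Phi> = "\<Phi> p' q'"
    define \<Theta> where "\<Theta> y = (1 - a) * ?\<Psi> (?S1 y) + (a - b) * ?\<Psi> (?S2 y) + b * ?\<Psi> (?S3 y) + ?\<Phi> y" for y
    have D\<Theta>: "(\<Theta> has_real_derivative hat p' q' y * k y) (at y)" if y: "y \<in> {p'..q'}" for y
    proof -
      note Dy = D(4-6)[OF in3(1)[OF y]]
      have b: "F bm \<le> y" "y \<le> F ap" using y in_big by auto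
      have "((\<lambda>y. ?\<Psi> (?S1 y)) has_real_derivative hat p' q' y * inverse (F' (?S1 y))) (at y)"
        using DERIV_chain2[OF \<Psi>[of p' q'] Dy(1)] F_S1[OF b(2)] by simp
      moreover have "((\<lambda>y. ?\<Psi> (?S2 y)) has_real_derivative hat p' q' y * inverse (F' (?S2 y))) (at y)"
        using DERIV_chain2[OF \<Psi>[of p' q'] Dy(2)] F_S2[OF b] by simp
      moreover have "((\<lambda>y. ?\<Psi> (?S3 y)) has_real_derivative hat p' q' y * inverse (F' (?S3 y))) (at y)"
        using DERIV_chain2[OF \<Psi>[of p' q'] Dy(3)] F_S3[OF b(1)] by simp
      ultimately have "(\<Theta> has_real_derivative (1 - a) * (hat p' q' y * inverse (F' (?S1 y))) +
          (a - b) * (hat p' q' y * inverse (F' (?S2 y))) + b * (hat p' q' y * inverse (F' (?S3 y))) + hat p' q' y) (at y)"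
        unfolding \<Theta>_def by (intro DERIV_add DERIV_cmult \<Phi>)
      then show ?thesis by (simp add: k_def algebra_simps)
    qed
    have "s * \<Theta> p' < s * \<Theta> q'"
    proof (rule DERIV_pos_imp_increasing_open[OF pq'(4)])
      show "\<exists>y. ((\<lambda>t. s * \<Theta> t) has_real_derivative y) (at x) \<and> 0 < y" if "p' < x" "x < q'" for x
      proof (intro exI conjI)
        show "((\<lambda>t. s * \<Theta> t) has_real_derivative s * (hat p' q' x * k x)) (at x)"
          using that by (intro DERIV_cmult D\<Theta>) auto
        show "0 < s * (hat p' q' x * k x)"
          using mult_pos_pos[OF hat_pos[OF that] in3(2)[of x]] that by (simp add: mult_ac)
      qed
      show "continuous_on {p'..q'} (\<lambda>t. s * \<Theta> t)"
        by (intro continuous_intros DERIV_continuous_on[OF has_field_derivative_at_within[OF D\<Theta>]])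
    qed
    \<comment> \<open>At the end points each branch value of \<open>\<Psi>\<close> is one of the
      four values in \<open>rel\<close>, and the relation says precisely that
      \<open>\<Theta>\<close> does not change.\<close>
    moreover have "\<Theta> q' = \<Theta> p'"
    proof -
      note ctx = \<Psi>[of p' q'] \<Phi>[of p' q'] pq'(4)
      have S1p: "0 \<le> ?S1 p'"
      proof (rule ccontr)
        assume "\<not> 0 \<le> ?S1 p'"
        then have "F (?S1 p') < F 0" using order by (intro F_mono1) auto
        then show False using F_S1[of p'] in_big pq'(4) f_minus_pos order by auto
      qed
      have FS: "F (?S1 p') = p'" "F (?S1 q') = q'" "F (?S2 p') = p'" "F (?S2 q') = q'" "F (?S3 p') = p'" "F (?S3 q') = q'"
        using in_big pq'(4) by (auto intro!: F_S1 F_S2 F_S3)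
      have S3M: "?S3 q' \<le> M"
      proof (rule ccontr)
        assume "\<not> ?S3 q' \<le> M"
        then have "F bp < F (?S3 q')" using M order by (intro F_mono3) auto
        then show False using FS(6) in_big order by simp
      qed
      have "?\<Psi> (?S1 p') = ?\<Psi> 0" using \<Psi>_below_left[OF ctx S1p S1_le] FS by simp
      moreover have "?\<Psi> (?S1 q') = ?\<Psi> ap"
        using \<Psi>_above_left[OF ctx, of "?S1 q'"] FS S1_le[of q'] order by simp
      moreover have "?\<Psi> (?S2 p') = ?\<Psi> bm" using \<Psi>_below_right[OF ctx S2_bounds(1)] FS by simp
      moreover have "?\<Psi> (?S2 q') = ?\<Psi> ap" using \<Psi>_above_left[OF ctx S2_bounds(2)] FS by simp
      moreover have "?\<Psi> (?S3 p') = ?\<Psi> bm" using \<Psi>_below_right[OF ctx, of "?S3 p'"] FS S3_ge[of p'] order by simp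
      moreover have "?\<Psi> (?S3 q') = ?\<Psi> M" using \<Psi>_above_right[OF ctx S3_ge S3M] FS by simp
      ultimately show ?thesis
        using rel[OF pq'(1,2)] in_big pq'(4) by (simp add: \<Theta>_def algebra_simps)
    qed
    ultimately show False by simp
  qed
qed

end

section \<open>A priori bounds for classical solutions\<close>

lemma second_derivative_nonneg_at_min:
  fixes f f' :: "real \<Rightarrow> real"
  assumes d: "0 < \<delta>" and D: "\<And>s. \<bar>s\<bar> < \<delta> \<Longrightarrow> (f has_real_derivative f' s) (at s)"
    and D2: "(f' has_real_derivative c) (at 0)" and min: "\<And>s. \<bar>s\<bar> < \<delta> \<Longrightarrow> f 0 \<le> f s"
  shows "0 \<le> c"
proof (rule ccontr)
  assume "\<not> 0 \<le> c"
  then obtain e where e: "e > 0" "\<And>h. 0 < h \<Longrightarrow> h < e \<Longrightarrow> f' h < f' 0"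
    using DERIV_neg_dec_right[OF D2] by (auto simp: not_le)
  have f0: "f' 0 = 0"
    by (rule DERIV_local_min[OF D[of 0] d]) (use d min in auto)
  define s where "s = min e \<delta> / 2"
  have s: "0 < s" "s < e" "s < \<delta>" using e d by (auto simp: s_def min_def)
  have "f s < f 0"
  proof (rule DERIV_neg_imp_decreasing_open[OF s(1)])
    show "\<exists>y. (f has_real_derivative y) (at x) \<and> y < 0" if "0 < x" "x < s" for x
      using D[of x] e(2)[of x] f0 that s by (intro exI[of _ "f' x"]) auto
    show "continuous_on {0..s} f"
      by (intro continuous_at_imp_continuous_on ballI DERIV_isCont[OF D]) (use s in auto)
  qed
  then show False using min[of s] s by simp
qed

lemma derivative_nonpos_at_right_end_min:
  fixes f :: "real \<Rightarrow> real"
  assumes D: "(f has_real_derivative c) (at t)" and t: "0 < t" and min: "\<And>s. 0 \<le> s \<Longrightarrow> s \<le> t \<Longrightarrow> f t \<le> f s"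
  shows "c \<le> 0"
proof (rule ccontr)
  assume "\<not> c \<le> 0"
  then obtain e where e: "e > 0" "\<And>h. 0 < h \<Longrightarrow> h < e \<Longrightarrow> f (t - h) < f t"
    using DERIV_pos_inc_left[OF D] by auto
  define h where "h = min e t / 2"
  have h: "0 < h" "h < e" "h < t" using e t by (auto simp: h_def min_def)
  show False using e(2)[OF h(1,2)] min[of "t - h"] h by simp
qed

text \<open>An interior sphere condition: the set where
  \<open>n \<bullet> y + A * (norm y)^2 <= 0\<close>, with \<open>y = x - x0\<close>, is the closed
  ball of diameter \<open>1 / A\<close> touching \<open>x0\<close> from the side of
  \<open>- n\<close>. As the defining function is twice differentiable, the frontier deviates at
  most quadratically from its tangent plane, so a small enough ball meets it only in
  \<open>x0\<close>. The quadratic function is later added as a perturbation that leaves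
  \<open>x0\<close> as the only possible minimum on the frontier.\<close>

lemma frontier_interior_parabola:
  fixes \<Omega> :: "'a::euclidean_space set"
  assumes dom: "smooth_bounded_domain \<Omega>" and x0: "x0 \<in> frontier \<Omega>"
  obtains n A s0 where "outward_unit_normal \<Omega> x0 n" "norm n = 1" "0 < (A::real)" "0 < (s0::real)"
    "\<And>x. x \<in> frontier \<Omega> \<Longrightarrow> n \<bullet> (x - x0) + A * (norm (x - x0))\<^sup>2 \<le> 0 \<Longrightarrow> x = x0"
    "\<And>s. 0 < s \<Longrightarrow> s < s0 \<Longrightarrow> x0 - s *\<^sub>R n \<in> \<Omega>"
proof -
  have op: "open \<Omega>" using dom by (simp add: smooth_bounded_domain_def)
  obtain U \<rho> where U: "x0 \<in> U" and ldf: "local_defining_function \<Omega> U \<rho>"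
    using dom x0 unfolding smooth_bounded_domain_def by blast
  have oU: "open U" and nz: "\<And>x. x \<in> U \<Longrightarrow> frechet_derivative \<rho> (at x) \<noteq> (\<lambda>_. 0)"
    and \<Omega>U: "\<Omega> \<inter> U = {x \<in> U. \<rho> x < 0}"
    using ldf by (auto simp: local_defining_function_def)
  have "Ck_on (Suc (Suc 0)) \<rho> U" using ldf unfolding local_defining_function_def smooth_on_def by blast
  then have d1: "\<rho> differentiable_on U"
    and d2: "\<And>b. b \<in> Basis \<Longrightarrow> (\<lambda>x. frechet_derivative \<rho> (at x) b) differentiable_on U" by auto
  define D\<rho> where "D\<rho> x = frechet_derivative \<rho> (at x)" for x
  have D\<rho>: "(\<rho> has_derivative D\<rho> x) (at x)" if "x \<in> U" for x
    using d1 oU that unfolding D\<rho>_def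
    by (metis at_within_open differentiable_on_def frechet_derivative_works)
  define g where "g x = (\<Sum>b\<in>Basis. D\<rho> x b *\<^sub>R b)" for x
  have D\<rho>g: "D\<rho> x h = g x \<bullet> h" if "x \<in> U" for x h
  proof -
    have lin: "linear (D\<rho> x)" using has_derivative_linear[OF D\<rho>[OF that]] .
    have "D\<rho> x h = D\<rho> x (\<Sum>b\<in>Basis. (h \<bullet> b) *\<^sub>R b)" by (simp add: euclidean_representation)
    also have "\<dots> = (\<Sum>b\<in>Basis. (h \<bullet> b) * D\<rho> x b)"
      using lin by (simp add: linear_sum linear_scale)
    also have "\<dots> = g x \<bullet> h" unfolding g_def inner_sum_left
      by (intro sum.cong refl) (simp add: inner_commute)
    finally show ?thesis .
  qed
  have "(\<lambda>x. D\<rho> x b *\<^sub>R b) differentiable (at x0)" if "b \<in> Basis" for b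
  proof -
    have "(\<lambda>x. frechet_derivative \<rho> (at x) b) differentiable (at x0)"
      using d2[OF that] oU U by (metis at_within_open differentiable_on_def)
    then show ?thesis unfolding D\<rho>_def by (intro differentiable_scaleR differentiable_const)
  qed
  then have "g differentiable (at x0)"
    unfolding g_def[abs_def] by (intro differentiable_sum) auto
  then obtain g' where g': "(g has_derivative g') (at x0)" unfolding differentiable_def by blast
  then obtain d0 where d0: "d0 > 0" "\<And>y. norm (y - x0) < d0 \<Longrightarrow> norm (g y - g x0 - g' (y - x0)) \<le> 1 * norm (y - x0)"
    unfolding has_derivative_at_alt by (metis zero_less_one)
  obtain B where B: "B > 0" "\<And>h. norm (g' h) \<le> norm h * B"
    using bounded_linear.pos_bounded[OF has_derivative_bounded_linear[OF g']] by blast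
  obtain d1 where d1: "d1 > 0" "ball x0 d1 \<subseteq> U" using oU U open_contains_ball by blast
  define \<delta> where "\<delta> = min d0 d1"
  have \<delta>: "\<delta> > 0" using d0 d1 by (simp add: \<delta>_def)
  define C where "C = B + 1"
  have C: "C > 0" using B by (simp add: C_def)
  have inU: "y \<in> U" if "norm (y - x0) < \<delta>" for y
    using that d1 by (auto simp: \<delta>_def dist_norm norm_minus_commute subset_eq)
  have glip: "norm (g y - g x0) \<le> C * norm (y - x0)" if "norm (y - x0) < \<delta>" for y
  proof -
    have "norm (g y - g x0) \<le> norm (g y - g x0 - g' (y - x0)) + norm (g' (y - x0))"
      using norm_triangle_ineq[of "g y - g x0 - g' (y - x0)" "g' (y - x0)"] by simp
    also have "\<dots> \<le> C * norm (y - x0)"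
      using d0(2)[of y] B(2)[of "y - x0"] that by (simp add: C_def \<delta>_def algebra_simps)
    finally show ?thesis .
  qed
  \<comment> \<open>The quadratic remainder comes from the mean value inequality on the ball of
    radius \<open>norm (x - x0)\<close>: there the gradient differs from \<open>g x0\<close> by at
    most \<open>C * norm (x - x0)\<close>, which uses differentiability of the gradient at the
    single point \<open>x0\<close>.\<close>
  have taylor: "\<bar>\<rho> x - \<rho> x0 - g x0 \<bullet> (x - x0)\<bar> \<le> C * (norm (x - x0))\<^sup>2" if x: "norm (x - x0) < \<delta>" for x
  proof -
    let ?S = "cball x0 (norm (x - x0))"
    have "norm ((\<rho> x - g x0 \<bullet> x) - (\<rho> x0 - g x0 \<bullet> x0)) \<le> (C * norm (x - x0)) * norm (x - x0)"
    proof (rule differentiable_bound[of ?S "\<lambda>y. \<rho> y - g x0 \<bullet> y" "\<lambda>y h. g y \<bullet> h - g x0 \<bullet> h"])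
      fix y assume "y \<in> ?S"
      then have y: "norm (y - x0) \<le> norm (x - x0)" by (simp add: dist_norm norm_minus_commute)
      have "(\<rho> has_derivative (\<lambda>h. g y \<bullet> h)) (at y)"
        using D\<rho>[OF inU] D\<rho>g[OF inU] y x by (metis (no_types, lifting) ext le_less_trans)
      from has_derivative_diff[OF this has_derivative_inner_right[OF has_derivative_ident]]
      show "((\<lambda>y. \<rho> y - g x0 \<bullet> y) has_derivative (\<lambda>h. g y \<bullet> h - g x0 \<bullet> h)) (at y within ?S)"
        by (rule has_derivative_at_withinI)
      show "onorm (\<lambda>h. g y \<bullet> h - g x0 \<bullet> h) \<le> C * norm (x - x0)"
      proof (rule onorm_le)
        fix h
        have "\<bar>(g y - g x0) \<bullet> h\<bar> \<le> norm (g y - g x0) * norm h" by (rule Cauchy_Schwarz_ineq2)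
        also have "\<dots> \<le> (C * norm (x - x0)) * norm h"
          using glip[of y] y x C by (intro mult_right_mono) (auto intro: order_trans mult_left_mono)
        finally show "norm (g y \<bullet> h - g x0 \<bullet> h) \<le> C * norm (x - x0) * norm h" by (simp add: inner_diff_left)
      qed
    qed (auto simp: dist_norm norm_minus_commute)
    then show ?thesis by (simp add: inner_diff_right power2_eq_square algebra_simps)
  qed
  define c where "c = norm (g x0)"
  have "g x0 \<noteq> 0"
    using nz[OF U] D\<rho>g[OF U] by (auto simp: D\<rho>_def fun_eq_iff)
  then have c: "c > 0" by (simp add: c_def)
  define n where "n = g x0 /\<^sub>R c"
  have gn: "g x0 = c *\<^sub>R n" using c by (simp add: n_def)
  have n1: "norm n = 1" using c by (simp add: n_def c_def)
  have out: "outward_unit_normal \<Omega> x0 n"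
    unfolding outward_unit_normal_def
  proof (intro conjI n1 exI)
    have "(\<lambda>h. h \<bullet> (c *\<^sub>R n)) = D\<rho> x0" using D\<rho>g[OF U] gn by (auto simp: inner_commute)
    then show "GDERIV \<rho> x0 :> c *\<^sub>R n" unfolding gderiv_def using D\<rho>[OF U] by simp
  qed (use U ldf c in auto)
  have zero: "\<rho> x = 0" if x: "x \<in> frontier \<Omega>" "x \<in> U" for x
  proof -
    have "x \<notin> \<Omega>" using x(1) op by (simp add: frontier_def interior_open)
    then have "x \<notin> {x \<in> U. \<rho> x < 0}" using \<Omega>U by blast
    then have ge: "\<rho> x \<ge> 0" using x(2) by simp
    have "\<not> \<rho> x > 0"
    proof
      assume pos: "\<rho> x > 0"
      have "continuous_on U \<rho>" by (rule differentiable_imp_continuous_on[OF \<open>\<rho> differentiable_on U\<close>])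
      then have op': "open (U \<inter> \<rho> -` {0<..})" using oU by (intro continuous_open_preimage) auto
      moreover have "x \<in> U \<inter> \<rho> -` {0<..}" using pos x by auto
      moreover have "x \<in> closure \<Omega>" using x(1) by (simp add: frontier_def)
      ultimately have "(U \<inter> \<rho> -` {0<..}) \<inter> \<Omega> \<noteq> {}"
        using open_Int_closure_eq_empty[OF op', of \<Omega>] by blast
      then obtain y where "y \<in> \<Omega>" "y \<in> U" "\<rho> y > 0" by auto
      then show False using \<Omega>U by force
    qed
    then show ?thesis using ge by simp
  qed
  \<comment> \<open>The first summand brings the diameter \<open>1 / A\<close> below
    \<open>\<delta>\<close>, where the Taylor bound is valid; the second makes \<open>A\<close>
    exceed \<open>C / c\<close>, the bound for the quadratic deviation of the frontier.\<close>
  define A where "A = 2 / \<delta> + 2 * C / c + 1"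
  have A: "A > 0" "A > C / c" "1 / A < \<delta>"
  proof -
    have pos: "2 / \<delta> > 0" "C / c > 0" "2 * C / c = C / c + C / c" using \<delta> C c by (auto simp: add_divide_distrib[symmetric])
    then show "A > 0" "A > C / c" unfolding A_def by linarith+
    have "1 < \<delta> * A" unfolding A_def using \<delta> pos(2) by (simp add: distrib_left) (smt (verit) mult_pos_pos pos(3) times_divide_eq_right)
    then show "1 / A < \<delta>" using \<open>A > 0\<close> by (simp add: divide_less_eq)
  qed
  have only: "x = x0" if x: "x \<in> frontier \<Omega>" and le: "n \<bullet> (x - x0) + A * (norm (x - x0))\<^sup>2 \<le> 0" for x
  proof (rule ccontr)
    assume "x \<noteq> x0"
    define y where "y = x - x0"
    have y: "norm y > 0" using \<open>x \<noteq> x0\<close> by (simp add: y_def)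
    have "A * (norm y)\<^sup>2 \<le> - (n \<bullet> y)" using le by (simp add: y_def)
    moreover have "- (n \<bullet> y) \<le> norm y" using Cauchy_Schwarz_ineq2[of n y] n1 by simp
    ultimately have "A * norm y * norm y \<le> 1 * norm y" by (simp add: power2_eq_square mult.assoc)
    then have "A * norm y \<le> 1" by (rule mult_right_le_imp_le[OF _ y])
    then have "norm y \<le> 1 / A" using A(1) by (simp add: le_divide_eq mult.commute)
    then have small: "norm (x - x0) < \<delta>" using A(3) by (simp add: y_def)
    have "\<rho> x = 0" "\<rho> x0 = 0" using zero x inU[OF small] x0 U by auto
    then have "\<bar>c * (n \<bullet> y)\<bar> \<le> C * (norm y)\<^sup>2" using taylor[OF small] gn by (simp add: y_def)
    then have "- (n \<bullet> y) \<le> C / c * (norm y)\<^sup>2"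
      using c by (simp add: abs_le_iff field_simps)
    then have "A * (norm y)\<^sup>2 \<le> C / c * (norm y)\<^sup>2" using \<open>A * (norm y)\<^sup>2 \<le> - (n \<bullet> y)\<close> by linarith
    moreover have "C / c * (norm y)\<^sup>2 < A * (norm y)\<^sup>2" using A(2) y by (intro mult_strict_right_mono) auto
    ultimately show False by linarith
  qed
  \<comment> \<open>For \<open>s < c / C\<close> the linear decrease \<open>- c * s\<close> of
    \<open>\<rho>\<close> in the direction \<open>- n\<close> outweighs the remainder
    \<open>C * s^2\<close>.\<close>
  define s0 where "s0 = min \<delta> (c / C)"
  have s0: "s0 > 0" using \<delta> c C by (simp add: s0_def)
  have inside: "x0 - s *\<^sub>R n \<in> \<Omega>" if s: "0 < s" "s < s0" for s
  proof -
    have ns: "norm ((x0 - s *\<^sub>R n) - x0) = s" using n1 s by simp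
    have sd: "s < \<delta>" "s < c / C" using s by (auto simp: s0_def)
    have sm: "norm ((x0 - s *\<^sub>R n) - x0) < \<delta>" using ns sd by simp
    have nn: "n \<bullet> n = 1" using n1 by (simp add: dot_square_norm)
    have "\<bar>\<rho> (x0 - s *\<^sub>R n) + c * s\<bar> \<le> C * s\<^sup>2"
      using taylor[OF sm] unfolding ns zero[OF x0 U] gn by (simp add: nn mult.commute)
    then have "\<rho> (x0 - s *\<^sub>R n) \<le> s * (C * s - c)" by (simp add: power2_eq_square algebra_simps)
    moreover have "s * (C * s - c) < 0" using s sd C by (intro mult_pos_neg) (auto simp: field_simps)
    ultimately have "x0 - s *\<^sub>R n \<in> {x \<in> U. \<rho> x < 0}" using inU[OF sm] by simp
    then show ?thesis using \<Omega>U by blast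
  qed
  show ?thesis by (rule that[OF out n1 A(1) s0 only inside])
qed

text \<open>A barrier argument: at a negative minimum of \<open>u + \<theta> * exp (K * t)\<close>
  the sign of \<open>F\<close> leaves the derivative of \<open>u\<close> at least
  \<open>- m * exp (K * t) / \<epsilon>\<close>, while the barrier grows at twice that rate because
  \<open>\<theta> * K = 2 * m / \<epsilon>\<close>. The factor 2 makes the contradiction
  strict.\<close>

lemma ode_lower_bound:
  fixes u v :: "real \<Rightarrow> real"
  assumes eps: "0 < \<epsilon>" and K: "0 < K" and m: "0 < m"
    and F: "\<And>y. y < 0 \<Longrightarrow> F y \<le> 0" and u0: "0 \<le> u 0" and c: "continuous_on {0..T} u"
    and D: "\<And>t. 0 < t \<Longrightarrow> (u has_real_derivative (v t - F (u t)) / \<epsilon>) (at t)"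
    and v: "\<And>t. t \<in> {0..T} \<Longrightarrow> - m * exp (K * t) \<le> v t" and t: "t \<in> {0..T}"
  shows "- (2 * m / (\<epsilon> * K)) * exp (K * t) \<le> u t"
proof (rule ccontr)
  define \<theta> where "\<theta> = 2 * m / (\<epsilon> * K)"
  have \<theta>: "\<theta> > 0" "\<theta> * K = 2 * m / \<epsilon>" using m eps K by (auto simp: \<theta>_def)
  define y where "y s = u s + \<theta> * exp (K * s)" for s
  assume "\<not> - (2 * m / (\<epsilon> * K)) * exp (K * t) \<le> u t"
  then have yt: "y t < 0" by (simp add: y_def \<theta>_def)
  have "continuous_on {0..t} y" unfolding y_def using c t by (intro continuous_intros continuous_on_subset[OF c]) auto
  then obtain t1 where t1: "t1 \<in> {0..t}" "\<And>s. s \<in> {0..t} \<Longrightarrow> y t1 \<le> y s"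
    using continuous_attains_inf[of "{0..t}" y] t by auto
  have y1: "y t1 < 0" using t1(2)[of t] yt t by auto
  have "y 0 > 0" using u0 \<theta> by (simp add: y_def)
  then have pos: "t1 > 0" using y1 t1 by (cases "t1 = 0") auto
  have "(y has_real_derivative (v t1 - F (u t1)) / \<epsilon> + \<theta> * (K * exp (K * t1))) (at t1)"
    unfolding y_def by (auto intro!: derivative_eq_intros D[OF pos])
  then have D0: "(v t1 - F (u t1)) / \<epsilon> + \<theta> * (K * exp (K * t1)) \<le> 0"
    by (rule derivative_nonpos_at_right_end_min[OF _ pos]) (use t1 in auto)
  have "u t1 < 0"
  proof -
    have "0 < \<theta> * exp (K * t1)" using \<theta> by simp
    then show ?thesis using y1 by (simp add: y_def)
  qed
  then have "F (u t1) \<le> 0" by (rule F)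
  define P where "P = m * exp (K * t1) / \<epsilon>"
  have "(- m * exp (K * t1)) / \<epsilon> \<le> (v t1 - F (u t1)) / \<epsilon>"
    using v[of t1] t1 t eps \<open>F (u t1) \<le> 0\<close> by (intro divide_right_mono) auto
  then have "- P \<le> (v t1 - F (u t1)) / \<epsilon>" by (simp add: P_def)
  moreover have "\<theta> * (K * exp (K * t1)) = 2 * P"
    using \<theta>(2) by (simp add: P_def mult.assoc[symmetric])
  moreover have "0 < P" using m eps by (simp add: P_def)
  ultimately show False using D0 by linarith
qed

text \<open>A minimum principle for a system in which only \<open>v\<close> diffuses. If
  \<open>w = exp (- K * t) * v\<close> had the negative minimum \<open>- m\<close>, then
  \<open>ode_lower_bound\<close> would keep \<open>u\<close> above a multiple of
  \<open>- m / K\<close>, apart from the exponential; for large \<open>K\<close> the loss through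
  \<open>F u / \<epsilon>\<close> is then smaller than the damping produced by the exponential
  factor. A minimum on the boundary is treated by adding a small multiple of the tangent ball
  function: the perturbed minimum is interior or at \<open>x0\<close>, and at \<open>x0\<close> it
  contradicts the Neumann condition, because the perturbation has a nonzero normal derivative
  there.\<close>

lemma classical_solution_nonneg_v:
  fixes \<Omega> :: "'a::euclidean_space set"
  assumes dom: "smooth_bounded_domain \<Omega>" and eps: "0 < \<epsilon>"
    and sol: "classical_solution \<Omega> F \<epsilon> u0 v0 u v"
    and Fneg: "\<And>y. y < 0 \<Longrightarrow> F y \<le> 0" and Fpos: "\<And>y. 0 \<le> y \<Longrightarrow> 0 \<le> F y"
    and Flip: "\<And>R. \<exists>L\<ge>0. \<forall>y\<in>{-R..0}. L * y \<le> F y"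
    and u0: "\<And>x. x \<in> closure \<Omega> \<Longrightarrow> 0 \<le> u0 x" and v0: "\<And>x. x \<in> closure \<Omega> \<Longrightarrow> 0 \<le> v0 x"
    and T: "0 \<le> T" and z: "z \<in> closure \<Omega>"
  shows "0 \<le> v T z"
proof (rule ccontr)
  assume neg: "\<not> 0 \<le> v T z"
  have op: "open \<Omega>" and bd: "bounded \<Omega>" using dom by (auto simp: smooth_bounded_domain_def)
  define X where "X = {0..T} \<times> closure \<Omega>"
  have X: "compact X" unfolding X_def using bd by (intro compact_Times) (auto simp: compact_closure)
  have cu: "continuous_on ({0..} \<times> closure \<Omega>) (\<lambda>(t, x). u t x)"
    and cv: "continuous_on ({0..} \<times> closure \<Omega>) (\<lambda>(t, x). v t x)"
    and init: "\<And>x. x \<in> closure \<Omega> \<Longrightarrow> u 0 x = u0 x \<and> v 0 x = v0 x"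
    and ut: "\<And>t x. 0 < t \<Longrightarrow> x \<in> \<Omega> \<Longrightarrow> ((\<lambda>s. u s x) has_real_derivative (v t x - F (u t x)) / \<epsilon>) (at t)"
    and neu: "\<And>t. 0 < t \<Longrightarrow> neumann_condition \<Omega> (v t)"
    using sol unfolding classical_solution_def by blast+
  obtain vt g H where
    vt: "\<And>t x. 0 < t \<Longrightarrow> x \<in> \<Omega> \<Longrightarrow> ((\<lambda>s. v s x) has_real_derivative vt t x) (at t)"
    and gr: "\<And>t x. 0 < t \<Longrightarrow> x \<in> \<Omega> \<Longrightarrow> GDERIV (v t) x :> g t x"
    and he: "\<And>t x. 0 < t \<Longrightarrow> x \<in> \<Omega> \<Longrightarrow> (g t has_derivative H t x) (at x)"
    and pde: "\<And>t x. 0 < t \<Longrightarrow> x \<in> \<Omega> \<Longrightarrow> vt t x = (\<Sum>b\<in>Basis. H t x b \<bullet> b) + (F (u t x) - v t x) / \<epsilon>"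
    using sol unfolding classical_solution_def by blast
  have XS: "X \<subseteq> {0..} \<times> closure \<Omega>" by (auto simp: X_def)
  have cuX: "continuous_on X (\<lambda>z. u (fst z) (snd z))" and cvX: "continuous_on X (\<lambda>z. v (fst z) (snd z))"
    using continuous_on_subset[OF cu XS] continuous_on_subset[OF cv XS] by (auto simp: case_prod_unfold)
  obtain R where R: "R \<ge> 0" "\<And>z. z \<in> X \<Longrightarrow> \<bar>u (fst z) (snd z)\<bar> \<le> R"
    using compact_bound_abs[OF X cuX] by blast
  obtain L where L: "L \<ge> 0" "\<And>y. y \<in> {-R..0} \<Longrightarrow> L * y \<le> F y" using Flip by blast
  \<comment> \<open>Chosen so that \<open>4 * L / \<epsilon>^2 < K * K\<close>, which is the
    condition for \<open>gap\<close> below to be positive.\<close>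
  define K where "K = 1 + 4 * L / \<epsilon>\<^sup>2"
  have K: "K \<ge> 1" using L(1) by (simp add: K_def)
  have KK: "4 * L / \<epsilon>\<^sup>2 < K * K"
  proof -
    have "4 * L / \<epsilon>\<^sup>2 < K" by (simp add: K_def)
    also have "K * 1 \<le> K * K" using K by (intro mult_left_mono) auto
    finally show ?thesis by simp
  qed
  define w where "w z = exp (- K * fst z) * v (fst z) (snd z)" for z
  have cw: "continuous_on X w" unfolding w_def by (intro continuous_intros cvX)
  have Tz: "(T, z) \<in> X" using T z by (simp add: X_def)
  obtain z0 where z0: "z0 \<in> X" "\<And>y. y \<in> X \<Longrightarrow> w z0 \<le> w y"
    using continuous_attains_inf[OF X _ cw] Tz by blast
  obtain t0 x0 where z0e: "z0 = (t0, x0)" by (cases z0)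
  define m where "m = - w z0"
  have "w z0 \<le> w (T, z)" using z0(2) Tz by blast
  also have "\<dots> < 0" using neg by (simp add: w_def mult_pos_neg)
  finally have m: "m > 0" by (simp add: m_def)
  have wm: "- m \<le> w y" if "y \<in> X" for y using z0(2)[OF that] by (simp add: m_def)
  define \<theta> where "\<theta> = 2 * m / (\<epsilon> * K)"
  have \<theta>: "\<theta> \<ge> 0" using m eps K by (simp add: \<theta>_def)
  have ulow: "- \<theta> * exp (K * t) \<le> u t x" if t: "t \<in> {0..T}" and x: "x \<in> \<Omega>" for t x
    unfolding \<theta>_def
  proof (rule ode_lower_bound[where F=F and v="\<lambda>t. v t x" and T=T])
    have xc: "x \<in> closure \<Omega>" using x closure_subset by blast
    show "0 \<le> u 0 x" using init u0 xc by simp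
    show "continuous_on {0..T} (\<lambda>t. u t x)"
    proof -
      have "continuous_on {0..T} (\<lambda>t. (\<lambda>z. u (fst z) (snd z)) (t, x))"
        by (rule continuous_on_compose2[OF cuX]) (use xc in \<open>auto simp: X_def intro!: continuous_intros\<close>)
      then show ?thesis by simp
    qed
    show "- m * exp (K * t) \<le> v t x" if "t \<in> {0..T}" for t
    proof -
      have "- m \<le> exp (- K * t) * v t x" using wm[of "(t, x)"] that xc by (simp add: X_def w_def)
      then have "- m * exp (K * t) \<le> exp (- K * t) * v t x * exp (K * t)" by (intro mult_right_mono) auto
      also have "\<dots> = v t x" by (simp add: exp_minus field_simps)
      finally show ?thesis .
    qed
  qed (use eps K m Fneg ut x t in auto)
  \<comment> \<open>The damping \<open>K * m / 2\<close> at a point with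
    \<open>w <= - m / 2\<close>, minus the largest loss caused by a negative value of
    \<open>F u\<close>. Working with \<open>m / 2\<close> instead of \<open>m\<close> leaves room
    for the perturbation at boundary minima.\<close>
  define gap where "gap = K * (m / 2) - L * \<theta> / \<epsilon>"
  have gap: "gap > 0"
  proof -
    have "L * \<theta> / \<epsilon> = (4 * L / \<epsilon>\<^sup>2) * (m / 2) / K"
      by (simp add: \<theta>_def power2_eq_square field_simps)
    also have "\<dots> < (K * K) * (m / 2) / K"
      using KK m K by (intro divide_strict_right_mono mult_strict_right_mono) auto
    also have "\<dots> = K * (m / 2)" using K by simp
    finally show ?thesis by (simp add: gap_def)
  qed
  \<comment> \<open>Covers both the unperturbed minimum, with \<open>\<eta> = 0\<close>, and the
    perturbed one, where the quadratic term adds \<open>2 * \<eta> * A\<close> to each second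
    derivative.\<close>
  have interior: False
    if t1: "0 < t1" "t1 \<le> T" and x1: "x1 \<in> \<Omega>" and \<eta>: "0 \<le> \<eta>" "0 \<le> A" "2 * \<eta> * A * real DIM('a) < gap"
      and small: "w (t1, x1) \<le> - m / 2"
      and min: "\<And>t x. t \<in> {0..T} \<Longrightarrow> x \<in> closure \<Omega> \<Longrightarrow>
        w (t1, x1) + \<eta> * (n \<bullet> (x1 - x0) + A * (norm (x1 - x0))\<^sup>2) \<le> w (t, x) + \<eta> * (n \<bullet> (x - x0) + A * (norm (x - x0))\<^sup>2)"
    for t1 x1 n and \<eta> A :: real
  proof -
    define E where "E = exp (- K * t1)"
    have E: "E > 0" by (simp add: E_def)
    have x1c: "x1 \<in> closure \<Omega>" using x1 closure_subset by blast
    have time: "E * vt t1 x1 - K * w (t1, x1) \<le> 0"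
    proof -
      have "((\<lambda>s. exp (- K * s) * v s x1) has_real_derivative E * vt t1 x1 - K * w (t1, x1)) (at t1)"
        unfolding E_def w_def by (auto intro!: derivative_eq_intros vt t1 x1 simp: algebra_simps)
      then show ?thesis
      proof (rule derivative_nonpos_at_right_end_min[OF _ t1(1)])
        fix s assume "0 \<le> s" "s \<le> t1"
        then show "exp (- K * t1) * v t1 x1 \<le> exp (- K * s) * v s x1"
          using min[of s x1] t1 x1c by (simp add: w_def)
      qed
    qed
    have lap: "0 \<le> E * (H t1 x1 b \<bullet> b) + 2 * \<eta> * A" if b: "b \<in> Basis" for b
    proof -
      obtain \<delta> where \<delta>: "\<delta> > 0" "ball x1 \<delta> \<subseteq> \<Omega>" using op x1 open_contains_ball by blast
      have inO: "x1 + s *\<^sub>R b \<in> \<Omega>" if "\<bar>s\<bar> < \<delta>" for s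
        using \<delta>(2) that b by (auto simp: subset_eq dist_norm)
      define \<psi> where "\<psi> s = n \<bullet> (x1 + s *\<^sub>R b - x0) + A * ((x1 + s *\<^sub>R b - x0) \<bullet> (x1 + s *\<^sub>R b - x0))" for s
      define f where "f s = E * v t1 (x1 + s *\<^sub>R b) + \<eta> * \<psi> s" for s
      define f' where "f' s = E * (g t1 (x1 + s *\<^sub>R b) \<bullet> b) + \<eta> * (n \<bullet> b + 2 * A * ((x1 + s *\<^sub>R b - x0) \<bullet> b))" for s
      have bb: "b \<bullet> b = 1" using b by (simp add: inner_Basis)
      have D\<psi>: "(\<psi> has_real_derivative n \<bullet> b + 2 * A * ((x1 + s *\<^sub>R b - x0) \<bullet> b)) (at s)" for s
        unfolding \<psi>_def has_field_derivative_def
        by (auto intro!: derivative_eq_intros simp: inner_commute algebra_simps fun_eq_iff)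
      have Dv: "((\<lambda>s. v t1 (x1 + s *\<^sub>R b)) has_real_derivative g t1 (x1 + s *\<^sub>R b) \<bullet> b) (at s)" if "\<bar>s\<bar> < \<delta>" for s
      proof -
        have "((\<lambda>s. v t1 (x1 + s *\<^sub>R b)) has_derivative (\<lambda>h. (h *\<^sub>R b) \<bullet> g t1 (x1 + s *\<^sub>R b))) (at s)"
          by (rule has_derivative_compose[where g="v t1" and f="\<lambda>s. x1 + s *\<^sub>R b"])
            (use gr[OF t1(1) inO[OF that]] in \<open>auto simp: gderiv_def intro!: derivative_eq_intros\<close>)
        then show ?thesis unfolding has_field_derivative_def
          by (rule has_derivative_eq_rhs) (auto simp: inner_commute)
      qed
      have Dg: "((\<lambda>s. g t1 (x1 + s *\<^sub>R b) \<bullet> b) has_real_derivative H t1 x1 b \<bullet> b) (at 0)"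
      proof -
        have he': "(g t1 has_derivative H t1 x1) (at (x1 + 0 *\<^sub>R b))" using he[OF t1(1) x1] by simp
        have "((\<lambda>s. g t1 (x1 + s *\<^sub>R b)) has_derivative (\<lambda>h. H t1 x1 (h *\<^sub>R b))) (at 0)"
          by (rule has_derivative_compose[where g="g t1" and f="\<lambda>s. x1 + s *\<^sub>R b", OF _ he'])
            (auto intro!: derivative_eq_intros)
        then have "((\<lambda>s. g t1 (x1 + s *\<^sub>R b) \<bullet> b) has_derivative (\<lambda>h. H t1 x1 (h *\<^sub>R b) \<bullet> b)) (at 0)"
          by (rule has_derivative_inner_left)
        then show ?thesis unfolding has_field_derivative_def
          by (rule has_derivative_eq_rhs)
            (auto simp: linear_scale[OF has_derivative_linear[OF he[OF t1(1) x1]]])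
      qed
      have "0 \<le> E * (H t1 x1 b \<bullet> b) + \<eta> * (2 * A * (b \<bullet> b))"
      proof (rule second_derivative_nonneg_at_min[OF \<delta>(1), of f f'])
        show "(f has_real_derivative f' s) (at s)" if "\<bar>s\<bar> < \<delta>" for s
          unfolding f_def f'_def by (intro DERIV_add DERIV_cmult Dv[OF that] D\<psi>)
        have "((\<lambda>s. n \<bullet> b + 2 * A * ((x1 + s *\<^sub>R b - x0) \<bullet> b)) has_real_derivative 2 * A * (b \<bullet> b)) (at 0)"
          unfolding has_field_derivative_def
          by (auto intro!: derivative_eq_intros simp: fun_eq_iff algebra_simps)
        then show "(f' has_real_derivative E * (H t1 x1 b \<bullet> b) + \<eta> * (2 * A * (b \<bullet> b))) (at 0)"
          unfolding f'_def by (intro DERIV_add DERIV_cmult Dg)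
        show "f 0 \<le> f s" if "\<bar>s\<bar> < \<delta>" for s
          using min[of t1 "x1 + s *\<^sub>R b"] t1 inO[OF that] closure_subset[of \<Omega>]
          by (auto simp: f_def \<psi>_def w_def E_def power2_norm_eq_inner subset_eq)
      qed
      then show ?thesis using bb by (simp add: algebra_simps)
    qed
    have "0 \<le> (\<Sum>b\<in>Basis. E * (H t1 x1 b \<bullet> b) + 2 * \<eta> * A)" by (intro sum_nonneg lap)
    then have lap': "- (2 * \<eta> * A * real DIM('a)) \<le> E * (\<Sum>b\<in>Basis. H t1 x1 b \<bullet> b)"
      by (simp add: sum.distrib sum_distrib_left mult_ac)
    have Fu: "- L * \<theta> \<le> E * F (u t1 x1)"
    proof (cases "u t1 x1 < 0")
      case True
      have "\<bar>u t1 x1\<bar> \<le> R" using R(2)[of "(t1, x1)"] t1 x1c by (simp add: X_def)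
      then have "L * u t1 x1 \<le> F (u t1 x1)" using True by (intro L(2)) auto
      moreover have "L * (- \<theta> * exp (K * t1)) \<le> L * u t1 x1"
        using ulow[of t1 x1] t1 x1 L(1) by (intro mult_left_mono) auto
      ultimately have "E * (L * (- \<theta> * exp (K * t1))) \<le> E * F (u t1 x1)"
        using E by (intro mult_left_mono) auto
      moreover have "E * (L * (- \<theta> * exp (K * t1))) = - L * \<theta>"
      proof -
        have "E * (L * (- \<theta> * exp (K * t1))) = - L * \<theta> * (E * exp (K * t1))" by simp
        also have "E * exp (K * t1) = 1" by (simp add: E_def exp_minus)
        finally show ?thesis by simp
      qed
      ultimately show ?thesis by (simp only:)
    next
      case False
      then have "0 \<le> E * F (u t1 x1)" using Fpos E by simp
      moreover have "- L * \<theta> \<le> 0" using L(1) \<theta> by simp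
      ultimately show ?thesis by linarith
    qed
    have "E * vt t1 x1 = E * (\<Sum>b\<in>Basis. H t1 x1 b \<bullet> b) + (E * F (u t1 x1)) / \<epsilon> - w (t1, x1) / \<epsilon>"
      unfolding pde[OF t1(1) x1] by (simp add: w_def E_def algebra_simps diff_divide_distrib)
    moreover have "- L * \<theta> / \<epsilon> \<le> (E * F (u t1 x1)) / \<epsilon>" using Fu eps by (intro divide_right_mono) auto
    moreover have "w (t1, x1) / \<epsilon> \<le> 0" using small m eps by (simp add: divide_nonpos_pos)
    moreover have "K * w (t1, x1) \<le> K * (- m / 2)" using small K by (intro mult_left_mono) auto
    ultimately show False using time lap' \<eta>(3) unfolding gap_def by (simp add: algebra_simps)
  qed
  have t0: "t0 \<in> {0..T}" and x0: "x0 \<in> closure \<Omega>" using z0(1) by (auto simp: z0e X_def)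
  have init_w: "0 \<le> w (0, x)" if "x \<in> closure \<Omega>" for x using init v0 that by (simp add: w_def)
  show False
  proof (cases "x0 \<in> \<Omega>")
    case True
    have "t0 \<noteq> 0" using init_w[OF x0] m z0e m_def by auto
    then show False
      using interior[where ?t1.0=t0 and ?x1.0=x0 and \<eta>=0 and A=0 and n=0] t0 True gap m z0(2) by (auto simp: z0e X_def m_def)
  next
    case False
    then have fr: "x0 \<in> frontier \<Omega>" using x0 op by (simp add: frontier_def interior_open)
    obtain n A s0 where n: "outward_unit_normal \<Omega> x0 n" "norm n = 1" "0 < A" "0 < s0"
      "\<And>x. x \<in> frontier \<Omega> \<Longrightarrow> n \<bullet> (x - x0) + A * (norm (x - x0))\<^sup>2 \<le> 0 \<Longrightarrow> x = x0"
      "\<And>s. 0 < s \<Longrightarrow> s < s0 \<Longrightarrow> x0 - s *\<^sub>R n \<in> \<Omega>"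
      using frontier_interior_parabola[OF dom fr] by blast
    define \<psi> where "\<psi> x = n \<bullet> (x - x0) + A * (norm (x - x0))\<^sup>2" for x
    have \<psi>_low: "- (1 / (4 * A)) \<le> \<psi> x" for x
    proof -
      let ?y = "norm (x - x0)"
      have "- ?y \<le> n \<bullet> (x - x0)" using Cauchy_Schwarz_ineq2[of n "x - x0"] n(2) by simp
      moreover have "0 \<le> (2 * A * ?y - 1)\<^sup>2 / (4 * A)" using n(3) by simp
      moreover have "(2 * A * ?y - 1)\<^sup>2 / (4 * A) = A * ?y\<^sup>2 - ?y + 1 / (4 * A)"
        using n(3) by (simp add: power2_eq_square field_simps)
      ultimately show ?thesis unfolding \<psi>_def by linarith
    qed
    \<comment> \<open>The first bound keeps \<open>\<eta> * \<psi>\<close> above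
      \<open>- m / 4\<close>, so the perturbed minimum still has \<open>w <= - m / 2\<close>; the
      second keeps the added Laplacian below \<open>gap\<close>.\<close>
    define \<eta> where "\<eta> = min (A * m) (gap / ((2 * A) * (2 * (real DIM('a) + 1))))"
    have \<eta>: "\<eta> > 0" unfolding \<eta>_def using n(3) m gap by simp
    have \<eta>1: "\<eta> * (1 / (4 * A)) \<le> m / 4"
    proof -
      have "\<eta> * (1 / (4 * A)) \<le> (A * m) * (1 / (4 * A))" using n(3) by (intro mult_right_mono) (auto simp: \<eta>_def)
      also have "\<dots> = m / 4" using n(3) by simp
      finally show ?thesis .
    qed
    have \<eta>2: "2 * \<eta> * A * real DIM('a) < gap"
    proof -
      define N where "N = real DIM('a)"
      have N: "N > 0" by (simp add: N_def)
      have "2 * \<eta> * A * N = \<eta> * (2 * A * N)" by simp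
      also have "\<dots> \<le> gap / ((2 * A) * (2 * (N + 1))) * (2 * A * N)"
        using n(3) N by (intro mult_right_mono) (auto simp: \<eta>_def N_def)
      also have "\<dots> = gap * (N / (2 * (N + 1)))" using n(3) by simp
      also have "\<dots> < gap * 1" using gap N by (intro mult_strict_left_mono) auto
      finally show ?thesis by (simp add: N_def)
    qed
    have c\<psi>: "continuous_on X (\<lambda>z. w z + \<eta> * \<psi> (snd z))"
      unfolding \<psi>_def by (intro continuous_intros cw)
    obtain z1 where z1: "z1 \<in> X" "\<And>y. y \<in> X \<Longrightarrow> w z1 + \<eta> * \<psi> (snd z1) \<le> w y + \<eta> * \<psi> (snd y)"
      using continuous_attains_inf[OF X _ c\<psi>] Tz by blast
    obtain t1 x1 where z1e: "z1 = (t1, x1)" by (cases z1)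
    have t1: "t1 \<in> {0..T}" and x1: "x1 \<in> closure \<Omega>" using z1(1) by (auto simp: z1e X_def)
    have le: "w (t1, x1) + \<eta> * \<psi> x1 \<le> - m"
      using z1(2)[OF z0(1)] by (simp add: z1e z0e m_def \<psi>_def)
    \<comment> \<open>Comparison with \<open>z0\<close>, where \<open>\<psi>\<close> vanishes and
      \<open>w\<close> is minimal, makes \<open>\<psi> x1\<close> nonpositive; hence a minimum on
      the frontier can only be at \<open>x0\<close>.\<close>
    have \<psi>1: "\<psi> x1 \<le> 0"
    proof -
      have "\<eta> * \<psi> x1 \<le> 0" using le wm[OF z1(1)] by (simp add: z1e)
      then show ?thesis using \<eta> by (simp add: mult_le_0_iff)
    qed
    have low: "- (m / 4) \<le> \<eta> * \<psi> x1"
      using mult_left_mono[OF \<psi>_low[of x1], of \<eta>] \<eta> \<eta>1 by simp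
    have t1p: "0 < t1"
    proof (rule ccontr)
      assume "\<not> 0 < t1"
      then have "0 \<le> w (t1, x1)" using t1 init_w[OF x1] by auto
      then show False using le low m by linarith
    qed
    show False
    proof (cases "x1 \<in> \<Omega>")
      case True
      have "w (t1, x1) \<le> - m / 2" using le low m by linarith
      then show False
        using interior[where ?t1.0=t1 and ?x1.0=x1 and \<eta>=\<eta> and A=A and n=n] t1p t1 True \<eta> n(3) \<eta>2 z1(2) unfolding z1e \<psi>_def X_def by auto
    next
      case False
      then have "x1 \<in> frontier \<Omega>" using x1 op by (simp add: frontier_def interior_open)
      then have x1e: "x1 = x0" using n(5) \<psi>1 by (simp add: \<psi>_def)
      define E where "E = exp (- K * t1)"
      \<comment> \<open>Minimality at \<open>x0\<close> makes the difference quotients of the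
        perturbed function along the normal, taken from inside, nonpositive. Their limit is
        \<open>\<eta>\<close>: the part from \<open>v\<close> vanishes by the Neumann condition and
        \<open>\<psi>\<close> contributes slope 1.\<close>
      let ?q = "\<lambda>s. (v t1 x0 - v t1 (x0 - s *\<^sub>R n)) / s"
      have lim: "((\<lambda>s. E * ?q s + \<eta> * (1 - A * s)) \<longlongrightarrow> E * 0 + \<eta> * (1 - A * 0)) (at_right 0)"
        using neu[OF t1p] fr n(1) unfolding neumann_condition_def by (intro tendsto_intros) auto
      have "\<forall>\<^sub>F s in at_right 0. E * ?q s + \<eta> * (1 - A * s) \<le> 0"
        unfolding eventually_at_right_field
      proof (intro exI conjI allI impI)
        fix s assume s: "0 < s" "s < s0"
        have "x0 - s *\<^sub>R n \<in> closure \<Omega>" using n(6)[OF s] closure_subset by blast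
        then have "w (t1, x0) + \<eta> * \<psi> x0 \<le> w (t1, x0 - s *\<^sub>R n) + \<eta> * \<psi> (x0 - s *\<^sub>R n)"
          using z1(2)[of "(t1, x0 - s *\<^sub>R n)"] t1 by (simp add: z1e x1e X_def)
        moreover have "\<psi> x0 = 0" "\<psi> (x0 - s *\<^sub>R n) = - s + A * s\<^sup>2"
          using n(2) s by (auto simp: \<psi>_def dot_square_norm)
        ultimately have "E * (v t1 x0 - v t1 (x0 - s *\<^sub>R n)) + \<eta> * (s - A * s\<^sup>2) \<le> 0"
          by (simp add: w_def E_def algebra_simps)
        then have "(E * (v t1 x0 - v t1 (x0 - s *\<^sub>R n)) + \<eta> * (s - A * s\<^sup>2)) / s \<le> 0"
          using s by (simp add: divide_nonpos_pos)
        moreover have "(E * (v t1 x0 - v t1 (x0 - s *\<^sub>R n)) + \<eta> * (s - A * s\<^sup>2)) / s = E * ?q s + \<eta> * (1 - A * s)"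
          using s by (simp add: field_simps power2_eq_square)
        ultimately show "E * ?q s + \<eta> * (1 - A * s) \<le> 0" by simp
      qed (rule n(4))
      from tendsto_upperbound[OF lim this] show False using \<eta> by simp
    qed
  qed
qed

lemma classical_solution_nonneg:
  fixes \<Omega> :: "'a::euclidean_space set"
  assumes dom: "smooth_bounded_domain \<Omega>" and eps: "0 < \<epsilon>"
    and sol: "classical_solution \<Omega> F \<epsilon> u0 v0 u v"
    and Fneg: "\<And>y. y < 0 \<Longrightarrow> F y \<le> 0" and Fpos: "\<And>y. 0 \<le> y \<Longrightarrow> 0 \<le> F y"
    and Flip: "\<And>R. \<exists>L\<ge>0. \<forall>y\<in>{-R..0}. L * y \<le> F y"
    and u0: "\<And>x. x \<in> closure \<Omega> \<Longrightarrow> 0 \<le> u0 x" and v0: "\<And>x. x \<in> closure \<Omega> \<Longrightarrow> 0 \<le> v0 x"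
    and T: "0 \<le> T" and z: "z \<in> closure \<Omega>"
  shows "0 \<le> v T z" and "z \<in> \<Omega> \<Longrightarrow> 0 \<le> u T z"
proof -
  have v: "0 \<le> v t x" if "0 \<le> t" "x \<in> closure \<Omega>" for t x
    by (rule classical_solution_nonneg_v[OF dom eps sol Fneg Fpos Flip u0 v0 that])
  show "0 \<le> v T z" by (rule v[OF T z])
  assume zO: "z \<in> \<Omega>"
  have cu: "continuous_on ({0..} \<times> closure \<Omega>) (\<lambda>(t, x). u t x)"
    and init: "u 0 z = u0 z"
    and ut: "\<And>t. 0 < t \<Longrightarrow> ((\<lambda>s. u s z) has_real_derivative (v t z - F (u t z)) / \<epsilon>) (at t)"
    using sol zO z unfolding classical_solution_def by blast+
  have "- u T z \<le> 0 + e" if "0 < e" for e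
  proof -
    \<comment> \<open>As \<open>v >= 0\<close>, the barrier argument is open to every positive
      \<open>m\<close>; this one, with rate 1 for \<open>K\<close>, makes the lower bound at time
      \<open>T\<close> equal to \<open>- e\<close>.\<close>
    define m where "m = e * \<epsilon> / (2 * exp T)"
    have m: "m > 0" using that eps by (simp add: m_def)
    have "- (2 * m / (\<epsilon> * 1)) * exp (1 * T) \<le> u T z"
    proof (rule ode_lower_bound[OF eps _ m Fneg, where v="\<lambda>t. v t z" and T=T])
      show "continuous_on {0..T} (\<lambda>t. u t z)"
      proof -
        have "continuous_on {0..T} (\<lambda>t. (\<lambda>(t, x). u t x) (t, z))"
          by (rule continuous_on_compose2[OF cu]) (use z in \<open>auto intro!: continuous_intros\<close>)
        then show ?thesis by simp
      qed
      show "- m * exp (1 * t) \<le> v t z" if "t \<in> {0..T}" for t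
        by (rule order_trans[OF _ v[of t z]]) (use m that z in auto)
    qed (use init u0[OF z] ut T in auto)
    also have "- (2 * m / (\<epsilon> * 1)) * exp (1 * T) = - e" using eps by (simp add: m_def)
    finally show ?thesis by simp
  qed
  then have "- u T z \<le> 0" by (rule field_le_epsilon)
  then show "0 \<le> u T z" by simp
qed

text \<open>Upper bounds for \<open>u\<close> and \<open>v\<close> are lower bounds for
  \<open>M - u\<close> and \<open>N - v\<close>, which solve a system of the same form with the
  reflected reaction.\<close>

lemma classical_solution_reflect:
  assumes sol: "classical_solution \<Omega> F \<epsilon> u0 v0 u v"
  shows "classical_solution \<Omega> (\<lambda>y. N - F (M - y)) \<epsilon> (\<lambda>x. M - u0 x) (\<lambda>x. N - v0 x)
    (\<lambda>t x. M - u t x) (\<lambda>t x. N - v t x)"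
proof -
  obtain vt g H where
    c: "continuous_on ({0<..} \<times> closure \<Omega>) (\<lambda>(t, x). vt t x)" "continuous_on ({0<..} \<times> closure \<Omega>) (\<lambda>(t, x). g t x)"
      "\<And>b. b \<in> Basis \<Longrightarrow> continuous_on ({0<..} \<times> closure \<Omega>) (\<lambda>(t, x). H t x b)"
    and d: "\<And>t x. 0 < t \<Longrightarrow> x \<in> \<Omega> \<Longrightarrow> ((\<lambda>s. v s x) has_real_derivative vt t x) (at t)"
      "\<And>t x. 0 < t \<Longrightarrow> x \<in> \<Omega> \<Longrightarrow> GDERIV (v t) x :> g t x"
      "\<And>t x. 0 < t \<Longrightarrow> x \<in> \<Omega> \<Longrightarrow> (g t has_derivative H t x) (at x)"
      "\<And>t x. 0 < t \<Longrightarrow> x \<in> \<Omega> \<Longrightarrow> vt t x = (\<Sum>b\<in>Basis. H t x b \<bullet> b) + (F (u t x) - v t x) / \<epsilon>"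
    using sol unfolding classical_solution_def by blast
  have s: "continuous_on ({0..} \<times> closure \<Omega>) (\<lambda>(t, x). u t x)" "continuous_on ({0..} \<times> closure \<Omega>) (\<lambda>(t, x). v t x)"
    "\<And>x. x \<in> closure \<Omega> \<Longrightarrow> u 0 x = u0 x \<and> v 0 x = v0 x"
    "\<And>t x. 0 < t \<Longrightarrow> x \<in> \<Omega> \<Longrightarrow> ((\<lambda>s. u s x) has_real_derivative (v t x - F (u t x)) / \<epsilon>) (at t)"
    "\<And>t. 0 < t \<Longrightarrow> neumann_condition \<Omega> (v t)"
    using sol unfolding classical_solution_def by blast+
  have neu: "neumann_condition \<Omega> (\<lambda>x. N - v t x)" if "0 < t" for t
    unfolding neumann_condition_def
  proof (intro ballI allI impI)
    fix x n assume "x \<in> frontier \<Omega>" "outward_unit_normal \<Omega> x n"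
    then have "((\<lambda>s. (v t x - v t (x - s *\<^sub>R n)) / s) \<longlongrightarrow> 0) (at_right 0)"
      using s(5)[OF that] unfolding neumann_condition_def by blast
    from tendsto_minus[OF this]
    show "((\<lambda>s. (N - v t x - (N - v t (x - s *\<^sub>R n))) / s) \<longlongrightarrow> 0) (at_right 0)"
      by (simp add: minus_divide_left)
  qed
  have du: "((\<lambda>s. M - u s x) has_real_derivative ((N - v t x) - (N - F (M - (M - u t x)))) / \<epsilon>) (at t)"
    if "0 < t" "x \<in> \<Omega>" for t x
    using DERIV_diff[OF DERIV_const s(4)[OF that], of M] by (simp add: minus_divide_left)
  have dv: "((\<lambda>s. N - v s x) has_real_derivative - vt t x) (at t) \<and> (GDERIV (\<lambda>x. N - v t x) x :> - g t x) \<and>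
      ((\<lambda>x. - g t x) has_derivative (\<lambda>b. - H t x b)) (at x) \<and>
      - vt t x = (\<Sum>b\<in>Basis. - H t x b \<bullet> b) + ((N - F (M - (M - u t x))) - (N - v t x)) / \<epsilon>"
    if "0 < t" "x \<in> \<Omega>" for t x
  proof (intro conjI)
    show "((\<lambda>s. N - v s x) has_real_derivative - vt t x) (at t)"
      using DERIV_diff[OF DERIV_const d(1)[OF that], of N] by simp
    show "GDERIV (\<lambda>x. N - v t x) x :> - g t x"
      using GDERIV_diff[OF GDERIV_const d(2)[OF that], of N] by simp
    show "((\<lambda>x. - g t x) has_derivative (\<lambda>b. - H t x b)) (at x)"
      by (rule has_derivative_minus[OF d(3)[OF that]])
    show "- vt t x = (\<Sum>b\<in>Basis. - H t x b \<bullet> b) + ((N - F (M - (M - u t x))) - (N - v t x)) / \<epsilon>"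
      unfolding d(4)[OF that] by (simp add: sum_negf diff_divide_distrib)
  qed
  show ?thesis
    unfolding classical_solution_def
  proof (intro conjI exI[of _ "\<lambda>t x. - vt t x"] exI[of _ "\<lambda>t x. - g t x"] exI[of _ "\<lambda>t x b. - H t x b"] ballI allI impI)
    show "continuous_on ({0..} \<times> closure \<Omega>) (\<lambda>(t, x). M - u t x)"
      "continuous_on ({0..} \<times> closure \<Omega>) (\<lambda>(t, x). N - v t x)"
      using s(1,2) by (auto simp: case_prod_unfold intro!: continuous_intros)
    show "continuous_on ({0<..} \<times> closure \<Omega>) (\<lambda>(t, x). - vt t x)"
      "continuous_on ({0<..} \<times> closure \<Omega>) (\<lambda>(t, x). - g t x)"
      using c(1,2) by (auto simp: case_prod_unfold intro!: continuous_intros)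
    show "continuous_on ({0<..} \<times> closure \<Omega>) (\<lambda>(t, x). - H t x b)" if "b \<in> Basis" for b
      using c(3)[OF that] by (auto simp: case_prod_unfold intro!: continuous_intros)
    show "M - u 0 x = M - u0 x" "N - v 0 x = N - v0 x" if "x \<in> closure \<Omega>" for x
      using s(3)[OF that] by simp_all
  qed ((rule du dv[THEN conjunct1] dv[THEN conjunct2, THEN conjunct1] dv[THEN conjunct2, THEN conjunct2, THEN conjunct1]
      dv[THEN conjunct2, THEN conjunct2, THEN conjunct2] neu; assumption)+)
qed

section \<open>Bounds uniform in \<epsilon> and the passage to the interior setting\<close>

lemma C1_lower_linear_bound:
  fixes G :: "real \<Rightarrow> real"
  assumes G: "\<And>x. (G has_real_derivative G' x) (at x)" and G': "continuous_on UNIV G'" and G0: "G 0 = 0"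
  shows "\<exists>L\<ge>0. \<forall>y\<in>{-R..0}. L * y \<le> G y"
proof -
  obtain L where L: "L \<ge> 0" "\<And>x. x \<in> {-R..0} \<Longrightarrow> \<bar>G' x\<bar> \<le> L"
    using compact_bound_abs[OF compact_Icc continuous_on_subset[OF G']] by blast
  have "L * y \<le> G y" if y: "y \<in> {-R..0}" for y
  proof -
    have "norm (G y - G 0) \<le> L * norm (y - 0)"
      by (rule field_differentiable_bound[of "{-R..0}" G G'])
        (use L y G in \<open>auto intro: has_field_derivative_at_within\<close>)
    then show ?thesis using y G0 by (simp add: abs_le_iff)
  qed
  then show ?thesis using L(1) by blast
qed

context reaction
begin

lemma F_le_top: "bp \<le> N \<Longrightarrow> x \<le> N \<Longrightarrow> F x \<le> F N"
proof -
  assume N: "bp \<le> N" "x \<le> N"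
  have top: "F ap \<le> F N" using F_mono3[of bp N] N order by (cases "bp = N") auto
  consider "x \<le> ap" | "ap \<le> x" "x \<le> bm" | "bm \<le> x" by linarith
  then show "F x \<le> F N"
  proof cases
    case 1 then show ?thesis using F_mono1[of x ap] top by (cases "x = ap") auto
  next
    case 2 then show ?thesis using F_anti2[of ap x] top by (cases "x = ap") auto
  next
    case 3 then show ?thesis using F_mono3[of x N] N by (cases "x = N") auto
  qed
qed

text \<open>The pair \<open>(N, F N)\<close> is a stationary state above the initial data, and
  \<open>F x <= F N\<close> for \<open>x <= N\<close> as soon as \<open>N >= bp\<close>. Reflected
  at this state, the reaction vanishes at 0 and has the signs required by the minimum principle, so
  the upper bounds follow from the lower ones. \<open>M\<close> is chosen from the data alone and
  does not involve \<epsilon>.\<close>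

lemma uniform_bounds:
  fixes \<Omega> :: "'a::euclidean_space set"
  assumes dom: "smooth_bounded_domain \<Omega>"
    and c0: "continuous_on (closure \<Omega>) u0" "continuous_on (closure \<Omega>) v0"
    and u0: "\<And>x. x \<in> closure \<Omega> \<Longrightarrow> 0 \<le> u0 x" and v0: "\<And>x. x \<in> closure \<Omega> \<Longrightarrow> 0 \<le> v0 x"
  shows "\<exists>M\<ge>bp. \<forall>\<epsilon> u v. 0 < \<epsilon> \<longrightarrow> classical_solution \<Omega> F \<epsilon> u0 v0 u v \<longrightarrow>
    (\<forall>t\<ge>0. \<forall>x\<in>\<Omega>. u t x \<in> {0..M} \<and> v t x \<in> {0..M} \<and> F (u t x) \<in> {0..M})"
proof -
  have cpt: "compact (closure \<Omega>)" using dom by (simp add: smooth_bounded_domain_def compact_closure)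
  obtain B1 where B1: "B1 \<ge> 0" "\<And>x. x \<in> closure \<Omega> \<Longrightarrow> \<bar>u0 x\<bar> \<le> B1" using compact_bound_abs[OF cpt c0(1)] by blast
  obtain B2 where B2: "B2 \<ge> 0" "\<And>x. x \<in> closure \<Omega> \<Longrightarrow> \<bar>v0 x\<bar> \<le> B2" using compact_bound_abs[OF cpt c0(2)] by blast
  have "\<forall>\<^sub>F N in at_top. B2 \<le> F N \<and> max bp B1 \<le> N"
    using F_top eventually_ge_at_top[of "max bp B1"] by (auto simp: filterlim_at_top intro: eventually_conj)
  then obtain N where "B2 \<le> F N \<and> max bp B1 \<le> N" unfolding eventually_at_top_linorder by blast
  then have N: "B2 \<le> F N" "bp \<le> N" "B1 \<le> N" by auto
  obtain F' where F': "continuous_on UNIV F'" "\<And>x. (F has_real_derivative F' x) (at x)" using DERIV_F by blast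
  define G where "G y = F N - F (N - y)" for y
  have G: "(G has_real_derivative F' (N - y)) (at y)" for y
  proof -
    have "((\<lambda>y. N - y) has_real_derivative - 1) (at y)" by (auto intro!: derivative_eq_intros)
    from DERIV_diff[OF DERIV_const DERIV_chain2[OF F'(2) this], of "F N"]
    show ?thesis by (simp add: G_def[abs_def])
  qed
  have G': "continuous_on UNIV (\<lambda>y. F' (N - y))"
    by (rule continuous_on_compose2[OF F'(1)]) (auto intro!: continuous_intros)
  have "u t x \<in> {0..max N (F N)} \<and> v t x \<in> {0..max N (F N)} \<and> F (u t x) \<in> {0..max N (F N)}"
    if eps: "0 < \<epsilon>" and sol: "classical_solution \<Omega> F \<epsilon> u0 v0 u v" and t: "0 \<le> t" and x: "x \<in> \<Omega>" for \<epsilon> u v t x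
  proof -
    have xc: "x \<in> closure \<Omega>" using x closure_subset by blast
    have Fn: "F y \<le> 0" if "y < 0" for y using F_mono1[of y 0] that order by auto
    have lower_v: "0 \<le> v t x" by (rule classical_solution_nonneg(1)[OF dom eps sol Fn F_nonneg C1_lower_linear_bound[OF F'(2,1) order(7)] u0 v0 t xc])
    have lower_u: "0 \<le> u t x" by (rule classical_solution_nonneg(2)[OF dom eps sol Fn F_nonneg C1_lower_linear_bound[OF F'(2,1) order(7)] u0 v0 t xc x])
    have "0 \<le> N - u0 x" "0 \<le> F N - v0 x" if "x \<in> closure \<Omega>" for x
      using B1(2)[OF that] B2(2)[OF that] N by auto
    moreover have "G y \<le> 0" if "y < 0" for y using F_mono3[of N "N - y"] N order that by (simp add: G_def)
    moreover have "0 \<le> G y" if "0 \<le> y" for y using F_le_top[OF N(2), of "N - y"] that by (simp add: G_def)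
    moreover have "\<exists>L\<ge>0. \<forall>y\<in>{-R..0}. L * y \<le> G y" for R
      by (rule C1_lower_linear_bound[OF G G']) (simp add: G_def)
    moreover have "classical_solution \<Omega> G \<epsilon> (\<lambda>x. N - u0 x) (\<lambda>x. F N - v0 x) (\<lambda>t x. N - u t x) (\<lambda>t x. F N - v t x)"
      unfolding G_def[abs_def] by (rule classical_solution_reflect[OF sol])
    ultimately have upper: "0 \<le> F N - v t x" "0 \<le> N - u t x"
      using classical_solution_nonneg[OF dom eps, of G "\<lambda>x. N - u0 x" "\<lambda>x. F N - v0 x" "\<lambda>t x. N - u t x" "\<lambda>t x. F N - v t x" t x]
        t xc x by blast+
    have "0 \<le> F (u t x)" "F (u t x) \<le> F N"
      using F_nonneg[OF lower_u] F_le_top[OF N(2), of "u t x"] upper(2) by simp_all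
    then show ?thesis using upper lower_u lower_v by (simp add: le_max_iff_disj)
  qed
  then show ?thesis using N(2) by (intro exI[of _ "max N (F N)"]) auto
qed

text \<open>Only the open cylinder is kept. The components \<open>g t x \<bullet> b\<close> of the
  gradient and the diagonal entries \<open>H t x b \<bullet> b\<close> of the Hessian are the
  derivatives asked for by the interior setting.\<close>

lemma rd_solution_of_classical_solution:
  fixes \<Omega> :: "'a::euclidean_space set"
  assumes op: "open \<Omega>" and eps: "0 < \<epsilon>" and sol: "classical_solution \<Omega> F \<epsilon> u0 v0 u v"
    and bounds: "\<And>t x. 0 \<le> t \<Longrightarrow> x \<in> \<Omega> \<Longrightarrow> u t x \<in> {0..M} \<and> v t x \<in> {0..M} \<and> F (u t x) \<in> {0..M}"
  shows "\<exists>vt g h. rd_solution ({0<..<T} \<times> \<Omega>) F \<epsilon> M (\<lambda>(t, x). u t x) (\<lambda>(t, x). v t x) vt g h"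
proof -
  obtain vt g H where
    c: "continuous_on ({0<..} \<times> closure \<Omega>) (\<lambda>(t, x). vt t x)" "continuous_on ({0<..} \<times> closure \<Omega>) (\<lambda>(t, x). g t x)"
      "\<And>b. b \<in> Basis \<Longrightarrow> continuous_on ({0<..} \<times> closure \<Omega>) (\<lambda>(t, x). H t x b)"
    and d: "\<And>t x. 0 < t \<Longrightarrow> x \<in> \<Omega> \<Longrightarrow> ((\<lambda>s. v s x) has_real_derivative vt t x) (at t)"
      "\<And>t x. 0 < t \<Longrightarrow> x \<in> \<Omega> \<Longrightarrow> GDERIV (v t) x :> g t x"
      "\<And>t x. 0 < t \<Longrightarrow> x \<in> \<Omega> \<Longrightarrow> (g t has_derivative H t x) (at x)"
      "\<And>t x. 0 < t \<Longrightarrow> x \<in> \<Omega> \<Longrightarrow> vt t x = (\<Sum>b\<in>Basis. H t x b \<bullet> b) + (F (u t x) - v t x) / \<epsilon>"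
    using sol unfolding classical_solution_def by blast
  have s: "continuous_on ({0..} \<times> closure \<Omega>) (\<lambda>(t, x). u t x)" "continuous_on ({0..} \<times> closure \<Omega>) (\<lambda>(t, x). v t x)"
    "\<And>t x. 0 < t \<Longrightarrow> x \<in> \<Omega> \<Longrightarrow> ((\<lambda>s. u s x) has_real_derivative (v t x - F (u t x)) / \<epsilon>) (at t)"
    using sol unfolding classical_solution_def by blast+
  let ?Q = "{0<..<T} \<times> \<Omega>"
  have sub: "?Q \<subseteq> {0..} \<times> closure \<Omega>" "?Q \<subseteq> {0<..} \<times> closure \<Omega>" using closure_subset by fastforce+
  note cs = s(1,2)[THEN continuous_on_subset, OF sub(1)] c(1,2)[THEN continuous_on_subset, OF sub(2)]
  have time: "has_dir_deriv (1, 0) (\<lambda>(t, x). k t x) D (t, x)"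
    if "((\<lambda>s. k s x) has_real_derivative D) (at t)" for k :: "real \<Rightarrow> 'a \<Rightarrow> real" and D t x
    using that DERIV_shift[of "\<lambda>s. k s x" D 0 t] by (simp add: has_dir_deriv_def add.commute)
  show ?thesis
  proof (intro exI rd_solution.intro)
    show "open ?Q" using op by (intro open_Times) auto
    show "continuous_on UNIV F" by (rule cont_F)
    show "continuous_on ?Q (\<lambda>(t, x). u t x)" "continuous_on ?Q (\<lambda>(t, x). v t x)" "continuous_on ?Q (\<lambda>(t, x). vt t x)"
      by (rule cs)+
    show "continuous_on ?Q (\<lambda>(t, x). g t x \<bullet> b)" for b
      using cs(4) by (auto simp: case_prod_unfold intro!: continuous_intros)
    show "continuous_on ?Q (\<lambda>(t, x). H t x b \<bullet> b)" if "b \<in> Basis" for b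
      using continuous_on_subset[OF c(3)[OF that] sub(2)] by (auto simp: case_prod_unfold intro!: continuous_intros)
    fix z :: "real \<times> 'a" assume z: "z \<in> ?Q"
    obtain t x where tx: "z = (t, x)" by (cases z)
    have t: "0 < t" and x: "x \<in> \<Omega>" using z tx by auto
    show "has_dir_deriv (1, 0) (\<lambda>(t, x). u t x) (((\<lambda>(t, x). v t x) z - F ((\<lambda>(t, x). u t x) z)) / \<epsilon>) z"
      using time[where k=u and t=t and x=x, OF s(3)[OF t x]] by (simp add: tx)
    show "has_dir_deriv (1, 0) (\<lambda>(t, x). v t x) ((\<lambda>(t, x). vt t x) z) z"
      using time[where k=v and t=t and x=x, OF d(1)[OF t x]] by (simp add: tx)
    show "has_dir_deriv (0, y) (\<lambda>(t, x). v t x) (\<Sum>b\<in>Basis. (y \<bullet> b) * (\<lambda>(t, x). g t x \<bullet> b) z) z" for y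
    proof -
      have g': "(v t has_derivative (\<lambda>h. h \<bullet> g t x)) (at (x + 0 *\<^sub>R y))" using d(2)[OF t x] by (simp add: gderiv_def)
      have "((\<lambda>s. v t (x + s *\<^sub>R y)) has_derivative (\<lambda>h. (h *\<^sub>R y) \<bullet> g t x)) (at 0)"
        by (rule has_derivative_compose[where g="v t" and f="\<lambda>s. x + s *\<^sub>R y", OF _ g'])
          (auto intro!: derivative_eq_intros)
      moreover have "(\<Sum>b\<in>Basis. (y \<bullet> b) * (g t x \<bullet> b)) = y \<bullet> g t x" by (rule euclidean_inner[symmetric])
      ultimately show ?thesis
        by (auto simp: has_dir_deriv_def tx has_field_derivative_def mult.commute elim!: has_derivative_eq_rhs)
    qed
    show "has_dir_deriv (0, b) (\<lambda>(t, x). g t x \<bullet> b) ((\<lambda>(t, x). H t x b \<bullet> b) z) z" for b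
    proof -
      have g': "(g t has_derivative H t x) (at (x + 0 *\<^sub>R b))" using d(3)[OF t x] by simp
      have "((\<lambda>s. g t (x + s *\<^sub>R b)) has_derivative (\<lambda>h. H t x (h *\<^sub>R b))) (at 0)"
        by (rule has_derivative_compose[where g="g t" and f="\<lambda>s. x + s *\<^sub>R b", OF _ g'])
          (auto intro!: derivative_eq_intros)
      then have "((\<lambda>s. g t (x + s *\<^sub>R b) \<bullet> b) has_derivative (\<lambda>h. H t x (h *\<^sub>R b) \<bullet> b)) (at 0)"
        by (rule has_derivative_inner_left)
      then show ?thesis
        by (auto simp: has_dir_deriv_def tx has_field_derivative_def mult.commute
            linear_scale[OF has_derivative_linear[OF d(3)[OF t x]]] elim!: has_derivative_eq_rhs)
    qed
    show "(\<lambda>(t, x). vt t x) z = (\<Sum>b\<in>Basis. (\<lambda>(t, x). H t x b \<bullet> b) z) +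
        (F ((\<lambda>(t, x). u t x) z) - (\<lambda>(t, x). v t x) z) / \<epsilon>"
      using d(4)[OF t x] by (simp add: tx)
    show "(\<lambda>(t, x). u t x) z \<in> {0..M} \<and> (\<lambda>(t, x). v t x) z \<in> {0..M} \<and> F ((\<lambda>(t, x). u t x) z) \<in> {0..M}"
      using bounds[of t x] t x by (simp add: tx)
  qed (rule eps)
qed

end

section \<open>The fast reaction limit\<close>

text \<open>By Lindelof countably many of the balls cover \<open>Q\<close>, so the exceptional null
  sets can be united.\<close>

lemma AE_from_local_balls:
  fixes Q :: "'b::euclidean_space set"
  assumes Q: "open Q" and loc: "\<And>a. a \<in> Q \<Longrightarrow> \<exists>r>0. AE z in lborel. z \<in> ball a r \<longrightarrow> P z"
  shows "AE z in lborel. z \<in> Q \<longrightarrow> P z"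
proof -
  define R where "R a = (SOME r. r > 0 \<and> (AE z in lborel. z \<in> ball a r \<longrightarrow> P z))" for a
  have R: "R a > 0 \<and> (AE z in lborel. z \<in> ball a (R a) \<longrightarrow> P z)" if "a \<in> Q" for a
    unfolding R_def using loc[OF that] by (rule someI_ex)
  define \<F> where "\<F> = (\<lambda>a. ball a (R a)) ` Q"
  have "\<And>S. S \<in> \<F> \<Longrightarrow> open S" by (auto simp: \<F>_def)
  from Lindelof[OF this] obtain \<F>' where F': "\<F>' \<subseteq> \<F>" "countable \<F>'" "\<Union>\<F>' = \<Union>\<F>" by blast
  have "AE z in lborel. \<forall>S\<in>\<F>'. z \<in> S \<longrightarrow> P z"
  proof (subst AE_ball_countable[OF F'(2)], rule ballI)
    fix S assume "S \<in> \<F>'"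
    then obtain a where "a \<in> Q" "S = ball a (R a)" using F'(1) by (auto simp: \<F>_def)
    then show "AE z in lborel. z \<in> S \<longrightarrow> P z" using R by simp
  qed
  then show ?thesis
  proof eventually_elim
    case (elim z)
    show ?case
    proof
      assume z: "z \<in> Q"
      then have "z \<in> ball z (R z)" using R by simp
      then have "z \<in> \<Union>\<F>" unfolding \<F>_def using z by blast
      then show "P z" using elim F'(3) by blast
    qed
  qed
qed

text \<open>Weak-star convergence with one bound valid at every point instead of essentially, so
  that sums and products need no exceptional sets for their bounds; the passage to
  \<open>weak_star_Linf\<close> is made at the end.\<close>

definition weakly_converges :: "'z measure \<Rightarrow> (nat \<Rightarrow> 'z \<Rightarrow> real) \<Rightarrow> ('z \<Rightarrow> real) \<Rightarrow> bool" where
  "weakly_converges M f g \<longleftrightarrow>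
    (\<forall>k. f k \<in> borel_measurable M) \<and> g \<in> borel_measurable M \<and> (\<exists>C. \<forall>z. (\<forall>k. \<bar>f k z\<bar> \<le> C) \<and> \<bar>g z\<bar> \<le> C) \<and>
    (\<forall>\<phi>. integrable M \<phi> \<longrightarrow> (\<lambda>k. \<integral>z. f k z * \<phi> z \<partial>M) \<longlonglongrightarrow> (\<integral>z. g z * \<phi> z \<partial>M))"

lemma integrable_bounded_mult:
  fixes \<phi> f :: "'z \<Rightarrow> real"
  assumes "integrable M \<phi>" "f \<in> borel_measurable M" "\<And>z. \<bar>f z\<bar> \<le> C"
  shows "integrable M (\<lambda>z. f z * \<phi> z)"
proof (rule Bochner_Integration.integrable_bound[where f="\<lambda>z. C * \<phi> z"])
  show "AE z in M. norm (f z * \<phi> z) \<le> norm (C * \<phi> z)"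
  proof (rule AE_I2)
    fix z
    have "\<bar>f z\<bar> * \<bar>\<phi> z\<bar> \<le> \<bar>C\<bar> * \<bar>\<phi> z\<bar>"
      by (rule mult_right_mono) (use assms(3)[of z] in auto)
    then show "norm (f z * \<phi> z) \<le> norm (C * \<phi> z)" by (simp add: abs_mult)
  qed
qed (use assms in auto)

lemma weakly_convergesD:
  assumes "weakly_converges M f g" "integrable M \<phi>"
  shows "(\<lambda>k. \<integral>z. f k z * \<phi> z \<partial>M) \<longlonglongrightarrow> (\<integral>z. g z * \<phi> z \<partial>M)"
    "integrable M (\<lambda>z. f k z * \<phi> z)" "integrable M (\<lambda>z. g z * \<phi> z)"
proof -
  obtain C where "\<And>z. (\<forall>k. \<bar>f k z\<bar> \<le> C) \<and> \<bar>g z\<bar> \<le> C"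
    using assms(1) unfolding weakly_converges_def by blast
  then have C: "\<And>z k. \<bar>f k z\<bar> \<le> C" "\<And>z. \<bar>g z\<bar> \<le> C" by auto
  show "integrable M (\<lambda>z. f k z * \<phi> z)"
    by (rule integrable_bounded_mult[OF assms(2) _ C(1)]) (use assms(1) in \<open>simp add: weakly_converges_def\<close>)
  show "integrable M (\<lambda>z. g z * \<phi> z)"
    by (rule integrable_bounded_mult[OF assms(2) _ C(2)]) (use assms(1) in \<open>simp add: weakly_converges_def\<close>)
  show "(\<lambda>k. \<integral>z. f k z * \<phi> z \<partial>M) \<longlonglongrightarrow> (\<integral>z. g z * \<phi> z \<partial>M)"
    using assms unfolding weakly_converges_def by blast
qed

lemma weakly_converges_add:
  assumes "weakly_converges M f g" "weakly_converges M f' g'"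
  shows "weakly_converges M (\<lambda>k z. f k z + f' k z) (\<lambda>z. g z + g' z)"
proof -
  obtain C where "\<And>z. (\<forall>k. \<bar>f k z\<bar> \<le> C) \<and> \<bar>g z\<bar> \<le> C"
    using assms(1) unfolding weakly_converges_def by blast
  moreover obtain C' where "\<And>z. (\<forall>k. \<bar>f' k z\<bar> \<le> C') \<and> \<bar>g' z\<bar> \<le> C'"
    using assms(2) unfolding weakly_converges_def by blast
  ultimately have "\<forall>z. (\<forall>k. \<bar>f k z + f' k z\<bar> \<le> C + C') \<and> \<bar>g z + g' z\<bar> \<le> C + C'"
    by (meson abs_triangle_ineq add_mono order_trans)
  moreover have "(\<lambda>k. \<integral>z. (f k z + f' k z) * \<phi> z \<partial>M) \<longlonglongrightarrow> (\<integral>z. (g z + g' z) * \<phi> z \<partial>M)" if "integrable M \<phi>" for \<phi>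
    using tendsto_add[OF weakly_convergesD(1)[OF assms(1) that] weakly_convergesD(1)[OF assms(2) that]]
    by (simp add: distrib_right weakly_convergesD(2,3)[OF assms(1) that] weakly_convergesD(2,3)[OF assms(2) that])
  moreover have "(\<lambda>z. f k z + f' k z) \<in> borel_measurable M" "(\<lambda>z. g z + g' z) \<in> borel_measurable M" for k
    using assms unfolding weakly_converges_def by (blast intro: borel_measurable_add)+
  ultimately show ?thesis unfolding weakly_converges_def by blast
qed

lemma weakly_converges_cmult:
  assumes "weakly_converges M f g"
  shows "weakly_converges M (\<lambda>k z. c * f k z) (\<lambda>z. c * g z)"
proof -
  have m: "f k \<in> borel_measurable M" "g \<in> borel_measurable M" for k
    using assms by (auto simp: weakly_converges_def)
  obtain C where "\<And>z. (\<forall>k. \<bar>f k z\<bar> \<le> C) \<and> \<bar>g z\<bar> \<le> C"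
    using assms(1) unfolding weakly_converges_def by blast
  then have "\<forall>z. (\<forall>k. \<bar>c * f k z\<bar> \<le> \<bar>c\<bar> * C) \<and> \<bar>c * g z\<bar> \<le> \<bar>c\<bar> * C"
    by (simp add: abs_mult mult_left_mono)
  moreover have "(\<lambda>k. \<integral>z. (c * f k z) * \<phi> z \<partial>M) \<longlonglongrightarrow> (\<integral>z. (c * g z) * \<phi> z \<partial>M)" if "integrable M \<phi>" for \<phi>
    using tendsto_mult_left[OF weakly_convergesD(1)[OF assms(1) that], of c] by (simp add: mult.assoc)
  moreover have "(\<lambda>z. c * f k z) \<in> borel_measurable M" "(\<lambda>z. c * g z) \<in> borel_measurable M" for k
    by (intro borel_measurable_times borel_measurable_const m)+
  ultimately show ?thesis unfolding weakly_converges_def by blast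
qed

lemma weakly_converges_subseq:
  assumes "weakly_converges M f g" "strict_mono (s :: nat \<Rightarrow> nat)"
  shows "weakly_converges M (\<lambda>k. f (s k)) g"
  using assms LIMSEQ_subseq_LIMSEQ[OF weakly_convergesD(1)[OF assms(1)] assms(2)]
  unfolding weakly_converges_def comp_def by blast

lemma (in finite_measure) weakly_converges_nonneg:
  assumes w: "weakly_converges M f g" and nn: "\<And>k. AE z in M. 0 \<le> f k z"
  shows "AE z in M. 0 \<le> g z"
proof (rule AE_nonneg_of_set_integral)
  show "integrable M g" using weakly_convergesD(3)[OF w, of "\<lambda>_. 1"] by simp
  fix A assume A: "A \<in> sets M"
  have iA: "integrable M (indicator A :: 'a \<Rightarrow> real)" using A by (simp add: less_top[symmetric])
  have "0 \<le> (\<integral>z. f k z * indicator A z \<partial>M)" for k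
    by (rule integral_nonneg_AE) (use nn[of k] in \<open>auto elim!: eventually_mono simp: indicator_def\<close>)
  then have "0 \<le> (\<integral>z. g z * indicator A z \<partial>M)"
    by (intro LIMSEQ_le_const[OF weakly_convergesD(1)[OF w iA]]) auto
  then show "0 \<le> (\<integral>z. indicator A z * g z \<partial>M)" by (simp add: mult.commute)
qed

text \<open>A sequence of interior solutions with \<epsilon> tending to 0, freed from the geometry
  of the domain. The condition \<open>bp <= M\<close> ensures that the third branch reaches the
  level \<open>F ap = F bp\<close> no later than at \<open>M\<close>.\<close>

locale fast_reaction = reaction F am ap bm bp for F am ap bm bp +
  fixes Q :: "(real \<times> 'a::euclidean_space) set" and M :: real and e :: "nat \<Rightarrow> real"
    and u v :: "nat \<Rightarrow> real \<times> 'a \<Rightarrow> real"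
  assumes openQ: "open Q" and finQ: "emeasure lborel Q < \<infinity>" and M: "bp \<le> M"
    and e_pos: "\<And>k. 0 < e k" and e_lim: "e \<longlonglongrightarrow> 0"
    and sol: "\<And>k. \<exists>vt g h. rd_solution Q F (e k) M (u k) (v k) vt g h"
begin

text \<open>A density on the whole space instead of a restricted measure: its space is
  \<open>UNIV\<close> and its measurable sets are the Borel sets, as
  \<open>weak_star_compact\<close> requires.\<close>

definition MQ :: "(real \<times> 'a) measure" where "MQ = density lborel (\<lambda>z. ennreal (indicator Q z))"

lemma sets_MQ[measurable_cong, simp]: "sets MQ = sets borel" by (simp add: MQ_def)
lemma space_MQ[simp]: "space MQ = UNIV" by (simp add: MQ_def)

lemma finite_MQ: "finite_measure MQ"
proof
  have "emeasure MQ UNIV = emeasure lborel Q"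
    using openQ by (simp add: MQ_def emeasure_density ennreal_indicator)
  then show "emeasure MQ (space MQ) \<noteq> \<infinity>" using finQ by simp
qed

sublocale MQ: finite_measure MQ by (rule finite_MQ)

lemma Q_borel[measurable]: "Q \<in> sets borel" using openQ by simp

lemma AE_MQ: "(AE z in MQ. P z) \<longleftrightarrow> (AE z in lborel. z \<in> Q \<longrightarrow> P z)"
proof -
  have "(\<lambda>z. ennreal (indicator Q z)) \<in> borel_measurable lborel" by measurable
  then show ?thesis unfolding MQ_def by (simp add: AE_density indicator_def)
qed

lemma borel_MQ: "f \<in> borel_measurable MQ \<longleftrightarrow> f \<in> borel_measurable borel"
  unfolding measurable_cong_sets[OF sets_MQ refl] ..

lemma integral_ballm_MQ:
  fixes f :: "real \<times> 'a \<Rightarrow> real"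
  assumes "cball a r \<subseteq> Q" "f \<in> borel_measurable borel"
  shows "(\<integral>z. f z \<partial>ballm a r) = (\<integral>z. f z * indicator (cball a r) z \<partial>MQ)"
proof -
  have m1: "(\<lambda>z. f z * indicator (cball a r) z) \<in> borel_measurable lborel"
    unfolding measurable_lborel1 using assms(2) by (intro borel_measurable_times borel_measurable_indicator) auto
  have "(\<integral>z. f z * indicator (cball a r) z \<partial>MQ) = (\<integral>z. indicator Q z *\<^sub>R (f z * indicator (cball a r) z) \<partial>lborel)"
    unfolding MQ_def by (intro integral_density m1 AE_I2) auto
  also have "\<dots> = (\<integral>z. f z \<partial>ballm a r)" unfolding integral_ballm
    by (rule Bochner_Integration.integral_cong) (use assms(1) in \<open>auto simp: indicator_def simp del: mem_cball\<close>)
  finally show ?thesis by simp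
qed

text \<open>Extension by zero makes functions of the solution Borel on the whole space. Both values
  are arguments of \<open>G\<close>, so that \<open>v\<close> and its distance to \<open>F u\<close>
  fit the same scheme as functions of \<open>u\<close> alone.\<close>

definition ext :: "(real \<Rightarrow> real \<Rightarrow> real) \<Rightarrow> nat \<Rightarrow> real \<times> 'a \<Rightarrow> real" where
  "ext G k z = (if z \<in> Q then G (u k z) (v k z) else 0)"

lemma bounds: "z \<in> Q \<Longrightarrow> u k z \<in> {0..M}" "z \<in> Q \<Longrightarrow> v k z \<in> {0..M}" "z \<in> Q \<Longrightarrow> F (u k z) \<in> {0..M}"
  using sol[of k] rd_solution.bounds by metis+

lemma cont_u: "continuous_on Q (u k)" and cont_v: "continuous_on Q (v k)"
  using sol[of k] rd_solution.cont_u rd_solution.cont_v by metis+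

lemma ext_measurable:
  assumes "(\<lambda>x. G (fst x) (snd x)) \<in> borel_measurable borel"
  shows "ext G k \<in> borel_measurable borel"
proof -
  have Qb: "Q \<in> sets borel" using openQ by simp
  have um: "(\<lambda>z. if z \<in> Q then u k z else 0) \<in> borel_measurable borel"
    by (rule borel_measurable_continuous_on_if[OF Qb cont_u]) simp
  have vm: "(\<lambda>z. if z \<in> Q then v k z else 0) \<in> borel_measurable borel"
    by (rule borel_measurable_continuous_on_if[OF Qb cont_v]) simp
  have "(\<lambda>z. G (fst ((if z \<in> Q then u k z else 0), (if z \<in> Q then v k z else 0)))
      (snd ((if z \<in> Q then u k z else 0), (if z \<in> Q then v k z else 0)))) \<in> borel_measurable borel"
    by (rule measurable_compose[OF borel_measurable_Pair[OF um vm] assms])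
  then have "(\<lambda>z. if z \<in> Q then G (if z \<in> Q then u k z else 0) (if z \<in> Q then v k z else 0) else 0) \<in> borel_measurable borel"
    using Qb by (intro measurable_If_set) auto
  moreover have "ext G k = (\<lambda>z. if z \<in> Q then G (if z \<in> Q then u k z else 0) (if z \<in> Q then v k z else 0) else 0)"
    by (auto simp: ext_def fun_eq_iff)
  ultimately show ?thesis by simp
qed

lemma ext_bound:
  assumes "\<And>x y. x \<in> {0..M} \<Longrightarrow> y \<in> {0..M} \<Longrightarrow> \<bar>G x y\<bar> \<le> C" "0 \<le> C"
  shows "\<bar>ext G k z\<bar> \<le> C"
  unfolding ext_def using assms bounds by auto

definition admissible :: "(real \<Rightarrow> real \<Rightarrow> real) \<Rightarrow> bool" where
  "admissible G \<longleftrightarrow> (\<lambda>x. G (fst x) (snd x)) \<in> borel_measurable borel \<and>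
    (\<exists>C. \<forall>x\<in>{0..M}. \<forall>y\<in>{0..M}. \<bar>G x y\<bar> \<le> C)"

lemma weak_limits_exist:
  assumes I: "countable I" "I \<noteq> {}" and adm: "\<And>G. G \<in> I \<Longrightarrow> admissible G"
  shows "\<exists>r lim. strict_mono (r :: nat \<Rightarrow> nat) \<and> (\<forall>G\<in>I. weakly_converges MQ (\<lambda>k. ext G (r k)) (lim G))"
proof -
  define G where "G = from_nat_into I"
  have G: "G j \<in> I" for j unfolding G_def using I(2) by (rule from_nat_into)
  have "\<exists>C\<ge>0. \<forall>k z. \<bar>ext (G j) k z\<bar> \<le> C" for j
  proof -
    obtain C where C: "\<And>x y. x \<in> {0..M} \<Longrightarrow> y \<in> {0..M} \<Longrightarrow> \<bar>G j x y\<bar> \<le> C"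
      using adm[OF G[of j]] unfolding admissible_def by blast
    have "\<bar>ext (G j) k z\<bar> \<le> max C 0" for k z
      by (rule ext_bound) (use C in \<open>auto simp: le_max_iff_disj\<close>)
    then show ?thesis by (intro exI[of _ "max C 0"]) auto
  qed
  then obtain C where C: "\<And>j k z. \<bar>ext (G j) k z\<bar> \<le> C j" by metis
  have m: "ext (G j) k \<in> borel_measurable borel" for j k
    using adm[OF G[of j]] by (intro ext_measurable) (simp add: admissible_def)
  obtain r g where r: "strict_mono r" and g: "\<forall>j. g j \<in> borel_measurable borel \<and> (\<forall>z. \<bar>g j z\<bar> \<le> C j) \<and>
    (\<forall>\<phi>. integrable MQ \<phi> \<longrightarrow> (\<lambda>k. \<integral>z. ext (G j) (r k) z * \<phi> z \<partial>MQ) \<longlonglongrightarrow> (\<integral>z. g j z * \<phi> z \<partial>MQ))"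
    using weak_star_compact[OF finite_MQ sets_MQ, of "\<lambda>j. ext (G j)" C, OF m C] by blast
  have w: "weakly_converges MQ (\<lambda>k. ext (G j) (r k)) (g j)" for j
    unfolding weakly_converges_def borel_MQ using g m C by blast
  have "weakly_converges MQ (\<lambda>k. ext H (r k)) (g (to_nat_on I H))" if "H \<in> I" for H
  proof -
    have "G (to_nat_on I H) = H" unfolding G_def using I(1) that by simp
    then show ?thesis using w[of "to_nat_on I H"] by simp
  qed
  then show ?thesis using r by (intro exI[of _ r] exI[of _ "\<lambda>H. g (to_nat_on I H)"]) blast
qed

section \<open>Relaxation of \<open>v - F u\<close> and products of weak limits\<close>

lemma local_energy:
  assumes "a \<in> Q"
  shows "\<exists>r E. 0 < r \<and> cball a (3 * r) \<subseteq> Q \<and> (\<forall>k vt g h. rd_solution Q F (e k) M (u k) (v k) vt g h \<longrightarrow>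
    (\<integral>z. rd_solution.energy F (e k) (u k) (v k) g z \<partial>ballm a (2 * r)) \<le> E)"
proof -
  obtain s where s: "s > 0" "cball a s \<subseteq> Q" using openQ assms open_contains_cball by blast
  define r where "r = s / 3"
  have r: "0 < r" "cball a (3 * r) \<subseteq> Q" using s by (auto simp: r_def)
  obtain E where "\<And>Q \<epsilon> u v vt g h. rd_solution Q F \<epsilon> M u v vt g h \<Longrightarrow> cball a (3 * r) \<subseteq> Q \<Longrightarrow>
    (\<integral>z. rd_solution.energy F \<epsilon> u v g z \<partial>ballm a (2 * r)) \<le> E"
    using energy_bound[OF cont_F r(1), of M a] by blast
  then show ?thesis using r by blast
qed

lemma cont_Fu: "continuous_on Q (\<lambda>z. F (u k z))"
  by (rule continuous_on_compose2[OF cont_F cont_u]) auto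

text \<open>For \<open>x = abs (v - F u)\<close>, expanding
  \<open>(x / sqrt \<epsilon> - 1)^2 >= 0\<close> gives
  \<open>x <= sqrt \<epsilon> * (1 + x^2 / \<epsilon>)\<close>, and the energy bounds the integral
  of the second factor.\<close>

lemma local_relaxation:
  assumes r: "0 < r" "cball a (3 * r) \<subseteq> Q"
    and E: "\<And>k vt g h. rd_solution Q F (e k) M (u k) (v k) vt g h \<Longrightarrow>
      (\<integral>z. rd_solution.energy F (e k) (u k) (v k) g z \<partial>ballm a (2 * r)) \<le> E"
  shows "(\<lambda>k. \<integral>z. \<bar>v k z - F (u k z)\<bar> \<partial>ballm a (2 * r)) \<longlonglongrightarrow> 0"
proof -
  let ?B = "ballm a (2 * r)"
  interpret B: finite_measure ?B by (rule finite_measure_ballm)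
  let ?m = "measure ?B (space ?B)"
  have sub: "cball a (2 * r) \<subseteq> Q" using r by (auto simp: subset_eq)
  have bound: "(\<integral>z. \<bar>v k z - F (u k z)\<bar> \<partial>?B) \<le> sqrt (e k) * (?m + E)" for k
  proof -
    obtain vt g h where s: "rd_solution Q F (e k) M (u k) (v k) vt g h" using sol by blast
    interpret rd_solution Q F "e k" M "u k" "v k" vt g h by (rule s)
    have sq: "sqrt (e k) > 0" "sqrt (e k) * sqrt (e k) = e k" using e_pos[of k] by auto
    have "(\<integral>z. \<bar>v k z - F (u k z)\<bar> \<partial>?B) \<le> (\<integral>z. sqrt (e k) * (1 + energy z) \<partial>?B)"
    proof (rule integral_ballm_mono)
      show "continuous_on (cball a (2 * r)) (\<lambda>z. \<bar>v k z - F (u k z)\<bar>)"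
        by (intro continuous_intros continuous_on_subset[OF cont_v sub] continuous_on_subset[OF cont_Fu sub])
      show "continuous_on (cball a (2 * r)) (\<lambda>z. sqrt (e k) * (1 + energy z))"
        by (intro continuous_intros continuous_on_subset[OF cont_energy sub])
      fix z
      let ?x = "v k z - F (u k z)"
      have "0 \<le> (\<bar>?x\<bar> / sqrt (e k) - 1)\<^sup>2" by simp
      also have "\<dots> = ?x\<^sup>2 / e k - 2 * (\<bar>?x\<bar> / sqrt (e k)) + 1"
        using sq by (simp add: power2_eq_square algebra_simps)
      finally have "2 * (\<bar>?x\<bar> / sqrt (e k)) \<le> 1 + ?x\<^sup>2 / e k" by simp
      moreover have "0 \<le> \<bar>?x\<bar> / sqrt (e k)" using sq(1) by simp
      moreover have "?x\<^sup>2 / e k \<le> energy z" unfolding energy_def by (simp add: sum_nonneg)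
      ultimately have "\<bar>?x\<bar> / sqrt (e k) \<le> 1 + energy z" by linarith
      then show "\<bar>?x\<bar> \<le> sqrt (e k) * (1 + energy z)" using sq(1) by (simp add: divide_le_eq mult.commute)
    qed
    also have "\<dots> = sqrt (e k) * (?m + (\<integral>z. energy z \<partial>?B))"
      using integrable_ballm[OF continuous_on_subset[OF cont_energy sub]] by simp
    also have "\<dots> \<le> sqrt (e k) * (?m + E)"
      using E[OF s] sq(1) by (intro mult_left_mono) auto
    finally show ?thesis .
  qed
  have "(\<lambda>k. sqrt (e k) * (?m + E)) \<longlonglongrightarrow> sqrt 0 * (?m + E)"
    by (intro tendsto_intros e_lim)
  then have lim: "(\<lambda>k. sqrt (e k) * (?m + E)) \<longlonglongrightarrow> 0" by simp
  show ?thesis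
    by (rule Lim_null_comparison[OF _ lim]) (use bound in \<open>auto intro!: always_eventually\<close>)
qed

lemma weakly_converges_ballm:
  assumes w: "weakly_converges MQ (\<lambda>k. ext G (r k)) g" and a: "cball a s \<subseteq> Q"
    and \<phi>: "\<phi> \<in> borel_measurable borel" "\<And>z. \<bar>\<phi> z\<bar> \<le> C"
  shows "(\<lambda>k. \<integral>z. ext G (r k) z * \<phi> z \<partial>ballm a s) \<longlonglongrightarrow> (\<integral>z. g z * \<phi> z \<partial>ballm a s)"
proof -
  have "integrable MQ (\<lambda>z. \<phi> z * indicator (cball a s) z)"
  proof (rule MQ.integrable_const_bound[where B="\<bar>C\<bar>"])
    show "AE z in MQ. norm (\<phi> z * indicator (cball a s) z) \<le> \<bar>C\<bar>"
      using \<phi>(2) by (intro AE_I2) (auto simp: indicator_def intro: order_trans[OF _ abs_ge_self])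
    show "(\<lambda>z. \<phi> z * indicator (cball a s) z) \<in> borel_measurable MQ"
      unfolding borel_MQ using \<phi>(1) by (intro borel_measurable_times borel_measurable_indicator) auto
  qed
  note lim = weakly_convergesD(1)[OF w this]
  have m: "(\<lambda>z. ext G (r k) z * \<phi> z) \<in> borel_measurable borel" "(\<lambda>z. g z * \<phi> z) \<in> borel_measurable borel" for k
    using w \<phi>(1) unfolding weakly_converges_def borel_MQ by (blast intro: borel_measurable_times)+
  show ?thesis
    unfolding integral_ballm_MQ[OF a m(1)] integral_ballm_MQ[OF a m(2)] mult.assoc by (rule lim)
qed

text \<open>\<open>compensated_compactness\<close> is applied to
  \<open>(\<Psi> u + \<Phi> v) * \<zeta>\<close> and \<open>H v\<close>, for which
  \<open>dc_estimate\<close> supplies the shift bound. The statement has \<open>F u\<close> in place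
  of \<open>v\<close>, because it concerns functions of \<open>u\<close> alone, whose weak limits
  play the part of integrals against the Young measure; the exchange is harmless since
  \<open>v - F u\<close> tends to zero locally in L1. The resulting identity of limits is tested
  with polynomials times a bump.\<close>

lemma compensated_product:
  assumes \<Psi>: "\<And>x. (\<Psi> has_real_derivative \<phi> (F x)) (at x)"
    and \<Phi>: "\<And>x. (\<Phi> has_real_derivative \<phi> x) (at x)"
    and \<phi>: "\<And>x. (\<phi> has_real_derivative \<phi>' x) (at x)" and \<phi>': "continuous_on UNIV \<phi>'"
    and H: "\<And>x. (H has_real_derivative H' x) (at x)" and H': "continuous_on UNIV H'"
    and r: "strict_mono r"
    and wU: "weakly_converges MQ (\<lambda>k. ext (\<lambda>x y. \<Psi> x + \<Phi> (F x)) (r k)) gU"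
    and wH: "weakly_converges MQ (\<lambda>k. ext (\<lambda>x y. H (F x)) (r k)) gH"
    and wP: "weakly_converges MQ (\<lambda>k. ext (\<lambda>x y. (\<Psi> x + \<Phi> (F x)) * H (F x)) (r k)) gP"
  shows "AE z in MQ. gP z = gU z * gH z"
  unfolding AE_MQ
proof (rule AE_from_local_balls[OF openQ])
  fix a assume "a \<in> Q"
  from local_energy[OF this] obtain \<rho> E where \<rho>: "0 < \<rho>" "cball a (3 * \<rho>) \<subseteq> Q"
    and E: "\<And>k vt g h. rd_solution Q F (e k) M (u k) (v k) vt g h \<Longrightarrow>
      (\<integral>z. rd_solution.energy F (e k) (u k) (v k) g z \<partial>ballm a (2 * \<rho>)) \<le> E" by blast
  have E0: "0 \<le> E"
  proof -
    obtain vt g h where s: "rd_solution Q F (e 0) M (u 0) (v 0) vt g h" using sol by blast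
    have "0 \<le> (\<integral>z. rd_solution.energy F (e 0) (u 0) (v 0) g z \<partial>ballm a (2 * \<rho>))"
      by (rule integral_nonneg_AE) (rule AE_I2, rule rd_solution.energy_nonneg[OF s])
    then show ?thesis using E[OF s] by linarith
  qed
  have sub2: "cball a (2 * \<rho>) \<subseteq> Q" and sub1: "cball a \<rho> \<subseteq> Q" using \<rho> by (auto simp: subset_eq)
  define d where "d k = (\<integral>z. \<bar>v k z - F (u k z)\<bar> \<partial>ballm a (2 * \<rho>))" for k
  have "d \<longlonglongrightarrow> 0" unfolding d_def by (rule local_relaxation[OF \<rho> E])
  from LIMSEQ_subseq_LIMSEQ[OF this r] have dr: "(\<lambda>k. d (r k)) \<longlonglongrightarrow> 0" by (simp add: comp_def)
  have c1: "continuous_on S \<Psi>" "continuous_on S \<Phi>" "continuous_on S \<phi>" "continuous_on S H" for S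
    by (rule DERIV_continuous_on[OF has_field_derivative_at_within[OF \<Psi>]]
        DERIV_continuous_on[OF has_field_derivative_at_within[OF \<Phi>]]
        DERIV_continuous_on[OF has_field_derivative_at_within[OF \<phi>]]
        DERIV_continuous_on[OF has_field_derivative_at_within[OF H]])+
  have c2: "continuous_on S \<phi>'" "continuous_on S H'" for S
    using \<phi>' H' continuous_on_subset by blast+
  obtain B1 where B1: "B1 \<ge> 0" "\<And>x. x \<in> {0..M} \<Longrightarrow> \<bar>\<Psi> x\<bar> \<le> B1" using compact_bound_abs[OF compact_Icc c1(1)] by blast
  obtain B2 where B2: "B2 \<ge> 0" "\<And>x. x \<in> {0..M} \<Longrightarrow> \<bar>\<Phi> x\<bar> \<le> B2" using compact_bound_abs[OF compact_Icc c1(2)] by blast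
  obtain B3 where B3: "B3 \<ge> 0" "\<And>x. x \<in> {0..M} \<Longrightarrow> \<bar>\<phi> x\<bar> \<le> B3" using compact_bound_abs[OF compact_Icc c1(3)] by blast
  obtain B4 where B4: "B4 \<ge> 0" "\<And>x. x \<in> {0..M} \<Longrightarrow> \<bar>H x\<bar> \<le> B4" using compact_bound_abs[OF compact_Icc c1(4)] by blast
  obtain B5 where B5: "B5 \<ge> 0" "\<And>x. x \<in> {0..M} \<Longrightarrow> \<bar>\<phi>' x\<bar> \<le> B5" using compact_bound_abs[OF compact_Icc c2(1)] by blast
  obtain B6 where B6: "B6 \<ge> 0" "\<And>x. x \<in> {0..M} \<Longrightarrow> \<bar>H' x\<bar> \<le> B6" using compact_bound_abs[OF compact_Icc c2(2)] by blast
  have lip: "\<bar>f x - f y\<bar> \<le> B * \<bar>x - y\<bar>" if "x \<in> {0..M}" "y \<in> {0..M}"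
    "\<And>x. (f has_real_derivative f' x) (at x)" "\<And>x. x \<in> {0..M} \<Longrightarrow> \<bar>f' x\<bar> \<le> B" for f f' :: "real \<Rightarrow> real" and B x y
    using field_differentiable_bound[of "{0..M}" f f' B x y] that by (auto intro: has_field_derivative_at_within)
  obtain CU where CU: "\<And>z. \<bar>gU z\<bar> \<le> CU" using wU unfolding weakly_converges_def by blast
  obtain CH where CH: "\<And>z. \<bar>gH z\<bar> \<le> CH" using wH unfolding weakly_converges_def by blast
  obtain CP where CP: "\<And>z. \<bar>gP z\<bar> \<le> CP" using wP unfolding weakly_converges_def by blast
  have gm: "gU \<in> borel_measurable borel" "gH \<in> borel_measurable borel" "gP \<in> borel_measurable borel"
    using wU wH wP unfolding weakly_converges_def borel_MQ by blast+
  let ?U = "\<lambda>x y. \<Psi> x + \<Phi> y"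
  have cf: "continuous_on UNIV (\<lambda>x::real\<times>real. \<Psi> (fst x))" "continuous_on UNIV (\<lambda>x::real\<times>real. \<Phi> (snd x))"
    "continuous_on UNIV (\<lambda>x::real\<times>real. H (snd x))"
    by (rule continuous_on_compose2[OF c1(1)[of UNIV] continuous_on_fst[OF continuous_on_id]], simp)
      (rule continuous_on_compose2[OF c1(2)[of UNIV] continuous_on_snd[OF continuous_on_id]], simp,
       rule continuous_on_compose2[OF c1(4)[of UNIV] continuous_on_snd[OF continuous_on_id]], simp)
  have pm: "(\<lambda>x::real\<times>real. \<Psi> (fst x) + \<Phi> (snd x)) \<in> borel_measurable borel" "(\<lambda>x::real\<times>real. H (snd x)) \<in> borel_measurable borel"
    by (intro borel_measurable_continuous_onI continuous_on_add cf)+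
  have "AE z in lborel. z \<in> ball a \<rho> \<longrightarrow> gP z - gU z * gH z = 0"
  proof (rule AE_zero_of_test_functions[where C="CP + CU * CH"])
    show "(\<lambda>z. gP z - gU z * gH z) \<in> borel_measurable borel" using gm by auto
    show "\<bar>gP z - gU z * gH z\<bar> \<le> CP + CU * CH" for z
    proof -
      have "\<bar>gU z\<bar> * \<bar>gH z\<bar> \<le> CU * CH" by (rule mult_mono) (use CU[of z] CH[of z] in auto)
      then show ?thesis using CP[of z] unfolding abs_mult[symmetric] by linarith
    qed
    fix p :: "real \<times> 'a \<Rightarrow> real" assume p: "real_polynomial_function p"
    obtain p' where p': "\<And>d. continuous_on UNIV (p' d)" "\<And>d z. has_dir_deriv d p (p' d z) z"
      using real_polynomial_function_dir_deriv[OF p] by blast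
    have pc: "continuous_on UNIV p" using p continuous_real_polymonial_function by (auto simp: continuous_on_eq_continuous_at)
    define \<zeta> where "\<zeta> z = bump a \<rho> z * p z" for z
    define \<zeta>d where "\<zeta>d d z = bump_deriv a \<rho> d z * p z + bump a \<rho> z * p' d z" for d z
    have c\<zeta>: "continuous_on UNIV \<zeta>" "continuous_on UNIV (\<zeta>d d)" for d
      unfolding \<zeta>_def \<zeta>d_def by (intro continuous_intros continuous_on_bump pc p'(1))+
    have \<zeta>c: "continuous_on S \<zeta>" "continuous_on S (\<zeta>d d)" for S d using c\<zeta> continuous_on_subset by blast+
    have D\<zeta>: "has_dir_deriv d \<zeta> (\<zeta>d d z) z" for d z
      unfolding \<zeta>_def[abs_def] \<zeta>d_def by (intro has_dir_deriv_mult has_dir_deriv_bump p'(2))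
    have Z\<zeta>: "\<zeta> z = 0" if "z \<notin> cball a \<rho>" for z using bump_outside[OF _ that] \<rho>(1) by (simp add: \<zeta>_def)
    have \<zeta>m: "\<zeta> \<in> borel_measurable borel" by (rule borel_measurable_continuous_onI[OF c\<zeta>(1)])
    obtain Z1 where Z1: "Z1 \<ge> 0" "\<And>z. z \<in> cball a \<rho> \<Longrightarrow> \<bar>\<zeta> z\<bar> \<le> Z1" using compact_bound_abs[OF compact_cball \<zeta>c(1)] by blast
    obtain Z2 where Z2: "Z2 \<ge> 0" "\<And>z. z \<in> cball a \<rho> \<Longrightarrow> \<bar>\<zeta>d (1, 0) z\<bar> \<le> Z2" using compact_bound_abs[OF compact_cball \<zeta>c(2)] by blast
    have "continuous_on (cball a \<rho>) (\<lambda>z. \<Sum>b\<in>Basis. \<bar>\<zeta>d (0, b) z\<bar>)" by (intro continuous_intros \<zeta>c)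
    then obtain Z3 where Z3: "Z3 \<ge> 0" "\<And>z. z \<in> cball a \<rho> \<Longrightarrow> \<bar>\<Sum>b\<in>Basis. \<bar>\<zeta>d (0, b) z\<bar>\<bar> \<le> Z3" using compact_bound_abs[OF compact_cball] by blast
    have Z3': "\<bar>\<zeta>d (0, b) z\<bar> \<le> Z3" if "b \<in> Basis" "z \<in> cball a \<rho>" for b z
    proof -
      have "\<bar>\<zeta>d (0, b) z\<bar> \<le> (\<Sum>b\<in>Basis. \<bar>\<zeta>d (0, b) z\<bar>)"
        by (rule member_le_sum[OF that(1), where f="\<lambda>b. \<bar>\<zeta>d (0, b) z\<bar>"]) auto
      then show ?thesis using Z3(2)[OF that(2)] by linarith
    qed
    have \<zeta>_all: "\<bar>\<zeta> z\<bar> \<le> Z1" for z using Z1 Z\<zeta> by (cases "z \<in> cball a \<rho>") (auto simp del: mem_cball)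
    \<comment> \<open>One constant for all the bounds required by \<open>dc_estimate\<close>; it is
      independent of the index \<open>k\<close>.\<close>
    define K where "K = 1 + (B1 + B2) + B3 + B4 + B5 + B6 + Z1 + Z2 + Z3"
    have K: "1 \<le> K" "B1 + B2 \<le> K" "B3 \<le> K" "B4 \<le> K" "B5 \<le> K" "B6 \<le> K" "Z1 \<le> K" "Z2 \<le> K" "Z3 \<le> K"
      unfolding K_def using B1(1) B2(1) B3(1) B4(1) B5(1) B6(1) Z1(1) Z2(1) Z3(1) by linarith+
    define L where "L = K * K * K"
    have KL: "0 \<le> L" "L \<ge> K" "L \<ge> K * K"
    proof -
      have "K * 1 \<le> K * K" using K(1) by (intro mult_left_mono) auto
      moreover have "K * K * 1 \<le> K * K * K" using K(1) by (intro mult_left_mono) auto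
      ultimately show "0 \<le> L" "L \<ge> K" "L \<ge> K * K" using K(1) unfolding L_def by linarith+
    qed
    have Ub: "\<bar>\<Psi> x + \<Phi> y\<bar> \<le> K" if "x \<in> {0..M}" "y \<in> {0..M}" for x y
      using B1(2)[OF that(1)] B2(2)[OF that(2)] K(2) by linarith
    define f where "f k z = ext ?U (r k) z * \<zeta> z" for k z
    define w where "w k z = ext (\<lambda>x y. H y) (r k) z" for k z
    define C where "C = K * K + \<bar>CU\<bar> * K + K + \<bar>CH\<bar>"
    have CC: "K * K \<le> C" "\<bar>CU\<bar> * K \<le> C" "K \<le> C" "\<bar>CH\<bar> \<le> C"
    proof -
      have "0 \<le> K * K" "0 \<le> \<bar>CU\<bar> * K" "0 \<le> K" "0 \<le> \<bar>CH\<bar>" using K(1) by auto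
      then show "K * K \<le> C" "\<bar>CU\<bar> * K \<le> C" "K \<le> C" "\<bar>CH\<bar> \<le> C" unfolding C_def by linarith+
    qed
    have eb: "\<bar>ext ?U k z\<bar> \<le> K" "\<bar>ext (\<lambda>x y. H y) k z\<bar> \<le> K" for k z
      using Ub B4(2) K(1,4) by (intro ext_bound; force)+
    have em: "ext ?U k \<in> borel_measurable borel" "ext (\<lambda>x y. H y) k \<in> borel_measurable borel" for k
      by (rule ext_measurable, rule pm)+
    have d_le: "(\<integral>z. \<bar>v k z - F (u k z)\<bar> \<partial>ballm b s) \<le> d k" if "cball b s \<subseteq> cball a (2 * \<rho>)" for k b s
    proof -
      have c: "continuous_on (cball b s) (\<lambda>z. \<bar>v k z - F (u k z)\<bar>)" "continuous_on (cball a (2 * \<rho>)) (\<lambda>z. \<bar>v k z - F (u k z)\<bar>)"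
        using that sub2 by (auto intro!: continuous_intros continuous_on_subset[OF cont_v] continuous_on_subset[OF cont_Fu])
      have i1: "integrable lborel (\<lambda>y. indicator (cball b s) y *\<^sub>R \<bar>v k y - F (u k y)\<bar>)"
        "integrable lborel (\<lambda>y. indicator (cball a (2 * \<rho>)) y *\<^sub>R \<bar>v k y - F (u k y)\<bar>)"
        by (rule borel_integrable_compact[OF compact_cball c(1)], rule borel_integrable_compact[OF compact_cball c(2)])
      have "(\<integral>y. indicator (cball b s) y *\<^sub>R \<bar>v k y - F (u k y)\<bar> \<partial>lborel) \<le> (\<integral>y. indicator (cball a (2 * \<rho>)) y *\<^sub>R \<bar>v k y - F (u k y)\<bar> \<partial>lborel)"
        by (rule integral_mono[OF i1]) (use that in \<open>auto simp: indicator_def simp del: mem_cball\<close>)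
      then show ?thesis by (simp add: d_def integral_ballm)
    qed
    \<comment> \<open>Weak limits do not change when a sequence is altered by at most a multiple of
      \<open>abs (v - F u)\<close>. This is used for each of the two factors and for their
      product.\<close>
    have close: "(\<lambda>k. (\<integral>z. q k z * \<xi> z \<partial>ballm b s)) \<longlonglongrightarrow> l"
      if q': "(\<lambda>k. (\<integral>z. q' k z * \<xi> z \<partial>ballm b s)) \<longlonglongrightarrow> l" and sb: "cball b s \<subseteq> cball a (2 * \<rho>)"
        and qm: "\<And>k. q k \<in> borel_measurable borel" "\<And>k. q' k \<in> borel_measurable borel" "\<xi> \<in> borel_measurable borel"
        and qb: "\<And>k z. \<bar>q k z\<bar> \<le> A" "\<And>k z. \<bar>q' k z\<bar> \<le> A" "\<And>z. \<bar>\<xi> z\<bar> \<le> A'"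
        and qd: "\<And>k z. z \<in> Q \<Longrightarrow> \<bar>q k z - q' k z\<bar> \<le> A * \<bar>v (r k) z - F (u (r k) z)\<bar>"
      for q q' :: "nat \<Rightarrow> real \<times> 'a \<Rightarrow> real" and \<xi> b s l A A'
    proof -
      have A0: "0 \<le> A" "0 \<le> A'" using qb(1)[of 0 a] qb(3)[of a] by linarith+
      have i: "integrable (ballm b s) (\<lambda>z. q k z * \<xi> z)" "integrable (ballm b s) (\<lambda>z. q' k z * \<xi> z)" for k
        by (intro integrable_bounded_mult[of _ _ _ A] integrable_ballm_bounded[where C=A'] borel_measurable_ballm qm qb)+
      have bd: "norm ((\<integral>z. q k z * \<xi> z \<partial>ballm b s) - (\<integral>z. q' k z * \<xi> z \<partial>ballm b s)) \<le> A * A' * d (r k)" for k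
      proof -
        have "(\<integral>z. q k z * \<xi> z \<partial>ballm b s) - (\<integral>z. q' k z * \<xi> z \<partial>ballm b s) = (\<integral>z. q k z * \<xi> z - q' k z * \<xi> z \<partial>ballm b s)"
          using i by simp
        also have "\<bar>\<dots>\<bar> \<le> (\<integral>z. \<bar>q k z * \<xi> z - q' k z * \<xi> z\<bar> \<partial>ballm b s)" by (rule integral_abs_bound)
        also have "\<dots> \<le> (\<integral>z. A * A' * \<bar>v (r k) z - F (u (r k) z)\<bar> \<partial>ballm b s)"
        proof (rule integral_mono)
          show "integrable (ballm b s) (\<lambda>z. \<bar>q k z * \<xi> z - q' k z * \<xi> z\<bar>)" using i by simp
          show "integrable (ballm b s) (\<lambda>z. A * A' * \<bar>v (r k) z - F (u (r k) z)\<bar>)"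
            using sb sub2 by (intro integrable_ballm continuous_intros continuous_on_subset[OF cont_v] continuous_on_subset[OF cont_Fu]) auto
          fix z assume "z \<in> space (ballm b s)"
          then have zQ: "z \<in> Q" using sb sub2 by (auto simp: space_restrict_space simp del: mem_cball)
          have "\<bar>q k z - q' k z\<bar> * \<bar>\<xi> z\<bar> \<le> (A * \<bar>v (r k) z - F (u (r k) z)\<bar>) * A'"
            using qd[OF zQ] qb(3) A0 by (intro mult_mono) auto
          then show "\<bar>q k z * \<xi> z - q' k z * \<xi> z\<bar> \<le> A * A' * \<bar>v (r k) z - F (u (r k) z)\<bar>"
            by (simp only: left_diff_distrib[symmetric] abs_mult) (simp add: mult_ac)
        qed
        also have "\<dots> \<le> A * A' * d (r k)" using d_le[OF sb, of "r k"] A0 by (simp add: mult_left_mono)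
        finally show ?thesis by simp
      qed
      have "(\<lambda>k. A * A' * d (r k)) \<longlonglongrightarrow> 0" using tendsto_mult_right_zero[OF dr] by simp
      from Lim_null_comparison[OF always_eventually[OF allI[OF bd]] this]
      have "(\<lambda>k. (\<integral>z. q k z * \<xi> z \<partial>ballm b s) - (\<integral>z. q' k z * \<xi> z \<partial>ballm b s)) \<longlonglongrightarrow> 0" .
      from tendsto_add[OF this q'] show ?thesis by simp
    qed
    have cc: "(\<lambda>k. \<integral>z. f k z * w k z \<partial>ballm a \<rho>) \<longlonglongrightarrow> (\<integral>z. (gU z * \<zeta> z) * gH z \<partial>ballm a \<rho>)"
    proof (rule compensated_compactness[where C=C and ?\<eta>0.0=\<rho> and K="K^3 * ((2 * real DIM('a) + 1) * measure lborel (cball a \<rho>) + 5 * E)"])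
      show "f k \<in> borel_measurable borel" for k unfolding f_def[abs_def] using em \<zeta>m by simp
      show "\<bar>f k z\<bar> \<le> C" for k z
      proof -
        have "\<bar>ext ?U (r k) z\<bar> * \<bar>\<zeta> z\<bar> \<le> K * K"
          using eb(1)[of "r k" z] \<zeta>_all[of z] K by (intro mult_mono) auto
        then show ?thesis unfolding f_def abs_mult using CC(1) by linarith
      qed
      show "w k \<in> borel_measurable borel" for k unfolding w_def[abs_def] using em by simp
      show "\<bar>w k z\<bar> \<le> C" for k z using eb(2)[of "r k" z] CC(3) by (simp add: w_def)
      show "(\<lambda>z. gU z * \<zeta> z) \<in> borel_measurable borel" using gm \<zeta>m by simp
      show "\<bar>gU z * \<zeta> z\<bar> \<le> C" for z
      proof -
        have "\<bar>gU z\<bar> * \<bar>\<zeta> z\<bar> \<le> \<bar>CU\<bar> * K"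
          using CU[of z] \<zeta>_all[of z] K by (intro mult_mono) auto
        then show ?thesis unfolding abs_mult using CC(2) by linarith
      qed
      show "gH \<in> borel_measurable borel" by (rule gm)
      show "\<bar>gH z\<bar> \<le> C" for z using CH[of z] CC(4) by linarith
      show "0 < \<rho>" by (rule \<rho>)
      show "0 \<le> K^3 * ((2 * real DIM('a) + 1) * measure lborel (cball a \<rho>) + 5 * E)" using K(1) E0 by simp
    next
      fix \<psi> :: "real \<times> 'a \<Rightarrow> real" assume \<psi>: "\<psi> \<in> borel_measurable borel" "\<And>z. \<bar>\<psi> z\<bar> \<le> C"
      have b\<psi>: "\<bar>\<zeta> z * \<psi> z\<bar> \<le> K * C" for z
        unfolding abs_mult using \<psi>(2)[of z] \<zeta>_all[of z] K by (intro mult_mono) auto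
      have m\<psi>: "(\<lambda>z. \<zeta> z * \<psi> z) \<in> borel_measurable borel" using \<psi> \<zeta>m by simp
      have "(\<lambda>k. \<integral>z. ext ?U (r k) z * (\<zeta> z * \<psi> z) \<partial>ballm a \<rho>) \<longlonglongrightarrow> (\<integral>z. gU z * (\<zeta> z * \<psi> z) \<partial>ballm a \<rho>)"
      proof (rule close[OF weakly_converges_ballm[OF wU sub1 m\<psi> b\<psi>]])
        show "cball a \<rho> \<subseteq> cball a (2 * \<rho>)" using \<rho>(1) by auto
        show "ext (\<lambda>x y. \<Psi> x + \<Phi> (F x)) (r k) \<in> borel_measurable borel" for k
          using wU unfolding weakly_converges_def borel_MQ by blast
        show "\<bar>ext ?U (r k) z\<bar> \<le> K" "\<bar>ext (\<lambda>x y. \<Psi> x + \<Phi> (F x)) (r k) z\<bar> \<le> K" for k z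
          using eb(1)[of "r k" z] Ub bounds[of z "r k"] K(1) by (auto simp: ext_def)
        show "\<bar>ext ?U (r k) z - ext (\<lambda>x y. \<Psi> x + \<Phi> (F x)) (r k) z\<bar> \<le> K * \<bar>v (r k) z - F (u (r k) z)\<bar>" if "z \<in> Q" for k z
          using lip[OF bounds(2,3)[OF that] \<Phi> order_trans[OF B3(2) K(3)], of "r k" "r k"] that by (simp add: ext_def)
      qed (use em m\<psi> b\<psi> in auto)
      then show "(\<lambda>k. \<integral>z. f k z * \<psi> z \<partial>ballm a \<rho>) \<longlonglongrightarrow> (\<integral>z. gU z * \<zeta> z * \<psi> z \<partial>ballm a \<rho>)"
        by (simp add: f_def mult.assoc)
    next
      fix z \<eta> assume z: "z \<in> cball a \<rho>" and \<eta>: "0 < \<eta>" "\<eta> \<le> \<rho>"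
      have sb: "cball z \<eta> \<subseteq> cball a (2 * \<rho>)"
      proof
        fix y assume "y \<in> cball z \<eta>"
        then show "y \<in> cball a (2 * \<rho>)" using dist_triangle[of a y z] z \<eta> by (simp add: dist_commute)
      qed
      have "(\<lambda>k. \<integral>y. w k y * 1 \<partial>ballm z \<eta>) \<longlonglongrightarrow> (\<integral>y. gH y * 1 \<partial>ballm z \<eta>)"
      proof (rule close[OF weakly_converges_ballm[OF wH subset_trans[OF sb sub2], of "\<lambda>_. 1" 1] sb, of _ K 1])
        show "ext (\<lambda>x y. H (F x)) (r k) \<in> borel_measurable borel" for k
          using wH unfolding weakly_converges_def borel_MQ by blast
        show "\<bar>w k z\<bar> \<le> K" "\<bar>ext (\<lambda>x y. H (F x)) (r k) z\<bar> \<le> K" for k z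
          using eb(2)[of "r k" z] order_trans[OF B4(2) K(4)] bounds[of z "r k"] K(1) by (auto simp: ext_def w_def)
        show "\<bar>w k z - ext (\<lambda>x y. H (F x)) (r k) z\<bar> \<le> K * \<bar>v (r k) z - F (u (r k) z)\<bar>" if "z \<in> Q" for k z
          using lip[OF bounds(2,3)[OF that] H order_trans[OF B6(2) K(6)], of "r k" "r k"] that by (simp add: ext_def w_def)
      qed (use em in \<open>auto simp: w_def[abs_def]\<close>)
      then show "(\<lambda>k. \<integral>y. w k y \<partial>ballm z \<eta>) \<longlonglongrightarrow> (\<integral>y. gH y \<partial>ballm z \<eta>)" by simp
    next
      fix k and h :: "real \<times> 'a" assume h: "norm h \<le> \<rho>"
      obtain vt g hh where s: "rd_solution Q F (e (r k)) M (u (r k)) (v (r k)) vt g hh" using sol by blast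
      have inQ: "z + h \<in> Q" if "z \<in> cball a \<rho>" for z
        using that h sub2 norm_triangle_ineq4[of "a - z" h] by (auto simp: dist_norm subset_eq algebra_simps)
      have eq: "(\<integral>z. f k z * w k (z + h) \<partial>ballm a \<rho>) =
          (\<integral>z. (\<Psi> (u (r k) z) + \<Phi> (v (r k) z)) * \<zeta> z * H (v (r k) (z + h)) \<partial>ballm a \<rho>)"
        "(\<integral>z. f k z * w k z \<partial>ballm a \<rho>) =
          (\<integral>z. (\<Psi> (u (r k) z) + \<Phi> (v (r k) z)) * \<zeta> z * H (v (r k) z) \<partial>ballm a \<rho>)"
        using inQ sub1 by (auto intro!: Bochner_Integration.integral_cong simp: space_restrict_space f_def w_def ext_def simp del: mem_cball)
      show "\<bar>(\<integral>z. f k z * w k (z + h) \<partial>ballm a \<rho>) - (\<integral>z. f k z * w k z \<partial>ballm a \<rho>)\<bar>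
        \<le> norm h * (K^3 * ((2 * real DIM('a) + 1) * measure lborel (cball a \<rho>) + 5 * E))"
        unfolding eq
      proof (rule rd_solution.dc_estimate[OF s \<rho>(1) sub2 K(1) c\<zeta> D\<zeta> Z\<zeta> _ _ _ \<Psi> \<Phi> \<phi> \<phi>' H H' _ _ _ _ _ E[OF s] h])
        show "\<bar>\<zeta> z\<bar> \<le> K" if "z \<in> cball a \<rho>" for z using Z1(2)[OF that] K by linarith
        show "\<bar>\<zeta>d (1, 0) z\<bar> \<le> K" if "z \<in> cball a \<rho>" for z using Z2(2)[OF that] K by linarith
        show "\<bar>\<zeta>d (0, b) z\<bar> \<le> K" if "b \<in> Basis" "z \<in> cball a \<rho>" for b z using Z3'[OF that] K by linarith
        show "\<bar>\<phi> x\<bar> \<le> K" if "x \<in> {0..M}" for x using B3(2)[OF that] K by linarith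
        show "\<bar>\<phi>' x\<bar> \<le> K" if "x \<in> {0..M}" for x using B5(2)[OF that] K by linarith
        show "\<bar>H x\<bar> \<le> K" if "x \<in> {0..M}" for x using B4(2)[OF that] K by linarith
        show "\<bar>H' x\<bar> \<le> K" if "x \<in> {0..M}" for x using B6(2)[OF that] K by linarith
        show "\<bar>\<Psi> (u (r k) z) + \<Phi> (v (r k) z)\<bar> \<le> K" if "z \<in> Q" for z by (rule Ub[OF bounds(1,2)[OF that]])
      qed
    qed
    have limP: "(\<lambda>k. \<integral>z. ext (\<lambda>x y. (\<Psi> x + \<Phi> y) * H y) (r k) z * \<zeta> z \<partial>ballm a \<rho>) \<longlonglongrightarrow> (\<integral>z. gP z * \<zeta> z \<partial>ballm a \<rho>)"
    proof (rule close[OF weakly_converges_ballm[OF wP sub1 \<zeta>m \<zeta>_all]])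
      show "cball a \<rho> \<subseteq> cball a (2 * \<rho>)" using \<rho>(1) by auto
      show "ext (\<lambda>x y. (\<Psi> x + \<Phi> y) * H y) (r k) \<in> borel_measurable borel" for k
        by (rule ext_measurable) (use pm in auto)
      show "ext (\<lambda>x y. (\<Psi> x + \<Phi> (F x)) * H (F x)) (r k) \<in> borel_measurable borel" for k
        using wP unfolding weakly_converges_def borel_MQ by blast
      have UH: "\<bar>(\<Psi> x + \<Phi> y) * H y'\<bar> \<le> K * K" if "x \<in> {0..M}" "y \<in> {0..M}" "y' \<in> {0..M}" for x y y'
        unfolding abs_mult using Ub[OF that(1,2)] order_trans[OF B4(2)[OF that(3)] K(4)] K(1) by (intro mult_mono) auto
      show "\<bar>ext (\<lambda>x y. (\<Psi> x + \<Phi> y) * H y) (r k) z\<bar> \<le> 2 * L" "\<bar>ext (\<lambda>x y. (\<Psi> x + \<Phi> (F x)) * H (F x)) (r k) z\<bar> \<le> 2 * L" for k z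
        using UH[OF bounds(1,2,2), of z z z "r k" "r k" "r k"] UH[OF bounds(1,3,3), of z z z "r k" "r k" "r k"] KL by (auto simp: ext_def)
      show "\<bar>ext (\<lambda>x y. (\<Psi> x + \<Phi> y) * H y) (r k) z - ext (\<lambda>x y. (\<Psi> x + \<Phi> (F x)) * H (F x)) (r k) z\<bar>
          \<le> 2 * L * \<bar>v (r k) z - F (u (r k) z)\<bar>" if z: "z \<in> Q" for k z
      proof -
        let ?x = "u (r k) z" and ?y = "v (r k) z"
        have "(\<Psi> ?x + \<Phi> ?y) * H ?y - (\<Psi> ?x + \<Phi> (F ?x)) * H (F ?x)
          = (\<Psi> ?x + \<Phi> ?y) * (H ?y - H (F ?x)) + (\<Phi> ?y - \<Phi> (F ?x)) * H (F ?x)" by (simp add: algebra_simps)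
        moreover have "\<bar>(\<Psi> ?x + \<Phi> ?y) * (H ?y - H (F ?x))\<bar> \<le> K * (K * \<bar>?y - F ?x\<bar>)"
          unfolding abs_mult using Ub[OF bounds(1,2)[OF z]] lip[OF bounds(2,3)[OF z] H order_trans[OF B6(2) K(6)], of "r k" "r k"] K(1)
          by (intro mult_mono) auto
        moreover have "\<bar>(\<Phi> ?y - \<Phi> (F ?x)) * H (F ?x)\<bar> \<le> (K * \<bar>?y - F ?x\<bar>) * K"
          unfolding abs_mult using lip[OF bounds(2,3)[OF z] \<Phi> order_trans[OF B3(2) K(3)], of "r k" "r k"]
            order_trans[OF B4(2)[OF bounds(3)[OF z]] K(4), of "r k"] K(1)
          by (intro mult_mono) auto
        moreover have "K * K * \<bar>?y - F ?x\<bar> \<le> L * \<bar>?y - F ?x\<bar>" using KL(3) by (intro mult_right_mono) auto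
        ultimately have "\<bar>(\<Psi> ?x + \<Phi> ?y) * H ?y - (\<Psi> ?x + \<Phi> (F ?x)) * H (F ?x)\<bar> \<le> 2 * L * \<bar>?y - F ?x\<bar>"
        proof -
          assume a: "(\<Psi> ?x + \<Phi> ?y) * H ?y - (\<Psi> ?x + \<Phi> (F ?x)) * H (F ?x)
              = (\<Psi> ?x + \<Phi> ?y) * (H ?y - H (F ?x)) + (\<Phi> ?y - \<Phi> (F ?x)) * H (F ?x)"
            "\<bar>(\<Psi> ?x + \<Phi> ?y) * (H ?y - H (F ?x))\<bar> \<le> K * (K * \<bar>?y - F ?x\<bar>)"
            "\<bar>(\<Phi> ?y - \<Phi> (F ?x)) * H (F ?x)\<bar> \<le> (K * \<bar>?y - F ?x\<bar>) * K"
            "K * K * \<bar>?y - F ?x\<bar> \<le> L * \<bar>?y - F ?x\<bar>"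
          have e: "K * (K * \<bar>?y - F ?x\<bar>) = K * K * \<bar>?y - F ?x\<bar>" "(K * \<bar>?y - F ?x\<bar>) * K = K * K * \<bar>?y - F ?x\<bar>"
            "2 * L * \<bar>?y - F ?x\<bar> = L * \<bar>?y - F ?x\<bar> + L * \<bar>?y - F ?x\<bar>"
            by simp_all
          show ?thesis unfolding a(1) e(3)
            by (rule order_trans[OF abs_triangle_ineq add_mono[OF order_trans[OF a(2)[unfolded e(1)] a(4)] order_trans[OF a(3)[unfolded e(2)] a(4)]]])
        qed
        then show ?thesis using z by (simp add: ext_def)
      qed
    qed (use \<zeta>m \<zeta>_all in auto)
    have fw: "(\<integral>z. f k z * w k z \<partial>ballm a \<rho>) = (\<integral>z. ext (\<lambda>x y. (\<Psi> x + \<Phi> y) * H y) (r k) z * \<zeta> z \<partial>ballm a \<rho>)" for k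
      by (rule Bochner_Integration.integral_cong) (auto simp: f_def w_def ext_def)
    have "(\<integral>z. gP z * \<zeta> z \<partial>ballm a \<rho>) = (\<integral>z. (gU z * \<zeta> z) * gH z \<partial>ballm a \<rho>)"
      by (rule LIMSEQ_unique[OF limP cc[unfolded fw]])
    moreover have iz: "integrable (ballm a \<rho>) \<zeta>" by (rule integrable_ballm[OF \<zeta>c(1)])
    moreover have "integrable (ballm a \<rho>) (\<lambda>z. gP z * \<zeta> z)"
      by (rule integrable_bounded_mult[OF iz borel_measurable_ballm CP]) (rule gm)
    moreover have "integrable (ballm a \<rho>) (\<lambda>z. gH z * (gU z * \<zeta> z))"
      by (rule integrable_bounded_mult[OF integrable_bounded_mult[OF iz borel_measurable_ballm CU] borel_measurable_ballm CH]) (rule gm)+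
    ultimately have "(\<integral>z. gP z * \<zeta> z - gH z * (gU z * \<zeta> z) \<partial>ballm a \<rho>) = 0" by (simp add: mult_ac)
    moreover have "(gP z - gU z * gH z) * (bump a \<rho> z * p z) = gP z * \<zeta> z - gH z * (gU z * \<zeta> z)" for z
      by (simp add: \<zeta>_def algebra_simps)
    ultimately show "(\<integral>z. (gP z - gU z * gH z) * (bump a \<rho> z * p z) \<partial>ballm a \<rho>) = 0" by simp
  qed
  then show "\<exists>r>0. AE z in lborel. z \<in> ball a r \<longrightarrow> gP z = gU z * gH z" using \<rho>(1) by auto
qed

end

section \<open>Limits of the test functions and concentration of the law of
  \<open>F u\<close>\<close>

context fast_reaction
begin

lemma M_bounds: "bm < M" "0 < M" using M order by linarith+

lemma ext_cong:
  assumes "\<And>x y. x \<in> {0..M} \<Longrightarrow> y \<in> {0..M} \<Longrightarrow> F x \<in> {0..M} \<Longrightarrow> G x y = G' x y"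
  shows "ext G k z = ext G' k z"
  unfolding ext_def using assms[OF bounds] by simp

lemma admissible_indicator_mult:
  assumes P: "Collect P \<in> sets borel" and g: "continuous_on UNIV g"
  shows "admissible (\<lambda>x y. of_bool (P x) * g x)"
  unfolding admissible_def
proof
  have "(\<lambda>x. indicator (Collect P) x * g x) \<in> borel_measurable borel"
    using P by (intro borel_measurable_times borel_measurable_indicator borel_measurable_continuous_onI[OF g]) auto
  moreover have "fst \<in> borel_measurable (borel :: (real \<times> real) measure)"
    by (intro borel_measurable_continuous_onI continuous_on_fst continuous_on_id)
  ultimately have "(\<lambda>x :: real \<times> real. indicator (Collect P) (fst x) * g (fst x)) \<in> borel_measurable borel"
    using measurable_compose[of fst borel borel "\<lambda>x. indicator (Collect P) x * g x" borel] by simp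
  then show "(\<lambda>x :: real \<times> real. of_bool (P (fst x)) * g (fst x)) \<in> borel_measurable borel"
    by (simp add: indicator_def)
  obtain C where C: "C \<ge> 0" "\<And>x. x \<in> {0..M} \<Longrightarrow> \<bar>g x\<bar> \<le> C"
    using compact_bound_abs[OF compact_Icc continuous_on_subset[OF g]] by blast
  show "\<exists>C. \<forall>x\<in>{0..M}. \<forall>y\<in>{0..M}. \<bar>of_bool (P x) * g x\<bar> \<le> C"
    using C by (intro exI[of _ C]) (auto simp: abs_mult of_bool_def)
qed

lemma admissible_continuous: "continuous_on UNIV g \<Longrightarrow> admissible (\<lambda>x y. g x)"
  using admissible_indicator_mult[of "\<lambda>_. True" g] by simp

lemma admissible_relaxation: "admissible (\<lambda>x y. (y - F x)\<^sup>2)"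
  unfolding admissible_def
proof
  have c: "continuous_on UNIV (\<lambda>x :: real \<times> real. (snd x - F (fst x))\<^sup>2)"
    by (intro continuous_intros continuous_on_compose2[OF cont_F[of UNIV] continuous_on_fst[OF continuous_on_id]]) auto
  then show "(\<lambda>x :: real \<times> real. (snd x - F (fst x))\<^sup>2) \<in> borel_measurable borel"
    by (rule borel_measurable_continuous_onI)
  have "compact ({0..M} \<times> {0..M})" by (intro compact_Times compact_Icc)
  then obtain C where C: "C \<ge> 0" "\<And>x. x \<in> {0..M} \<times> {0..M} \<Longrightarrow> \<bar>(snd x - F (fst x))\<^sup>2\<bar> \<le> C"
    by (rule compact_bound_abs[OF _ continuous_on_subset[OF c]]) auto
  have "\<bar>(y - F x)\<^sup>2\<bar> \<le> C" if "x \<in> {0..M}" "y \<in> {0..M}" for x y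
    using C(2)[of "(x, y)"] that by simp
  then show "\<exists>C. \<forall>x\<in>{0..M}. \<forall>y\<in>{0..M}. \<bar>(y - F x)\<^sup>2\<bar> \<le> C" by blast
qed

definition wlim :: "(nat \<Rightarrow> nat) \<Rightarrow> (real \<Rightarrow> real \<Rightarrow> real) \<Rightarrow> (real \<times> 'a \<Rightarrow> real) \<Rightarrow> bool" where
  "wlim r G g \<longleftrightarrow> weakly_converges MQ (\<lambda>k. ext G (r k)) g"

lemma wlim_add: "wlim r G g \<Longrightarrow> wlim r G' g' \<Longrightarrow> wlim r (\<lambda>x y. G x y + G' x y) (\<lambda>z. g z + g' z)"
proof -
  assume a: "wlim r G g" "wlim r G' g'"
  have "ext (\<lambda>x y. G x y + G' x y) k = (\<lambda>z. ext G k z + ext G' k z)" for k by (auto simp: ext_def)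
  then show ?thesis using weakly_converges_add[OF a[unfolded wlim_def]] by (simp add: wlim_def)
qed

lemma wlim_cmult: "wlim r G g \<Longrightarrow> wlim r (\<lambda>x y. c * G x y) (\<lambda>z. c * g z)"
proof -
  assume a: "wlim r G g"
  have "ext (\<lambda>x y. c * G x y) k = (\<lambda>z. c * ext G k z)" for k by (auto simp: ext_def)
  then show ?thesis using weakly_converges_cmult[OF a[unfolded wlim_def], of c] by (simp add: wlim_def)
qed

lemma wlim_const: "wlim r (\<lambda>x y. c) (\<lambda>z. c * indicator Q z)"
proof -
  have e: "ext (\<lambda>x y. c) k = (\<lambda>z. c * indicator Q z)" for k by (auto simp: ext_def)
  have m: "(\<lambda>z. c * indicator Q z) \<in> borel_measurable MQ"
    unfolding borel_MQ by (intro borel_measurable_times borel_measurable_const borel_measurable_indicator Q_borel)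
  show ?thesis unfolding wlim_def weakly_converges_def e
    using m by (auto intro!: exI[of _ "\<bar>c\<bar>"] simp: indicator_def)
qed

lemma AE_in_Q: "AE z in MQ. z \<in> Q" unfolding AE_MQ by simp

text \<open>The functions need to be compared only on values that the solutions take; in particular
  \<open>x >= 0\<close> and \<open>F x\<close> in \<open>{0..M}\<close> are available.\<close>

lemma wlim_mono:
  assumes "wlim r G g" "wlim r G' g'"
    and le: "\<And>x y. x \<in> {0..M} \<Longrightarrow> y \<in> {0..M} \<Longrightarrow> F x \<in> {0..M} \<Longrightarrow> G x y \<le> G' x y"
  shows "AE z in MQ. g z \<le> g' z"
proof -
  have "wlim r (\<lambda>x y. G' x y + (-1) * G x y) (\<lambda>z. g' z + (-1) * g z)"
    by (rule wlim_add[OF assms(2) wlim_cmult[OF assms(1)]])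
  then have "AE z in MQ. 0 \<le> g' z + (-1) * g z"
    unfolding wlim_def
  proof (rule MQ.weakly_converges_nonneg)
    show "AE z in MQ. 0 \<le> ext (\<lambda>x y. G' x y + (-1) * G x y) (r k) z" for k
    proof (rule AE_I2)
      fix z
      show "0 \<le> ext (\<lambda>x y. G' x y + (-1) * G x y) (r k) z"
        using le[OF bounds(1)[of z "r k"] bounds(2)[of z "r k"] bounds(3)[of z "r k"]] by (simp add: ext_def)
    qed
  qed
  then show ?thesis by eventually_elim simp
qed

lemma wlim_cong:
  assumes "wlim r G g" "\<And>x y. x \<in> {0..M} \<Longrightarrow> y \<in> {0..M} \<Longrightarrow> F x \<in> {0..M} \<Longrightarrow> G x y = G' x y"
  shows "wlim r G' g"
proof -
  have "ext G' k = ext G k" for k using ext_cong[of G G' k] assms(2) by auto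
  then show ?thesis using assms(1) by (simp add: wlim_def)
qed

text \<open>Squared so as to be continuously differentiable, as \<open>compensated_product\<close>
  requires. Where the weak limits of \<open>lower_part p (F u)\<close> and
  \<open>upper_part q (F u)\<close> are positive, the law of \<open>F u\<close> charges values below
  \<open>p\<close>, respectively above \<open>q\<close>.\<close>

definition lower_part :: "real \<Rightarrow> real \<Rightarrow> real" where "lower_part p y = (max 0 (p - y))\<^sup>2"
definition upper_part :: "real \<Rightarrow> real \<Rightarrow> real" where "upper_part q y = (max 0 (y - q))\<^sup>2"

lemma DERIV_parts:
  "(lower_part p has_real_derivative - (2 * max 0 (p - y))) (at y)"
  "(upper_part q has_real_derivative 2 * max 0 (y - q)) (at y)"
  unfolding lower_part_def[abs_def] upper_part_def[abs_def] by (rule DERIV_pos_part_square_shift)+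

lemma continuous_parts: "continuous_on S (lower_part p)" "continuous_on S (upper_part q)"
  unfolding lower_part_def[abs_def] upper_part_def[abs_def] by (intro continuous_intros)+

lemma parts_nonneg: "0 \<le> lower_part p y" "0 \<le> upper_part q y" by (auto simp: lower_part_def upper_part_def)

lemma parts_zero: "p \<le> y \<Longrightarrow> lower_part p y = 0" "y \<le> q \<Longrightarrow> upper_part q y = 0"
  by (auto simp: lower_part_def upper_part_def max_def)

lemma potentials_exist:
  "\<exists>\<Psi> \<Phi>. \<forall>p q. (\<forall>x. (\<Psi> p q has_real_derivative hat p q (F x)) (at x)) \<and> \<Psi> p q 0 = 0 \<and>
    (\<forall>x. (\<Phi> p q has_real_derivative hat p q x) (at x)) \<and> \<Phi> p q p = 0"
proof -
  have sub: "\<exists>G. (\<forall>x. (G has_real_derivative f x) (at x)) \<and> G c = 0"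
    if f: "continuous_on UNIV f" for f :: "real \<Rightarrow> real" and c
  proof -
    obtain G where G: "\<And>x. (G has_real_derivative f x) (at x)" using continuous_antiderivative[OF f] by blast
    have "((\<lambda>x. G x - G c) has_real_derivative f x) (at x)" for x
      using DERIV_diff[OF G[of x] DERIV_const[of "G c"]] by simp
    then show ?thesis by (intro exI[of _ "\<lambda>x. G x - G c"]) auto
  qed
  have c: "continuous_on UNIV (\<lambda>x. hat p q (F x))" for p q
    by (rule continuous_on_compose2[OF continuous_on_hat[of UNIV] cont_F]) simp
  have "\<forall>p q. \<exists>G. (\<forall>x. (G has_real_derivative hat p q (F x)) (at x)) \<and> G 0 = 0" using sub[OF c] by blast
  then obtain \<Psi> where \<Psi>: "\<And>p q. (\<forall>x. (\<Psi> p q has_real_derivative hat p q (F x)) (at x)) \<and> \<Psi> p q 0 = 0" by metis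
  have "\<forall>p q. \<exists>G. (\<forall>x. (G has_real_derivative hat p q x) (at x)) \<and> G p = 0" using sub[OF continuous_on_hat] by blast
  then obtain \<Phi> where \<Phi>: "\<And>p q. (\<forall>x. (\<Phi> p q has_real_derivative hat p q x) (at x)) \<and> \<Phi> p q p = 0" by metis
  show ?thesis using \<Psi> \<Phi> by blast
qed

text \<open>Countable, so that one subsequence gives the limits of all members. The identity yields
  the limit of \<open>u\<close>, \<open>F\<close> and its square the variance of the law of
  \<open>F u\<close>, \<open>(y - F x)^2\<close> the relaxation, and the three indicators the branch
  weights; the families with rational parameters enter the concentration argument.\<close>

definition test_functions :: "(real \<Rightarrow> real \<Rightarrow> real \<Rightarrow> real) \<Rightarrow> (real \<Rightarrow> real \<Rightarrow> real \<Rightarrow> real) \<Rightarrow> (real \<Rightarrow> real \<Rightarrow> real) set" where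
  "test_functions \<Psi> \<Phi> = {\<lambda>x y. x, \<lambda>x y. F x, \<lambda>x y. (F x)\<^sup>2, \<lambda>x y. (y - F x)\<^sup>2,
      \<lambda>x y. of_bool (x < ap), \<lambda>x y. of_bool (ap \<le> x \<and> x \<le> bm), \<lambda>x y. of_bool (bm < x)}
    \<union> (\<lambda>p x y. lower_part p (F x)) ` \<rat> \<union> (\<lambda>p x y. upper_part p (F x)) ` \<rat>
    \<union> (\<lambda>p x y. of_bool (ap \<le> x) * lower_part p (F x)) ` \<rat> \<union> (\<lambda>p x y. of_bool (bm < x) * upper_part p (F x)) ` \<rat>
    \<union> (\<lambda>pq x y. \<Psi> (fst pq) (snd pq) x + \<Phi> (fst pq) (snd pq) (F x)) ` (\<rat> \<times> \<rat>)"

lemma test_functions_basic: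
  "(\<lambda>x y. x) \<in> test_functions \<Psi> \<Phi>" "(\<lambda>x y. F x) \<in> test_functions \<Psi> \<Phi>"
  "(\<lambda>x y. (F x)\<^sup>2) \<in> test_functions \<Psi> \<Phi>" "(\<lambda>x y. (y - F x)\<^sup>2) \<in> test_functions \<Psi> \<Phi>"
  "(\<lambda>x y. of_bool (x < ap)) \<in> test_functions \<Psi> \<Phi>"
  "(\<lambda>x y. of_bool (ap \<le> x \<and> x \<le> bm)) \<in> test_functions \<Psi> \<Phi>" "(\<lambda>x y. of_bool (bm < x)) \<in> test_functions \<Psi> \<Phi>"
  by (simp_all add: test_functions_def)

lemma test_functions_parts:
  assumes "p \<in> \<rat>"
  shows "(\<lambda>x y. lower_part p (F x)) \<in> test_functions \<Psi> \<Phi>" "(\<lambda>x y. upper_part p (F x)) \<in> test_functions \<Psi> \<Phi>"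
    "(\<lambda>x y. of_bool (ap \<le> x) * lower_part p (F x)) \<in> test_functions \<Psi> \<Phi>"
    "(\<lambda>x y. of_bool (bm < x) * upper_part p (F x)) \<in> test_functions \<Psi> \<Phi>"
  using assms unfolding test_functions_def by blast+

lemma test_functions_potentials:
  assumes "p \<in> \<rat>" "q \<in> \<rat>"
  shows "(\<lambda>x y. \<Psi> p q x + \<Phi> p q (F x)) \<in> test_functions \<Psi> \<Phi>"
proof -
  have "(\<lambda>x y. \<Psi> p q x + \<Phi> p q (F x)) \<in> (\<lambda>pq x y. \<Psi> (fst pq) (snd pq) x + \<Phi> (fst pq) (snd pq) (F x)) ` (\<rat> \<times> \<rat>)"
    by (rule image_eqI[of _ _ "(p, q)"]) (use assms in auto)
  then show ?thesis unfolding test_functions_def by blast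
qed

lemma test_limits_exist:
  assumes \<Psi>: "\<And>p q x. (\<Psi> p q has_real_derivative hat p q (F x)) (at x)"
    and \<Phi>: "\<And>p q x. (\<Phi> p q has_real_derivative hat p q x) (at x)"
  shows "\<exists>r lim. strict_mono r \<and> (\<forall>G\<in>test_functions \<Psi> \<Phi>. wlim r G (lim G))"
proof -
  have cnt: "countable (test_functions \<Psi> \<Phi>)"
    unfolding test_functions_def by (intro countable_Un countable_image countable_SIGMA countable_rat) auto
  have c\<Psi>: "continuous_on S (\<Psi> p q)" "continuous_on S (\<Phi> p q)" for S p q
    by (rule DERIV_continuous_on[OF has_field_derivative_at_within[OF \<Psi>]]
        DERIV_continuous_on[OF has_field_derivative_at_within[OF \<Phi>]])+
  have cF: "continuous_on UNIV (\<lambda>x. k (F x))" if "continuous_on UNIV k" for k :: "real \<Rightarrow> real"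
    by (rule continuous_on_compose2[OF that cont_F]) simp
  have c1: "continuous_on UNIV (\<lambda>x::real. 1::real)" by simp
  have m: "Collect (\<lambda>x. x < ap) \<in> sets borel" "Collect (\<lambda>x. ap \<le> x \<and> x \<le> bm) \<in> sets borel"
    "Collect (\<lambda>x. bm < x) \<in> sets borel" "Collect (\<lambda>x. ap \<le> x) \<in> sets borel"
    by measurable
  have fixed: "admissible (\<lambda>x y. x)" "admissible (\<lambda>x y. F x)" "admissible (\<lambda>x y. (F x)\<^sup>2)"
    "admissible (\<lambda>x y. of_bool (x < ap))" "admissible (\<lambda>x y. of_bool (ap \<le> x \<and> x \<le> bm))" "admissible (\<lambda>x y. of_bool (bm < x))"
    using admissible_indicator_mult[OF m(1) c1] admissible_indicator_mult[OF m(2) c1] admissible_indicator_mult[OF m(3) c1]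
    by (auto intro!: admissible_continuous continuous_intros cont_F)
  have par: "admissible (\<lambda>x y. lower_part p (F x))" "admissible (\<lambda>x y. upper_part p (F x))"
    "admissible (\<lambda>x y. of_bool (ap \<le> x) * lower_part p (F x))" "admissible (\<lambda>x y. of_bool (bm < x) * upper_part p (F x))"
    "admissible (\<lambda>x y. \<Psi> p q x + \<Phi> p q (F x))" for p q
    by (intro admissible_continuous cF continuous_parts admissible_indicator_mult[OF m(4)] admissible_indicator_mult[OF m(3)]
        continuous_on_add c\<Psi>)+
  have adm: "admissible G" if "G \<in> test_functions \<Psi> \<Phi>" for G
    using that unfolding test_functions_def by (elim UnE insertE imageE emptyE) (simp_all only: fixed par admissible_relaxation)
  have ne: "test_functions \<Psi> \<Phi> \<noteq> {}" using test_functions_basic(1) by blast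
  show ?thesis using weak_limits_exist[OF cnt ne adm] unfolding wlim_def .
qed

text \<open>By \<open>compensated_product\<close> the weak limit \<open>U\<close> of the potential
  equals its average with the weight \<open>lower_part p (F u)\<close>, and also its average with
  the weight \<open>upper_part q (F u)\<close>. Where both weights have a positive limit, equating
  the two averages for all rational hats between \<open>p\<close> and \<open>q\<close> contradicts
  nondegeneracy.\<close>

lemma concentration:
  assumes \<Psi>: "\<And>p q x. (\<Psi> p q has_real_derivative hat p q (F x)) (at x)" and \<Psi>0: "\<And>p q. \<Psi> p q 0 = 0"
    and \<Phi>: "\<And>p q x. (\<Phi> p q has_real_derivative hat p q x) (at x)" and \<Phi>0: "\<And>p q. \<Phi> p q p = 0"
    and r: "strict_mono r"
    and wH1: "\<And>p. p \<in> \<rat> \<Longrightarrow> wlim r (\<lambda>x y. lower_part p (F x)) (H1 p)"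
    and wH2: "\<And>p. p \<in> \<rat> \<Longrightarrow> wlim r (\<lambda>x y. upper_part p (F x)) (H2 p)"
    and wA: "\<And>p. p \<in> \<rat> \<Longrightarrow> wlim r (\<lambda>x y. of_bool (ap \<le> x) * lower_part p (F x)) (A p)"
    and wB: "\<And>p. p \<in> \<rat> \<Longrightarrow> wlim r (\<lambda>x y. of_bool (bm < x) * upper_part p (F x)) (B p)"
    and wU: "\<And>p q. p \<in> \<rat> \<Longrightarrow> q \<in> \<rat> \<Longrightarrow> wlim r (\<lambda>x y. \<Psi> p q x + \<Phi> p q (F x)) (U p q)"
  shows "AE z in MQ. \<forall>p\<in>\<rat>. \<forall>q\<in>\<rat>. p < q \<longrightarrow> \<not> (0 < H1 p z \<and> 0 < H2 q z)"
proof -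
  have hat': "\<And>p q. \<exists>h'. continuous_on UNIV h' \<and> (\<forall>r. (hat p q has_real_derivative h' r) (at r))" by (rule DERIV_hat)
  have zero_lim: "wlim r (\<lambda>x y. 0) (\<lambda>z. 0)" using wlim_const[of r 0] by simp
  have A: "AE z in MQ. 0 \<le> A p z \<and> A p z \<le> H1 p z" if p: "p \<in> \<rat>" for p
  proof -
    have "AE z in MQ. 0 \<le> A p z" by (rule wlim_mono[OF zero_lim wA[OF p]]) (simp add: parts_nonneg)
    moreover have "AE z in MQ. A p z \<le> H1 p z"
      by (rule wlim_mono[OF wA[OF p] wH1[OF p]]) (simp add: parts_nonneg of_bool_def)
    ultimately show ?thesis by eventually_elim simp
  qed
  have B: "AE z in MQ. 0 \<le> B p z \<and> B p z \<le> H2 p z" if p: "p \<in> \<rat>" for p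
  proof -
    have "AE z in MQ. 0 \<le> B p z" by (rule wlim_mono[OF zero_lim wB[OF p]]) (simp add: parts_nonneg)
    moreover have "AE z in MQ. B p z \<le> H2 p z"
      by (rule wlim_mono[OF wB[OF p] wH2[OF p]]) (simp add: parts_nonneg of_bool_def)
    ultimately show ?thesis by eventually_elim simp
  qed
  \<comment> \<open>On \<open>F x <= p\<close> the function \<open>\<Phi> p' q'\<close> vanishes,
    while \<open>\<Psi> p' q'\<close> is 0 on the first branch and \<open>\<Psi> p' q' bm\<close>
    beyond; so the weighted potential is a multiple of the function with limit
    \<open>A p\<close>.\<close>
  have E1: "AE z in MQ. \<Psi> p' q' bm * A p z = U p' q' z * H1 p z"
    if q: "p \<in> \<rat>" "p' \<in> \<rat>" "q' \<in> \<rat>" "p \<le> p'" "p' < q'" for p p' q'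
  proof -
    obtain h' where h': "continuous_on UNIV h'" "\<And>r. (hat p' q' has_real_derivative h' r) (at r)" using hat' by blast
    note ctx = \<Psi>[of p' q'] \<Phi>[of p' q'] q(5)
    have "wlim r (\<lambda>x y. (\<Psi> p' q' x + \<Phi> p' q' (F x)) * lower_part p (F x)) (\<lambda>z. \<Psi> p' q' bm * A p z)"
    proof (rule wlim_cong[OF wlim_cmult[OF wA[OF q(1)]]])
      fix x y assume x: "x \<in> {0..M}"
      show "\<Psi> p' q' bm * (of_bool (ap \<le> x) * lower_part p (F x)) = (\<Psi> p' q' x + \<Phi> p' q' (F x)) * lower_part p (F x)"
      proof (cases "F x \<le> p")
        case True
        have "\<Phi> p' q' (F x) = 0" using \<Phi>_below[OF ctx, of "F x"] True q(4) \<Phi>0 by simp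
        moreover have "\<Psi> p' q' x = 0" if "\<not> ap \<le> x" using \<Psi>_below_left[OF ctx, of x] True q(4) that x \<Psi>0 by simp
        moreover have "\<Psi> p' q' x = \<Psi> p' q' bm" if "ap \<le> x" using \<Psi>_below_right[OF ctx that] True q(4) by simp
        ultimately show ?thesis by (cases "ap \<le> x") auto
      next
        case False
        then show ?thesis using parts_zero(1)[of p "F x"] by simp
      qed
    qed
    moreover have "continuous_on UNIV (\<lambda>y. - (2 * max 0 (p - y)))" by (intro continuous_intros)
    ultimately show ?thesis
      using compensated_product[OF \<Psi>[of p' q'] \<Phi>[of p' q'] h'(2,1) DERIV_parts(1)[of p] _ r] wU[OF q(2,3)] wH1[OF q(1)]
      unfolding wlim_def by blast
  qed
  \<comment> \<open>On \<open>p <= F x\<close> the function \<open>\<Phi> p' q'\<close> has the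
    constant value \<open>\<Phi> p' q' q'\<close>, while \<open>\<Psi> p' q'\<close> has its value
    at \<open>ap\<close> for arguments up to \<open>bm\<close> and its value at \<open>M\<close>
    beyond.\<close>
  have E2: "AE z in MQ. \<Psi> p' q' ap * H2 p z + ((\<Psi> p' q' M - \<Psi> p' q' ap) * B p z + \<Phi> p' q' q' * H2 p z) = U p' q' z * H2 p z"
    if q: "p \<in> \<rat>" "p' \<in> \<rat>" "q' \<in> \<rat>" "q' \<le> p" "p' < q'" for p p' q'
  proof -
    obtain h' where h': "continuous_on UNIV h'" "\<And>r. (hat p' q' has_real_derivative h' r) (at r)" using hat' by blast
    note ctx = \<Psi>[of p' q'] \<Phi>[of p' q'] q(5)
    have "wlim r (\<lambda>x y. (\<Psi> p' q' x + \<Phi> p' q' (F x)) * upper_part p (F x))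
        (\<lambda>z. \<Psi> p' q' ap * H2 p z + ((\<Psi> p' q' M - \<Psi> p' q' ap) * B p z + \<Phi> p' q' q' * H2 p z))"
    proof (rule wlim_cong[OF wlim_add[OF wlim_cmult[OF wH2[OF q(1)]] wlim_add[OF wlim_cmult[OF wB[OF q(1)]] wlim_cmult[OF wH2[OF q(1)]]]]])
      fix x y assume x: "x \<in> {0..M}"
      show "\<Psi> p' q' ap * upper_part p (F x) + ((\<Psi> p' q' M - \<Psi> p' q' ap) * (of_bool (bm < x) * upper_part p (F x)) + \<Phi> p' q' q' * upper_part p (F x))
        = (\<Psi> p' q' x + \<Phi> p' q' (F x)) * upper_part p (F x)"
      proof (cases "p \<le> F x")
        case True
        have "\<Phi> p' q' (F x) = \<Phi> p' q' q'" using \<Phi>_above[OF ctx, of "F x"] True q(4) by simp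
        moreover have "\<Psi> p' q' x = \<Psi> p' q' ap" if "\<not> bm < x" using \<Psi>_above_left[OF ctx, of x] True q(4) that by simp
        moreover have "\<Psi> p' q' x = \<Psi> p' q' M" if "bm < x" using \<Psi>_above_right[OF ctx, of x M] True q(4) that x by simp
        ultimately show ?thesis by (cases "bm < x") (auto simp: algebra_simps)
      next
        case False
        then show ?thesis using parts_zero(2)[of "F x" p] by simp
      qed
    qed
    moreover have "continuous_on UNIV (\<lambda>y. 2 * max 0 (y - p))" by (intro continuous_intros)
    ultimately show ?thesis
      using compensated_product[OF \<Psi>[of p' q'] \<Phi>[of p' q'] h'(2,1) DERIV_parts(2)[of p] _ r] wU[OF q(2,3)] wH2[OF q(1)]
      unfolding wlim_def by blast
  qed
  have A': "AE z in MQ. \<forall>p\<in>\<rat>. 0 \<le> A p z \<and> A p z \<le> H1 p z"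
    by (rule AE_ball_countable'[OF A countable_rat])
  have B': "AE z in MQ. \<forall>p\<in>\<rat>. 0 \<le> B p z \<and> B p z \<le> H2 p z"
    by (rule AE_ball_countable'[OF B countable_rat])
  have E1': "AE z in MQ. \<forall>p\<in>\<rat>. \<forall>p'\<in>\<rat>. \<forall>q'\<in>\<rat>. p \<le> p' \<and> p' < q' \<longrightarrow> \<Psi> p' q' bm * A p z = U p' q' z * H1 p z"
  proof (intro AE_ball_countable' countable_rat)
    fix p p' q' :: real assume "p \<in> \<rat>" "p' \<in> \<rat>" "q' \<in> \<rat>"
    then show "AE z in MQ. p \<le> p' \<and> p' < q' \<longrightarrow> \<Psi> p' q' bm * A p z = U p' q' z * H1 p z"
      using E1[of p p' q'] by (cases "p \<le> p' \<and> p' < q'") auto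
  qed
  have E2': "AE z in MQ. \<forall>p\<in>\<rat>. \<forall>p'\<in>\<rat>. \<forall>q'\<in>\<rat>. q' \<le> p \<and> p' < q' \<longrightarrow>
      \<Psi> p' q' ap * H2 p z + ((\<Psi> p' q' M - \<Psi> p' q' ap) * B p z + \<Phi> p' q' q' * H2 p z) = U p' q' z * H2 p z"
  proof (intro AE_ball_countable' countable_rat)
    fix p p' q' :: real assume "p \<in> \<rat>" "p' \<in> \<rat>" "q' \<in> \<rat>"
    then show "AE z in MQ. q' \<le> p \<and> p' < q' \<longrightarrow>
      \<Psi> p' q' ap * H2 p z + ((\<Psi> p' q' M - \<Psi> p' q' ap) * B p z + \<Phi> p' q' q' * H2 p z) = U p' q' z * H2 p z"
      using E2[of p p' q'] by (cases "q' \<le> p \<and> p' < q'") auto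
  qed
  from A' B' E1' E2' show ?thesis
  proof eventually_elim
    case (elim z)
    show ?case
    proof (intro ballI impI notI)
      fix p q :: real assume pq: "p \<in> \<rat>" "q \<in> \<rat>" "p < q" and pos: "0 < H1 p z \<and> 0 < H2 q z"
      \<comment> \<open>\<open>a\<close> is the share of \<open>ap <= u\<close> in the mass below
        \<open>p\<close> and \<open>b\<close> the share of the third branch in the mass above
        \<open>q\<close>, both measured with the weights of the test functions.\<close>
      define a b where "a = A p z / H1 p z" and "b = B q z / H2 q z"
      have ab: "0 \<le> a" "a \<le> 1" "0 \<le> b" "b \<le> 1"
        using elim(1)[rule_format, OF pq(1)] elim(2)[rule_format, OF pq(2)] pos by (auto simp: a_def b_def)
      show False
      proof (rule nondegeneracy_contradiction[OF pq(3) ab M \<Psi> \<Phi>])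
        fix p' q' :: real assume q': "p' \<in> \<rat>" "q' \<in> \<rat>" "p \<le> p'" "p' < q'" "q' \<le> q"
        have "\<Psi> p' q' bm * A p z = U p' q' z * H1 p z"
          using elim(3) pq(1) q' by blast
        then have 1: "U p' q' z = \<Psi> p' q' bm * a" using pos by (simp add: a_def field_simps)
        have "\<Psi> p' q' ap * H2 q z + ((\<Psi> p' q' M - \<Psi> p' q' ap) * B q z + \<Phi> p' q' q' * H2 q z) = U p' q' z * H2 q z"
          using elim(4) pq(2) q' by blast
        moreover have "B q z = b * H2 q z" using pos by (simp add: b_def)
        ultimately have "(\<Psi> p' q' ap + (\<Psi> p' q' M - \<Psi> p' q' ap) * b + \<Phi> p' q' q') * H2 q z = U p' q' z * H2 q z"
          by (simp add: algebra_simps)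
        then have 2: "U p' q' z = \<Psi> p' q' ap + (\<Psi> p' q' M - \<Psi> p' q' ap) * b + \<Phi> p' q' q'" using pos by simp
        show "a * (\<Psi> p' q' bm - \<Psi> p' q' 0) = (1 - b) * (\<Psi> p' q' ap - \<Psi> p' q' 0) + b * (\<Psi> p' q' M - \<Psi> p' q' 0) + (\<Phi> p' q' q' - \<Phi> p' q' p')"
          using 1 2 by (simp add: \<Psi>0 \<Phi>0 algebra_simps)
      qed
    qed
  qed
qed

lemma wlimD:
  assumes "wlim r G g"
  shows "g \<in> borel_measurable borel" "ext G (r k) \<in> borel_measurable borel" "\<exists>C. \<forall>z. (\<forall>k. \<bar>ext G (r k) z\<bar> \<le> C) \<and> \<bar>g z\<bar> \<le> C"
  using assms unfolding wlim_def weakly_converges_def borel_MQ by blast+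

text \<open>\<open>W2 - W^2\<close> is the variance of the law of \<open>F u\<close>. On a grid of
  width \<open>\<delta>\<close> the concentration property confines this law to an interval of
  length at most \<open>2 * \<delta>\<close>, so the variance is at most
  \<open>12 * \<delta>^2\<close> for every positive rational \<open>\<delta>\<close>.\<close>

lemma square_limit_le:
  assumes r: "strict_mono r" and wF: "wlim r (\<lambda>x y. F x) W" and wF2: "wlim r (\<lambda>x y. (F x)\<^sup>2) W2"
    and wH1: "\<And>p. p \<in> \<rat> \<Longrightarrow> wlim r (\<lambda>x y. lower_part p (F x)) (H1 p)"
    and wH2: "\<And>p. p \<in> \<rat> \<Longrightarrow> wlim r (\<lambda>x y. upper_part p (F x)) (H2 p)"
    and conc: "AE z in MQ. \<forall>p\<in>\<rat>. \<forall>q\<in>\<rat>. p < q \<longrightarrow> \<not> (0 < H1 p z \<and> 0 < H2 q z)"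
  shows "AE z in MQ. W2 z \<le> (W z)\<^sup>2"
proof -
  have zero_lim: "wlim r (\<lambda>x y. 0) (\<lambda>z. 0)" using wlim_const[of r 0] by simp
  have key: "AE z in MQ. p \<le> q \<longrightarrow> W2 z - 2 * p * W z + p\<^sup>2 \<le> 3 * H2 q z + 3 * H1 p z + 3 * (q - p)\<^sup>2"
    if pq: "p \<in> \<rat>" "q \<in> \<rat>" for p q
  proof (cases "p \<le> q")
    case True
    \<comment> \<open>Pointwise, \<open>(s - p)^2\<close> is at most three times the sum of
      \<open>(q - p)^2\<close> and the squared distances of \<open>s\<close> above \<open>q\<close>
      and below \<open>p\<close>. Expanding the left side makes both sides linear in the available
      weak limits.\<close>
    have "AE z in MQ. W2 z + ((- 2 * p) * W z + p\<^sup>2 * indicator Q z) \<le> 3 * H2 q z + (3 * H1 p z + (3 * (q - p)\<^sup>2) * indicator Q z)"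
    proof (rule wlim_mono[OF wlim_add[OF wF2 wlim_add[OF wlim_cmult[OF wF] wlim_const]]
          wlim_add[OF wlim_cmult[OF wH2[OF pq(2)]] wlim_add[OF wlim_cmult[OF wH1[OF pq(1)]] wlim_const]]])
      fix x y :: real
      let ?s = "F x"
      have "(?s)\<^sup>2 + ((- 2 * p) * ?s + p\<^sup>2) = (?s - p)\<^sup>2" by (simp add: power2_eq_square algebra_simps)
      also have "\<dots> \<le> 3 * upper_part q ?s + (3 * lower_part p ?s + 3 * (q - p)\<^sup>2)"
      proof -
        consider "?s \<le> p" | "p \<le> ?s" "?s \<le> q" | "q \<le> ?s" by linarith
        then show ?thesis
        proof cases
          case 1
          then have "lower_part p ?s = (?s - p)\<^sup>2" by (simp add: lower_part_def power2_commute)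
          then show ?thesis using parts_nonneg(2)[of q ?s] zero_le_power2[of "?s - p"] zero_le_power2[of "q - p"] by linarith
        next
          case 2
          then have "(?s - p)\<^sup>2 \<le> (q - p)\<^sup>2" by (intro power_mono) auto
          then show ?thesis using parts_nonneg[of q ?s] parts_nonneg(1)[of p ?s] parts_nonneg(2)[of q ?s] zero_le_power2[of "q - p"] by linarith
        next
          case 3
          have e: "?s - p = (?s - q) + (q - p)" by simp
          have "(?s - p)\<^sup>2 \<le> 2 * (?s - q)\<^sup>2 + 2 * (q - p)\<^sup>2"
            unfolding e power2_sum using sum_squares_bound[of "?s - q" "q - p"] by linarith
          moreover have "upper_part q ?s = (?s - q)\<^sup>2" using 3 by (simp add: upper_part_def)
          ultimately show ?thesis using parts_nonneg(1)[of p ?s] zero_le_power2[of "?s - q"] zero_le_power2[of "q - p"] by linarith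
        qed
      qed
      finally show "(?s)\<^sup>2 + ((- 2 * p) * ?s + p\<^sup>2) \<le> 3 * upper_part q ?s + (3 * lower_part p ?s + 3 * (q - p)\<^sup>2)" .
    qed
    with AE_in_Q show ?thesis by eventually_elim simp
  qed simp
  have key': "AE z in MQ. \<forall>p\<in>\<rat>. \<forall>q\<in>\<rat>. p \<le> q \<longrightarrow> W2 z - 2 * p * W z + p\<^sup>2 \<le> 3 * H2 q z + 3 * H1 p z + 3 * (q - p)\<^sup>2"
    by (intro AE_ball_countable' countable_rat key)
  have low: "AE z in MQ. \<forall>p\<in>\<rat>. p \<le> 0 \<longrightarrow> H1 p z \<le> 0"
  proof (intro AE_ball_countable' countable_rat)
    fix p :: real assume p: "p \<in> \<rat>"
    show "AE z in MQ. p \<le> 0 \<longrightarrow> H1 p z \<le> 0"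
    proof (cases "p \<le> 0")
      case True
      have "AE z in MQ. H1 p z \<le> 0"
        by (rule wlim_mono[OF wH1[OF p] zero_lim]) (use True parts_zero(1) in auto)
      then show ?thesis by eventually_elim simp
    qed simp
  qed
  have high: "AE z in MQ. \<forall>q\<in>\<rat>. M \<le> q \<longrightarrow> H2 q z \<le> 0"
  proof (intro AE_ball_countable' countable_rat)
    fix q :: real assume q: "q \<in> \<rat>"
    show "AE z in MQ. M \<le> q \<longrightarrow> H2 q z \<le> 0"
    proof (cases "M \<le> q")
      case True
      have "AE z in MQ. H2 q z \<le> 0"
        by (rule wlim_mono[OF wH2[OF q] zero_lim]) (use True parts_zero(2) in auto)
      then show ?thesis by eventually_elim simp
    qed simp
  qed
  from key' low high conc show ?thesis
  proof eventually_elim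
    case (elim z)
    have step: "W2 z - (W z)\<^sup>2 \<le> 12 * \<delta>\<^sup>2" if \<delta>: "\<delta> \<in> \<rat>" "0 < \<delta>" for \<delta> :: real
    proof -
      have rat: "real i * \<delta> \<in> \<rat>" "real i * \<delta> - c * \<delta> \<in> \<rat>" if "c \<in> \<rat>" for i c using \<delta>(1) that by simp_all
      define P where "P i \<longleftrightarrow> H2 (real i * \<delta>) z \<le> 0" for i
      obtain n where "M / \<delta> < real n" using reals_Archimedean2 by blast
      then have "M \<le> real n * \<delta>" using \<delta>(2) by (simp add: divide_less_eq)
      then have "P n" unfolding P_def using elim(3) \<delta>(1) by simp
      \<comment> \<open>The lowest grid level above which there is no mass.\<close>
      define i where "i = (LEAST i. P i)"
      have Pi: "P i" unfolding i_def using \<open>P n\<close> by (rule LeastI)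
      \<comment> \<open>There is mass above the level just below \<open>i\<close>, hence none below
        any strictly smaller level; the strict inequality in the concentration property is the
        reason for going down two steps. For \<open>i = 0\<close> one step is enough, since
        \<open>F u\<close> is nonnegative.\<close>
      define q p where "q = real i * \<delta>" and "p = real i * \<delta> - (if i = 0 then 1 else 2) * \<delta>"
      have pqr: "p \<in> \<rat>" "q \<in> \<rat>" "p \<le> q" using \<delta> by (auto simp: p_def q_def)
      have "H1 p z \<le> 0"
      proof (cases "i = 0")
        case True
        then have "p \<le> 0" using \<delta>(2) by (simp add: p_def)
        then show ?thesis using elim(2) pqr(1) by blast
      next
        case False
        then have "\<not> P (i - 1)" unfolding i_def by (intro not_less_Least) simp
        then have "0 < H2 (real (i - 1) * \<delta>) z" by (simp add: P_def)
        moreover have "p < real (i - 1) * \<delta>" using False \<delta>(2) by (simp add: p_def of_nat_diff left_diff_distrib)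
        moreover have "real (i - 1) * \<delta> \<in> \<rat>" using \<delta>(1) by simp
        ultimately show ?thesis using elim(4) pqr(1) by (meson not_less)
      qed
      moreover have "H2 q z \<le> 0" using Pi by (simp add: P_def q_def)
      moreover have "W2 z - 2 * p * W z + p\<^sup>2 \<le> 3 * H2 q z + 3 * H1 p z + 3 * (q - p)\<^sup>2" using elim(1) pqr by blast
      moreover have "(q - p)\<^sup>2 \<le> (2 * \<delta>)\<^sup>2" using \<delta>(2) by (intro power_mono) (auto simp: p_def q_def)
      moreover have "(W z)\<^sup>2 - 2 * p * W z + p\<^sup>2 = (W z - p)\<^sup>2" by (simp add: power2_eq_square algebra_simps)
      ultimately have "W2 z - (W z)\<^sup>2 \<le> 3 * (2 * \<delta>)\<^sup>2" using zero_le_power2[of "W z - p"] by linarith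
      then show ?thesis by (simp add: power_mult_distrib)
    qed
    have "W2 z - (W z)\<^sup>2 \<le> 12 * (1 / real (Suc n))\<^sup>2" for n by (rule step) auto
    then have le: "\<exists>N. \<forall>n\<ge>N. W2 z - (W z)\<^sup>2 \<le> 12 * (1 / real (Suc n))\<^sup>2" by blast
    have "(\<lambda>n. 12 * (1 / real (Suc n))\<^sup>2) \<longlonglongrightarrow> 12 * 0\<^sup>2"
      by (intro tendsto_intros LIMSEQ_Suc[OF lim_1_over_n])
    from LIMSEQ_le_const[OF this le] have "W2 z - (W z)\<^sup>2 \<le> 12 * 0\<^sup>2" .
    then show ?case by simp
  qed
qed

section \<open>Strong convergence of \<open>F u\<close> and of \<open>v\<close>\<close>

lemma bounded_integrable_MQ:
  fixes f :: "real \<times> 'a \<Rightarrow> real"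
  assumes "f \<in> borel_measurable borel" "\<And>z. \<bar>f z\<bar> \<le> C"
  shows "integrable MQ f"
  using assms by (intro MQ.integrable_const_bound[where B=C]) (auto simp: borel_MQ)

text \<open>Expanding the square and using the weak limits of \<open>(F u)^2\<close> and of
  \<open>F u\<close>, the latter against the fixed function \<open>W\<close>, the squared distances
  converge to the integral of \<open>W2 - W^2\<close>. This number is nonnegative as a limit and
  nonpositive by \<open>le\<close>.\<close>

lemma strong_limit_F:
  assumes wF: "wlim r (\<lambda>x y. F x) W" and wF2: "wlim r (\<lambda>x y. (F x)\<^sup>2) W2"
    and le: "AE z in MQ. W2 z \<le> (W z)\<^sup>2"
  shows "(\<lambda>k. \<integral>z. (ext (\<lambda>x y. F x) (r k) z - W z)\<^sup>2 \<partial>MQ) \<longlonglongrightarrow> 0"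
proof -
  obtain C where C: "\<And>z k. \<bar>ext (\<lambda>x y. F x) (r k) z\<bar> \<le> C" "\<And>z. \<bar>W z\<bar> \<le> C" using wlimD(3)[OF wF] by blast
  obtain C2 where C2: "\<And>z k. \<bar>ext (\<lambda>x y. (F x)\<^sup>2) (r k) z\<bar> \<le> C2" "\<And>z. \<bar>W2 z\<bar> \<le> C2" using wlimD(3)[OF wF2] by blast
  note m = wlimD(1)[OF wF] wlimD(2)[OF wF] wlimD(1)[OF wF2] wlimD(2)[OF wF2]
  have iW: "integrable MQ W" by (rule bounded_integrable_MQ[OF m(1) C(2)])
  have iWW: "integrable MQ (\<lambda>z. W z * W z)" by (rule integrable_bounded_mult[OF iW _ C(2)]) (simp add: borel_MQ m)
  have ieW: "integrable MQ (\<lambda>z. ext (\<lambda>x y. F x) (r k) z * W z)" for k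
    by (rule integrable_bounded_mult[OF iW _ C(1)]) (simp add: borel_MQ m)
  have ie2: "integrable MQ (ext (\<lambda>x y. (F x)\<^sup>2) (r k))" for k by (rule bounded_integrable_MQ[OF m(4) C2(1)])
  have iW2: "integrable MQ W2" by (rule bounded_integrable_MQ[OF m(3) C2(2)])
  have i1: "integrable MQ (\<lambda>_. 1 :: real)" by simp
  have "(\<lambda>k. (\<integral>z. ext (\<lambda>x y. (F x)\<^sup>2) (r k) z * 1 \<partial>MQ) - 2 * (\<integral>z. ext (\<lambda>x y. F x) (r k) z * W z \<partial>MQ) + (\<integral>z. W z * W z \<partial>MQ))
      \<longlonglongrightarrow> (\<integral>z. W2 z * 1 \<partial>MQ) - 2 * (\<integral>z. W z * W z \<partial>MQ) + (\<integral>z. W z * W z \<partial>MQ)"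
    by (intro tendsto_intros weakly_convergesD(1)[OF wF2[unfolded wlim_def] i1] weakly_convergesD(1)[OF wF[unfolded wlim_def] iW])
  moreover have eq: "(\<integral>z. (ext (\<lambda>x y. F x) (r k) z - W z)\<^sup>2 \<partial>MQ) =
     (\<integral>z. ext (\<lambda>x y. (F x)\<^sup>2) (r k) z * 1 \<partial>MQ) - 2 * (\<integral>z. ext (\<lambda>x y. F x) (r k) z * W z \<partial>MQ) + (\<integral>z. W z * W z \<partial>MQ)" for k
  proof -
    have "(\<integral>z. (ext (\<lambda>x y. F x) (r k) z - W z)\<^sup>2 \<partial>MQ)
      = (\<integral>z. ext (\<lambda>x y. (F x)\<^sup>2) (r k) z - 2 * (ext (\<lambda>x y. F x) (r k) z * W z) + W z * W z \<partial>MQ)"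
      by (rule Bochner_Integration.integral_cong) (auto simp: ext_def power2_eq_square algebra_simps)
    then show ?thesis using ie2 ieW iWW by simp
  qed
  ultimately have lim: "(\<lambda>k. \<integral>z. (ext (\<lambda>x y. F x) (r k) z - W z)\<^sup>2 \<partial>MQ) \<longlonglongrightarrow> (\<integral>z. W2 z \<partial>MQ) - (\<integral>z. W z * W z \<partial>MQ)"
    by simp
  have "(\<integral>z. W2 z \<partial>MQ) \<le> (\<integral>z. W z * W z \<partial>MQ)"
    using le by (intro integral_mono_AE iW2 iWW) (auto simp: power2_eq_square)
  moreover have "0 \<le> (\<integral>z. W2 z \<partial>MQ) - (\<integral>z. W z * W z \<partial>MQ)"
    by (rule LIMSEQ_le_const[OF lim]) auto
  ultimately show ?thesis using lim by simp
qed

text \<open>The energy bound is local, so relaxation is known only on interior balls. There the weak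
  limit \<open>D\<close> vanishes, hence it vanishes almost everywhere in \<open>Q\<close>; testing
  with the constant 1 on all of \<open>Q\<close>, which has finite measure, gives convergence of the
  full integrals. The uniform bound prevents mass from escaping to the boundary.\<close>

lemma relaxation_limit:
  assumes r: "strict_mono r" and wD: "wlim r (\<lambda>x y. (y - F x)\<^sup>2) D"
  shows "(\<lambda>k. \<integral>z. ext (\<lambda>x y. (y - F x)\<^sup>2) (r k) z \<partial>MQ) \<longlonglongrightarrow> 0"
proof -
  have zero_lim: "wlim r (\<lambda>x y. 0) (\<lambda>z. 0)" using wlim_const[of r 0] by simp
  have nn: "AE z in MQ. 0 \<le> D z" by (rule wlim_mono[OF zero_lim wD]) simp
  obtain C where C: "\<And>z. \<bar>D z\<bar> \<le> C" using wlimD(3)[OF wD] by blast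
  have "AE z in lborel. z \<in> Q \<longrightarrow> D z = 0"
  proof (rule AE_from_local_balls[OF openQ])
    fix a assume "a \<in> Q"
    from local_energy[OF this] obtain \<rho> E where \<rho>: "0 < \<rho>" "cball a (3 * \<rho>) \<subseteq> Q"
      and E: "\<And>k vt g h. rd_solution Q F (e k) M (u k) (v k) vt g h \<Longrightarrow>
        (\<integral>z. rd_solution.energy F (e k) (u k) (v k) g z \<partial>ballm a (2 * \<rho>)) \<le> E" by blast
    have sub: "cball a (2 * \<rho>) \<subseteq> Q" using \<rho> by (auto simp: subset_eq)
    let ?B = "ballm a (2 * \<rho>)"
    have d: "(\<lambda>k. \<integral>z. \<bar>v (r k) z - F (u (r k) z)\<bar> \<partial>?B) \<longlonglongrightarrow> 0"
      using LIMSEQ_subseq_LIMSEQ[OF local_relaxation[OF \<rho> E] r] by (simp add: comp_def)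
    have lim: "(\<lambda>k. \<integral>z. ext (\<lambda>x y. (y - F x)\<^sup>2) (r k) z * 1 \<partial>?B) \<longlonglongrightarrow> (\<integral>z. D z * 1 \<partial>?B)"
      by (rule weakly_converges_ballm[OF wD[unfolded wlim_def] sub, where C=1]) auto
    have "\<bar>\<integral>z. ext (\<lambda>x y. (y - F x)\<^sup>2) (r k) z * 1 \<partial>?B\<bar> \<le> M * (\<integral>z. \<bar>v (r k) z - F (u (r k) z)\<bar> \<partial>?B)" for k
    proof -
      have c: "continuous_on (cball a (2 * \<rho>)) (\<lambda>z. v (r k) z - F (u (r k) z))"
        by (intro continuous_intros continuous_on_subset[OF cont_v sub] continuous_on_subset[OF cont_Fu sub])
      have "(\<integral>z. ext (\<lambda>x y. (y - F x)\<^sup>2) (r k) z * 1 \<partial>?B) = (\<integral>z. (v (r k) z - F (u (r k) z))\<^sup>2 \<partial>?B)"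
        by (rule Bochner_Integration.integral_cong) (use sub in \<open>auto simp: ext_def space_restrict_space simp del: mem_cball\<close>)
      also have "\<bar>\<dots>\<bar> \<le> (\<integral>z. M * \<bar>v (r k) z - F (u (r k) z)\<bar> \<partial>?B)"
      proof (rule abs_integral_ballm_le)
        fix z assume "z \<in> cball a (2 * \<rho>)"
        then have "z \<in> Q" using sub by blast
        then have "\<bar>v (r k) z - F (u (r k) z)\<bar> \<le> M" using bounds(2,3)[of z "r k"] by auto
        then have "\<bar>v (r k) z - F (u (r k) z)\<bar> * \<bar>v (r k) z - F (u (r k) z)\<bar> \<le> M * \<bar>v (r k) z - F (u (r k) z)\<bar>"
          by (intro mult_right_mono) auto
        then show "\<bar>(v (r k) z - F (u (r k) z))\<^sup>2\<bar> \<le> M * \<bar>v (r k) z - F (u (r k) z)\<bar>"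
          by (simp add: power2_eq_square)
      qed (intro continuous_intros c)+
      finally show ?thesis by simp
    qed
    then have "(\<lambda>k. \<integral>z. ext (\<lambda>x y. (y - F x)\<^sup>2) (r k) z * 1 \<partial>?B) \<longlonglongrightarrow> 0"
      by (intro Lim_null_comparison[OF _ tendsto_mult_right_zero[OF d]]) (auto intro!: always_eventually)
    with lim have int0: "(\<integral>z. D z \<partial>?B) = 0" using LIMSEQ_unique by fastforce
    have nnB: "AE z in ?B. 0 \<le> D z"
    proof (subst AE_restrict_space_iff)
      show "cball a (2 * \<rho>) \<inter> space lborel \<in> sets lborel" by simp
      show "AE z in lborel. z \<in> cball a (2 * \<rho>) \<longrightarrow> 0 \<le> D z"
        using nn[unfolded AE_MQ] by eventually_elim (use sub in blast)
    qed
    have "AE z in ?B. D z = 0"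
      using integral_nonneg_eq_0_iff_AE[OF integrable_ballm_bounded[OF wlimD(1)[OF wD] C] nnB] int0 by simp
    then have "AE z in lborel. z \<in> cball a (2 * \<rho>) \<longrightarrow> D z = 0"
      by (subst (asm) AE_restrict_space_iff) auto
    then have "AE z in lborel. z \<in> ball a \<rho> \<longrightarrow> D z = 0"
      by eventually_elim (use \<rho>(1) in auto)
    then show "\<exists>r>0. AE z in lborel. z \<in> ball a r \<longrightarrow> D z = 0" using \<rho>(1) by blast
  qed
  then have "(\<integral>z. D z \<partial>MQ) = (\<integral>z. 0 \<partial>MQ)"
    using wlimD(1)[OF wD] by (intro integral_cong_AE) (auto simp: AE_MQ borel_MQ)
  moreover have "(\<lambda>k. \<integral>z. ext (\<lambda>x y. (y - F x)\<^sup>2) (r k) z * 1 \<partial>MQ) \<longlonglongrightarrow> (\<integral>z. D z * 1 \<partial>MQ)"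
    by (rule weakly_convergesD(1)[OF wD[unfolded wlim_def]]) simp
  ultimately show ?thesis by simp
qed

lemma strong_limit_v:
  assumes F: "(\<lambda>k. \<integral>z. (ext (\<lambda>x y. F x) (r k) z - W z)\<^sup>2 \<partial>MQ) \<longlonglongrightarrow> 0"
    and D: "(\<lambda>k. \<integral>z. ext (\<lambda>x y. (y - F x)\<^sup>2) (r k) z \<partial>MQ) \<longlonglongrightarrow> 0"
    and W: "W \<in> borel_measurable borel" "\<And>z. \<bar>W z\<bar> \<le> C"
  shows "(\<lambda>k. \<integral>z. (ext (\<lambda>x y. y) (r k) z - W z)\<^sup>2 \<partial>MQ) \<longlonglongrightarrow> 0"
proof -
  have F_m: "ext (\<lambda>x y. F x) k \<in> borel_measurable borel" for k
    using admissible_continuous[OF cont_F] by (intro ext_measurable) (simp add: admissible_def)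
  have v_m: "ext (\<lambda>x y. y) k \<in> borel_measurable borel" for k
    by (rule ext_measurable) (intro borel_measurable_continuous_onI continuous_on_snd continuous_on_id)
  have D_m: "ext (\<lambda>x y. (y - F x)\<^sup>2) k \<in> borel_measurable borel" for k
    using admissible_relaxation by (intro ext_measurable) (simp add: admissible_def)
  have fb: "\<bar>ext (\<lambda>x y. F x) k z\<bar> \<le> M" "\<bar>ext (\<lambda>x y. y) k z\<bar> \<le> M" "\<bar>ext (\<lambda>x y. (y - F x)\<^sup>2) k z\<bar> \<le> M\<^sup>2" for k z
  proof -
    show "\<bar>ext (\<lambda>x y. F x) k z\<bar> \<le> M" "\<bar>ext (\<lambda>x y. y) k z\<bar> \<le> M" using bounds[of z k] M_bounds by (auto simp: ext_def)
    have "\<bar>v k z - F (u k z)\<bar> \<le> M" if "z \<in> Q" using bounds(2,3)[OF that, of k] by auto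
    then have "(v k z - F (u k z))\<^sup>2 \<le> M\<^sup>2" if "z \<in> Q" using that M_bounds by (metis abs_le_square_iff abs_of_pos)
    then show "\<bar>ext (\<lambda>x y. (y - F x)\<^sup>2) k z\<bar> \<le> M\<^sup>2" by (auto simp: ext_def)
  qed
  have sq: "integrable MQ (\<lambda>z. (f z - W z)\<^sup>2)" if "f \<in> borel_measurable borel" "\<And>z. \<bar>f z\<bar> \<le> M" for f
  proof (rule bounded_integrable_MQ[where C="(M + C)\<^sup>2"])
    show "(\<lambda>z. (f z - W z)\<^sup>2) \<in> borel_measurable borel" using that(1) W(1) by (intro borel_measurable_power borel_measurable_diff)
    show "\<bar>(f z - W z)\<^sup>2\<bar> \<le> (M + C)\<^sup>2" for z
    proof -
      have "\<bar>f z - W z\<bar> \<le> \<bar>M + C\<bar>" using that(2)[of z] W(2)[of z] by linarith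
      then show ?thesis by (simp add: abs_le_square_iff)
    qed
  qed
  have iD: "integrable MQ (ext (\<lambda>x y. (y - F x)\<^sup>2) k)" for k by (rule bounded_integrable_MQ[OF D_m fb(3)])
  have le: "(\<integral>z. (ext (\<lambda>x y. y) (r k) z - W z)\<^sup>2 \<partial>MQ) \<le>
    2 * (\<integral>z. ext (\<lambda>x y. (y - F x)\<^sup>2) (r k) z \<partial>MQ) + 2 * (\<integral>z. (ext (\<lambda>x y. F x) (r k) z - W z)\<^sup>2 \<partial>MQ)" for k
  proof -
    have "(\<integral>z. (ext (\<lambda>x y. y) (r k) z - W z)\<^sup>2 \<partial>MQ) \<le>
      (\<integral>z. 2 * ext (\<lambda>x y. (y - F x)\<^sup>2) (r k) z + 2 * (ext (\<lambda>x y. F x) (r k) z - W z)\<^sup>2 \<partial>MQ)"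
    proof (rule integral_mono)
      show "integrable MQ (\<lambda>z. 2 * ext (\<lambda>x y. (y - F x)\<^sup>2) (r k) z + 2 * (ext (\<lambda>x y. F x) (r k) z - W z)\<^sup>2)"
        using iD sq[OF F_m fb(1)] by simp
      have sq2: "(s - w)\<^sup>2 \<le> 2 * (s - t)\<^sup>2 + 2 * (t - w)\<^sup>2" for s t w :: real
        using sum_squares_bound[of "s - t" "t - w"] by (simp add: power2_eq_square algebra_simps)
      show "(ext (\<lambda>x y. y) (r k) z - W z)\<^sup>2 \<le> 2 * ext (\<lambda>x y. (y - F x)\<^sup>2) (r k) z + 2 * (ext (\<lambda>x y. F x) (r k) z - W z)\<^sup>2" for z
        using sq2[of "v (r k) z" "W z" "F (u (r k) z)"] by (simp add: ext_def)
    qed (rule sq[OF v_m fb(2)])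
    then show ?thesis using iD sq[OF F_m fb(1)] by simp
  qed
  have lim: "(\<lambda>k. 2 * (\<integral>z. ext (\<lambda>x y. (y - F x)\<^sup>2) (r k) z \<partial>MQ) + 2 * (\<integral>z. (ext (\<lambda>x y. F x) (r k) z - W z)\<^sup>2 \<partial>MQ)) \<longlonglongrightarrow> 0"
    using tendsto_add[OF tendsto_mult_right_zero[OF D, of 2] tendsto_mult_right_zero[OF F, of 2]] by simp
  have nonneg: "0 \<le> (\<integral>z. (ext (\<lambda>x y. y) (r k) z - W z)\<^sup>2 \<partial>MQ)" for k by simp
  show ?thesis
    by (rule tendsto_sandwich[OF always_eventually[OF allI[OF nonneg]] always_eventually[OF allI[OF le]] tendsto_const lim])
qed

end

text \<open>The continuous factor converges boundedly almost everywhere, so dominated convergence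
  replaces it by its limit, which is then absorbed into the test function of the weakly convergent
  factor.\<close>

lemma weakly_converges_mult_AE:
  fixes h :: "real \<Rightarrow> real"
  assumes w: "weakly_converges M \<chi>' l" and h: "continuous_on UNIV h"
    and f: "\<And>k. f k \<in> borel_measurable M" "W \<in> borel_measurable M"
    and C: "\<And>k z. \<bar>f k z\<bar> \<le> C" "\<And>z. \<bar>W z\<bar> \<le> C" and lim: "AE z in M. (\<lambda>k. f k z) \<longlonglongrightarrow> W z"
  shows "weakly_converges M (\<lambda>k z. \<chi>' k z * h (f k z)) (\<lambda>z. l z * h (W z))"
proof -
  obtain D where D': "\<And>z. (\<forall>k. \<bar>\<chi>' k z\<bar> \<le> D) \<and> \<bar>l z\<bar> \<le> D"
    using w unfolding weakly_converges_def by blast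
  then have D: "\<And>z k. \<bar>\<chi>' k z\<bar> \<le> D" "\<And>z. \<bar>l z\<bar> \<le> D" by auto
  then have D0: "0 \<le> D" using abs_ge_zero order_trans by blast
  have wm: "\<chi>' k \<in> borel_measurable M" "l \<in> borel_measurable M" for k
    using w by (auto simp: weakly_converges_def)
  obtain K where K: "K \<ge> 0" "\<And>x. x \<in> {-C..C} \<Longrightarrow> \<bar>h x\<bar> \<le> K"
    using compact_bound_abs[OF compact_Icc continuous_on_subset[OF h]] by blast
  have hb: "\<bar>h (f k z)\<bar> \<le> K" "\<bar>h (W z)\<bar> \<le> K" for k z
    using K(2)[of "f k z"] K(2)[of "W z"] C(1)[of k z] C(2)[of z] by (auto simp: abs_le_iff)
  have hm: "(\<lambda>z. h (f k z)) \<in> borel_measurable M" "(\<lambda>z. h (W z)) \<in> borel_measurable M" for k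
    using borel_measurable_continuous_onI[OF h] f by (blast intro: measurable_compose)+
  have m: "(\<lambda>z. \<chi>' k z * h (f k z)) \<in> borel_measurable M" "(\<lambda>z. l z * h (W z)) \<in> borel_measurable M" for k
    by (intro borel_measurable_times wm hm)+
  have b: "\<bar>\<chi>' k z * h (f k z)\<bar> \<le> D * K" "\<bar>l z * h (W z)\<bar> \<le> D * K" for k z
    unfolding abs_mult using D hb D0 by (auto intro!: mult_mono)
  have "(\<lambda>k. \<integral>z. (\<chi>' k z * h (f k z)) * \<phi> z \<partial>M) \<longlonglongrightarrow> (\<integral>z. (l z * h (W z)) * \<phi> z \<partial>M)" if \<phi>: "integrable M \<phi>" for \<phi>
  proof -
    have i1: "integrable M (\<lambda>z. h (W z) * \<phi> z)" by (rule integrable_bounded_mult[OF \<phi> hm(2) hb(2)])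
    have i2: "integrable M (\<lambda>z. \<chi>' k z * h (f k z) * \<phi> z)" for k by (rule integrable_bounded_mult[OF \<phi> m(1) b(1)])
    note lim1 = weakly_convergesD[OF w i1]
    have lim2: "(\<lambda>k. \<integral>z. \<chi>' k z * h (f k z) * \<phi> z - \<chi>' k z * (h (W z) * \<phi> z) \<partial>M) \<longlonglongrightarrow> (\<integral>z. 0 \<partial>M)"
    proof (rule integral_dominated_convergence)
      show "integrable M (\<lambda>z. D * (2 * K) * \<bar>\<phi> z\<bar>)" using \<phi> by simp
      show "(\<lambda>z. \<chi>' k z * h (f k z) * \<phi> z - \<chi>' k z * (h (W z) * \<phi> z)) \<in> borel_measurable M" for k
        using i2 lim1(2) by (intro borel_measurable_diff) (auto dest: borel_measurable_integrable)
      have e: "\<chi>' k z * h (f k z) * \<phi> z - \<chi>' k z * (h (W z) * \<phi> z) = \<chi>' k z * (h (f k z) - h (W z)) * \<phi> z" for k z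
        by (simp add: algebra_simps)
      show "AE z in M. norm (\<chi>' k z * h (f k z) * \<phi> z - \<chi>' k z * (h (W z) * \<phi> z)) \<le> D * (2 * K) * \<bar>\<phi> z\<bar>" for k
      proof (rule AE_I2)
        fix z
        have "\<bar>h (f k z) - h (W z)\<bar> \<le> 2 * K" using hb(1)[of k z] hb(2)[of z] by linarith
        then have "\<bar>\<chi>' k z\<bar> * \<bar>h (f k z) - h (W z)\<bar> * \<bar>\<phi> z\<bar> \<le> D * (2 * K) * \<bar>\<phi> z\<bar>"
          using D(1)[of k z] D0 K(1) by (intro mult_right_mono mult_mono) auto
        then show "norm (\<chi>' k z * h (f k z) * \<phi> z - \<chi>' k z * (h (W z) * \<phi> z)) \<le> D * (2 * K) * \<bar>\<phi> z\<bar>"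
          unfolding e by (simp add: abs_mult)
      qed
      show "AE z in M. (\<lambda>k. \<chi>' k z * h (f k z) * \<phi> z - \<chi>' k z * (h (W z) * \<phi> z)) \<longlonglongrightarrow> 0"
        using lim
      proof eventually_elim
        fix z assume l: "(\<lambda>k. f k z) \<longlonglongrightarrow> W z"
        have "isCont h (W z)" using h by (simp add: continuous_on_eq_continuous_at)
        from isCont_tendsto_compose[OF this l] have hl: "(\<lambda>k. h (f k z)) \<longlonglongrightarrow> h (W z)" .
        have "(\<lambda>k. D * \<bar>\<phi> z\<bar> * \<bar>h (f k z) - h (W z)\<bar>) \<longlonglongrightarrow> D * \<bar>\<phi> z\<bar> * \<bar>h (W z) - h (W z)\<bar>"
          by (intro tendsto_intros hl)
        then have zero: "(\<lambda>k. D * \<bar>\<phi> z\<bar> * \<bar>h (f k z) - h (W z)\<bar>) \<longlonglongrightarrow> 0" by simp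
        have bd: "norm (\<chi>' k z * h (f k z) * \<phi> z - \<chi>' k z * (h (W z) * \<phi> z)) \<le> D * \<bar>\<phi> z\<bar> * \<bar>h (f k z) - h (W z)\<bar>" for k
        proof -
          have "\<bar>\<chi>' k z\<bar> * (\<bar>\<phi> z\<bar> * \<bar>h (f k z) - h (W z)\<bar>) \<le> D * (\<bar>\<phi> z\<bar> * \<bar>h (f k z) - h (W z)\<bar>)"
            by (rule mult_right_mono[OF D(1)]) simp
          then show ?thesis unfolding e by (simp add: abs_mult mult_ac)
        qed
        show "(\<lambda>k. \<chi>' k z * h (f k z) * \<phi> z - \<chi>' k z * (h (W z) * \<phi> z)) \<longlonglongrightarrow> 0"
          by (rule Lim_null_comparison[OF always_eventually[OF allI[OF bd]] zero])
      qed
    qed simp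
    have "(\<lambda>k. (\<integral>z. \<chi>' k z * h (f k z) * \<phi> z - \<chi>' k z * (h (W z) * \<phi> z) \<partial>M) + (\<integral>z. \<chi>' k z * (h (W z) * \<phi> z) \<partial>M))
        \<longlonglongrightarrow> (\<integral>z. 0 \<partial>M) + (\<integral>z. l z * (h (W z) * \<phi> z) \<partial>M)"
      by (rule tendsto_add[OF lim2 lim1(1)])
    then show ?thesis using i2 lim1(2) by (simp add: mult.assoc)
  qed
  moreover have "\<exists>C. \<forall>z. (\<forall>k. \<bar>\<chi>' k z * h (f k z)\<bar> \<le> C) \<and> \<bar>l z * h (W z)\<bar> \<le> C"
    using b by blast
  ultimately show ?thesis unfolding weakly_converges_def using m by blast
qed

text \<open>Indexing the atoms by \<open>I\<close> and mapping them to the line allows atoms to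
  coincide, as the values of \<open>S1\<close> and \<open>S2\<close> do at
  \<open>F ap\<close>.\<close>

lemma finite_combination_measure:
  fixes w s :: "'i \<Rightarrow> real"
  assumes I: "finite I" and w: "\<And>i. i \<in> I \<Longrightarrow> 0 \<le> w i" "sum w I = 1"
  defines "\<mu> \<equiv> distr (point_measure I (\<lambda>i. ennreal (w i))) borel s"
  shows "prob_space \<mu>" "G \<in> borel_measurable borel \<Longrightarrow> (\<integral>y. G y \<partial>\<mu>) = (\<Sum>i\<in>I. w i * G (s i))"
    "A \<in> sets borel \<Longrightarrow> measure \<mu> A = (\<Sum>i\<in>I. w i * measure (return borel (s i)) A)"
proof -
  have s: "s \<in> measurable (point_measure I (\<lambda>i. ennreal (w i))) borel" by simp
  have "emeasure (point_measure I (\<lambda>i. ennreal (w i))) I = (\<Sum>i\<in>I. ennreal (w i))"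
    by (rule emeasure_point_measure_finite[OF I]) simp
  also have "\<dots> = ennreal (sum w I)" using w(1) by (simp add: sum_ennreal)
  finally have "prob_space (point_measure I (\<lambda>i. ennreal (w i)))"
    using w(2) by (intro prob_spaceI) (simp add: space_point_measure)
  then show p: "prob_space \<mu>" unfolding \<mu>_def by (rule prob_space.prob_space_distr[OF _ s])
  show *: "(\<integral>y. G y \<partial>\<mu>) = (\<Sum>i\<in>I. w i * G (s i))" if "G \<in> borel_measurable borel" for G :: "real \<Rightarrow> real"
    unfolding \<mu>_def integral_distr[OF s that] using lebesgue_integral_point_measure_finite[OF I, of w "\<lambda>i. G (s i)"] w(1) by simp
  show "measure \<mu> A = (\<Sum>i\<in>I. w i * measure (return borel (s i)) A)" if A: "A \<in> sets borel"
  proof -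
    have "measure \<mu> A = (\<integral>y. indicator A y \<partial>\<mu>)" using A by (simp add: \<mu>_def)
    also have "\<dots> = (\<Sum>i\<in>I. w i * indicator A (s i))" using A by (intro *) simp
    finally show ?thesis using A by (simp add: measure_return)
  qed
qed

section \<open>The branch weights and the Young measure\<close>

context fast_reaction
begin

lemma wlim_cong_AE:
  assumes "wlim r G g" "AE z in MQ. g z = g' z" "g' \<in> borel_measurable borel" "\<And>z. \<bar>g' z\<bar> \<le> C"
  shows "wlim r G g'"
proof -
  obtain D where D: "\<And>z. (\<forall>k. \<bar>ext G (r k) z\<bar> \<le> D) \<and> \<bar>g z\<bar> \<le> D" using wlimD(3)[OF assms(1)] by blast
  have "\<forall>z. (\<forall>k. \<bar>ext G (r k) z\<bar> \<le> max C D) \<and> \<bar>g' z\<bar> \<le> max C D"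
    using D assms(4) by (auto simp: le_max_iff_disj)
  moreover have "(\<integral>z. g z * \<phi> z \<partial>MQ) = (\<integral>z. g' z * \<phi> z \<partial>MQ)" if "integrable MQ \<phi>" for \<phi>
  proof (rule integral_cong_AE)
    show "(\<lambda>z. g z * \<phi> z) \<in> borel_measurable MQ" "(\<lambda>z. g' z * \<phi> z) \<in> borel_measurable MQ"
      using wlimD(1)[OF assms(1)] assms(3) borel_measurable_integrable[OF that]
      by (intro borel_measurable_times; simp add: borel_MQ)+
    show "AE z in MQ. g z * \<phi> z = g' z * \<phi> z" using assms(2) by eventually_elim simp
  qed
  ultimately show ?thesis
    using assms(1,3) unfolding wlim_def weakly_converges_def borel_MQ by (auto intro: exI[of _ "max C D"])
qed

lemma wlim_subseq: "wlim r G g \<Longrightarrow> strict_mono s \<Longrightarrow> wlim (\<lambda>k. r (s k)) G g"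
  unfolding wlim_def by (rule weakly_converges_subseq)

text \<open>The three indicators add up to 1 and order passes to weak limits, so the limits are
  nonnegative with sum 1, but only almost everywhere in \<open>Q\<close>; they are changed on a null
  set to make this hold at every point.\<close>

lemma branch_weights:
  assumes w: "wlim r (\<lambda>x y. of_bool (x < ap)) k1" "wlim r (\<lambda>x y. of_bool (ap \<le> x \<and> x \<le> bm)) k2"
    "wlim r (\<lambda>x y. of_bool (bm < x)) k3"
  shows "\<exists>l1 l2 l3. wlim r (\<lambda>x y. of_bool (x < ap)) l1 \<and> wlim r (\<lambda>x y. of_bool (ap \<le> x \<and> x \<le> bm)) l2 \<and>
    wlim r (\<lambda>x y. of_bool (bm < x)) l3 \<and> (\<forall>z. 0 \<le> l1 z \<and> 0 \<le> l2 z \<and> 0 \<le> l3 z \<and> l1 z + l2 z + l3 z = 1)"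
proof -
  have zero: "wlim r (\<lambda>x y. 0) (\<lambda>z. 0)" using wlim_const[of r 0] by simp
  note sum = wlim_add[OF wlim_add[OF w(1,2)] w(3)]
  have nn: "AE z in MQ. 0 \<le> k1 z" "AE z in MQ. 0 \<le> k2 z" "AE z in MQ. 0 \<le> k3 z"
    by (rule wlim_mono[OF zero w(1)] wlim_mono[OF zero w(2)] wlim_mono[OF zero w(3)], simp)+
  have le: "AE z in MQ. k1 z + k2 z + k3 z \<le> 1 * indicator Q z"
    by (rule wlim_mono[OF sum wlim_const]) (use order in auto)
  have ge: "AE z in MQ. 1 * indicator Q z \<le> k1 z + k2 z + k3 z"
    by (rule wlim_mono[OF wlim_const sum]) (use order in \<open>auto simp: not_less\<close>)
  define N where "N z \<longleftrightarrow> 0 \<le> k1 z \<and> 0 \<le> k2 z \<and> 0 \<le> k3 z \<and> k1 z + k2 z + k3 z = 1" for z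
  have N: "AE z in MQ. N z" using nn le ge AE_in_Q by eventually_elim (auto simp: N_def)
  have km: "k1 \<in> borel_measurable borel" "k2 \<in> borel_measurable borel" "k3 \<in> borel_measurable borel"
    using w wlimD(1) by blast+
  have Nm: "Measurable.pred borel N" unfolding N_def[abs_def] using km by measurable
  \<comment> \<open>Where \<open>N\<close> fails the weights default to \<open>(1, 0, 0)\<close>, so
    that a probability measure is defined at every point.\<close>
  define l1 l2 l3 where "l1 z = (if N z then k1 z else 1)" and "l2 z = (if N z then k2 z else 0)"
    and "l3 z = (if N z then k3 z else 0)" for z
  have l: "0 \<le> l1 z \<and> 0 \<le> l2 z \<and> 0 \<le> l3 z \<and> l1 z + l2 z + l3 z = 1" for z by (auto simp: l1_def l2_def l3_def N_def)
  have lm: "l1 \<in> borel_measurable borel" "l2 \<in> borel_measurable borel" "l3 \<in> borel_measurable borel"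
    unfolding l1_def[abs_def] l2_def[abs_def] l3_def[abs_def] using km Nm by measurable
  have "\<bar>l1 z\<bar> \<le> 1" "\<bar>l2 z\<bar> \<le> 1" "\<bar>l3 z\<bar> \<le> 1" for z using l[of z] by auto
  moreover have "AE z in MQ. k1 z = l1 z" "AE z in MQ. k2 z = l2 z" "AE z in MQ. k3 z = l3 z"
    using N by (eventually_elim, simp add: l1_def l2_def l3_def)+
  ultimately have "wlim r (\<lambda>x y. of_bool (x < ap)) l1" "wlim r (\<lambda>x y. of_bool (ap \<le> x \<and> x \<le> bm)) l2"
    "wlim r (\<lambda>x y. of_bool (bm < x)) l3"
    using wlim_cong_AE[OF w(1) _ lm(1)] wlim_cong_AE[OF w(2) _ lm(2)] wlim_cong_AE[OF w(3) _ lm(3)] by blast+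
  then show ?thesis using l by blast
qed

text \<open>Each branch indicator converges weakly and \<open>G (S_i (F u))\<close> almost
  everywhere, so the products converge weakly. Their sum is exactly \<open>G u\<close>, because
  \<open>S_i (F u) = u\<close> on the corresponding branch and the three indicators partition the
  line.\<close>

lemma young_limit:
  assumes wF: "wlim r (\<lambda>x y. F x) W" and lim: "AE z in MQ. (\<lambda>k. ext (\<lambda>x y. F x) (r k) z) \<longlonglongrightarrow> W z"
    and w: "wlim r (\<lambda>x y. of_bool (x < ap)) l1" "wlim r (\<lambda>x y. of_bool (ap \<le> x \<and> x \<le> bm)) l2"
      "wlim r (\<lambda>x y. of_bool (bm < x)) l3"
    and G: "continuous_on UNIV G"
  shows "wlim r (\<lambda>x y. G x)
    (\<lambda>z. l1 z * G (S1 F ap (W z)) + l2 z * G (S2 F ap bm (W z)) + l3 z * G (S3 F bm (W z)))"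
proof -
  obtain C where C: "\<And>z. (\<forall>k. \<bar>ext (\<lambda>x y. F x) (r k) z\<bar> \<le> C) \<and> \<bar>W z\<bar> \<le> C" using wlimD(3)[OF wF] by blast
  then have C': "\<And>k z. \<bar>ext (\<lambda>x y. F x) (r k) z\<bar> \<le> C" "\<And>z. \<bar>W z\<bar> \<le> C" by auto
  have fm: "ext (\<lambda>x y. F x) (r k) \<in> borel_measurable MQ" "W \<in> borel_measurable MQ" for k
    using wlimD(1,2)[OF wF] by (simp_all add: borel_MQ)
  have h: "continuous_on UNIV (\<lambda>y. G (S1 F ap y))" "continuous_on UNIV (\<lambda>y. G (S2 F ap bm y))" "continuous_on UNIV (\<lambda>y. G (S3 F bm y))"
    by (rule continuous_on_compose2[OF G continuous_S1] continuous_on_compose2[OF G continuous_S2]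
        continuous_on_compose2[OF G continuous_S3], simp)+
  have *: "weakly_converges MQ (\<lambda>k z. ext \<kappa> (r k) z * k' (ext (\<lambda>x y. F x) (r k) z)) (\<lambda>z. l z * k' (W z))"
    if "wlim r \<kappa> l" "continuous_on UNIV k'" for \<kappa> l k'
    by (rule weakly_converges_mult_AE[OF that(1)[unfolded wlim_def] that(2) fm C' lim])
  have eq: "ext (\<lambda>x y. of_bool (x < ap)) (r k) z * G (S1 F ap (ext (\<lambda>x y. F x) (r k) z)) +
      ext (\<lambda>x y. of_bool (ap \<le> x \<and> x \<le> bm)) (r k) z * G (S2 F ap bm (ext (\<lambda>x y. F x) (r k) z)) +
      ext (\<lambda>x y. of_bool (bm < x)) (r k) z * G (S3 F bm (ext (\<lambda>x y. F x) (r k) z)) = ext (\<lambda>x y. G x) (r k) z" for k z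
    using S1_F[of "u (r k) z"] S2_F[of "u (r k) z"] S3_F[of "u (r k) z"] order by (auto simp: ext_def)
  show ?thesis
    using weakly_converges_add[OF weakly_converges_add[OF *[OF w(1) h(1)] *[OF w(2) h(2)]] *[OF w(3) h(3)]]
    unfolding wlim_def eq .
qed

lemma limit_theorem:
  "\<exists>r U W l1 l2 l3. strict_mono r \<and> wlim r (\<lambda>x y. x) U \<and> wlim r (\<lambda>x y. F x) W \<and>
    (\<lambda>k. \<integral>z. (ext (\<lambda>x y. F x) (r k) z - W z)\<^sup>2 \<partial>MQ) \<longlonglongrightarrow> 0 \<and>
    (\<lambda>k. \<integral>z. (ext (\<lambda>x y. y) (r k) z - W z)\<^sup>2 \<partial>MQ) \<longlonglongrightarrow> 0 \<and>
    (\<forall>z. 0 \<le> l1 z \<and> 0 \<le> l2 z \<and> 0 \<le> l3 z \<and> l1 z + l2 z + l3 z = 1) \<and>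
    (\<forall>G. continuous_on UNIV G \<longrightarrow> wlim r (\<lambda>x y. G x)
      (\<lambda>z. l1 z * G (S1 F ap (W z)) + l2 z * G (S2 F ap bm (W z)) + l3 z * G (S3 F bm (W z))))"
proof -
  obtain \<Psi> \<Phi> where pot: "\<forall>p q. (\<forall>x. (\<Psi> p q has_real_derivative hat p q (F x)) (at x)) \<and> \<Psi> p q 0 = 0 \<and>
      (\<forall>x. (\<Phi> p q has_real_derivative hat p q x) (at x)) \<and> \<Phi> p q p = 0" using potentials_exist by blast
  then have \<Psi>: "\<And>p q x. (\<Psi> p q has_real_derivative hat p q (F x)) (at x)" "\<And>p q. \<Psi> p q 0 = 0"
    and \<Phi>: "\<And>p q x. (\<Phi> p q has_real_derivative hat p q x) (at x)" "\<And>p q. \<Phi> p q p = 0" by blast+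
  obtain r lim where r: "strict_mono r" and lim: "\<And>G. G \<in> test_functions \<Psi> \<Phi> \<Longrightarrow> wlim r G (lim G)"
    using test_limits_exist[of \<Psi> \<Phi>, OF \<Psi>(1) \<Phi>(1)] by blast
  note L = lim[OF test_functions_basic(1)] lim[OF test_functions_basic(2)] lim[OF test_functions_basic(3)] lim[OF test_functions_basic(4)]
    lim[OF test_functions_basic(5)] lim[OF test_functions_basic(6)] lim[OF test_functions_basic(7)]
  note Lp = lim[OF test_functions_parts(1)] lim[OF test_functions_parts(2)] lim[OF test_functions_parts(3)]
    lim[OF test_functions_parts(4)] lim[OF test_functions_potentials]
  define W where "W = lim (\<lambda>x y. F x)"
  have wF: "wlim r (\<lambda>x y. F x) W" using L(2) by (simp add: W_def)
  have conc: "AE z in MQ. \<forall>p\<in>\<rat>. \<forall>q\<in>\<rat>. p < q \<longrightarrow>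
      \<not> (0 < lim (\<lambda>x y. lower_part p (F x)) z \<and> 0 < lim (\<lambda>x y. upper_part q (F x)) z)"
    by (rule concentration[where \<Psi>=\<Psi> and \<Phi>=\<Phi>, OF \<Psi> \<Phi> r Lp])
  have sF: "(\<lambda>k. \<integral>z. (ext (\<lambda>x y. F x) (r k) z - W z)\<^sup>2 \<partial>MQ) \<longlonglongrightarrow> 0"
    by (rule strong_limit_F[OF wF L(3) square_limit_le[OF r wF L(3) Lp(1,2) conc]])
  obtain C where C: "\<And>z. (\<forall>k. \<bar>ext (\<lambda>x y. F x) (r k) z\<bar> \<le> C) \<and> \<bar>W z\<bar> \<le> C" using wlimD(3)[OF wF] by blast
  have sv: "(\<lambda>k. \<integral>z. (ext (\<lambda>x y. y) (r k) z - W z)\<^sup>2 \<partial>MQ) \<longlonglongrightarrow> 0"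
    by (rule strong_limit_v[OF sF relaxation_limit[OF r L(4)] wlimD(1)[OF wF], of C]) (use C in blast)
  have i: "integrable MQ (\<lambda>z. (ext (\<lambda>x y. F x) (r k) z - W z)\<^sup>2)" for k
  proof (rule bounded_integrable_MQ[where C="(2 * C)\<^sup>2"])
    show "(\<lambda>z. (ext (\<lambda>x y. F x) (r k) z - W z)\<^sup>2) \<in> borel_measurable borel"
      by (intro borel_measurable_power borel_measurable_diff wlimD(1,2)[OF wF])
    show "\<bar>(ext (\<lambda>x y. F x) (r k) z - W z)\<^sup>2\<bar> \<le> (2 * C)\<^sup>2" for z
    proof -
      have "\<bar>ext (\<lambda>x y. F x) (r k) z\<bar> \<le> C" "\<bar>W z\<bar> \<le> C" using C by auto
      then have "\<bar>ext (\<lambda>x y. F x) (r k) z - W z\<bar> \<le> \<bar>2 * C\<bar>" by linarith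
      then show ?thesis unfolding abs_le_square_iff by simp
    qed
  qed
  have "(\<lambda>k. \<integral>z. norm ((ext (\<lambda>x y. F x) (r k) z - W z)\<^sup>2) \<partial>MQ) \<longlonglongrightarrow> 0" using sF by simp
  \<comment> \<open>Strong convergence gives almost everywhere convergence along a further
    subsequence; the weak and strong limits already found persist along it.\<close>
  from tendsto_L1_AE_subseq[OF i this] obtain s where s: "strict_mono s" and ae: "AE z in MQ. (\<lambda>k. (ext (\<lambda>x y. F x) (r (s k)) z - W z)\<^sup>2) \<longlonglongrightarrow> 0"
    by blast
  have lim': "AE z in MQ. (\<lambda>k. ext (\<lambda>x y. F x) (r (s k)) z) \<longlonglongrightarrow> W z"
    using ae
  proof eventually_elim
    fix z assume "(\<lambda>k. (ext (\<lambda>x y. F x) (r (s k)) z - W z)\<^sup>2) \<longlonglongrightarrow> 0"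
    from tendsto_real_sqrt[OF this] have "(\<lambda>k. \<bar>ext (\<lambda>x y. F x) (r (s k)) z - W z\<bar>) \<longlonglongrightarrow> 0" by simp
    then show "(\<lambda>k. ext (\<lambda>x y. F x) (r (s k)) z) \<longlonglongrightarrow> W z"
      by (simp add: tendsto_rabs_zero_iff LIM_zero_iff)
  qed
  obtain l1 l2 l3 where l: "wlim r (\<lambda>x y. of_bool (x < ap)) l1" "wlim r (\<lambda>x y. of_bool (ap \<le> x \<and> x \<le> bm)) l2"
      "wlim r (\<lambda>x y. of_bool (bm < x)) l3"
    and l01: "\<forall>z. 0 \<le> l1 z \<and> 0 \<le> l2 z \<and> 0 \<le> l3 z \<and> l1 z + l2 z + l3 z = 1"
    using branch_weights[OF L(5,6,7)] by blast
  have rs: "strict_mono (\<lambda>k. r (s k))" using strict_mono_o[OF r s] by (simp add: comp_def)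
  have "\<forall>G. continuous_on UNIV G \<longrightarrow> wlim (\<lambda>k. r (s k)) (\<lambda>x y. G x)
      (\<lambda>z. l1 z * G (S1 F ap (W z)) + l2 z * G (S2 F ap bm (W z)) + l3 z * G (S3 F bm (W z)))"
    using young_limit[OF wlim_subseq[OF wF s] lim' wlim_subseq[OF l(1) s] wlim_subseq[OF l(2) s] wlim_subseq[OF l(3) s]] by blast
  moreover have "(\<lambda>k. \<integral>z. (ext (\<lambda>x y. F x) (r (s k)) z - W z)\<^sup>2 \<partial>MQ) \<longlonglongrightarrow> 0"
    "(\<lambda>k. \<integral>z. (ext (\<lambda>x y. y) (r (s k)) z - W z)\<^sup>2 \<partial>MQ) \<longlonglongrightarrow> 0"
    using LIMSEQ_subseq_LIMSEQ[OF sF s] LIMSEQ_subseq_LIMSEQ[OF sv s] by (simp_all add: comp_def)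
  ultimately show ?thesis using rs l01 wlim_subseq[OF L(1) s] wlim_subseq[OF wF s] by blast
qed

section \<open>From Borel functions to Lebesgue measure on the cylinder\<close>

lemma Q_lebesgue: "Q \<inter> space lebesgue \<in> sets lebesgue" using openQ by (simp add: borel_open)

lemma borel_lebesgue_on: "f \<in> borel_measurable borel \<Longrightarrow> f \<in> borel_measurable (lebesgue_on Q)"
  by (intro measurable_restrict_space1 measurable_completion) simp

lemma borel_lebesgue: "f \<in> borel_measurable borel \<Longrightarrow> (f :: real \<times> 'a \<Rightarrow> real) \<in> borel_measurable lebesgue"
  by (intro measurable_completion) simp

lemma indicator_borel:
  "f \<in> borel_measurable borel \<Longrightarrow> (\<lambda>z. indicator Q z *\<^sub>R (f z :: real)) \<in> borel_measurable borel"
  by (intro borel_measurable_scaleR borel_measurable_indicator Q_borel)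

lemma lebesgue_on_MQ:
  fixes f :: "real \<times> 'a \<Rightarrow> real"
  assumes f: "f \<in> borel_measurable borel"
  shows "(\<integral>z. f z \<partial>lebesgue_on Q) = (\<integral>z. f z \<partial>MQ)" "integrable (lebesgue_on Q) f \<longleftrightarrow> integrable MQ f"
proof -
  have m: "(\<lambda>z. indicator Q z *\<^sub>R f z) \<in> borel_measurable lborel" using indicator_borel[OF f] by simp
  have i: "(indicator Q :: _ \<Rightarrow> real) \<in> borel_measurable lborel" using openQ by simp
  have fl: "f \<in> borel_measurable lborel" using f by simp
  have "(\<integral>z. f z \<partial>lebesgue_on Q) = (\<integral>z. indicator Q z *\<^sub>R f z \<partial>lborel)"
    unfolding integral_restrict_space[OF Q_lebesgue] by (rule integral_completion[OF m])
  also have "\<dots> = (\<integral>z. f z \<partial>MQ)" unfolding MQ_def by (rule integral_density[symmetric, OF fl i]) simp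
  finally show "(\<integral>z. f z \<partial>lebesgue_on Q) = (\<integral>z. f z \<partial>MQ)" .
  have "integrable (lebesgue_on Q) f \<longleftrightarrow> integrable lborel (\<lambda>z. indicator Q z *\<^sub>R f z)"
    unfolding integrable_restrict_space[OF Q_lebesgue] by (rule integrable_completion[OF m])
  also have "\<dots> \<longleftrightarrow> integrable MQ f" unfolding MQ_def by (rule integrable_density[symmetric, OF fl i]) simp
  finally show "integrable (lebesgue_on Q) f \<longleftrightarrow> integrable MQ f" .
qed

text \<open>The final statement tests with Lebesgue integrable functions, whereas the limits were
  taken against Borel ones. A Borel function agreeing almost everywhere with \<open>\<phi>\<close>
  cut off outside \<open>Q\<close> makes the passage.\<close>

lemma borel_representative:
  assumes \<phi>: "integrable (lebesgue_on Q) (\<phi> :: real \<times> 'a \<Rightarrow> real)"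
  shows "\<exists>\<psi>. integrable MQ \<psi> \<and>
    (\<forall>f\<in>borel_measurable borel. (\<integral>z. f z * \<phi> z \<partial>lebesgue_on Q) = (\<integral>z. f z * \<psi> z \<partial>MQ))"
proof -
  have i: "integrable lebesgue (\<lambda>z. indicator Q z *\<^sub>R \<phi> z)"
    using \<phi> unfolding integrable_restrict_space[OF Q_lebesgue] .
  obtain \<psi> where "\<psi> \<in> borel_measurable lborel" and ae: "AE z in lborel. indicator Q z *\<^sub>R \<phi> z = \<psi> z"
    using completion_ex_borel_measurable_real[OF borel_measurable_integrable[OF i]] by blast
  then have \<psi>: "\<psi> \<in> borel_measurable borel" by simp
  have ae': "AE z in lebesgue. indicator Q z *\<^sub>R \<phi> z = \<psi> z" by (rule AE_completion[OF ae])
  have "integrable lebesgue \<psi>"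
    using i integrable_cong_AE[OF borel_measurable_integrable[OF i] borel_lebesgue[OF \<psi>] ae'] by simp
  then have "integrable (lebesgue_on Q) \<psi>"
    unfolding integrable_restrict_space[OF Q_lebesgue] using openQ
    by (intro integrable_mult_indicator) (simp_all add: borel_open)
  then have "integrable MQ \<psi>" using lebesgue_on_MQ(2)[OF \<psi>] by simp
  moreover have "(\<integral>z. f z * \<phi> z \<partial>lebesgue_on Q) = (\<integral>z. f z * \<psi> z \<partial>MQ)" if f: "f \<in> borel_measurable borel" for f
  proof -
    have "(\<integral>z. f z * \<phi> z \<partial>lebesgue_on Q) = (\<integral>z. f z * (indicator Q z *\<^sub>R \<phi> z) \<partial>lebesgue)"
      unfolding integral_restrict_space[OF Q_lebesgue] by (simp add: mult_ac)
    also have "\<dots> = (\<integral>z. indicator Q z *\<^sub>R (f z * \<psi> z) \<partial>lebesgue)"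
    proof (rule integral_cong_AE)
      show "(\<lambda>z. f z * (indicator Q z *\<^sub>R \<phi> z)) \<in> borel_measurable lebesgue"
        by (rule borel_measurable_times[OF borel_lebesgue[OF f] borel_measurable_integrable[OF i]])
      show "(\<lambda>z. indicator Q z *\<^sub>R (f z * \<psi> z)) \<in> borel_measurable lebesgue"
        by (rule borel_lebesgue[OF indicator_borel[OF borel_measurable_times[OF f \<psi>]]])
      show "AE z in lebesgue. f z * (indicator Q z *\<^sub>R \<phi> z) = indicator Q z *\<^sub>R (f z * \<psi> z)"
        using ae' by eventually_elim (auto simp: indicator_def split: if_splits)
    qed
    also have "\<dots> = (\<integral>z. f z * \<psi> z \<partial>lebesgue_on Q)" unfolding integral_restrict_space[OF Q_lebesgue] ..
    also have "\<dots> = (\<integral>z. f z * \<psi> z \<partial>MQ)" by (rule lebesgue_on_MQ(1)[OF borel_measurable_times[OF f \<psi>]])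
    finally show ?thesis .
  qed
  ultimately show ?thesis by blast
qed

lemma measurable_lebesgue_on_ext:
  assumes "ext G k \<in> borel_measurable borel"
  shows "(\<lambda>z. G (u k z) (v k z)) \<in> borel_measurable (lebesgue_on Q)"
  using borel_lebesgue_on[OF assms]
  by (rule measurable_cong[THEN iffD1, rotated]) (simp add: ext_def space_restrict_space)

lemma weak_star_Linf_of_wlim:
  assumes w: "wlim r G g"
  shows "weak_star_Linf (lebesgue_on Q) (\<lambda>k z. G (u (r k) z) (v (r k) z)) g"
  unfolding weak_star_Linf_def
proof (intro conjI allI impI)
  obtain C where C: "\<And>z. (\<forall>k. \<bar>ext G (r k) z\<bar> \<le> C) \<and> \<bar>g z\<bar> \<le> C" using wlimD(3)[OF w] by blast
  note m = wlimD(2)[OF w] wlimD(1)[OF w]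
  show "in_Linf (lebesgue_on Q) (\<lambda>z. G (u (r k) z) (v (r k) z))" for k
  proof -
    have "\<bar>G (u (r k) z) (v (r k) z)\<bar> \<le> C" if "z \<in> Q" for z using C[of z] that by (auto simp: ext_def)
    then show ?thesis unfolding in_Linf_def
      using measurable_lebesgue_on_ext[OF m(1)] by (intro conjI exI[of _ C] AE_I2) (auto simp: space_restrict_space)
  qed
  show "in_Linf (lebesgue_on Q) g" unfolding in_Linf_def
    using borel_lebesgue_on[OF m(2)] C by (intro conjI exI[of _ C] AE_I2) auto
  fix \<phi> :: "real \<times> 'a \<Rightarrow> real" assume "integrable (lebesgue_on Q) \<phi>"
  from borel_representative[OF this] obtain \<psi> where \<psi>: "integrable MQ \<psi>"
    "\<And>f. f \<in> borel_measurable borel \<Longrightarrow> (\<integral>z. f z * \<phi> z \<partial>lebesgue_on Q) = (\<integral>z. f z * \<psi> z \<partial>MQ)" by blast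
  have "(\<integral>z. G (u (r k) z) (v (r k) z) * \<phi> z \<partial>lebesgue_on Q) = (\<integral>z. ext G (r k) z * \<psi> z \<partial>MQ)" for k
    unfolding \<psi>(2)[OF m(1), symmetric]
    by (rule Bochner_Integration.integral_cong) (auto simp: ext_def space_restrict_space)
  then show "(\<lambda>k. \<integral>z. G (u (r k) z) (v (r k) z) * \<phi> z \<partial>lebesgue_on Q) \<longlonglongrightarrow> (\<integral>z. g z * \<phi> z \<partial>lebesgue_on Q)"
    using weakly_convergesD(1)[OF w[unfolded wlim_def] \<psi>(1)] \<psi>(2)[OF m(2)] by simp
qed

lemma strong_L2_of_limit:
  assumes lim: "(\<lambda>k. \<integral>z. (ext G (r k) z - W z)\<^sup>2 \<partial>MQ) \<longlonglongrightarrow> 0"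
    and G: "\<And>k. ext G k \<in> borel_measurable borel" "\<And>k z. \<bar>ext G k z\<bar> \<le> C"
    and W: "W \<in> borel_measurable borel" "\<And>z. \<bar>W z\<bar> \<le> C"
  shows "strong_L2 (lebesgue_on Q) (\<lambda>k z. G (u (r k) z) (v (r k) z)) W"
proof -
  have sq: "integrable (lebesgue_on Q) (\<lambda>z. (f z)\<^sup>2)" if f: "f \<in> borel_measurable borel" "\<And>z. \<bar>f z\<bar> \<le> C" for f
  proof -
    have "(f z)\<^sup>2 \<le> C\<^sup>2" for z using f(2)[of z] by (intro power2_le_iff_abs_le[THEN iffD2]) auto
    then have "integrable MQ (\<lambda>z. (f z)\<^sup>2)"
      by (intro bounded_integrable_MQ[where C="C\<^sup>2"] borel_measurable_power f(1)) simp
    then show ?thesis using lebesgue_on_MQ(2)[OF borel_measurable_power[OF f(1)]] by simp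
  qed
  have eq: "(\<integral>z. (G (u (r k) z) (v (r k) z) - W z)\<^sup>2 \<partial>lebesgue_on Q) = (\<integral>z. (ext G (r k) z - W z)\<^sup>2 \<partial>MQ)" for k
    unfolding lebesgue_on_MQ(1)[OF borel_measurable_power[OF borel_measurable_diff[OF G(1) W(1)]], symmetric]
    by (rule Bochner_Integration.integral_cong) (auto simp: ext_def space_restrict_space)
  have "integrable (lebesgue_on Q) (\<lambda>z. (G (u (r k) z) (v (r k) z))\<^sup>2)" for k
    using sq[OF G] by (rule Bochner_Integration.integrable_cong[THEN iffD1, rotated 2])
      (auto simp: ext_def space_restrict_space)
  then show ?thesis unfolding strong_L2_def in_L2_def eq
    using lim sq[OF W] borel_lebesgue_on[OF W(1)] measurable_lebesgue_on_ext[OF G(1)] by blast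
qed

theorem fast_reaction_limit:
  "\<exists>r U W. strict_mono r \<and> weak_star_Linf (lebesgue_on Q) (\<lambda>k. u (r k)) U \<and>
    strong_L2 (lebesgue_on Q) (\<lambda>k z. F (u (r k) z)) W \<and> strong_L2 (lebesgue_on Q) (\<lambda>k. v (r k)) W \<and>
    (\<exists>\<mu> l1 l2 l3. generates_young_measure (lebesgue_on Q) (\<lambda>k. u (r k)) \<mu> \<and>
      (AE z in lebesgue_on Q. 0 \<le> l1 z \<and> 0 \<le> l2 z \<and> 0 \<le> l3 z \<and> l1 z + l2 z + l3 z = 1 \<and>
        (\<forall>A \<in> sets borel. measure (\<mu> z) A =
          l1 z * measure (return borel (S1 F ap (W z))) A +
          l2 z * measure (return borel (S2 F ap bm (W z))) A +
          l3 z * measure (return borel (S3 F bm (W z))) A)))"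
proof -
  obtain r U W l1 l2 l3 where r: "strict_mono r" and wU: "wlim r (\<lambda>x y. x) U" and wF: "wlim r (\<lambda>x y. F x) W"
    and sF: "(\<lambda>k. \<integral>z. (ext (\<lambda>x y. F x) (r k) z - W z)\<^sup>2 \<partial>MQ) \<longlonglongrightarrow> 0"
    and sv: "(\<lambda>k. \<integral>z. (ext (\<lambda>x y. y) (r k) z - W z)\<^sup>2 \<partial>MQ) \<longlonglongrightarrow> 0"
    and l: "\<And>z. 0 \<le> l1 z \<and> 0 \<le> l2 z \<and> 0 \<le> l3 z \<and> l1 z + l2 z + l3 z = 1"
    and Y: "\<And>G. continuous_on UNIV G \<Longrightarrow> wlim r (\<lambda>x y. G x)
      (\<lambda>z. l1 z * G (S1 F ap (W z)) + l2 z * G (S2 F ap bm (W z)) + l3 z * G (S3 F bm (W z)))"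
    using limit_theorem by blast
  obtain C where C: "\<And>z. (\<forall>k. \<bar>ext (\<lambda>x y. F x) (r k) z\<bar> \<le> C) \<and> \<bar>W z\<bar> \<le> C" using wlimD(3)[OF wF] by blast
  have WC: "\<bar>W z\<bar> \<le> max C M" for z using C[of z] by (simp add: le_max_iff_disj)
  have F_m: "ext (\<lambda>x y. F x) k \<in> borel_measurable borel" for k
    using admissible_continuous[OF cont_F] by (intro ext_measurable) (simp add: admissible_def)
  have v_m: "ext (\<lambda>x y. y) k \<in> borel_measurable borel" for k
    by (rule ext_measurable) (intro borel_measurable_continuous_onI continuous_on_snd continuous_on_id)
  have fb: "\<bar>ext (\<lambda>x y. F x) k z\<bar> \<le> max C M" "\<bar>ext (\<lambda>x y. y) k z\<bar> \<le> max C M" for k z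
    using bounds[of z k] M_bounds by (auto simp: ext_def le_max_iff_disj)
  \<comment> \<open>Weights and atoms are numbered 0, 1, 2 for the three branches; the last
    alternative stands for index 2.\<close>
  define w where "w z i = (if i = 0 then l1 z else if i = 1 then l2 z else l3 z)" for z and i :: nat
  define S where "S z i = (if i = 0 then S1 F ap (W z) else if i = 1 then S2 F ap bm (W z) else S3 F bm (W z))" for z and i :: nat
  define \<mu> where "\<mu> z = distr (point_measure {0, 1, 2} (\<lambda>i. ennreal (w z i))) borel (S z)" for z
  have w: "0 \<le> w z i" "sum (w z) {0, 1, 2} = 1" for z i using l[of z] by (auto simp: w_def)
  have fin: "finite {0, 1, 2 :: nat}" by simp
  have prob: "prob_space (\<mu> z)" for z
    unfolding \<mu>_def by (rule finite_combination_measure(1)[OF fin w])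
  have int: "(\<integral>y. G y \<partial>\<mu> z) = (\<Sum>i\<in>{0, 1, 2}. w z i * G (S z i))" if "G \<in> borel_measurable borel" for G z
    unfolding \<mu>_def by (rule finite_combination_measure(2)[OF fin w that])
  have meas: "measure (\<mu> z) A = (\<Sum>i\<in>{0, 1, 2}. w z i * measure (return borel (S z i)) A)" if "A \<in> sets borel" for A z
    unfolding \<mu>_def by (rule finite_combination_measure(3)[OF fin w that])
  have young: "generates_young_measure (lebesgue_on Q) (\<lambda>k. u (r k)) \<mu>"
    unfolding generates_young_measure_def
  proof (intro conjI ballI allI impI)
    show "prob_space (\<mu> z)" for z by (rule prob)
    show "sets (\<mu> z) = sets borel" for z by (simp add: \<mu>_def)
    fix G :: "real \<Rightarrow> real" assume G: "continuous_on UNIV G"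
    have "(\<integral>y. G y \<partial>\<mu> z) = l1 z * G (S1 F ap (W z)) + l2 z * G (S2 F ap bm (W z)) + l3 z * G (S3 F bm (W z))" for z
      unfolding int[OF borel_measurable_continuous_onI[OF G]] by (simp add: w_def S_def)
    then show "weak_star_Linf (lebesgue_on Q) (\<lambda>k z. G (u (r k) z)) (\<lambda>z. \<integral>y. G y \<partial>\<mu> z)"
      using weak_star_Linf_of_wlim[OF Y[OF G]] by simp
  qed
  have m: "measure (\<mu> z) A = l1 z * measure (return borel (S1 F ap (W z))) A +
          l2 z * measure (return borel (S2 F ap bm (W z))) A +
          l3 z * measure (return borel (S3 F bm (W z))) A" if "A \<in> sets borel" for z A
    unfolding meas[OF that] by (simp add: w_def S_def)
  have "AE z in lebesgue_on Q. 0 \<le> l1 z \<and> 0 \<le> l2 z \<and> 0 \<le> l3 z \<and> l1 z + l2 z + l3 z = 1 \<and>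
      (\<forall>A \<in> sets borel. measure (\<mu> z) A = l1 z * measure (return borel (S1 F ap (W z))) A +
          l2 z * measure (return borel (S2 F ap bm (W z))) A + l3 z * measure (return borel (S3 F bm (W z))) A)"
    using l m by (intro AE_I2) blast
  moreover note young
  moreover have "strong_L2 (lebesgue_on Q) (\<lambda>k z. F (u (r k) z)) W"
    by (rule strong_L2_of_limit[OF sF F_m fb(1) wlimD(1)[OF wF] WC])
  moreover have "strong_L2 (lebesgue_on Q) (\<lambda>k. v (r k)) W"
    by (rule strong_L2_of_limit[OF sv v_m fb(2) wlimD(1)[OF wF] WC])
  moreover have "weak_star_Linf (lebesgue_on Q) (\<lambda>k. u (r k)) U"
    by (rule weak_star_Linf_of_wlim[OF wU])
  ultimately show ?thesis using r by blast
qed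

end

section \<open>Application to classical solutions on a smooth bounded domain\<close>

theorem theorem2p3:
  fixes \<Omega> :: "'a::euclidean_space set"
    and F :: "real \<Rightarrow> real"
    and am ap bm bp \<alpha> T :: real
    and u0 v0 :: "'a \<Rightarrow> real"
    and u\<epsilon> v\<epsilon> :: "real \<Rightarrow> real \<Rightarrow> 'a \<Rightarrow> real"
    and e :: "nat \<Rightarrow> real"
  assumes "smooth_bounded_domain \<Omega>"
    and "admissible_reaction F am ap bm bp"
    and "0 < \<alpha>" and "\<alpha> < 1"
    and "C2_holder_closure \<alpha> \<Omega> u0" and "C2_holder_closure \<alpha> \<Omega> v0"
    and "\<And>x. x \<in> closure \<Omega> \<Longrightarrow> 0 \<le> u0 x" and "\<And>x. x \<in> closure \<Omega> \<Longrightarrow> 0 \<le> v0 x"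
    and "neumann_condition \<Omega> u0" and "neumann_condition \<Omega> v0"
    and "0 < T"
    and "\<And>\<epsilon>. 0 < \<epsilon> \<Longrightarrow> \<epsilon> < 1 \<Longrightarrow> classical_solution \<Omega> F \<epsilon> u0 v0 (u\<epsilon> \<epsilon>) (v\<epsilon> \<epsilon>)"
    and "\<And>k. 0 < e k" and "\<And>k. e k < 1" and "e \<longlonglongrightarrow> 0"
  shows "\<exists>(r :: nat \<Rightarrow> nat) (u :: real \<times> 'a \<Rightarrow> real) (v :: real \<times> 'a \<Rightarrow> real).
    strict_mono r \<and>
    weak_star_Linf (spacetime T \<Omega>) (\<lambda>k (t, x). u\<epsilon> (e (r k)) t x) u \<and>
    strong_L2 (spacetime T \<Omega>) (\<lambda>k (t, x). F (u\<epsilon> (e (r k)) t x)) v \<and>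
    strong_L2 (spacetime T \<Omega>) (\<lambda>k (t, x). v\<epsilon> (e (r k)) t x) v \<and>
    (\<exists>\<mu> l1 l2 l3.
      generates_young_measure (spacetime T \<Omega>) (\<lambda>k (t, x). u\<epsilon> (e (r k)) t x) \<mu> \<and>
      (AE z in spacetime T \<Omega>.
        0 \<le> l1 z \<and> 0 \<le> l2 z \<and> 0 \<le> l3 z \<and> l1 z + l2 z + l3 z = 1 \<and>
        (\<forall>A \<in> sets borel.
          measure (\<mu> z) A =
            l1 z * measure (return borel (S1 F ap (v z))) A +
            l2 z * measure (return borel (S2 F ap bm (v z))) A +
            l3 z * measure (return borel (S3 F bm (v z))) A)))"
proof -
  interpret reaction F am ap bm bp by (rule reaction.intro) (rule assms(2))
  have op: "open \<Omega>" and bd: "bounded \<Omega>" using assms(1) by (simp_all add: smooth_bounded_domain_def)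
  have c0: "continuous_on (closure \<Omega>) u0" "continuous_on (closure \<Omega>) v0"
    using assms(5,6) unfolding C2_holder_closure_def by blast+
  \<comment> \<open>Boundary condition and initial data enter through this bound, common to all
    \<epsilon>; what follows takes place in the open cylinder.\<close>
  obtain M where M: "bp \<le> M" and bounds: "\<And>\<epsilon> u v t x. 0 < \<epsilon> \<Longrightarrow> classical_solution \<Omega> F \<epsilon> u0 v0 u v \<Longrightarrow>
      0 \<le> t \<Longrightarrow> x \<in> \<Omega> \<Longrightarrow> u t x \<in> {0..M} \<and> v t x \<in> {0..M} \<and> F (u t x) \<in> {0..M}"
    using uniform_bounds[OF assms(1) c0 assms(7,8)] by blast
  let ?Q = "{0<..<T} \<times> \<Omega>"
  have "bounded ?Q" using bd by (intro bounded_Times) auto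
  then have fin: "emeasure lborel ?Q < \<infinity>" by (rule emeasure_bounded_finite)
  interpret fast_reaction F am ap bm bp ?Q M e "\<lambda>k (t, x). u\<epsilon> (e k) t x" "\<lambda>k (t, x). v\<epsilon> (e k) t x"
  proof
    show "open ?Q" using op by (intro open_Times) auto
    show "\<exists>vt g h. rd_solution ?Q F (e k) M (\<lambda>(t, x). u\<epsilon> (e k) t x) (\<lambda>(t, x). v\<epsilon> (e k) t x) vt g h" for k
      by (rule rd_solution_of_classical_solution[OF op assms(13) assms(12)[OF assms(13,14)]
          bounds[OF assms(13) assms(12)[OF assms(13,14)]]])
  qed (fact fin M assms(13) assms(15))+
  show ?thesis using fast_reaction_limit by (simp add: case_prod_unfold)
qed

end
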